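(* Let $\varepsilon_I\in(0,1)$. Assume that either (A) [first inverse problem] hypotheses (h1)–(h6) hold, $\mathfrak C_{\nu,0}\neq0$ and $\rho_{i^*}(t)\ne 0$ for all $t\in[0,t^*]$, and $(\nu_1,\nu_{i^*},u)$ is the unique solution of the first inverse problem; or (B) [second inverse problem] hypotheses (h1)–(h6) hold, $\mathfrak C_{\nu,0}\neq0$, $\mathfrak C_{1,0}\ne0$, $\mathcal K(t)=t^{-\gamma}\mathcal K_0(t)$ with $\mathcal K_0(0)\neq0$ and $\mathcal K_0\in L^1(0,T)\cap C([0,t^*])$, and $(\nu_1,\gamma,u)$ is the unique solution of the second inverse problem. Then the bound $$|\nu_1-\nu_{1,a}|<\varepsilon_I$$ holds for each $t_a\in(0,T_I]$ with some (positive) time $T_I$ satisfying $T_I\le T_I^0$. If in the first inverse problem $M\ge3$, then one can take $$T_I=\begin{cases}\min\Big\{T_I^0,\Big(\dfrac{\varepsilon_I|\mathfrak C_{\nu,0}|}{C_4\rho_1(0)\mathcal R}\Big)^{1/\nu_0}\Big\}&\text{for the I type FDO},\\[2mm]\min\Big\{T_I^0,\Big(\dfrac{\varepsilon_I|\mathfrak C_{\nu,0}|}{C_4\mathcal R}\Big)^{1/\nu_0}\Big\}&\text{for the II type FDO},\end{cases}\qquad \nu_0=\begin{cases}\frac{\alpha\nu_2}{2},& i^*\ne2,\\ \frac{\alpha\nu_3}{2},& i^*=2.\end{cases}$$ If in the second inverse problem the unknown $\gamma$ is looked for in the interval $(0,\gamma_0)$ with given $\gamma_0<1$, then one can take $$T_I=\begin{cases}\min\Big\{T_I^0,\Big(\dfrac{\varepsilon_I|\mathfrak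 C_{\nu,0}|}{C_4\rho_1(0)\mathcal R}\Big)^{2/(\alpha\nu_2)},T_K\Big\}&\text{for the I type FDO},\\[2mm]\min\Big\{T_I^0,\Big(\dfrac{\varepsilon_I|\mathfrak C_{\nu,0}|}{C_4\mathcal R}\Big)^{2/(\alpha\nu_2)},T_K\Big\}&\text{for the II type FDO}.\end{cases}$$
   Context: **Setting.** $n\ge1$, $\alpha\in(0,1)$; $\Omega\subset\mathbb R^n$ is a bounded domain with $\partial\Omega\in C^{2+\alpha}$ ($\Omega=(\mathfrak l_1,\mathfrak l_2)$ if $n=1$), $|\Omega|$ is its Lebesgue measure; $0<T<\infty$; $\Omega_T=\Omega\times(0,T)$, $\partial\Omega_T=\partial\Omega\times[0,T]$; $0<t^*<\min\{1,T\}$; $(h_1*h_2)(t)=\int_0^th_1(s)h_2(t-s)ds$. For $\theta\in(0,1)$, $\mathbf D_t^\theta w(t)=\frac1{\Gamma(1-\theta)}\frac{\partial}{\partial t}\int_0^t\frac{w(s)-w(0)}{(t-s)^\theta}ds$ (regularized Caputo derivative). $x^*\approx0.4616$ is defined by $\Gamma(1+x^* )=\min_{x>0}\Gamma(x)$. **Spaces.** $\langle\cdot\rangle_t^{(\beta)}$ is the Hölder seminorm in time of exponent $\beta$. For $\nu\in(0,1]$: $C^{l+\alpha,\frac{l+\alpha}2\nu}(\bar\Omega_T)$ has norm $\|v\|_{C([0,T],C^{l+\alpha}(\bar\Omega))}+\sum_{|j|=0}^l\langle D_x^jv\rangle_t^{(\frac{l+\alpha-|j|}2\nu)}$ for $l=0,1$,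 and $\|v\|_{C([0,T],C^{2+\alpha}(\bar\Omega))}+\|\mathbf D_t^\nu v\|_{C^{\alpha,\nu\alpha/2}(\bar\Omega_T)}+\sum_{|j|=1}^2\langle D_x^jv\rangle_t^{(\frac{2+\alpha-|j|}2\nu)}$ for $l=2$; similarly on $\partial\Omega_T$. **Model.** $M\ge1$, $0<\nu_M<\dots<\nu_1<1$. The fractional differential operator (FDO) is $\mathbf D_tu=\sum_{i=1}^M\rho_i(t)\mathbf D_t^{\nu_i}u$ (I type) or $\mathbf D_tu=\sum_{i=1}^M\mathbf D_t^{\nu_i}(\rho_i(t)u)$ (II type). The direct problem is $$\mathbf D_tu-\mathcal L_1u-\mathcal K*\mathcal L_2u=g\ \text{in }\Omega_T,\quad u(\cdot,0)=u_0\ \text{in }\bar\Omega,\quad \mathcal Nu+(1-\delta)(\mathcal K*\mathcal Nu)=\varphi\ \text{on }\partial\Omega_T,$$ with $\delta\in\{0,1\}$ and observation $\int_\Omega u(x,t)dx=\psi(t)$, $t\in[0,t^*]$. **Hypotheses.** (h1) $\mathcal L_1=\sum_{ij}\partial_{x_i}(b_{ij}(x,t)\partial_{x_j})+a_0(t)$, $\mathcal L_2=\sum_{ij}\partial_{x_i}(b_{ij}(x,t)\partial_{x_j})+b_0(t)$, $\mathcal N=-\sum_{ij}b_{ij}(x,t)N_i\partial_{x_j}$, with $\mathbf N=(N_i)$ the unit outward normal; $\varrho_1|\xi|^2\le\sum b_{ij}\xi_i\xi_j\le\varrho_2|\xi|^2$ on $\bar\Omega_T\times\mathbb R^n$, $0<\varrho_1<\varrho_2$.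 (h2) $\nu_1\in(\frac{2\nu_2}{2-\alpha},1)$, $0<\nu_M<\dots<\nu_2<1$, and $\rho_1(t)\ge\varrho_3>0$ on $[0,T]$. (h3) $a_0,b_0\in C^{\alpha/2}([0,T])$, $b_{ij}\in C^{1+\alpha,\frac{1+\alpha}2}(\bar\Omega_T)$, $\rho_k\in C^\nu([0,T])$ with some $\nu\in(1,1+\alpha/2)$. (h4) $\mathcal K\in L^1(0,T)$, $\varphi\in C^{1+\alpha,\frac{1+\alpha}2}(\partial\Omega_T)$, $u_0\in C^{2+\alpha}(\bar\Omega)$, $g\in C^{\alpha,\alpha/2}(\bar\Omega_T)$. (h5) $\psi\in C([0,t^*])$ has Caputo derivatives $\mathbf D_t^{\nu_i}\psi$, $i=1,\dots,M$, all Hölder continuous. (h6) $\mathcal Nu_0(x)|_{t=0}=\varphi(x,0)$ on $\partial\Omega$. **Inverse problems.** First: given all data except $\nu_1,\nu_{i^*}$ ($i^*\in\{2,\dots,M\}$ fixed), find $(\nu_1,\nu_{i^*},u)$ with $\nu_1\in(\nu_2,1)$, $\nu_{i^*}$ strictly between $\nu_{i^*+1}$ and $\nu_{i^*-1}$, and $u$ the unique global classical solution of the direct problem satisfying the observation. Second: $\mathcal K(t)=t^{-\gamma}\mathcal K_0(t)$ with $\mathcal K_0$ given; given all data except $\nu_1,\gamma$, find $(\nu_1,\gamma,u)$ with $\nu_1\in(\frac{2\nu_2}{2-\alpha},1)$, $\gamma\in(0,1)$, and $u$ the unique global classical solution satisfying the observation. Under (A), resp. (B), unique solvability is known, with $\nu_1=\lim_{t\to0}\ln|\psi(t)-\int_\Omega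 u_0|/\ln t$ (I type), $\nu_1=\lim_{t\to0}\ln|\rho_1(t)\psi(t)-\rho_1(0)\int_\Omega u_0|/\ln t$ (II type). **Notation.** $\mathcal I(t)=\int_{\partial\Omega}\varphi(x,t)dx$ if $n\ge2$, $\mathcal I(t)=\varphi(\mathfrak l_2,t)-\varphi(\mathfrak l_1,t)$ if $n=1$; $\mathfrak C_\nu(t)=\int_\Omega g\,dx-\delta(\mathcal K*\mathcal I)(t)+a_0(t)\psi(t)+(\mathcal K*b_0\psi)(t)-\mathcal I(t)$, $\mathfrak C_{\nu,0}=\mathfrak C_\nu(0)$; $\mathfrak C_1(t)=\delta\mathcal I(t)-b_0(t)\psi(t)$, $\mathfrak C_{1,0}=\mathfrak C_1(0)$; $\mathcal R=\|g\|_{C^{\alpha,\alpha/2}(\bar\Omega_T)}+\|\varphi\|_{C^{1+\alpha,\frac{1+\alpha}2}(\partial\Omega_T)}+\|u_0\|_{C^{2+\alpha}(\bar\Omega)}$. For $t_a\in(0,t^*]$: $\nu_{1,a}=\nu_{1,a}(t_a)=\dfrac{\ln|\psi(t_a)-\int_\Omega u_0dx|}{\ln t_a}$ (I type), $\nu_{1,a}=\dfrac{\ln|\rho_1(t_a)\psi(t_a)-\rho_1(0)\int_\Omega u_0dx|}{\ln t_a}$ (II type). $T_I^0=\min\Big\{t^*,\Big(\frac{\rho_1(0)}{\Gamma(1+x^* )|\mathfrak C_{\nu,0}|}\Big)^{-2/\varepsilon_I},\Big(\frac{|\mathfrak C_{\nu,0}|}{\Gamma(1+x^* )\rho_1(0)}\Big)^{-2/\varepsilon_I},(1-\varepsilon_I)^{2/\varepsilon_I}\Big\}$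 (I type), $T_I^0=\min\Big\{t^*,(\Gamma(1+x^* )|\mathfrak C_{\nu,0}|)^{2/\varepsilon_I},\Big(\frac{|\mathfrak C_{\nu,0}|}{\Gamma(1+x^* )}\Big)^{-2/\varepsilon_I},(1-\varepsilon_I)^{2/\varepsilon_I}\Big\}$ (II type). $T_K$ is the maximum positive time in $[0,t^*]$ such that $\operatorname{sgn}\mathcal K_0(t)=\operatorname{sgn}\mathcal K_0(0)$ (for $t$ up to $T_K$). $C_4=\frac{C_0}{\Gamma(1+x^* )}\Big(1+2\sum_{i=2}^M\frac{|\rho_i(0)|}{\rho_1(0)\Gamma(1+x^* )}\Big)$ (I type), $C_4=\frac{C_0}{\Gamma(1+x^* )}[C_1+C_2]\Big[1+\frac2{\Gamma(1+x^* )}\Big]\sum_{i=1}^M\|\rho_i\|_{C^\nu([0,t^*])}$ (II type). Constants: $C_0$, depending only on $T$, $|\Omega|$, $\|\mathcal K\|_{L^1(0,T)}$ and the norms of the coefficients of the operators, is the constant in the known estimate $\|u\|_{C^{2+\alpha,\frac{2+\alpha}2\nu_1}(\bar\Omega_T)}+\sum_{i=2}^M\|\mathbf D_t^{\nu_i}u\|_{C^{\alpha,\frac{\alpha\nu_1}2}(\bar\Omega_T)}\le C_0\mathcal R$. $C_1,C_2$, depending only on $t^*$ and $\nu$, are the constants in the known estimates $\langle\mathbf D_t^{\nu_i}(\rho_i\psi)\rangle_{t,[0,t^*]}^{(\alpha_0)}\le C_1\|\rho_i\|_{C^\nu([0,t^*])}\|\mathbf D_t^{\nu_i}\psi\|_{C^{\alpha_0}([0,t^*])}$,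 $\|\mathbf D_t^{\nu_i}(\rho_i\psi)\|_{C^{\alpha_0}([0,t^*])}\le C_2\|\rho_i\|_{C^\nu([0,t^*])}\|\mathbf D_t^{\nu_i}\psi\|_{C^{\alpha_0}([0,t^*])}$, $\alpha_0\in(0,\frac{\alpha\nu_1}2]$, $i=1,\dots,M$.
   Formalization: For n=1 the operator N uses N=1 at both end points instead of the outward normal, the sign for which I=φ(l2)−φ(l1) is correct; C_0 is a suitable constant in the known estimate with the stated dependence, enlarged if necessary to absorb a factor |Ω|. *)

theory Defs
  imports "HOL-Analysis.Analysis" "HOL-Library.Multiset"
begin

section \<open>Hoelder spaces\<close>

text \<open>In all suprema the element 0 is inserted; the quantities are nonnegative, so this only
  fixes the value for empty index sets. Norms are real numbers; they are meaningful only together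
  with the corresponding membership predicate, which asserts that they are finite.\<close>

definition sup_norm :: "'a set \<Rightarrow> ('a \<Rightarrow> real) \<Rightarrow> real" where
  "sup_norm S f = Sup (insert 0 ((\<lambda>x. \<bar>f x\<bar>) ` S))"

definition holder_seminorm :: "real \<Rightarrow> 'a::metric_space set \<Rightarrow> ('a \<Rightarrow> real) \<Rightarrow> real" where
  "holder_seminorm \<beta> S f =
     Sup (insert 0 {\<bar>f x - f y\<bar> / dist x y powr \<beta> | x y. x \<in> S \<and> y \<in> S \<and> x \<noteq> y})"

definition holder_on :: "real \<Rightarrow> 'a::metric_space set \<Rightarrow> ('a \<Rightarrow> real) \<Rightarrow> bool" where
  "holder_on \<beta> S f \<longleftrightarrow> (\<exists>C. \<forall>x\<in>S. \<forall>y\<in>S. \<bar>f x - f y\<bar> \<le> C * dist x y powr \<beta>)"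

definition time_seminorm ::
  "real \<Rightarrow> 'a set \<Rightarrow> real \<Rightarrow> ('a \<Rightarrow> real \<Rightarrow> real) \<Rightarrow> real" where
  "time_seminorm \<beta> S T v =
     Sup (insert 0 {\<bar>v x t - v x s\<bar> / \<bar>t - s\<bar> powr \<beta> | x t s.
        x \<in> S \<and> t \<in> {0..T} \<and> s \<in> {0..T} \<and> t \<noteq> s})"

definition time_holder ::
  "real \<Rightarrow> 'a set \<Rightarrow> real \<Rightarrow> ('a \<Rightarrow> real \<Rightarrow> real) \<Rightarrow> bool" where
  "time_holder \<beta> S T v \<longleftrightarrow>
     (\<exists>C. \<forall>x\<in>S. \<forall>t\<in>{0..T}. \<forall>s\<in>{0..T}. \<bar>v x t - v x s\<bar> \<le> C * \<bar>t - s\<bar> powr \<beta>)"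

subsection \<open>Functions of time\<close>

definition C_holder_norm :: "real \<Rightarrow> real \<Rightarrow> (real \<Rightarrow> real) \<Rightarrow> real" where
  "C_holder_norm \<beta> \<tau> f = sup_norm {0..\<tau>} f + holder_seminorm \<beta> {0..\<tau>} f"

definition time_deriv :: "real \<Rightarrow> (real \<Rightarrow> real) \<Rightarrow> real \<Rightarrow> real" where
  "time_deriv \<tau> f t = vector_derivative f (at t within {0..\<tau>})"

text \<open>The space \<open>C\<^sup>\<nu>[0,\<tau>]\<close> for \<open>1 < \<nu> < 2\<close>.\<close>

definition in_C1_holder :: "real \<Rightarrow> real \<Rightarrow> (real \<Rightarrow> real) \<Rightarrow> bool" where
  "in_C1_holder \<nu> \<tau> f \<longleftrightarrow>
     (\<forall>t\<in>{0..\<tau>}. f differentiable (at t within {0..\<tau>})) \<and>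
     holder_on (\<nu> - 1) {0..\<tau>} (time_deriv \<tau> f)"

definition C1_holder_norm :: "real \<Rightarrow> real \<Rightarrow> (real \<Rightarrow> real) \<Rightarrow> real" where
  "C1_holder_norm \<nu> \<tau> f =
     sup_norm {0..\<tau>} f + sup_norm {0..\<tau>} (time_deriv \<tau> f)
       + holder_seminorm (\<nu> - 1) {0..\<tau>} (time_deriv \<tau> f)"

subsection \<open>Spatial derivatives on the closure and on the boundary\<close>

definition pd :: "'n \<Rightarrow> (real^'n \<Rightarrow> real) \<Rightarrow> real^'n::finite \<Rightarrow> real" where
  "pd i f x = frechet_derivative f (at x) (axis i 1)"

definition grad :: "(real^'n \<Rightarrow> real) \<Rightarrow> real^'n::finite \<Rightarrow> real^'n" where
  "grad f x = (\<chi> i. pd i f x)"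

text \<open>Continuous extension of a function from \<open>\<Omega>\<close> to its closure.\<close>

definition cl_ext :: "(real^'n::finite) set \<Rightarrow> (real^'n \<Rightarrow> real) \<Rightarrow> real^'n \<Rightarrow> real" where
  "cl_ext \<Omega> f x = (if x \<in> \<Omega> then f x else Lim (at x within \<Omega>) f)"

text \<open>Multi-indices are multisets of coordinate indices. The operators \<open>p i\<close> are
  iterated along an arbitrary enumeration of the multi-index; for the functions of class
  \<open>C\<^sup>2\<close> to which this is applied, the order of differentiation is irrelevant.\<close>

definition D_multi ::
  "('n \<Rightarrow> ('a \<Rightarrow> real) \<Rightarrow> 'a \<Rightarrow> real) \<Rightarrow> 'n multiset \<Rightarrow> ('a \<Rightarrow> real) \<Rightarrow> 'a \<Rightarrow> real" where
  "D_multi p \<beta> f = foldr p (SOME is. mset is = \<beta>) f"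

definition D_cl ::
  "(real^'n::finite) set \<Rightarrow> 'n multiset \<Rightarrow> (real^'n \<Rightarrow> real) \<Rightarrow> real^'n \<Rightarrow> real" where
  "D_cl \<Omega> \<beta> f = cl_ext \<Omega> (D_multi pd \<beta> f)"

text \<open>The norm of \<open>C\<^sup>l\<^sup>+\<^sup>\<alpha>(S)\<close> and the corresponding anisotropic norm on
  \<open>S \<times> [0,T]\<close>, relative to a family \<open>D\<close> of derivatives, so that they can be used both on the
  closure of \<open>\<Omega>\<close> (with \<open>D_cl\<close>) and on its boundary (with tangential derivatives).\<close>

definition Cl_norm ::
  "('a::metric_space) set \<Rightarrow> ('n multiset \<Rightarrow> ('a \<Rightarrow> real) \<Rightarrow> 'a \<Rightarrow> real) \<Rightarrow> nat \<Rightarrow> real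
     \<Rightarrow> ('a \<Rightarrow> real) \<Rightarrow> real" where
  "Cl_norm S D l \<alpha> f =
     (\<Sum>\<beta> | size \<beta> \<le> l. sup_norm S (D \<beta> f)) + (\<Sum>\<beta> | size \<beta> = l. holder_seminorm \<alpha> S (D \<beta> f))"

definition sup_Cl_norm ::
  "('a::metric_space) set \<Rightarrow> ('n multiset \<Rightarrow> ('a \<Rightarrow> real) \<Rightarrow> 'a \<Rightarrow> real) \<Rightarrow> nat \<Rightarrow> real \<Rightarrow> real
     \<Rightarrow> ('a \<Rightarrow> real \<Rightarrow> real) \<Rightarrow> real" where
  "sup_Cl_norm S D l \<alpha> T v = Sup (insert 0 ((\<lambda>t. Cl_norm S D l \<alpha> (\<lambda>x. v x t)) ` {0..T}))"

text \<open>The norm for \<open>l = 0, 1\<close>.\<close>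

definition aniso_norm ::
  "('a::metric_space) set \<Rightarrow> ('n multiset \<Rightarrow> ('a \<Rightarrow> real) \<Rightarrow> 'a \<Rightarrow> real) \<Rightarrow> nat \<Rightarrow> real \<Rightarrow> real
     \<Rightarrow> real \<Rightarrow> ('a \<Rightarrow> real \<Rightarrow> real) \<Rightarrow> real" where
  "aniso_norm S D l \<alpha> \<nu> T v =
     sup_Cl_norm S D l \<alpha> T v
     + (\<Sum>\<beta> | size \<beta> \<le> l. time_seminorm ((real l + \<alpha> - real (size \<beta>)) / 2 * \<nu>) S T
           (\<lambda>x t. D \<beta> (\<lambda>y. v y t) x))"

text \<open>Membership in the space, given the predicate \<open>R\<close> for membership of a time slice in
  \<open>C\<^sup>l\<^sup>+\<^sup>\<alpha>(S)\<close>: the map from \<open>[0,T]\<close> into \<open>C\<^sup>l\<^sup>+\<^sup>\<alpha>(S)\<close> is continuous (hence bounded),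
  and the time seminorms are finite.\<close>

definition in_C_time ::
  "(('a \<Rightarrow> real) \<Rightarrow> bool) \<Rightarrow> ('a::metric_space) set
     \<Rightarrow> ('n multiset \<Rightarrow> ('a \<Rightarrow> real) \<Rightarrow> 'a \<Rightarrow> real) \<Rightarrow> nat \<Rightarrow> real \<Rightarrow> real
     \<Rightarrow> ('a \<Rightarrow> real \<Rightarrow> real) \<Rightarrow> bool" where
  "in_C_time R S D l \<alpha> T v \<longleftrightarrow>
     (\<forall>t\<in>{0..T}. R (\<lambda>x. v x t)) \<and>
     (\<forall>t0\<in>{0..T}. ((\<lambda>t. Cl_norm S D l \<alpha> (\<lambda>x. v x t - v x t0)) \<longlongrightarrow> 0) (at t0 within {0..T})) \<and>
     bdd_above ((\<lambda>t. Cl_norm S D l \<alpha> (\<lambda>x. v x t)) ` {0..T})"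

definition in_aniso ::
  "(('a \<Rightarrow> real) \<Rightarrow> bool) \<Rightarrow> ('a::metric_space) set
     \<Rightarrow> ('n multiset \<Rightarrow> ('a \<Rightarrow> real) \<Rightarrow> 'a \<Rightarrow> real) \<Rightarrow> nat \<Rightarrow> real \<Rightarrow> real \<Rightarrow> real
     \<Rightarrow> ('a \<Rightarrow> real \<Rightarrow> real) \<Rightarrow> bool" where
  "in_aniso R S D l \<alpha> \<nu> T v \<longleftrightarrow>
     in_C_time R S D l \<alpha> T v \<and>
     (\<forall>\<beta>. size \<beta> \<le> l \<longrightarrow> time_holder ((real l + \<alpha> - real (size \<beta>)) / 2 * \<nu>) S T
        (\<lambda>x t. D \<beta> (\<lambda>y. v y t) x))"

text \<open>\<open>C\<^sup>l\<^sup>+\<^sup>\<alpha>\<close> on the closure of \<open>\<Omega>\<close>: all derivatives up to order \<open>l\<close> exist in \<open>\<Omega>\<close>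
  and extend continuously to the closure, those of order \<open>l\<close> being Hoelder continuous.\<close>

definition in_Cl :: "(real^'n::finite) set \<Rightarrow> nat \<Rightarrow> real \<Rightarrow> (real^'n \<Rightarrow> real) \<Rightarrow> bool" where
  "in_Cl \<Omega> l \<alpha> f \<longleftrightarrow>
     continuous_on (closure \<Omega>) f \<and>
     (\<forall>is. length is < l \<longrightarrow> (\<forall>x\<in>\<Omega>. foldr pd is f differentiable (at x))) \<and>
     (\<forall>is. length is \<le> l \<longrightarrow>
        continuous_on (closure \<Omega>) (cl_ext \<Omega> (foldr pd is f)) \<and>
        bounded (cl_ext \<Omega> (foldr pd is f) ` closure \<Omega>)) \<and>
     (\<forall>is. length is = l \<longrightarrow> holder_on \<alpha> (closure \<Omega>) (cl_ext \<Omega> (foldr pd is f)))"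

abbreviation norm_Cl :: "(real^'n::finite) set \<Rightarrow> nat \<Rightarrow> real \<Rightarrow> (real^'n \<Rightarrow> real) \<Rightarrow> real" where
  "norm_Cl \<Omega> l \<alpha> f \<equiv> Cl_norm (closure \<Omega>) (D_cl \<Omega>) l \<alpha> f"

abbreviation in_par ::
  "(real^'n::finite) set \<Rightarrow> nat \<Rightarrow> real \<Rightarrow> real \<Rightarrow> real \<Rightarrow> (real^'n \<Rightarrow> real \<Rightarrow> real) \<Rightarrow> bool" where
  "in_par \<Omega> l \<alpha> \<nu> T v \<equiv> in_aniso (in_Cl \<Omega> l \<alpha>) (closure \<Omega>) (D_cl \<Omega>) l \<alpha> \<nu> T v"

abbreviation norm_par ::
  "(real^'n::finite) set \<Rightarrow> nat \<Rightarrow> real \<Rightarrow> real \<Rightarrow> real \<Rightarrow> (real^'n \<Rightarrow> real \<Rightarrow> real) \<Rightarrow> real" where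
  "norm_par \<Omega> l \<alpha> \<nu> T v \<equiv> aniso_norm (closure \<Omega>) (D_cl \<Omega>) l \<alpha> \<nu> T v"

section \<open>Domains of class \<open>C\<^sup>2\<^sup>+\<^sup>\<alpha>\<close>, normal, surface measure\<close>

text \<open>In the open set \<open>U\<close>, \<open>\<Omega>\<close> is the subgraph, in the unit direction \<open>e\<close>, of a
  \<open>C\<^sup>2\<^sup>+\<^sup>\<alpha>\<close> function on the hyperplane orthogonal to \<open>e\<close>. That function is encoded
  as a function on the whole space which is constant along \<open>e\<close>.\<close>

definition graph_chart ::
  "real \<Rightarrow> (real^'n::finite) set \<Rightarrow> (real^'n) set \<Rightarrow> real^'n \<Rightarrow> (real^'n \<Rightarrow> real) \<Rightarrow> bool" where
  "graph_chart \<alpha> \<Omega> U e h \<longleftrightarrow>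
     open U \<and> norm e = 1 \<and> in_Cl UNIV 2 \<alpha> h \<and> (\<forall>y s. h (y + s *\<^sub>R e) = h y) \<and>
     \<Omega> \<inter> U = {x \<in> U. x \<bullet> e < h x}"

definition C2_domain :: "real \<Rightarrow> (real^'n::finite) set \<Rightarrow> bool" where
  "C2_domain \<alpha> \<Omega> \<longleftrightarrow>
     open \<Omega> \<and> connected \<Omega> \<and> bounded \<Omega> \<and> \<Omega> \<noteq> {} \<and>
     (\<forall>x\<in>frontier \<Omega>. \<exists>U e h. x \<in> U \<and> graph_chart \<alpha> \<Omega> U e h)"

text \<open>Since the gradient of \<open>h\<close> is orthogonal to \<open>e\<close>, the vector \<open>e - grad h x\<close> is the outward
  normal direction of the subgraph.\<close>

definition outward_normal :: "real \<Rightarrow> (real^'n::finite) set \<Rightarrow> real^'n \<Rightarrow> real^'n" where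
  "outward_normal \<alpha> \<Omega> x =
     (THE v. \<exists>U e h. x \<in> U \<and> graph_chart \<alpha> \<Omega> U e h \<and>
        v = (1 / norm (e - grad h x)) *\<^sub>R (e - grad h x))"

text \<open>The vector \<open>N\<close> of the conormal operator. In dimension one the boundary flux is
  \<open>- b \<partial>u/\<partial>x\<close> at both end points of the interval, i.e. \<open>N = 1\<close> there; this is the convention
  under which the net boundary flux is \<open>\<phi>\<close> at the right end point minus \<open>\<phi>\<close> at the left one
  (see \<open>bd_flux\<close> below).\<close>

definition conormal :: "real \<Rightarrow> (real^'n::finite) set \<Rightarrow> real^'n \<Rightarrow> real^'n" where
  "conormal \<alpha> \<Omega> x = (if CARD('n) = 1 then 1 else outward_normal \<alpha> \<Omega> x)"

text \<open>The surface measure on the boundary is the Borel measure that in every graph chart is given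
  by the usual density \<open>sqrt (1 + |grad h|\<^sup>2)\<close> with respect to the Lebesgue measure of the hyperplane
  orthogonal to \<open>e\<close>. Integration over this hyperplane is written as integration over the
  slab \<open>0 \<le> y \<bullet> e \<le> 1\<close> of thickness one, the integrand being constant along \<open>e\<close>. These conditions
  determine \<open>\<sigma>\<close> uniquely, as the charts cover the boundary.\<close>

definition surface_measure :: "real \<Rightarrow> (real^'n::finite) set \<Rightarrow> (real^'n) measure \<Rightarrow> bool" where
  "surface_measure \<alpha> \<Omega> \<sigma> \<longleftrightarrow>
     sets \<sigma> = sets borel \<and> emeasure \<sigma> (- frontier \<Omega>) = 0 \<and>
     (\<forall>U e h A. graph_chart \<alpha> \<Omega> U e h \<longrightarrow> A \<in> sets borel \<longrightarrow> A \<subseteq> U \<inter> frontier \<Omega> \<longrightarrow>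
        emeasure \<sigma> A =
          (\<integral>\<^sup>+ y. indicator {y. 0 \<le> y \<bullet> e \<and> y \<bullet> e \<le> 1} y
                * indicator A (y + (h y - y \<bullet> e) *\<^sub>R e)
                * ennreal (sqrt (1 + (norm (grad h y))\<^sup>2)) \<partial>lborel))"

subsection \<open>Hoelder spaces on the boundary\<close>

text \<open>First order derivatives on the boundary are the components of the tangential gradient, the
  tangent vector field representing the derivative along the boundary.\<close>

definition is_tgrad ::
  "real \<Rightarrow> (real^'n::finite) set \<Rightarrow> (real^'n \<Rightarrow> real) \<Rightarrow> real^'n \<Rightarrow> real^'n \<Rightarrow> bool" where
  "is_tgrad \<alpha> \<Omega> f x v \<longleftrightarrow>
     v \<bullet> conormal \<alpha> \<Omega> x = 0 \<and> (f has_derivative (\<lambda>h. v \<bullet> h)) (at x within frontier \<Omega>)"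

definition tpd ::
  "real \<Rightarrow> (real^'n::finite) set \<Rightarrow> 'n \<Rightarrow> (real^'n \<Rightarrow> real) \<Rightarrow> real^'n \<Rightarrow> real" where
  "tpd \<alpha> \<Omega> i f x = (THE v. is_tgrad \<alpha> \<Omega> f x v) $ i"

definition in_C1_bd :: "real \<Rightarrow> (real^'n::finite) set \<Rightarrow> (real^'n \<Rightarrow> real) \<Rightarrow> bool" where
  "in_C1_bd \<alpha> \<Omega> f \<longleftrightarrow>
     continuous_on (frontier \<Omega>) f \<and>
     (\<forall>x\<in>frontier \<Omega>. \<exists>v. is_tgrad \<alpha> \<Omega> f x v) \<and>
     (\<forall>i. continuous_on (frontier \<Omega>) (tpd \<alpha> \<Omega> i f) \<and> holder_on \<alpha> (frontier \<Omega>) (tpd \<alpha> \<Omega> i f))"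

abbreviation in_par1_bd ::
  "(real^'n::finite) set \<Rightarrow> real \<Rightarrow> real \<Rightarrow> (real^'n \<Rightarrow> real \<Rightarrow> real) \<Rightarrow> bool" where
  "in_par1_bd \<Omega> \<alpha> T v \<equiv>
     in_aniso (in_C1_bd \<alpha> \<Omega>) (frontier \<Omega>) (D_multi (tpd \<alpha> \<Omega>)) 1 \<alpha> 1 T v"

abbreviation norm_par1_bd ::
  "(real^'n::finite) set \<Rightarrow> real \<Rightarrow> real \<Rightarrow> (real^'n \<Rightarrow> real \<Rightarrow> real) \<Rightarrow> real" where
  "norm_par1_bd \<Omega> \<alpha> T v \<equiv> aniso_norm (frontier \<Omega>) (D_multi (tpd \<alpha> \<Omega>)) 1 \<alpha> 1 T v"

section \<open>Caputo derivative and convolution\<close>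

definition conv :: "(real \<Rightarrow> real) \<Rightarrow> (real \<Rightarrow> real) \<Rightarrow> real \<Rightarrow> real" where
  "conv h1 h2 t = (LINT s:{0..t}|lebesgue. h1 s * h2 (t - s))"

definition frac_int :: "real \<Rightarrow> (real \<Rightarrow> real) \<Rightarrow> real \<Rightarrow> real" where
  "frac_int \<theta> w t = (LINT s:{0..t}|lebesgue. (w s - w 0) / (t - s) powr \<theta>)"

text \<open>For functions on \<open>[0,\<tau>]\<close>; the time derivative is one-sided at the end points. As
  \<open>frac_int \<theta> w\<close> is continuous on \<open>[0,\<tau>]\<close> for continuous \<open>w\<close>, the value at an end point is the
  limit of the interior values whenever this limit exists.\<close>

definition has_caputo :: "real \<Rightarrow> real \<Rightarrow> (real \<Rightarrow> real) \<Rightarrow> bool" where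
  "has_caputo \<theta> \<tau> w \<longleftrightarrow> (\<forall>t\<in>{0..\<tau>}. frac_int \<theta> w differentiable (at t within {0..\<tau>}))"

definition caputo :: "real \<Rightarrow> real \<Rightarrow> (real \<Rightarrow> real) \<Rightarrow> real \<Rightarrow> real" where
  "caputo \<theta> \<tau> w t = 1 / Gamma (1 - \<theta>) * time_deriv \<tau> (frac_int \<theta> w) t"

definition in_par2 ::
  "(real^'n::finite) set \<Rightarrow> real \<Rightarrow> real \<Rightarrow> real \<Rightarrow> (real^'n \<Rightarrow> real \<Rightarrow> real) \<Rightarrow> bool" where
  "in_par2 \<Omega> \<alpha> \<nu> T v \<longleftrightarrow>
     in_C_time (in_Cl \<Omega> 2 \<alpha>) (closure \<Omega>) (D_cl \<Omega>) 2 \<alpha> T v \<and>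
     (\<forall>x\<in>closure \<Omega>. has_caputo \<nu> T (v x)) \<and>
     in_par \<Omega> 0 \<alpha> \<nu> T (\<lambda>x. caputo \<nu> T (v x)) \<and>
     (\<forall>\<beta>. size \<beta> \<in> {1, 2} \<longrightarrow> time_holder ((2 + \<alpha> - real (size \<beta>)) / 2 * \<nu>) (closure \<Omega>) T
        (\<lambda>x t. D_cl \<Omega> \<beta> (\<lambda>y. v y t) x))"

definition norm_par2 ::
  "(real^'n::finite) set \<Rightarrow> real \<Rightarrow> real \<Rightarrow> real \<Rightarrow> (real^'n \<Rightarrow> real \<Rightarrow> real) \<Rightarrow> real" where
  "norm_par2 \<Omega> \<alpha> \<nu> T v =
     sup_Cl_norm (closure \<Omega>) (D_cl \<Omega>) 2 \<alpha> T v
     + norm_par \<Omega> 0 \<alpha> \<nu> T (\<lambda>x. caputo \<nu> T (v x))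
     + (\<Sum>\<beta> | size \<beta> \<in> {1, 2}. time_seminorm ((2 + \<alpha> - real (size \<beta>)) / 2 * \<nu>) (closure \<Omega>) T
           (\<lambda>x t. D_cl \<Omega> \<beta> (\<lambda>y. v y t) x))"

section \<open>The direct problem\<close>

datatype fdo_type = TypeI | TypeII

text \<open>The coefficients \<open>rho\<close> and the orders \<open>\<nu>\<close> are indexed by \<open>{1..M}\<close>; \<open>rexp\<close> is the exponent
  of the space \<open>C\<^sup>\<nu>\<close> containing the \<open>rho k\<close>; \<open>surf\<close> is the surface measure on the boundary.\<close>

record ('n::finite) problem =
  dom :: "(real^'n) set"
  surf :: "(real^'n) measure"
  alpha :: real
  horizon :: real
  tstar :: real
  delta :: real
  ftype :: fdo_type
  M :: nat
  orders :: "nat \<Rightarrow> real"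
  rho :: "nat \<Rightarrow> real \<Rightarrow> real"
  rexp :: real
  bc :: "'n \<Rightarrow> 'n \<Rightarrow> real^'n \<Rightarrow> real \<Rightarrow> real"
  a0 :: "real \<Rightarrow> real"
  b0 :: "real \<Rightarrow> real"
  ker :: "real \<Rightarrow> real"
  rhs :: "real^'n \<Rightarrow> real \<Rightarrow> real"
  phi :: "real^'n \<Rightarrow> real \<Rightarrow> real"
  init :: "real^'n \<Rightarrow> real"
  psi :: "real \<Rightarrow> real"

abbreviation nu1 :: "('n::finite) problem \<Rightarrow> real" where
  "nu1 P \<equiv> orders P 1"

definition div_part ::
  "('n::finite) problem \<Rightarrow> (real^'n \<Rightarrow> real \<Rightarrow> real) \<Rightarrow> real^'n \<Rightarrow> real \<Rightarrow> real" where
  "div_part P u x t =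
     (\<Sum>i\<in>UNIV. \<Sum>j\<in>UNIV. pd i (\<lambda>y. bc P i j y t * pd j (\<lambda>z. u z t) y) x)"

definition L1_op ::
  "('n::finite) problem \<Rightarrow> (real^'n \<Rightarrow> real \<Rightarrow> real) \<Rightarrow> real^'n \<Rightarrow> real \<Rightarrow> real" where
  "L1_op P u x t = div_part P u x t + a0 P t * u x t"

definition L2_op ::
  "('n::finite) problem \<Rightarrow> (real^'n \<Rightarrow> real \<Rightarrow> real) \<Rightarrow> real^'n \<Rightarrow> real \<Rightarrow> real" where
  "L2_op P u x t = div_part P u x t + b0 P t * u x t"

definition N_op ::
  "('n::finite) problem \<Rightarrow> (real^'n \<Rightarrow> real \<Rightarrow> real) \<Rightarrow> real^'n \<Rightarrow> real \<Rightarrow> real" where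
  "N_op P u x t =
     - (\<Sum>i\<in>UNIV. \<Sum>j\<in>UNIV. bc P i j x t * conormal (alpha P) (dom P) x $ i
          * cl_ext (dom P) (pd j (\<lambda>y. u y t)) x)"

definition FDO :: "('n::finite) problem \<Rightarrow> (real^'n \<Rightarrow> real \<Rightarrow> real) \<Rightarrow> real^'n \<Rightarrow> real \<Rightarrow> real" where
  "FDO P u x t = (case ftype P of
       TypeI \<Rightarrow> (\<Sum>i=1..M P. rho P i t * caputo (orders P i) (horizon P) (u x) t)
     | TypeII \<Rightarrow> (\<Sum>i=1..M P. caputo (orders P i) (horizon P) (\<lambda>s. rho P i s * u x s) t))"

text \<open>Global classical solutions. For the II type operator, the fractional derivatives of the
  products that occur in the equation are required to exist and to be continuous.\<close>

definition classical_solution ::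
  "('n::finite) problem \<Rightarrow> (real^'n \<Rightarrow> real \<Rightarrow> real) \<Rightarrow> bool" where
  "classical_solution P u \<longleftrightarrow>
     in_par2 (dom P) (alpha P) (nu1 P) (horizon P) u \<and>
     (\<forall>i\<in>{2..M P}. (\<forall>x\<in>closure (dom P). has_caputo (orders P i) (horizon P) (u x)) \<and>
        in_par (dom P) 0 (alpha P) (nu1 P) (horizon P)
          (\<lambda>x. caputo (orders P i) (horizon P) (u x))) \<and>
     (ftype P = TypeII \<longrightarrow>
        (\<forall>i\<in>{1..M P}.
           (\<forall>x\<in>closure (dom P). has_caputo (orders P i) (horizon P) (\<lambda>s. rho P i s * u x s)) \<and>
           continuous_on (closure (dom P) \<times> {0..horizon P})
             (\<lambda>(x, t). caputo (orders P i) (horizon P) (\<lambda>s. rho P i s * u x s) t))) \<and>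
     (\<forall>x\<in>dom P. \<forall>t\<in>{0<..<horizon P}.
        FDO P u x t - L1_op P u x t - conv (ker P) (L2_op P u x) t = rhs P x t) \<and>
     (\<forall>x\<in>closure (dom P). u x 0 = init P x) \<and>
     (\<forall>x\<in>frontier (dom P). \<forall>t\<in>{0..horizon P}.
        N_op P u x t + (1 - delta P) * conv (ker P) (N_op P u x) t = phi P x t)"

definition unique_classical_solution ::
  "('n::finite) problem \<Rightarrow> (real^'n \<Rightarrow> real \<Rightarrow> real) \<Rightarrow> bool" where
  "unique_classical_solution P u \<longleftrightarrow>
     classical_solution P u \<and>
     (\<forall>v. classical_solution P v \<longrightarrow> (\<forall>x\<in>closure (dom P). \<forall>t\<in>{0..horizon P}. v x t = u x t))"

definition observed :: "('n::finite) problem \<Rightarrow> (real^'n \<Rightarrow> real \<Rightarrow> real) \<Rightarrow> bool" where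
  "observed P u \<longleftrightarrow> (\<forall>t\<in>{0..tstar P}. (LINT x:dom P|lebesgue. u x t) = psi P t)"

subsection \<open>Hypotheses\<close>

definition orders_ok :: "('n::finite) problem \<Rightarrow> bool" where
  "orders_ok P \<longleftrightarrow>
     (\<forall>i\<in>{1..M P}. 0 < orders P i \<and> orders P i < 1) \<and>
     (\<forall>i. 1 \<le> i \<and> i < M P \<longrightarrow> orders P (Suc i) < orders P i)"

definition setting :: "('n::finite) problem \<Rightarrow> bool" where
  "setting P \<longleftrightarrow>
     0 < alpha P \<and> alpha P < 1 \<and> C2_domain (alpha P) (dom P) \<and>
     surface_measure (alpha P) (dom P) (surf P) \<and>
     0 < horizon P \<and> 0 < tstar P \<and> tstar P < min 1 (horizon P) \<and>
     delta P \<in> {0, 1} \<and> 1 \<le> M P \<and> orders_ok P"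

definition h1 :: "('n::finite) problem \<Rightarrow> bool" where
  "h1 P \<longleftrightarrow>
     (\<exists>r1 r2. 0 < r1 \<and> r1 < r2 \<and>
       (\<forall>x\<in>closure (dom P). \<forall>t\<in>{0..horizon P}. \<forall>\<xi>::real^'n.
          r1 * (norm \<xi>)\<^sup>2 \<le> (\<Sum>i\<in>UNIV. \<Sum>j\<in>UNIV. bc P i j x t * \<xi> $ i * \<xi> $ j) \<and>
          (\<Sum>i\<in>UNIV. \<Sum>j\<in>UNIV. bc P i j x t * \<xi> $ i * \<xi> $ j) \<le> r2 * (norm \<xi>)\<^sup>2))"

text \<open>For \<open>M = 1\<close> there is no \<open>\<nu>\<^sub>2\<close> and the lower bound on \<open>\<nu>\<^sub>1\<close> is void.\<close>

definition h2 :: "('n::finite) problem \<Rightarrow> bool" where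
  "h2 P \<longleftrightarrow>
     orders_ok P \<and>
     (2 \<le> M P \<longrightarrow> 2 * orders P 2 / (2 - alpha P) < nu1 P) \<and>
     (\<exists>r3>0. \<forall>t\<in>{0..horizon P}. r3 \<le> rho P 1 t)"

definition h3 :: "('n::finite) problem \<Rightarrow> bool" where
  "h3 P \<longleftrightarrow>
     holder_on (alpha P / 2) {0..horizon P} (a0 P) \<and>
     holder_on (alpha P / 2) {0..horizon P} (b0 P) \<and>
     (\<forall>i j. in_par (dom P) 1 (alpha P) 1 (horizon P) (bc P i j)) \<and>
     1 < rexp P \<and> rexp P < 1 + alpha P / 2 \<and>
     (\<forall>k\<in>{1..M P}. in_C1_holder (rexp P) (horizon P) (rho P k))"

definition h4 :: "('n::finite) problem \<Rightarrow> bool" where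
  "h4 P \<longleftrightarrow>
     ker P absolutely_integrable_on {0<..<horizon P} \<and>
     in_par1_bd (dom P) (alpha P) (horizon P) (phi P) \<and>
     in_Cl (dom P) 2 (alpha P) (init P) \<and>
     in_par (dom P) 0 (alpha P) 1 (horizon P) (rhs P)"

definition h5 :: "('n::finite) problem \<Rightarrow> bool" where
  "h5 P \<longleftrightarrow>
     continuous_on {0..tstar P} (psi P) \<and>
     (\<forall>i\<in>{1..M P}. has_caputo (orders P i) (tstar P) (psi P) \<and>
        (\<exists>\<beta>. 0 < \<beta> \<and> \<beta> < 1 \<and> holder_on \<beta> {0..tstar P} (caputo (orders P i) (tstar P) (psi P))))"

definition h6 :: "('n::finite) problem \<Rightarrow> bool" where
  "h6 P \<longleftrightarrow> (\<forall>x\<in>frontier (dom P). N_op P (\<lambda>y s. init P y) x 0 = phi P x 0)"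

definition direct_hyps :: "('n::finite) problem \<Rightarrow> bool" where
  "direct_hyps P \<longleftrightarrow> setting P \<and> h1 P \<and> h2 P \<and> h3 P \<and> h4 P \<and> h6 P"

section \<open>The inverse problems\<close>

text \<open>A triple \<open>(\<mu>1, \<mu>i, u)\<close> solves the first inverse problem. As the remaining orders are
  given and decreasing, \<open>orders_ok\<close> expresses that \<open>\<mu>1\<close> lies between \<open>\<nu>\<^sub>2\<close> and \<open>1\<close>, and \<open>\<mu>i\<close>
  strictly between its neighbours (\<open>0\<close> being the lower neighbour of the last order).\<close>

definition solves_first ::
  "('n::finite) problem \<Rightarrow> nat \<Rightarrow> real \<Rightarrow> real \<Rightarrow> (real^'n \<Rightarrow> real \<Rightarrow> real) \<Rightarrow> bool" where
  "solves_first P i \<mu>1 \<mu>i u \<longleftrightarrow>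
     (let Q = P\<lparr>orders := (orders P)(1 := \<mu>1, i := \<mu>i)\<rparr>
      in orders_ok Q \<and> unique_classical_solution Q u \<and> observed Q u)"

definition unique_first ::
  "('n::finite) problem \<Rightarrow> nat \<Rightarrow> real \<Rightarrow> real \<Rightarrow> (real^'n \<Rightarrow> real \<Rightarrow> real) \<Rightarrow> bool" where
  "unique_first P i \<mu>1 \<mu>i u \<longleftrightarrow>
     solves_first P i \<mu>1 \<mu>i u \<and>
     (\<forall>\<mu>1' \<mu>i' u'. solves_first P i \<mu>1' \<mu>i' u' \<longrightarrow>
        \<mu>1' = \<mu>1 \<and> \<mu>i' = \<mu>i \<and> (\<forall>x\<in>closure (dom P). \<forall>t\<in>{0..horizon P}. u' x t = u x t))"

definition sing_kernel :: "real \<Rightarrow> (real \<Rightarrow> real) \<Rightarrow> real \<Rightarrow> real" where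
  "sing_kernel \<gamma> K0 t = t powr (- \<gamma>) * K0 t"

text \<open>A triple \<open>(\<mu>1, \<gamma>, u)\<close> solves the second inverse problem with \<open>\<gamma>\<close> looked for in \<open>(0,\<gamma>0)\<close>.\<close>

definition solves_second ::
  "('n::finite) problem \<Rightarrow> (real \<Rightarrow> real) \<Rightarrow> real \<Rightarrow> real \<Rightarrow> real
     \<Rightarrow> (real^'n \<Rightarrow> real \<Rightarrow> real) \<Rightarrow> bool" where
  "solves_second P K0 \<gamma>0 \<mu>1 \<gamma> u \<longleftrightarrow>
     (let Q = P\<lparr>orders := (orders P)(1 := \<mu>1), ker := sing_kernel \<gamma> K0\<rparr>
      in 0 < \<gamma> \<and> \<gamma> < \<gamma>0 \<and> orders_ok Q \<and>
         (2 \<le> M P \<longrightarrow> 2 * orders P 2 / (2 - alpha P) < \<mu>1) \<and>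
         unique_classical_solution Q u \<and> observed Q u)"

definition unique_second ::
  "('n::finite) problem \<Rightarrow> (real \<Rightarrow> real) \<Rightarrow> real \<Rightarrow> real \<Rightarrow> real
     \<Rightarrow> (real^'n \<Rightarrow> real \<Rightarrow> real) \<Rightarrow> bool" where
  "unique_second P K0 \<gamma>0 \<mu>1 \<gamma> u \<longleftrightarrow>
     solves_second P K0 \<gamma>0 \<mu>1 \<gamma> u \<and>
     (\<forall>\<mu>1' \<gamma>' u'. solves_second P K0 \<gamma>0 \<mu>1' \<gamma>' u' \<longrightarrow>
        \<mu>1' = \<mu>1 \<and> \<gamma>' = \<gamma> \<and> (\<forall>x\<in>closure (dom P). \<forall>t\<in>{0..horizon P}. u' x t = u x t))"

text \<open>In dimension one, \<open>\<Omega>\<close> is an interval with end points \<open>left_end\<close> and \<open>right_end\<close>.\<close>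

definition left_end :: "(real^'n::finite) set \<Rightarrow> real^'n" where
  "left_end \<Omega> = (\<chi> i. Inf ((\<lambda>x. x $ i) ` \<Omega>))"

definition right_end :: "(real^'n::finite) set \<Rightarrow> real^'n" where
  "right_end \<Omega> = (\<chi> i. Sup ((\<lambda>x. x $ i) ` \<Omega>))"

definition bd_flux :: "('n::finite) problem \<Rightarrow> real \<Rightarrow> real" where
  "bd_flux P t =
     (if CARD('n) = 1 then phi P (right_end (dom P)) t - phi P (left_end (dom P)) t
      else (LINT x:frontier (dom P)|surf P. phi P x t))"

definition C_nu :: "('n::finite) problem \<Rightarrow> real \<Rightarrow> real" where
  "C_nu P t =
     (LINT x:dom P|lebesgue. rhs P x t) - delta P * conv (ker P) (bd_flux P) t
     + a0 P t * psi P t + conv (ker P) (\<lambda>s. b0 P s * psi P s) t - bd_flux P t"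

definition C_one :: "('n::finite) problem \<Rightarrow> real \<Rightarrow> real" where
  "C_one P t = delta P * bd_flux P t - b0 P t * psi P t"

definition data_norm :: "('n::finite) problem \<Rightarrow> real" where
  "data_norm P =
     norm_par (dom P) 0 (alpha P) 1 (horizon P) (rhs P)
     + norm_par1_bd (dom P) (alpha P) (horizon P) (phi P)
     + norm_Cl (dom P) 2 (alpha P) (init P)"

definition nu1a :: "('n::finite) problem \<Rightarrow> real \<Rightarrow> real" where
  "nu1a P t = (case ftype P of
       TypeI \<Rightarrow> ln \<bar>psi P t - (LINT x:dom P|lebesgue. init P x)\<bar> / ln t
     | TypeII \<Rightarrow> ln \<bar>rho P 1 t * psi P t - rho P 1 0 * (LINT x:dom P|lebesgue. init P x)\<bar> / ln t)"

definition assumption_A ::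
  "('n::finite) problem \<Rightarrow> nat \<Rightarrow> (real^'n \<Rightarrow> real \<Rightarrow> real) \<Rightarrow> bool" where
  "assumption_A P i u \<longleftrightarrow>
     direct_hyps P \<and> h5 P \<and> C_nu P 0 \<noteq> 0 \<and>
     i \<in> {2..M P} \<and> (\<forall>t\<in>{0..tstar P}. rho P i t \<noteq> 0) \<and>
     unique_first P i (nu1 P) (orders P i) u"

definition assumption_B ::
  "('n::finite) problem \<Rightarrow> (real \<Rightarrow> real) \<Rightarrow> real \<Rightarrow> real \<Rightarrow> (real^'n \<Rightarrow> real \<Rightarrow> real) \<Rightarrow> bool" where
  "assumption_B P K0 \<gamma>0 \<gamma> u \<longleftrightarrow>
     direct_hyps P \<and> h5 P \<and> C_nu P 0 \<noteq> 0 \<and> C_one P 0 \<noteq> 0 \<and>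
     ker P = sing_kernel \<gamma> K0 \<and> K0 0 \<noteq> 0 \<and>
     K0 absolutely_integrable_on {0<..<horizon P} \<and> continuous_on {0..tstar P} K0 \<and>
     unique_second P K0 \<gamma>0 (nu1 P) \<gamma> u"

section \<open>Constants and times\<close>

definition x_star :: real where
  "x_star = (SOME x. 0 < 1 + x \<and> (\<forall>y>0. Gamma (1 + x) \<le> Gamma y))"

definition T0 :: "('n::finite) problem \<Rightarrow> real \<Rightarrow> real" where
  "T0 P \<epsilon> = (let G = Gamma (1 + x_star); C = \<bar>C_nu P 0\<bar>; r = rho P 1 0 in
     case ftype P of
       TypeI \<Rightarrow> Min {tstar P, (r / (G * C)) powr (- 2 / \<epsilon>), (C / (G * r)) powr (- 2 / \<epsilon>),
                     (1 - \<epsilon>) powr (2 / \<epsilon>)}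
     | TypeII \<Rightarrow> Min {tstar P, (G * C) powr (2 / \<epsilon>), (C / G) powr (- 2 / \<epsilon>),
                     (1 - \<epsilon>) powr (2 / \<epsilon>)})"

definition T_K :: "('n::finite) problem \<Rightarrow> (real \<Rightarrow> real) \<Rightarrow> real" where
  "T_K P K0 = Sup {\<tau>. 0 < \<tau> \<and> \<tau> \<le> tstar P \<and> (\<forall>t. 0 \<le> t \<and> t < \<tau> \<longrightarrow> sgn (K0 t) = sgn (K0 0))}"

definition C4 :: "('n::finite) problem \<Rightarrow> real \<Rightarrow> real \<Rightarrow> real \<Rightarrow> real" where
  "C4 P C0 C1 C2 = (let G = Gamma (1 + x_star) in
     case ftype P of
       TypeI \<Rightarrow> C0 / G * (1 + 2 * (\<Sum>i=2..M P. \<bar>rho P i 0\<bar> / (rho P 1 0 * G)))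
     | TypeII \<Rightarrow> C0 / G * (C1 + C2) * (1 + 2 / G)
                 * (\<Sum>i=1..M P. C1_holder_norm (rexp P) (tstar P) (rho P i)))"

definition explicit_time :: "('n::finite) problem \<Rightarrow> real \<Rightarrow> real \<Rightarrow> real \<Rightarrow> real \<Rightarrow> real" where
  "explicit_time P \<epsilon> C0 C1 C2 = (case ftype P of
       TypeI \<Rightarrow> \<epsilon> * \<bar>C_nu P 0\<bar> / (C4 P C0 C1 C2 * rho P 1 0 * data_norm P)
     | TypeII \<Rightarrow> \<epsilon> * \<bar>C_nu P 0\<bar> / (C4 P C0 C1 C2 * data_norm P))"

definition nu_zero :: "('n::finite) problem \<Rightarrow> nat \<Rightarrow> real" where
  "nu_zero P i = (if i \<noteq> 2 then alpha P * orders P 2 / 2 else alpha P * orders P 3 / 2)"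

definition T_first ::
  "('n::finite) problem \<Rightarrow> nat \<Rightarrow> real \<Rightarrow> real \<Rightarrow> real \<Rightarrow> real \<Rightarrow> real" where
  "T_first P i \<epsilon> C0 C1 C2 = min (T0 P \<epsilon>) (explicit_time P \<epsilon> C0 C1 C2 powr (1 / nu_zero P i))"

definition T_second ::
  "('n::finite) problem \<Rightarrow> (real \<Rightarrow> real) \<Rightarrow> real \<Rightarrow> real \<Rightarrow> real \<Rightarrow> real \<Rightarrow> real" where
  "T_second P K0 \<epsilon> C0 C1 C2 =
     Min {T0 P \<epsilon>, explicit_time P \<epsilon> C0 C1 C2 powr (2 / (alpha P * orders P 2)), T_K P K0}"

definition good_time :: "('n::finite) problem \<Rightarrow> real \<Rightarrow> real \<Rightarrow> bool" where
  "good_time P \<epsilon> TI \<longleftrightarrow>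
     0 < TI \<and> TI \<le> T0 P \<epsilon> \<and> (\<forall>ta\<in>{0<..TI}. \<bar>nu1 P - nu1a P ta\<bar> < \<epsilon>)"

definition apriori :: "('n::finite) problem \<Rightarrow> real \<Rightarrow> bool" where
  "apriori P C \<longleftrightarrow>
     (direct_hyps P \<longrightarrow> (\<forall>u. classical_solution P u \<longrightarrow>
        norm_par2 (dom P) (alpha P) (nu1 P) (horizon P) u
        + (\<Sum>i=2..M P. norm_par (dom P) 0 (alpha P) (nu1 P) (horizon P)
              (\<lambda>x. caputo (orders P i) (horizon P) (u x)))
        \<le> C * data_norm P))"

text \<open>The quantities the constant of the a priori estimate may depend on: \<open>T\<close>, the volume of
  \<open>\<Omega>\<close>, the \<open>L\<^sup>1\<close> norm of the kernel, and the norms of the coefficients. A constant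
  depending only on these is a function of \<open>size_data P\<close>; it depends neither on the data
  \<open>rhs, phi, init, psi\<close> nor on the orders.\<close>

type_synonym 'n size_data =
  "real \<times> real \<times> real \<times> real \<times> real \<times> ('n \<Rightarrow> 'n \<Rightarrow> real) \<times> (nat \<Rightarrow> real)"

definition size_data :: "('n::finite) problem \<Rightarrow> 'n size_data" where
  "size_data P =
     (horizon P, measure lebesgue (dom P),
      (LINT t:{0<..<horizon P}|lebesgue. \<bar>ker P t\<bar>),
      C_holder_norm (alpha P / 2) (horizon P) (a0 P),
      C_holder_norm (alpha P / 2) (horizon P) (b0 P),
      (\<lambda>i j. norm_par (dom P) 1 (alpha P) 1 (horizon P) (bc P i j)),
      (\<lambda>k. if k \<in> {1..M P} then C1_holder_norm (rexp P) (horizon P) (rho P k) else 0))"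

definition product_estimates :: "('n::finite) problem \<Rightarrow> real \<Rightarrow> real \<Rightarrow> bool" where
  "product_estimates P C1 C2 \<longleftrightarrow>
     (\<forall>i\<in>{1..M P}. \<forall>\<beta>. 0 < \<beta> \<and> \<beta> \<le> alpha P * nu1 P / 2 \<longrightarrow>
        (let w = caputo (orders P i) (tstar P) (\<lambda>s. rho P i s * psi P s);
             B = C1_holder_norm (rexp P) (tstar P) (rho P i)
                 * C_holder_norm \<beta> (tstar P) (caputo (orders P i) (tstar P) (psi P))
         in has_caputo (orders P i) (tstar P) (\<lambda>s. rho P i s * psi P s) \<and>
            holder_on \<beta> {0..tstar P} w \<and>
            holder_seminorm \<beta> {0..tstar P} w \<le> C1 * B \<and>
            C_holder_norm \<beta> (tstar P) w \<le> C2 * B))"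

end

theory Submission
  imports Defs
begin

text \<open>Let \<open>m t\<close> be the observed mass, weighted by \<open>\<rho>\<^sub>1\<close> for the II type operator. At
  \<open>t = 0\<close> the lower order fractional derivatives and the convolution vanish, so integrating the
  equation over \<open>\<Omega>\<close> by the divergence theorem identifies the leading coefficient \<open>c\<close>
  (the constant \<open>C\<^sub>\<nu>(0)\<close>, divided by \<open>\<rho>\<^sub>1(0)\<close> for the I type) as the integral of the initial
  Caputo derivative of order \<open>\<nu>\<^sub>1\<close>. Inverting the Caputo derivative gives
  \<open>m t - m 0 = (c + error) * t powr \<nu>\<^sub>1 / Gamma (1 + \<nu>\<^sub>1)\<close>, where the error is at most the modulus of
  continuity of that derivative; the a priori estimate bounds it by a multiple of
  \<open>t powr (\<alpha> * \<nu>\<^sub>1 / 2)\<close>. Once the relative error is below \<open>\<epsilon>\<close>, the time \<open>T0\<close> is small enough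
  for \<open>\<bar>c\<bar> / Gamma (1 + \<nu>\<^sub>1)\<close> to be absorbed when taking the logarithm and dividing by \<open>ln t\<close>.
  The constant \<open>C\<^sub>0\<close> of the statement is the given a priori constant enlarged so as to
  dominate also its product with \<open>|\<Omega>|\<close>, which appears on integrating over \<open>\<Omega>\<close>.\<close>

subsection \<open>Fractional integrals and Caputo derivatives\<close>

text \<open>The expansion is made for each fixed \<open>x\<close> and integrated afterwards, so the
  equation itself is integrated over the domain at \<open>t = 0\<close> only. The lower order terms
  are zero there because \<open>u x s - u x 0\<close> is of size \<open>s powr nu1 P\<close> and
  their orders are smaller; the convolution tends to zero because the kernel is integrable. Since
  \<open>surface_measure\<close> is specified only through charts, the divergence theorem is derived
  from scratch: a cutoff below each graph, then a partition of unity. For the II type operator the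
  given product constants concern the observation, not the solution, so the Caputo derivative of
  \<open>psi P\<close> must first be identified with the spatial integral of that of
  \<open>u\<close>. The explicit times contain an order below \<open>nu1 P\<close>; this is harmless
  because all times lie below 1, where lowering the exponent only enlarges a power. The final
  inequality is strict, so the error constant must be strictly below the one in \<open>C4\<close>;
  this is why the enlarged constant also has a summand 1.\<close>

lemma Gamma_real_nonzero: "Gamma x \<noteq> 0" if "0 < x" for x :: real
  using Gamma_real_pos[OF that] by simp

lemma Gamma_real_plus1: "Gamma (x + 1) = x * Gamma x" if "0 < x" for x :: real
  by (rule Gamma_plus1) (use that in \<open>auto simp: nonpos_Ints_def\<close>)

lemma Beta_real_1: "Beta x 1 = 1 / x" if "0 < x" for x :: real
  using Gamma_real_plus1[OF that] Gamma_real_nonzero[OF that] by (simp add: Beta_def)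

section \<open>Beta integrals and the composition of power kernels\<close>

text \<open>The substitution \<open>s = r + (t - r) * x\<close> turns the integral into Euler's Beta
  integral on the unit interval. This is the inner integral when two fractional integrals are
  composed.\<close>

lemma has_bochner_integral_Beta_kernel:
  fixes a b r t :: real
  assumes a: "0 < a" and b: "0 < b" and rt: "r \<le> t"
  shows "has_bochner_integral lborel
    (\<lambda>s. indicator {r..t} s * ((t - s) powr (a - 1) * (s - r) powr (b - 1)))
    (Beta a b * (t - r) powr (a + b - 1))"
proof (cases "r = t")
  case True
  \<comment> \<open>Only \<open>s = r = t\<close> is left, and there \<open>0 powr y = 0\<close>
    makes the integrand and the right-hand side vanish, whatever the exponents.\<close>
  then have "(\<lambda>s. indicator {r..t} s * ((t - s) powr (a - 1) * (s - r) powr (b - 1))) = (\<lambda>_. 0)"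
    by (auto simp: fun_eq_iff indicator_def)
  with True show ?thesis by (simp add: has_bochner_integral_zero)
next
  case False
  define c where "c = t - r"
  have c: "c > 0" using False rt by (simp add: c_def)
  have B: "has_bochner_integral lborel
      (\<lambda>x. indicator {0..1} x * (x powr (b - 1) * (1 - x) powr (a - 1))) (Beta b a)"
  proof -
    have si: "set_integrable lborel {0..1} (\<lambda>x. x powr (b - 1) * (1 - x) powr (a - 1))"
      by (rule integrable_Beta[OF b a])
    have "(LBINT x:{0..1}. x powr (b - 1) * (1 - x) powr (a - 1)) = Beta b a"
      using set_borel_integral_eq_integral[OF si] has_integral_Beta_real[OF b a]
      by (simp add: integral_unique)
    then show ?thesis
      using si unfolding set_integrable_def set_lebesgue_integral_def has_bochner_integral_iff by simp
  qed
  have eq: "indicator {r..t} (r + c * x) * ((t - (r + c * x)) powr (a - 1) * (r + c * x - r) powr (b - 1))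
      = c powr (a + b - 2) * (indicator {0..1} x * (x powr (b - 1) * (1 - x) powr (a - 1)))" for x
  proof (cases "0 \<le> x \<and> x \<le> 1")
    case True
    have "t - (r + c * x) = c * (1 - x)" by (simp add: c_def algebra_simps)
    moreover have "r + c * x \<le> t"
      using True mult_left_mono[of x 1 c] c c_def by linarith
    moreover have "c powr (a - 1) * c powr (b - 1) = c powr (a + b - 2)"
      by (simp add: powr_add[symmetric])
    ultimately show ?thesis using True c by (auto simp: powr_mult)
  next
    case False
    then have "c * x < 0 \<or> c < c * x" using c by (auto simp: mult_less_0_iff not_le)
    then have "r + c * x \<notin> {r..t}" by (auto simp: c_def)
    with False show ?thesis by (auto simp: indicator_def)
  qed
  have "has_bochner_integral lborel (\<lambda>x. indicator {r..t} (r + c * x) *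
      ((t - (r + c * x)) powr (a - 1) * (r + c * x - r) powr (b - 1))) (c powr (a + b - 2) * Beta b a)"
    unfolding eq by (intro has_bochner_integral_mult_right B)
  moreover have "c powr (a + b - 2) * Beta b a = (Beta a b * (t - r) powr (a + b - 1)) /\<^sub>R \<bar>c\<bar>"
  proof -
    have "c powr (a + b - 1) = c powr (a + b - 2) * c powr 1"
      by (simp only: powr_add[symmetric]) simp
    then show ?thesis using c by (simp add: c_def[symmetric] Beta_commute field_simps)
  qed
  ultimately show ?thesis
    using lborel_has_bochner_integral_real_affine_iff[of c
        "\<lambda>s. indicator {r..t} s * ((t - s) powr (a - 1) * (s - r) powr (b - 1))" _ r] c by simp
qed

text \<open>Domination by a multiple of the Beta kernel with second parameter 1.\<close>

lemma integrable_powr_kernel: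
  fixes a t :: real and q :: "real \<Rightarrow> real"
  assumes a: "0 < a" and t: "0 \<le> t" and q: "q \<in> borel_measurable borel" and bd: "\<And>s. \<bar>q s\<bar> \<le> B"
  shows "integrable lborel (\<lambda>r. indicator {0..t} r * (q r * (t - r) powr (a - 1)))"
proof (rule Bochner_Integration.integrable_bound)
  have "integrable lborel (\<lambda>s. indicator {0..t} s * ((t - s) powr (a - 1) * (s - 0) powr (1 - 1)))"
    using has_bochner_integral_Beta_kernel[of a 1 0 t] a t by (auto simp: has_bochner_integral_iff)
  then show "integrable lborel (\<lambda>s. B * (indicator {0..t} s * ((t - s) powr (a - 1) * (s - 0) powr (1 - 1))))"
    by simp
  show "(\<lambda>r. indicator {0..t} r * (q r * (t - r) powr (a - 1))) \<in> borel_measurable lborel"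
    using q by measurable
  \<comment> \<open>The factor \<open>(r - 0) powr (1 - 1)\<close> equals 1 except at
    \<open>r = 0\<close>, where \<open>0 powr 0 = 0\<close>; hence the excluded point and the
    almost-everywhere statement below.\<close>
  have *: "norm (indicator {0..t} r * (q r * (t - r) powr (a - 1)))
        \<le> norm (B * (indicator {0..t} r * ((t - r) powr (a - 1) * (r - 0) powr (1 - 1))))" if "r \<noteq> 0" for r
  proof -
    have "B \<ge> 0" using bd[of 0] by linarith
    then show ?thesis using that bd[of r]
      by (auto simp: abs_mult indicator_def intro!: mult_right_mono)
  qed
  show "AE r in lborel. norm (indicator {0..t} r * (q r * (t - r) powr (a - 1)))
        \<le> norm (B * (indicator {0..t} r * ((t - r) powr (a - 1) * (r - 0) powr (1 - 1))))"
    using AE_lborel_singleton[of 0] by eventually_elim (rule *)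
qed

text \<open>Semigroup law of Riemann-Liouville integrals: order \<open>b\<close> followed by order
  \<open>a\<close> is order \<open>a + b\<close>, up to the Gamma factors collected in
  \<open>Beta a b\<close>. It is Fubini on the triangle \<open>0 \<le> r \<le> s \<le> t\<close>,
  integrating over \<open>s\<close> first.\<close>

lemma convolution_powr_kernels:
  fixes a b t :: real and q :: "real \<Rightarrow> real"
  assumes a: "0 < a" and b: "0 < b" and t: "0 \<le> t"
    and q: "q \<in> borel_measurable borel" and bd: "\<And>s. \<bar>q s\<bar> \<le> B"
  shows "(\<integral>s. indicator {0..t} s * ((t - s) powr (a - 1)
            * (\<integral>r. indicator {0..s} r * (q r * (s - r) powr (b - 1)) \<partial>lborel)) \<partial>lborel)
       = Beta a b * (\<integral>r. indicator {0..t} r * (q r * (t - r) powr (a + b - 1)) \<partial>lborel)"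
proof -
  define f where "f = (\<lambda>(r::real, s::real). indicator {0..t} r *
    (q r * (indicator {r..t} s * ((t - s) powr (a - 1) * (s - r) powr (b - 1)))))"
  note K = has_bochner_integral_Beta_kernel[OF a b]
  have [measurable]: "q \<in> borel_measurable borel" by (rule q)
  have fm: "f \<in> borel_measurable (lborel \<Otimes>\<^sub>M lborel)"
  proof -
    have ind: "indicator {r..t} s = (if r \<le> s \<and> s \<le> t then 1 else (0::real))" for r s :: real by auto
    show ?thesis unfolding f_def ind by measurable
  qed
  have inner: "has_bochner_integral lborel (\<lambda>s. f (r, s))
      (indicator {0..t} r * (q r * (Beta a b * (t - r) powr (a + b - 1))))" for r
  proof (cases "r \<in> {0..t}")
    case True
    then show ?thesis unfolding f_def prod.case
      by (intro has_bochner_integral_mult_right K) auto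
  next
    case False
    then show ?thesis by (simp add: f_def has_bochner_integral_zero)
  qed
  have innern: "has_bochner_integral lborel (\<lambda>s. norm (f (r, s)))
      (indicator {0..t} r * (\<bar>q r\<bar> * (Beta a b * (t - r) powr (a + b - 1))))" for r
  proof -
    have e: "norm (f (r, s)) = indicator {0..t} r *
      (\<bar>q r\<bar> * (indicator {r..t} s * ((t - s) powr (a - 1) * (s - r) powr (b - 1))))" for s
      by (auto simp: f_def abs_mult indicator_def)
    show ?thesis
    proof (cases "r \<in> {0..t}")
      case True
      then show ?thesis unfolding e
        by (intro has_bochner_integral_mult_right K) auto
    next
      case False
      then have "(\<lambda>s. norm (f (r, s))) = (\<lambda>_. 0)" by (intro ext) (simp only: e, simp)
      with False show ?thesis by (simp only: indicator_simps not_False_eq_True mult_zero_left has_bochner_integral_zero)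
    qed
  qed
  have int: "integrable (lborel \<Otimes>\<^sub>M lborel) f"
  proof (rule lborel_pair.Fubini_integrable[OF fm])
    have ab: "0 < a + b" using a b by simp
    have "integrable lborel (\<lambda>r. Beta a b * (indicator {0..t} r * (\<bar>q r\<bar> * (t - r) powr (a + b - 1))))"
      by (intro integrable_mult_right impI integrable_powr_kernel[where B = B] ab t) (use bd in auto)
    moreover have "(\<integral>s. norm (f (r, s)) \<partial>lborel) =
        Beta a b * (indicator {0..t} r * (\<bar>q r\<bar> * (t - r) powr (a + b - 1)))" for r
      using has_bochner_integral_integral_eq[OF innern[of r]] by simp
    ultimately show "integrable lborel (\<lambda>r. \<integral>s. norm (f (r, s)) \<partial>lborel)" by simp
    show "AE r in lborel. integrable lborel (\<lambda>s. f (r, s))"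
      using inner by (auto simp: has_bochner_integral_iff)
  qed
  have "(\<integral>s. (\<integral>r. f (r, s) \<partial>lborel) \<partial>lborel) = (\<integral>r. (\<integral>s. f (r, s) \<partial>lborel) \<partial>lborel)"
    using lborel_pair.Fubini_integral[of "\<lambda>r s. f (r, s)"] int by simp
  also have "\<dots> = (\<integral>r. Beta a b * (indicator {0..t} r * (q r * (t - r) powr (a + b - 1))) \<partial>lborel)"
    by (intro Bochner_Integration.integral_cong refl)
       (subst has_bochner_integral_integral_eq[OF inner], simp)
  also have "\<dots> = Beta a b * (\<integral>r. indicator {0..t} r * (q r * (t - r) powr (a + b - 1)) \<partial>lborel)"
    by simp
  finally have main: "(\<integral>s. (\<integral>r. f (r, s) \<partial>lborel) \<partial>lborel) = \<dots>" .
  have "(\<integral>r. f (r, s) \<partial>lborel) = indicator {0..t} s * ((t - s) powr (a - 1)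
            * (\<integral>r. indicator {0..s} r * (q r * (s - r) powr (b - 1)) \<partial>lborel))" for s
  proof -
    have "f (r, s) = (indicator {0..t} s * (t - s) powr (a - 1))
        * (indicator {0..s} r * (q r * (s - r) powr (b - 1)))" for r
      by (auto simp: f_def indicator_def)
    then show ?thesis by simp
  qed
  with main show ?thesis by simp
qed

section \<open>Fractional integrals as Borel integrals, and Abel inversion\<close>

lemma set_lebesgue_eq_lborel:
  fixes f :: "'a::euclidean_space \<Rightarrow> real"
  assumes "(\<lambda>x. indicator A x * f x) \<in> borel_measurable borel"
  shows "(LINT x:A|lebesgue. f x) = (\<integral>x. indicator A x * f x \<partial>lborel)"
  unfolding set_lebesgue_integral_def real_scaleR_def
  by (rule integral_completion) (use assms in simp)

text \<open>Clamping the argument extends a function on \<open>{0..T}\<close> continuously to the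
  whole line, which supplies global Borel measurability and a global bound for the kernel
  lemmas.\<close>

lemma continuous_clamp:
  fixes w :: "real \<Rightarrow> real"
  assumes "continuous_on {0..T} w" and "0 \<le> T"
  shows "continuous_on UNIV (\<lambda>s. w (max 0 (min T s)))"
  by (rule continuous_on_compose2[OF assms(1)]) (use assms(2) in \<open>auto intro!: continuous_intros\<close>)

lemma bounded_clamp:
  fixes w :: "real \<Rightarrow> real"
  assumes "continuous_on {0..T} w" and "0 \<le> T"
  obtains B where "\<And>s. \<bar>w (max 0 (min T s))\<bar> \<le> B"
proof -
  have "bounded (w ` {0..T})"
    by (intro compact_imp_bounded compact_continuous_image assms) auto
  then obtain B where "\<forall>x\<in>w ` {0..T}. norm x \<le> B" unfolding bounded_iff by blast
  then have "\<And>s. s \<in> {0..T} \<Longrightarrow> \<bar>w s\<bar> \<le> B" by simp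
  then show ?thesis using assms(2) by (intro that[of B]) auto
qed

lemma frac_int_eq_lborel:
  assumes "continuous_on {0..T} w" and "0 \<le> T" and "t \<le> T"
  shows "frac_int \<theta> w t
    = (\<integral>s. indicator {0..t} s * ((w (max 0 (min T s)) - w 0) * (t - s) powr (- \<theta>)) \<partial>lborel)"
proof -
  have [measurable]: "(\<lambda>s. w (max 0 (min T s))) \<in> borel_measurable borel"
    by (intro borel_measurable_continuous_onI continuous_clamp assms)
  have eq: "indicator {0..t} s * ((w s - w 0) / (t - s) powr \<theta>)
     = indicator {0..t} s * ((w (max 0 (min T s)) - w 0) * (t - s) powr (- \<theta>))" for s
    using assms(3) by (auto simp: indicator_def powr_minus_divide min_def max_def)
  have "(\<lambda>s. indicator {0..t} s * ((w (max 0 (min T s)) - w 0) * (t - s) powr (- \<theta>))) \<in> borel_measurable borel"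
    by measurable
  then have "(\<lambda>s. indicator {0..t} s * ((w s - w 0) / (t - s) powr \<theta>)) \<in> borel_measurable borel"
    unfolding eq .
  from set_lebesgue_eq_lborel[OF this] show ?thesis unfolding frac_int_def eq .
qed

lemma frac_int_0: "frac_int \<theta> w 0 = 0"
proof -
  have "(\<lambda>s. indicator {0..0} s * ((w s - w 0) / (0 - s) powr \<theta>)) = (\<lambda>_. 0)"
    by (auto simp: indicator_def fun_eq_iff)
  then show ?thesis by (subst frac_int_def, subst set_lebesgue_eq_lborel) auto
qed

lemma time_deriv_eqI:
  assumes "(f has_vector_derivative D) (at t within {0..\<tau>})" "t \<in> {0..\<tau>}" "0 < \<tau>"
  shows "time_deriv \<tau> f t = D"
  unfolding time_deriv_def
  using vector_derivative_within_cbox[of 0 \<tau> t f D] assms by (simp add: cbox_interval)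

lemma has_vector_derivative_frac_int:
  assumes "has_caputo \<nu> T w" "t \<in> {0..T}" "\<nu> < 1"
  shows "(frac_int \<nu> w has_vector_derivative (Gamma (1 - \<nu>) * caputo \<nu> T w t)) (at t within {0..T})"
proof -
  have "Gamma (1 - \<nu>) \<noteq> 0" by (rule Gamma_real_nonzero) (use assms(3) in simp)
  then show ?thesis using assms
    by (simp add: caputo_def time_deriv_def has_caputo_def vector_derivative_works)
qed

text \<open>Abel inversion, integrated once so that no differentiation under the integral is needed.\<close>

lemma caputo_integrated_inversion:
  assumes nu: "0 < \<nu>" "\<nu> < 1" and T: "0 < T"
    and w: "continuous_on {0..T} w" and cap: "has_caputo \<nu> T w"
    and D: "continuous_on {0..T} (caputo \<nu> T w)" and t: "0 \<le> t" "t \<le> T"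
  shows "Gamma \<nu> * (\<integral>s. indicator {0..t} s * (w (max 0 (min T s)) - w 0) \<partial>lborel)
    = (\<integral>r. indicator {0..t} r * (caputo \<nu> T w (max 0 (min T r)) * (t - r) powr \<nu>) \<partial>lborel) / \<nu>"
proof -
  define q where "q s = w (max 0 (min T s)) - w 0" for s
  define d where "d s = caputo \<nu> T w (max 0 (min T s))" for s
  obtain B1 where B1: "\<And>s. \<bar>w (max 0 (min T s))\<bar> \<le> B1" using bounded_clamp[OF w] T by auto
  obtain B2 where B2: "\<And>s. \<bar>d s\<bar> \<le> B2" unfolding d_def using bounded_clamp[OF D] T by auto
  have qm: "q \<in> borel_measurable borel" unfolding q_def
    by (intro borel_measurable_continuous_onI continuous_intros continuous_clamp w) (use T in auto)
  have dm: "d \<in> borel_measurable borel" unfolding d_def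
    by (intro borel_measurable_continuous_onI continuous_intros continuous_clamp D) (use T in auto)
  have qb: "\<bar>q s\<bar> \<le> B1 + \<bar>w 0\<bar>" for s using B1[of s] by (simp add: q_def)
  \<comment> \<open>The fundamental theorem of calculus for \<open>frac_int \<nu> w\<close>, which
    starts from 0. The trivial factor with exponent \<open>1 - 1\<close> is written out so that the
    right side is a fractional integral of order 1; it differs from 1 only at
    \<open>r = s\<close>.\<close>
  have step: "(\<integral>r. indicator {0..s} r * (q r * (s - r) powr (1 - \<nu> - 1)) \<partial>lborel)
      = Gamma (1 - \<nu>) * (\<integral>r. indicator {0..s} r * (d r * (s - r) powr (1 - 1)) \<partial>lborel)"
    if s: "0 \<le> s" "s \<le> T" for s
  proof -
    have "(\<integral>r. indicator {0..s} r * (q r * (s - r) powr (1 - \<nu> - 1)) \<partial>lborel) = frac_int \<nu> w s"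
      unfolding q_def using frac_int_eq_lborel[OF w, of s \<nu>] s T by simp
    also have "\<dots> = frac_int \<nu> w s - frac_int \<nu> w 0" by (simp add: frac_int_0)
    also have "\<dots> = (\<integral>r. indicator {0..s} r *\<^sub>R (Gamma (1 - \<nu>) * caputo \<nu> T w r) \<partial>lborel)"
    proof (rule integral_FTC_atLeastAtMost[symmetric])
      show "(frac_int \<nu> w has_vector_derivative Gamma (1 - \<nu>) * caputo \<nu> T w x) (at x within {0..s})"
        if "0 \<le> x" "x \<le> s" for x
        by (rule has_vector_derivative_within_subset[OF has_vector_derivative_frac_int])
           (use cap nu that s in auto)
      show "continuous_on {0..s} (\<lambda>r. Gamma (1 - \<nu>) * caputo \<nu> T w r)"
        by (intro continuous_intros continuous_on_subset[OF D]) (use s in auto)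
    qed (use s in auto)
    also have "\<dots> = (\<integral>r. Gamma (1 - \<nu>) * (indicator {0..s} r * (d r * (s - r) powr (1 - 1))) \<partial>lborel)"
    proof (rule integral_cong_AE)
      have *: "indicator {0..s} r *\<^sub>R (Gamma (1 - \<nu>) * caputo \<nu> T w r)
          = Gamma (1 - \<nu>) * (indicator {0..s} r * d r)" for r
      proof (cases "r \<in> {0..s}")
        case True
        then have "max 0 (min T r) = r" using s by auto
        then show ?thesis by (simp add: d_def)
      qed simp
      show "(\<lambda>r. indicator {0..s} r *\<^sub>R (Gamma (1 - \<nu>) * caputo \<nu> T w r)) \<in> borel_measurable lborel"
        unfolding * using dm by measurable
      show "(\<lambda>r. Gamma (1 - \<nu>) * (indicator {0..s} r * (d r * (s - r) powr (1 - 1)))) \<in> borel_measurable lborel"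
        using dm by measurable
      show "AE r in lborel. indicator {0..s} r *\<^sub>R (Gamma (1 - \<nu>) * caputo \<nu> T w r)
          = Gamma (1 - \<nu>) * (indicator {0..s} r * (d r * (s - r) powr (1 - 1)))"
        using AE_lborel_singleton[of s] by eventually_elim (simp add: *[simplified])
    qed
    finally show ?thesis by simp
  qed
  \<comment> \<open>Integrating \<open>step\<close> once more with order \<open>\<nu>\<close> raises
    the left side from order \<open>1 - \<nu>\<close> to order 1 and the right side from order 1 to
    order \<open>\<nu> + 1\<close>.\<close>
  have "Beta \<nu> (1 - \<nu>) * (\<integral>r. indicator {0..t} r * (q r * (t - r) powr (\<nu> + (1 - \<nu>) - 1)) \<partial>lborel)
      = Gamma (1 - \<nu>) * (Beta \<nu> 1 * (\<integral>r. indicator {0..t} r * (d r * (t - r) powr (\<nu> + 1 - 1)) \<partial>lborel))"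
    (is "?l = ?r")
  proof -
    have "?l = (\<integral>s. indicator {0..t} s * ((t - s) powr (\<nu> - 1)
            * (\<integral>r. indicator {0..s} r * (q r * (s - r) powr (1 - \<nu> - 1)) \<partial>lborel)) \<partial>lborel)"
      by (rule convolution_powr_kernels[symmetric, where B = "B1 + \<bar>w 0\<bar>"]) (use nu t qm qb in auto)
    also have "\<dots> = (\<integral>s. Gamma (1 - \<nu>) * (indicator {0..t} s * ((t - s) powr (\<nu> - 1)
            * (\<integral>r. indicator {0..s} r * (d r * (s - r) powr (1 - 1)) \<partial>lborel))) \<partial>lborel)"
    proof (rule Bochner_Integration.integral_cong[OF refl])
      fix s :: real
      show "indicator {0..t} s * ((t - s) powr (\<nu> - 1)
            * (\<integral>r. indicator {0..s} r * (q r * (s - r) powr (1 - \<nu> - 1)) \<partial>lborel))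
        = Gamma (1 - \<nu>) * (indicator {0..t} s * ((t - s) powr (\<nu> - 1)
            * (\<integral>r. indicator {0..s} r * (d r * (s - r) powr (1 - 1)) \<partial>lborel)))"
      proof (cases "s \<in> {0..t}")
        case True
        then have "0 \<le> s" "s \<le> T" using t by auto
        from step[OF this] show ?thesis by simp
      qed simp
    qed
    also have "\<dots> = Gamma (1 - \<nu>) * (\<integral>s. indicator {0..t} s * ((t - s) powr (\<nu> - 1)
            * (\<integral>r. indicator {0..s} r * (d r * (s - r) powr (1 - 1)) \<partial>lborel)) \<partial>lborel)"
      by simp
    also have "\<dots> = ?r"
      by (subst convolution_powr_kernels[where B = B2]) (use nu t dm B2 in auto)
    finally show ?thesis .
  qed
  moreover have "(\<integral>r. indicator {0..t} r * (q r * (t - r) powr (\<nu> + (1 - \<nu>) - 1)) \<partial>lborel)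
      = (\<integral>r. indicator {0..t} r * q r \<partial>lborel)"
  proof (rule integral_cong_AE)
    show "AE r in lborel. indicator {0..t} r * (q r * (t - r) powr (\<nu> + (1 - \<nu>) - 1)) = indicator {0..t} r * q r"
      using AE_lborel_singleton[of t] by eventually_elim simp
  qed (use qm in measurable)
  moreover have "Beta \<nu> (1 - \<nu>) = Gamma \<nu> * Gamma (1 - \<nu>)" by (simp add: Beta_def)
  moreover have "Beta \<nu> 1 = 1 / \<nu>" by (rule Beta_real_1) (rule nu)
  moreover have "Gamma (1 - \<nu>) \<noteq> 0" by (rule Gamma_real_nonzero) (use nu in simp)
  moreover have "Gamma \<nu> * X = Y / \<nu>"
    if "Beta \<nu> (1 - \<nu>) * X' = Gamma (1 - \<nu>) * (Beta \<nu> 1 * Y)" "X' = X" "Beta \<nu> (1 - \<nu>) = Gamma \<nu> * Gamma (1 - \<nu>)"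
      "Beta \<nu> 1 = 1 / \<nu>" "Gamma (1 - \<nu>) \<noteq> 0" for X X' Y
  proof -
    have "(Gamma \<nu> * X) * Gamma (1 - \<nu>) = (Y / \<nu>) * Gamma (1 - \<nu>)" using that by (simp add: mult_ac)
    then show ?thesis using that(5) by (simp only: mult_right_cancel not_False_eq_True)
  qed
  ultimately show ?thesis unfolding q_def[symmetric] d_def[symmetric] by simp
qed

lemma continuous_on_powr_const: "continuous_on {0..T} (\<lambda>s. s powr a)" if "0 < a" for a :: real
  by (rule continuous_on_powr') (use that in \<open>auto intro!: continuous_intros\<close>)

section \<open>Comparison principles for the Caputo derivative\<close>

text \<open>By the integrated inversion, the primitive of \<open>\<sigma> * (w - w 0)\<close> minus
  that of the claimed bound is an integral of \<open>\<sigma> * d - L\<close>, nonnegative on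
  \<open>{0..t}\<close>, against a kernel increasing in its upper limit. It is therefore
  nondecreasing, and its derivative gives the pointwise inequality.\<close>

lemma caputo_lower_bound:
  assumes nu: "0 < \<nu>" "\<nu> < 1" and T: "0 < T"
    and w: "continuous_on {0..T} w" and cap: "has_caputo \<nu> T w"
    and D: "continuous_on {0..T} (caputo \<nu> T w)" and t: "0 < t" "t \<le> T"
    and \<sigma>: "\<And>s. 0 \<le> s \<Longrightarrow> s \<le> t \<Longrightarrow> L \<le> \<sigma> * caputo \<nu> T w s"
  shows "L * t powr \<nu> / Gamma (1 + \<nu>) \<le> \<sigma> * (w t - w 0)"
proof -
  define q where "q s = w (max 0 (min T s)) - w 0" for s
  define d where "d s = caputo \<nu> T w (max 0 (min T s))" for s
  define k where "k y r = indicator {0..y} r * (y - r) powr \<nu>" for y r :: real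
  define Q where "Q y = (\<integral>s. indicator {0..y} s * q s \<partial>lborel)" for y
  obtain B where B: "\<And>s. \<bar>d s\<bar> \<le> B" unfolding d_def using bounded_clamp[OF D] T by auto
  have qc: "continuous_on A q" for A unfolding q_def
    by (rule continuous_on_subset[of UNIV]) (auto intro!: continuous_intros continuous_clamp w less_imp_le T)
  have dm: "d \<in> borel_measurable borel" unfolding d_def
    by (intro borel_measurable_continuous_onI continuous_intros continuous_clamp D) (use T in auto)
  have kint: "integrable lborel (\<lambda>r. c r * k y r)" if "0 \<le> y" "c \<in> borel_measurable borel" "\<And>s. \<bar>c s\<bar> \<le> C" for c C y
    using integrable_powr_kernel[of "\<nu> + 1" y c C] that nu by (simp add: k_def mult_ac)
  have kval: "(\<integral>r. k y r \<partial>lborel) = y powr (\<nu> + 1) / (\<nu> + 1)" if "0 \<le> y" for y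
  proof -
    have "Beta (\<nu> + 1) 1 = 1 / (\<nu> + 1)" by (rule Beta_real_1) (use nu in simp)
    moreover have "(\<integral>s. indicator {0..y} s * ((y - s) powr (\<nu> + 1 - 1) * (s - 0) powr (1 - 1)) \<partial>lborel)
        = Beta (\<nu> + 1) 1 * (y - 0) powr (\<nu> + 1 + 1 - 1)"
      by (rule has_bochner_integral_integral_eq, rule has_bochner_integral_Beta_kernel) (use nu that in auto)
    moreover have "(\<integral>s. indicator {0..y} s * ((y - s) powr (\<nu> + 1 - 1) * (s - 0) powr (1 - 1)) \<partial>lborel)
       = (\<integral>r. k y r \<partial>lborel)"
    proof (rule integral_cong_AE)
      show "(\<lambda>s. indicator {0..y} s * ((y - s) powr (\<nu> + 1 - 1) * (s - 0) powr (1 - 1))) \<in> borel_measurable lborel"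
        by measurable
      show "k y \<in> borel_measurable lborel" unfolding k_def by measurable
      show "AE s in lborel. indicator {0..y} s * ((y - s) powr (\<nu> + 1 - 1) * (s - 0) powr (1 - 1)) = k y s"
        using AE_lborel_singleton[of 0] by eventually_elim (simp add: k_def)
    qed
    ultimately show ?thesis by (simp add: add.commute)
  qed
  have inv: "Gamma \<nu> * Q y = (\<integral>r. d r * k y r \<partial>lborel) / \<nu>" if "0 \<le> y" "y \<le> T" for y
    using caputo_integrated_inversion[OF nu T w cap D that]
    by (simp add: Q_def q_def d_def k_def mult_ac)
  \<comment> \<open>The subtracted term is \<open>L / \<nu>\<close> times the integral of
    \<open>k y\<close>, so that \<open>\<Phi> y\<close> is the integral of
    \<open>\<sigma> * d - L\<close> against \<open>k y\<close>, divided by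
    \<open>\<nu>\<close>.\<close>
  define \<Phi> where "\<Phi> y = \<sigma> * (Gamma \<nu> * Q y) - L * (y powr (\<nu> + 1) / (\<nu> + 1)) / \<nu>" for y
  have \<Phi>: "\<Phi> y = (\<integral>r. (\<sigma> * d r - L) * k y r \<partial>lborel) / \<nu>" if "0 \<le> y" "y \<le> T" for y
  proof -
    have "(\<integral>r. (\<sigma> * d r - L) * k y r \<partial>lborel) = (\<integral>r. \<sigma> * (d r * k y r) - L * (1 * k y r) \<partial>lborel)"
      by (simp add: algebra_simps)
    also have "\<dots> = \<sigma> * (\<integral>r. d r * k y r \<partial>lborel) - L * (\<integral>r. 1 * k y r \<partial>lborel)"
      using kint[OF that(1) dm B] kint[OF that(1), of "\<lambda>_. 1" 1]
      by (subst Bochner_Integration.integral_diff) auto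
    finally show ?thesis using kval[OF that(1)] inv[OF that] by (simp add: \<Phi>_def diff_divide_distrib)
  qed
  have mono: "mono_on {0..t} \<Phi>"
  proof (rule mono_onI)
    fix y z assume yz: "y \<in> {0..t}" "z \<in> {0..t}" "y \<le> z"
    have bd: "\<bar>\<sigma> * d r - L\<bar> \<le> \<bar>\<sigma>\<bar> * B + \<bar>L\<bar>" for r
      using B[of r] mult_left_mono[OF B[of r], of "\<bar>\<sigma>\<bar>"] abs_mult[of \<sigma> "d r"] by linarith
    have "(\<integral>r. (\<sigma> * d r - L) * k y r \<partial>lborel) \<le> (\<integral>r. (\<sigma> * d r - L) * k z r \<partial>lborel)"
    proof (rule Bochner_Integration.integral_mono)
      show "integrable lborel (\<lambda>r. (\<sigma> * d r - L) * k y r)" "integrable lborel (\<lambda>r. (\<sigma> * d r - L) * k z r)"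
        by (rule kint[OF _ _ bd]; use yz dm in \<open>auto\<close>)+
      fix r :: real
      show "(\<sigma> * d r - L) * k y r \<le> (\<sigma> * d r - L) * k z r"
      proof (cases "r \<in> {0..z}")
        case True
        have "k y r \<le> k z r" using True yz nu by (auto simp: k_def indicator_def intro!: powr_mono2)
        moreover have "0 \<le> \<sigma> * d r - L"
        proof -
          have "max 0 (min T r) = r" using True yz t by auto
          then show ?thesis using \<sigma>[of r] True yz t by (simp add: d_def)
        qed
        ultimately show ?thesis by (intro mult_left_mono)
      next
        case False
        then have "r \<notin> {0..y}" using yz by auto
        with False show ?thesis by (simp add: k_def)
      qed
    qed
    then show "\<Phi> y \<le> \<Phi> z" using \<Phi> yz t nu by (simp add: divide_right_mono)
  qed
  have int: "L * s powr \<nu> / Gamma (1 + \<nu>) \<le> \<sigma> * q s" if s: "s \<in> {0<..<t}" for s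
  proof -
    have "(Q has_vector_derivative q s) (at s within {0..t})"
    proof -
      have "((\<lambda>y. integral {0..y} q) has_vector_derivative q s) (at s within {0..t})"
        by (rule integral_has_vector_derivative[OF qc]) (use s in auto)
      moreover have "integral {0..y} q = Q y" for y
      proof -
        have "set_integrable lborel {0..y} q" by (rule borel_integrable_atLeastAtMost') (rule qc)
        from set_borel_integral_eq_integral(2)[OF this] show ?thesis
          by (simp add: Q_def set_lebesgue_integral_def)
      qed
      ultimately show ?thesis by simp
    qed
    moreover have "at s within {0..t} = at s" by (rule at_within_Icc_at) (use s in auto)
    ultimately have dQ: "(Q has_real_derivative q s) (at s)"
      by (simp add: has_real_derivative_iff_has_vector_derivative)
    have "(\<Phi> has_real_derivative (\<sigma> * (Gamma \<nu> * q s) - L * ((\<nu> + 1) * s powr (\<nu> + 1 - 1) / (\<nu> + 1)) / \<nu>)) (at s)"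
    proof -
      have "((\<lambda>y. y powr (\<nu> + 1)) has_real_derivative (\<nu> + 1) * s powr (\<nu> + 1 - 1)) (at s)"
        by (rule has_real_derivative_powr) (use s in simp)
      then show ?thesis unfolding \<Phi>_def by (intro DERIV_diff DERIV_cmult dQ DERIV_cdivide)
    qed
    from mono_on_imp_deriv_nonneg[OF mono this] s
    have "0 \<le> \<sigma> * (Gamma \<nu> * q s) - L * s powr \<nu> / \<nu>" using nu by simp
    then have "L * s powr \<nu> / \<nu> \<le> (\<sigma> * q s) * Gamma \<nu>" by (simp add: mult_ac)
    moreover have "Gamma (1 + \<nu>) = \<nu> * Gamma \<nu>"
      using Gamma_real_plus1[of \<nu>] nu by (simp add: add.commute)
    moreover have "Gamma \<nu> > 0" using nu by (simp add: Gamma_real_pos)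
    ultimately show ?thesis using nu by (simp add: field_simps)
  qed
  \<comment> \<open>Differentiating \<open>\<Phi>\<close> controls interior points only; continuity
    carries the inequality to the right end point \<open>t\<close>.\<close>
  have "0 \<le> \<sigma> * q t - L * t powr \<nu> / Gamma (1 + \<nu>)"
  proof (rule continuous_ge_on_Ioo[OF _ _ t(1), where x = t])
    show "continuous_on {0..t} (\<lambda>s. \<sigma> * q s - L * s powr \<nu> / Gamma (1 + \<nu>))"
      by (intro continuous_intros qc continuous_on_powr_const) (use nu Gamma_real_nonzero[of "1 + \<nu>"] in auto)
  qed (use int t in auto)
  moreover have "max 0 (min T t) = t" using t by auto
  ultimately show ?thesis by (simp add: q_def)
qed

text \<open>The number \<open>t powr \<nu> / Gamma (1 + \<nu>)\<close> is the fractional integral of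
  order \<open>\<nu>\<close> of the constant 1, so a deviation of the derivative by at most
  \<open>\<eta>\<close> is multiplied by exactly this factor. The two sides come from the lower
  bound with \<open>\<sigma>\<close> equal to 1 and -1.\<close>

lemma caputo_asymptotics:
  assumes nu: "0 < \<nu>" "\<nu> < 1" and T: "0 < T"
    and w: "continuous_on {0..T} w" and cap: "has_caputo \<nu> T w"
    and D: "continuous_on {0..T} (caputo \<nu> T w)" and t: "0 < t" "t \<le> T"
    and \<eta>: "\<And>s. 0 \<le> s \<Longrightarrow> s \<le> t \<Longrightarrow> \<bar>caputo \<nu> T w s - c\<bar> \<le> \<eta>"
  shows "\<bar>w t - w 0 - c * (t powr \<nu> / Gamma (1 + \<nu>))\<bar> \<le> \<eta> * (t powr \<nu> / Gamma (1 + \<nu>))"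
proof -
  define u where "u = t powr \<nu> / Gamma (1 + \<nu>)"
  have "c - \<eta> \<le> 1 * caputo \<nu> T w s" "- c - \<eta> \<le> (- 1) * caputo \<nu> T w s" if "0 \<le> s" "s \<le> t" for s
    using \<eta>[OF that] by linarith+
  note caputo_lower_bound[OF nu T w cap D t this(1)] caputo_lower_bound[OF nu T w cap D t this(2)]
  then have "(c - \<eta>) * u \<le> w t - w 0" "(- c - \<eta>) * u \<le> - (w t - w 0)" by (simp_all add: u_def)
  then show ?thesis unfolding u_def[symmetric] by (simp add: abs_le_iff algebra_simps)
qed

text \<open>Growth of order \<open>\<nu>\<close> above \<open>\<theta>\<close> makes
  \<open>frac_int \<theta> w t\<close> of size \<open>t powr (1 + (\<nu> - \<theta>))\<close>, so
  its difference quotient at 0 tends to zero. Applied later to every order below the leading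
  one.\<close>

lemma caputo_initial_zero:
  assumes th: "0 < \<theta>" "\<theta> < \<nu>" "\<nu> < 1" and T: "0 < T" and w: "continuous_on {0..T} w"
    and C: "\<And>s. 0 \<le> s \<Longrightarrow> s \<le> T \<Longrightarrow> \<bar>w s - w 0\<bar> \<le> C * s powr \<nu>"
  shows "caputo \<theta> T w 0 = 0"
proof -
  have C0: "C \<ge> 0"
  proof -
    have "0 \<le> C * T powr \<nu>" using C[of T] T by simp
    then show ?thesis using T by (simp add: zero_le_mult_iff)
  qed
  have bound: "\<bar>frac_int \<theta> w t\<bar> \<le> (C / (1 - \<theta>)) * t powr (1 + (\<nu> - \<theta>))" if t: "0 < t" "t \<le> T" for t
  proof -
    \<comment> \<open>In the majorant \<open>s powr \<nu>\<close> is replaced by its largest value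
      \<open>t powr \<nu>\<close>; what remains is a Beta kernel with second parameter 1.\<close>
    define g where "g s = C * t powr \<nu> * (indicator {0..t} s * ((t - s) powr (1 - \<theta> - 1) * (s - 0) powr (1 - 1)))" for s
    have g: "has_bochner_integral lborel g (C * t powr \<nu> * (Beta (1 - \<theta>) 1 * (t - 0) powr (1 - \<theta> + 1 - 1)))"
      unfolding g_def by (intro has_bochner_integral_mult_right has_bochner_integral_Beta_kernel) (use th t in auto)
    have "Beta (1 - \<theta>) 1 = 1 / (1 - \<theta>)" by (rule Beta_real_1) (use th in simp)
    then have gv: "(\<integral>s. g s \<partial>lborel) = (C / (1 - \<theta>)) * t powr (1 + (\<nu> - \<theta>))"
    proof -
      have "(\<integral>s. g s \<partial>lborel) = C * t powr \<nu> * (1 / (1 - \<theta>) * t powr (1 - \<theta>))"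
        using has_bochner_integral_integral_eq[OF g] \<open>Beta (1 - \<theta>) 1 = 1 / (1 - \<theta>)\<close> by simp
      moreover have "t powr (1 + (\<nu> - \<theta>)) = t powr \<nu> * t powr (1 - \<theta>)"
        by (simp only: powr_add[symmetric]) (simp add: algebra_simps)
      ultimately show ?thesis by simp
    qed
    define f where "f s = indicator {0..t} s * ((w (max 0 (min T s)) - w 0) * (t - s) powr (- \<theta>))" for s
    have [measurable]: "(\<lambda>s. w (max 0 (min T s))) \<in> borel_measurable borel"
      by (intro borel_measurable_continuous_onI continuous_clamp w) (use T in auto)
    have fg: "\<bar>f s\<bar> \<le> g s" if "s \<noteq> 0" for s
    proof (cases "s \<in> {0..t}")
      case True
      have "\<bar>w s - w 0\<bar> \<le> C * s powr \<nu>" using C[of s] True t by auto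
      also have "\<dots> \<le> C * t powr \<nu>"
        by (intro mult_left_mono powr_mono2) (use True th C0 in auto)
      finally have "\<bar>w s - w 0\<bar> * (t - s) powr (- \<theta>) \<le> C * t powr \<nu> * (t - s) powr (- \<theta>)"
        by (rule mult_right_mono) simp
      moreover have "max 0 (min T s) = s" using True t by auto
      ultimately show ?thesis using True that by (simp add: f_def g_def abs_mult)
    next
      case False then show ?thesis by (simp add: f_def g_def)
    qed
    have "\<bar>\<integral>s. f s \<partial>lborel\<bar> \<le> (\<integral>s. \<bar>f s\<bar> \<partial>lborel)"
      using integral_norm_bound[of lborel f] by simp
    also have "\<dots> \<le> (\<integral>s. g s \<partial>lborel)"
    proof (rule integral_mono_AE')
      show "integrable lborel g" using g by (simp add: has_bochner_integral_iff)
      show "AE s in lborel. \<bar>f s\<bar> \<le> g s" using AE_lborel_singleton[of 0] by eventually_elim (rule fg)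
      show "AE s in lborel. 0 \<le> g s" using C0 by (simp add: g_def)
    qed
    finally show ?thesis unfolding gv using frac_int_eq_lborel[OF w, of t \<theta>] t T by (simp add: f_def)
  qed
  have "((\<lambda>y. (frac_int \<theta> w y - frac_int \<theta> w 0) / (y - 0)) \<longlongrightarrow> 0) (at 0 within {0..T})"
  proof (rule Lim_null_comparison)
    show "eventually (\<lambda>y. norm ((frac_int \<theta> w y - frac_int \<theta> w 0) / (y - 0)) \<le> (C / (1 - \<theta>)) * y powr (\<nu> - \<theta>))
       (at 0 within {0..T})"
      unfolding eventually_at_filter
    proof (rule always_eventually, intro allI impI)
      fix y :: real assume y: "y \<noteq> 0" "y \<in> {0..T}"
      then have "\<bar>frac_int \<theta> w y\<bar> \<le> (C / (1 - \<theta>)) * y powr (1 + (\<nu> - \<theta>))" by (intro bound) auto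
      also have "\<dots> = (C / (1 - \<theta>)) * y powr (\<nu> - \<theta>) * y"
        unfolding powr_add using y by simp
      finally show "norm ((frac_int \<theta> w y - frac_int \<theta> w 0) / (y - 0)) \<le> (C / (1 - \<theta>)) * y powr (\<nu> - \<theta>)"
        using y by (simp add: frac_int_0 divide_le_eq)
    qed
    have "((\<lambda>y::real. (C / (1 - \<theta>)) * y powr (\<nu> - \<theta>)) \<longlongrightarrow> (C / (1 - \<theta>)) * 0 powr (\<nu> - \<theta>)) (at 0 within {0..T})"
      using continuous_on_powr_const[of "\<nu> - \<theta>" T] th T
      by (intro tendsto_mult_left) (simp only: continuous_on_def, force)
    then show "((\<lambda>y::real. (C / (1 - \<theta>)) * y powr (\<nu> - \<theta>)) \<longlongrightarrow> 0) (at 0 within {0..T})" by simp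
  qed
  then have "(frac_int \<theta> w has_vector_derivative 0) (at 0 within {0..T})"
    by (simp add: has_real_derivative_iff_has_vector_derivative[symmetric] has_field_derivative_iff)
  from time_deriv_eqI[OF this] T show ?thesis by (simp add: caputo_def)
qed

subsection \<open>The divergence theorem\<close>

lemma integrable_bounded_support:
  fixes g :: "'a::euclidean_space \<Rightarrow> real"
  assumes "g \<in> borel_measurable borel" and "\<And>x. \<bar>g x\<bar> \<le> B" and "\<And>x. R < norm x \<Longrightarrow> g x = 0"
  shows "integrable lborel g"
proof (rule Bochner_Integration.integrable_bound)
  show "integrable lborel (\<lambda>x::'a. B * indicator (cball 0 R) x)"
    by (intro integrable_mult_right impI integrable_real_indicator) (auto intro: emeasure_lborel_cball_finite[simplified])
  show "AE x in lborel. norm (g x) \<le> norm (B * indicator (cball 0 R) x)"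
  proof (rule AE_I2)
    fix x
    show "norm (g x) \<le> norm (B * indicator (cball 0 R) x)"
      using assms(2)[of x] assms(3)[of x] by (cases "norm x \<le> R") (auto simp: indicator_def)
  qed
qed (use assms in simp)

lemma integral_lborel_translate:
  fixes f :: "'a::euclidean_space \<Rightarrow> real"
  assumes "f \<in> borel_measurable borel"
  shows "(\<integral>x. f (x + c) \<partial>lborel) = (\<integral>x. f x \<partial>lborel)"
proof -
  have "(\<integral>x. f x \<partial>lborel) = (\<integral>x. f x \<partial>distr lborel borel ((+) c))" by (simp add: lborel_distr_plus)
  also have "\<dots> = (\<integral>x. f (c + x) \<partial>lborel)" using assms by (subst integral_distr) auto
  finally show ?thesis by (simp add: add.commute)
qed

text \<open>Differentiate the translation invariance of the integral.\<close>

lemma integral_directional_derivative_zero: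
  fixes k :: "'a::euclidean_space \<Rightarrow> real"
  assumes k: "\<And>x. (k has_derivative k' x) (at x)"
    and B: "\<And>x. \<bar>k' x v\<bar> \<le> B" and supp: "\<And>x. R < norm x \<Longrightarrow> k x = 0"
  shows "(\<integral>x. k' x v \<partial>lborel) = 0"
proof -
  have kc: "continuous_on UNIV k"
    by (rule differentiable_imp_continuous_on) (use k in \<open>auto simp: differentiable_on_def differentiable_def\<close>)
  then have km[measurable]: "k \<in> borel_measurable borel" by (rule borel_measurable_continuous_onI)
  obtain Bk where Bk: "\<And>x. \<bar>k x\<bar> \<le> Bk"
  proof -
    have "bounded (k ` cball 0 R)"
      by (intro compact_imp_bounded compact_continuous_image continuous_on_subset[OF kc]) auto
    then obtain b where b: "\<forall>y\<in>k ` cball 0 R. norm y \<le> b" unfolding bounded_iff by blast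
    show ?thesis
    proof (rule that[of "max b 0"])
      fix x show "\<bar>k x\<bar> \<le> max b 0"
      proof (cases "norm x \<le> R")
        case True
        then have "norm (k x) \<le> b" using b by simp
        then show ?thesis by simp
      qed (use supp[of x] in auto)
    qed
  qed
  \<comment> \<open>Difference quotients in direction \<open>v\<close> with step
    \<open>1 / Suc n\<close>. Their integrals vanish by translation invariance, the mean value
    theorem bounds them by the same \<open>B\<close>, and they are supported in the ball of radius
    \<open>R + norm v\<close>; dominated convergence then applies.\<close>
  define u where "u n x = real (Suc n) * (k (x + (1 / real (Suc n)) *\<^sub>R v) - k x)" for n and x :: 'a
  have um[measurable]: "u n \<in> borel_measurable borel" for n
    unfolding u_def by measurable
  have deriv_line: "((\<lambda>s. k (x + s *\<^sub>R v)) has_real_derivative k' (x + s *\<^sub>R v) v) (at s)" for x s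
  proof -
    have "((\<lambda>s. k (x + s *\<^sub>R v)) has_derivative (\<lambda>t. k' (x + s *\<^sub>R v) (t *\<^sub>R v))) (at s)"
      by (rule has_derivative_compose[OF _ k]) (auto intro!: derivative_eq_intros)
    moreover have "k' (x + s *\<^sub>R v) (t *\<^sub>R v) = k' (x + s *\<^sub>R v) v * t" for t
      using linear_scale[OF has_derivative_linear[OF k[of "x + s *\<^sub>R v"]], of t v] by simp
    ultimately show ?thesis by (simp add: has_field_derivative_def)
  qed
  have lim: "(\<lambda>n. u n x) \<longlonglongrightarrow> k' x v" for x
  proof -
    have "((\<lambda>h. (k (x + (0 + h) *\<^sub>R v) - k (x + 0 *\<^sub>R v)) / h) \<longlongrightarrow> k' x v) (at 0)"
      using deriv_line[of x 0] by (simp add: DERIV_def)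
    then have "((\<lambda>h. (k (x + h *\<^sub>R v) - k x) / h) \<longlongrightarrow> k' x v) (at 0)" by simp
    moreover have "filterlim (\<lambda>n. 1 / real (Suc n)) (at 0) sequentially"
      unfolding filterlim_at using LIMSEQ_inverse_real_of_nat by (auto simp: inverse_eq_divide)
    ultimately have "(\<lambda>n. (k (x + (1 / real (Suc n)) *\<^sub>R v) - k x) / (1 / real (Suc n))) \<longlonglongrightarrow> k' x v"
      by (rule filterlim_compose)
    then show ?thesis by (simp add: u_def mult.commute)
  qed
  have ub: "\<bar>u n x\<bar> \<le> B" for n x
  proof -
    obtain z where "k (x + (1 / real (Suc n)) *\<^sub>R v) - k (x + 0 *\<^sub>R v) = (1 / real (Suc n) - 0) * k' (x + z *\<^sub>R v) v"
      using MVT2[of 0 "1 / real (Suc n)" "\<lambda>s. k (x + s *\<^sub>R v)" "\<lambda>s. k' (x + s *\<^sub>R v) v"] deriv_line by auto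
    then have "u n x = k' (x + z *\<^sub>R v) v" by (simp add: u_def)
    with B show ?thesis by simp
  qed
  have small: "norm ((1 / real (Suc n)) *\<^sub>R v) \<le> norm v" for n
  proof -
    have "(1 / real (Suc n)) * norm v \<le> 1 * norm v" by (rule mult_right_mono) (auto simp: divide_le_eq)
    then show ?thesis by simp
  qed
  have us: "u n x = 0" if "R + norm v < norm x" for n x
  proof -
    have "R < norm (x + (1 / real (Suc n)) *\<^sub>R v)"
      using that small[of n] norm_triangle_ineq2[of x "- ((1 / real (Suc n)) *\<^sub>R v)"] by simp
    moreover have "R < norm x" using that norm_ge_zero[of v] by linarith
    ultimately show ?thesis using supp by (simp add: u_def)
  qed
  have "(\<lambda>n. \<integral>x. u n x \<partial>lborel) \<longlonglongrightarrow> (\<integral>x. k' x v \<partial>lborel)"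
  proof (rule integral_dominated_convergence)
    show "integrable lborel (\<lambda>x::'a. B * indicator (cball 0 (R + norm v)) x)"
      by (intro integrable_mult_right impI integrable_real_indicator) (auto intro: emeasure_lborel_cball_finite[simplified])
    show "AE x in lborel. norm (u n x) \<le> B * indicator (cball 0 (R + norm v)) x" for n
    proof (rule AE_I2)
      fix x
      show "norm (u n x) \<le> B * indicator (cball 0 (R + norm v)) x"
        using ub[of n x] us[of x n] by (cases "norm x \<le> R + norm v") auto
    qed
    show "(\<lambda>x. k' x v) \<in> borel_measurable lborel"
      by (rule borel_measurable_LIMSEQ_real[OF lim]) simp
  qed (use lim in auto)
  moreover have "(\<integral>x. u n x \<partial>lborel) = 0" for n
  proof -
    have ki: "integrable lborel (k :: 'a \<Rightarrow> real)" by (rule integrable_bounded_support[OF km Bk supp])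
    have ki': "integrable lborel (\<lambda>x::'a. k (x + (1 / real (Suc n)) *\<^sub>R v))"
    proof (rule integrable_bounded_support[where R = "R + norm v"])
      fix x :: 'a assume x: "R + norm v < norm x"
      have "R < norm (x + (1 / real (Suc n)) *\<^sub>R v)"
        using x small[of n] norm_triangle_ineq2[of x "- ((1 / real (Suc n)) *\<^sub>R v)"] by simp
      then show "k (x + (1 / real (Suc n)) *\<^sub>R v) = 0" by (rule supp)
    qed (use Bk in auto)
    show ?thesis unfolding u_def
      using ki ki' integral_lborel_translate[OF km, of "(1 / real (Suc n)) *\<^sub>R v"] by simp
  qed
  ultimately show ?thesis by (simp add: LIMSEQ_const_iff)
qed

text \<open>Fubini along the direction \<open>e\<close> without coordinates on the orthogonal
  hyperplane: the hyperplane is thickened to a slab of thickness one, matching the encoding in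
  \<open>surface_measure\<close>. Translating by \<open>\<tau> *\<^sub>R e\<close> exchanges
  \<open>f\<close> and \<open>g\<close>.\<close>

lemma slab_integral:
  fixes K :: "'a::euclidean_space \<Rightarrow> real" and e :: 'a
  assumes e: "norm e = 1" and K: "integrable lborel K"
  defines "slab \<equiv> {y. 0 \<le> y \<bullet> e \<and> y \<bullet> e \<le> 1}"
  shows "integrable lborel (\<lambda>y. indicator slab y * (\<integral>\<tau>. K (y + \<tau> *\<^sub>R e) \<partial>lborel))"
    and "(\<integral>x. K x \<partial>lborel) = (\<integral>y. indicator slab y * (\<integral>\<tau>. K (y + \<tau> *\<^sub>R e) \<partial>lborel) \<partial>lborel)"
proof -
  have Km[measurable]: "K \<in> borel_measurable borel" using K by (simp add: integrable_iff_bounded)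
  have slab_ind: "indicator slab y = (if 0 \<le> y \<bullet> e \<and> y \<bullet> e \<le> 1 then 1 else (0::real))" for y
    by (auto simp: slab_def)
  have ee: "e \<bullet> e = 1" using e by (simp add: dot_square_norm)
  \<comment> \<open>For fixed \<open>x\<close> the parameters \<open>\<tau>\<close> with
    \<open>x - \<tau> *\<^sub>R e\<close> in the slab form an interval of length one, which is why
    no normalising constant appears.\<close>
  have line: "has_bochner_integral lborel (\<lambda>\<tau>. indicator slab (x - \<tau> *\<^sub>R e) * c) c" for x and c :: real
  proof -
    have "indicator slab (x - \<tau> *\<^sub>R e) = (indicator {x \<bullet> e - 1..x \<bullet> e} \<tau> :: real)" for \<tau>
      by (auto simp: slab_def indicator_def inner_diff_left ee)
    moreover have "has_bochner_integral lborel (indicator {x \<bullet> e - 1..x \<bullet> e} :: real \<Rightarrow> real) 1"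
      using has_bochner_integral_real_indicator[of "{x \<bullet> e - 1..x \<bullet> e}" lborel] by simp
    ultimately show ?thesis
      using has_bochner_integral_mult_left[of c lborel "indicator {x \<bullet> e - 1..x \<bullet> e}" 1] by simp
  qed
  define f where "f = (\<lambda>(y::'a, \<tau>). indicator slab y * K (y + \<tau> *\<^sub>R e))"
  define g where "g = (\<lambda>(x::'a, \<tau>). indicator slab (x - \<tau> *\<^sub>R e) * K x)"
  have gm: "g \<in> borel_measurable (lborel \<Otimes>\<^sub>M lborel)"
    unfolding g_def slab_ind by measurable
  have fm: "f \<in> borel_measurable (lborel \<Otimes>\<^sub>M lborel)"
    unfolding f_def slab_ind by measurable
  have gi: "integrable (lborel \<Otimes>\<^sub>M lborel) g"
  proof (rule lborel_pair.Fubini_integrable[OF gm])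
    have "norm (g (x, \<tau>)) = indicator slab (x - \<tau> *\<^sub>R e) * norm (K x)" for x \<tau>
      by (simp add: g_def abs_mult)
    then have "(\<integral>\<tau>. norm (g (x, \<tau>)) \<partial>lborel) = norm (K x)" for x
      using has_bochner_integral_integral_eq[OF line[of x "norm (K x)"]] by simp
    then show "integrable lborel (\<lambda>x. \<integral>\<tau>. norm (g (x, \<tau>)) \<partial>lborel)" using K by simp
    show "AE x in lborel. integrable lborel (\<lambda>\<tau>. g (x, \<tau>))"
      using line unfolding g_def has_bochner_integral_iff by simp
  qed
  have shift: "(\<integral>y. f (y, \<tau>) \<partial>lborel) = (\<integral>x. g (x, \<tau>) \<partial>lborel)" for \<tau>
  proof -
    have "(\<lambda>x. g (x, \<tau>)) \<in> borel_measurable borel" using measurable_compose[OF _ gm, of "\<lambda>x. (x, \<tau>)" lborel] by simp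
    from integral_lborel_translate[OF this, of "\<tau> *\<^sub>R e"] show ?thesis by (simp add: f_def g_def)
  qed
  \<comment> \<open>With \<open>\<tau>\<close> as outer variable the slices of \<open>f\<close> are
    translates of those of \<open>g\<close>, so integrability is inherited slice by slice.\<close>
  have fi: "integrable (lborel \<Otimes>\<^sub>M lborel) f"
  proof -
    have f1: "integrable lborel (\<lambda>y. f (y, \<tau>))" if "integrable lborel (\<lambda>x. g (x, \<tau>))" for \<tau>
    proof -
      have "integrable (distr lborel borel ((+) (\<tau> *\<^sub>R e))) (\<lambda>x. g (x, \<tau>))"
        using that by (simp add: lborel_distr_plus)
      then have "integrable lborel (\<lambda>x. g (\<tau> *\<^sub>R e + x, \<tau>))"
        by (subst (asm) integrable_distr_eq) (use that in \<open>auto simp: integrable_iff_bounded\<close>)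
      then show ?thesis by (simp add: f_def g_def add.commute)
    qed
    have gi': "integrable (lborel \<Otimes>\<^sub>M lborel) (\<lambda>(\<tau>, x). g (x, \<tau>))"
      using gi by (subst lborel_pair.integrable_product_swap_iff)
    have nrm: "(\<integral>y. norm (f (y, \<tau>)) \<partial>lborel) = (\<integral>x. norm (g (x, \<tau>)) \<partial>lborel)" for \<tau>
    proof -
      have "(\<lambda>x. norm (g (x, \<tau>))) \<in> borel_measurable borel"
        using measurable_compose[OF _ gm, of "\<lambda>x. (x, \<tau>)" lborel] by simp
      from integral_lborel_translate[OF this, of "\<tau> *\<^sub>R e"] show ?thesis by (simp add: f_def g_def)
    qed
    have int1: "integrable lborel (\<lambda>\<tau>. \<integral>x. norm (g (x, \<tau>)) \<partial>lborel)"
      using lborel_pair.integrable_fst'[OF integrable_norm[OF gi']] by simp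
    have "integrable (lborel \<Otimes>\<^sub>M lborel) (\<lambda>(\<tau>, y). f (y, \<tau>))"
    proof (rule lborel_pair.Fubini_integrable)
      show "(\<lambda>(\<tau>, y). f (y, \<tau>)) \<in> borel_measurable (lborel \<Otimes>\<^sub>M lborel)"
        using fm by measurable
      show "integrable lborel (\<lambda>\<tau>. \<integral>y. norm ((case (\<tau>, y) of (\<tau>, y) \<Rightarrow> f (y, \<tau>))) \<partial>lborel)"
        using int1 unfolding prod.case nrm .
      show "AE \<tau> in lborel. integrable lborel (\<lambda>y. case (\<tau>, y) of (\<tau>, y) \<Rightarrow> f (y, \<tau>))"
        using lborel_pair.AE_integrable_fst'[OF gi'] by eventually_elim (simp add: f1)
    qed
    then show ?thesis by (subst (asm) lborel_pair.integrable_product_swap_iff)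
  qed
  show "integrable lborel (\<lambda>y. indicator slab y * (\<integral>\<tau>. K (y + \<tau> *\<^sub>R e) \<partial>lborel))"
    using lborel_pair.integrable_fst'[OF fi] by (simp add: f_def)
  have "(\<integral>\<tau>. g (x, \<tau>) \<partial>lborel) = K x" for x
    using has_bochner_integral_integral_eq[OF line[of x "K x"]] by (simp only: g_def prod.case)
  then have "(\<integral>x. K x \<partial>lborel) = (\<integral>x. (\<integral>\<tau>. g (x, \<tau>) \<partial>lborel) \<partial>lborel)" by simp
  also have "\<dots> = (\<integral>\<tau>. (\<integral>x. g (x, \<tau>) \<partial>lborel) \<partial>lborel)"
    using lborel_pair.Fubini_integral[of "\<lambda>x \<tau>. g (x, \<tau>)"] gi by simp
  also have "\<dots> = (\<integral>\<tau>. (\<integral>y. f (y, \<tau>) \<partial>lborel) \<partial>lborel)" by (simp add: shift)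
  also have "\<dots> = (\<integral>y. (\<integral>\<tau>. f (y, \<tau>) \<partial>lborel) \<partial>lborel)"
    using lborel_pair.Fubini_integral[of "\<lambda>x \<tau>. f (x, \<tau>)"] fi by simp
  finally show "(\<integral>x. K x \<partial>lborel) = (\<integral>y. indicator slab y * (\<integral>\<tau>. K (y + \<tau> *\<^sub>R e) \<partial>lborel) \<partial>lborel)"
    by (simp add: f_def)
qed

section \<open>The cutoff function and the divergence formula below a graph\<close>

lemma square_pos_part_deriv:
  "((\<lambda>x::real. (max 0 x)\<^sup>2) has_real_derivative 2 * max 0 x) (at x)"
proof (cases "x = 0")
  case True
  have "((\<lambda>h::real. ((max 0 (0 + h))\<^sup>2 - (max 0 0)\<^sup>2) / h) \<longlongrightarrow> 0) (at 0)"
  proof (rule Lim_null_comparison)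
    show "((\<lambda>h::real. \<bar>h\<bar>) \<longlongrightarrow> 0) (at 0)" by (intro tendsto_eq_intros) auto
    show "\<forall>\<^sub>F h::real in at 0. norm (((max 0 (0 + h))\<^sup>2 - (max 0 0)\<^sup>2) / h) \<le> \<bar>h\<bar>"
      by (rule always_eventually) (auto simp: max_def power2_eq_square)
  qed
  with True show ?thesis by (simp add: DERIV_def)
next
  case False
  show ?thesis
  proof (cases "x < 0")
    case True
    then have ev: "\<forall>\<^sub>F y in nhds x. (max 0 y)\<^sup>2 = (0::real)"
      using eventually_nhds_in_open[of "{..<0}" x] by (auto elim!: eventually_mono)
    have "((\<lambda>x::real. 0) has_real_derivative 2 * max 0 x) (at x)" using True by simp
    then show ?thesis using DERIV_cong_ev[of x x "\<lambda>y. (max 0 y)\<^sup>2" "\<lambda>_. 0" "2 * max 0 x" "2 * max 0 x"] ev by simp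
  next
    case f: False
    with False have ev: "\<forall>\<^sub>F y in nhds x. (max 0 y)\<^sup>2 = y\<^sup>2"
      using eventually_nhds_in_open[of "{0<..}" x] by (auto elim!: eventually_mono)
    have "((\<lambda>x::real. x\<^sup>2) has_real_derivative 2 * max 0 x) (at x)"
      using f by (auto intro!: derivative_eq_intros)
    then show ?thesis using DERIV_cong_ev[of x x "\<lambda>y. (max 0 y)\<^sup>2" "\<lambda>y. y\<^sup>2" "2 * max 0 x" "2 * max 0 x"] ev by simp
  qed
qed

text \<open>The \<open>C\<^sup>1\<close> quadratic spline rising from 0 at 1 to 1 at 2.\<close>

definition cutoff :: "real \<Rightarrow> real" where
  "cutoff s = 2 * (max 0 (s - 1))\<^sup>2 - 4 * (max 0 (s - 3/2))\<^sup>2 + 2 * (max 0 (s - 2))\<^sup>2"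

definition cutoff' :: "real \<Rightarrow> real" where
  "cutoff' s = 4 * max 0 (s - 1) - 8 * max 0 (s - 3/2) + 4 * max 0 (s - 2)"

lemma cutoff_deriv: "(cutoff has_real_derivative cutoff' s) (at s)"
proof -
  have "((\<lambda>s. (max 0 (s - a))\<^sup>2) has_real_derivative 2 * max 0 (s - a)) (at s)" for a :: real
    by (rule DERIV_chain'[OF _ square_pos_part_deriv, THEN DERIV_cong]) (auto intro!: derivative_eq_intros)
  then have "((\<lambda>s. 2 * (max 0 (s - 1))\<^sup>2 - 4 * (max 0 (s - 3/2))\<^sup>2 + 2 * (max 0 (s - 2))\<^sup>2)
      has_real_derivative 2 * (2 * max 0 (s - 1)) - 4 * (2 * max 0 (s - 3/2)) + 2 * (2 * max 0 (s - 2))) (at s)"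
    by (intro DERIV_add DERIV_diff DERIV_cmult)
  then show ?thesis by (simp only: cutoff_def[abs_def] cutoff'_def mult.assoc[symmetric]) simp
qed

lemma cutoff_values:
  "s \<le> 1 \<Longrightarrow> cutoff s = 0" "2 \<le> s \<Longrightarrow> cutoff s = 1" "\<bar>cutoff s\<bar> \<le> 1"
  "s \<le> 1 \<Longrightarrow> cutoff' s = 0" "2 \<le> s \<Longrightarrow> cutoff' s = 0" "\<bar>cutoff' s\<bar> \<le> 2"
proof -
  have 1: "cutoff s = 0 \<and> cutoff' s = 0" if "s \<le> 1" for s using that by (auto simp: cutoff_def cutoff'_def)
  have 2: "cutoff s = 1 \<and> cutoff' s = 0" if "2 \<le> s" for s
    using that by (auto simp: cutoff_def cutoff'_def max_def power2_eq_square algebra_simps)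
  have nn: "0 \<le> cutoff' t \<and> cutoff' t \<le> 2" for t by (auto simp: cutoff'_def max_def)
  show "cutoff s = 0" "cutoff' s = 0" if "s \<le> 1" using 1[OF that] by auto
  show "cutoff s = 1" "cutoff' s = 0" if "2 \<le> s" using 2[OF that] by auto
  from nn[of s] show "\<bar>cutoff' s\<bar> \<le> 2" by linarith
  have mono: "cutoff a \<le> cutoff b" if "a \<le> b" for a b
    by (rule DERIV_nonneg_imp_nondecreasing[OF that]) (intro exI conjI, rule cutoff_deriv, simp add: nn)
  show "\<bar>cutoff s\<bar> \<le> 1"
    using mono[of "min s 1" s] mono[of s "max s 2"] 1[of "min s 1"] 2[of "max s 2"] by simp
qed

lemma continuous_cutoff: "continuous_on A cutoff" "continuous_on A cutoff'"
  by (auto simp: cutoff_def[abs_def] cutoff'_def[abs_def] intro!: continuous_intros)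

text \<open>The cutoff rises by one on \<open>{1..2}\<close> and its derivative vanishes elsewhere.
  This unit mass gives the boundary integral its coefficient 1.\<close>

lemma has_bochner_integral_cutoff': "has_bochner_integral lborel cutoff' 1"
proof -
  have b: "\<bar>cutoff' x\<bar> \<le> 2" and z: "2 < norm x \<Longrightarrow> cutoff' x = 0" for x
    by (rule cutoff_values) (cases "x \<le> 1"; simp add: cutoff_values(4,5) abs_if split: if_splits)
  have "integrable lborel cutoff'"
    by (rule integrable_bounded_support[where B = 2 and R = 2])
       (rule b z borel_measurable_continuous_onI continuous_cutoff | assumption)+
  moreover have "(\<integral>x. indicator {1..2} x *\<^sub>R cutoff' x \<partial>lborel) = cutoff 2 - cutoff 1"
    by (rule integral_FTC_atLeastAtMost)
       (auto intro!: continuous_cutoff has_vector_derivative_at_within cutoff_deriv[THEN has_field_derivative_at_within]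
          simp: has_real_derivative_iff_has_vector_derivative[symmetric])
  moreover have "(\<lambda>x. indicator {1..2} x *\<^sub>R cutoff' x) = cutoff'"
  proof
    fix x show "indicator {1..2} x *\<^sub>R cutoff' x = cutoff' x"
    using cutoff_values(4,5)[of x] by (cases "x \<le> 1"; cases "2 \<le> x"; simp)
  qed
  ultimately show ?thesis by (simp only: has_bochner_integral_iff cutoff_values(1)[OF order_refl] cutoff_values(2)[OF order_refl]) simp
qed

text \<open>Multiply by a cutoff which vanishes in a layer of thickness \<open>1/m\<close> along the graph; the
  derivative of the cutoff concentrates on the graph as \<open>m\<close> tends to infinity.\<close>

lemma subgraph_divergence:
  fixes f h :: "'a::euclidean_space \<Rightarrow> real" and e v c :: 'a and r :: real
  assumes e: "norm e = 1" and U: "open U" and cU: "cball c r \<subseteq> U"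
    and \<Omega>: "open \<Omega>" "bounded \<Omega>"
    and sub: "\<And>x. x \<in> U \<Longrightarrow> x \<in> \<Omega> \<longleftrightarrow> x \<bullet> e < h x"
    and h: "\<And>x. (h has_derivative h' x) (at x)" and hB: "\<And>x. \<bar>h' x v\<bar> \<le> H"
    and hc: "continuous_on UNIV (\<lambda>x. h' x v)" and hinv: "\<And>y s. h (y + s *\<^sub>R e) = h y"
    and fc: "continuous_on (closure \<Omega>) f" and fs: "\<And>x. x \<notin> ball c r \<Longrightarrow> f x = 0"
    and fd: "\<And>x. x \<in> \<Omega> \<Longrightarrow> (f has_derivative f' x) (at x)"
    and fB: "\<And>x. x \<in> \<Omega> \<Longrightarrow> \<bar>f' x v\<bar> \<le> B" and fdc: "continuous_on \<Omega> (\<lambda>x. f' x v)"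
  defines "slab \<equiv> {y. 0 \<le> y \<bullet> e \<and> y \<bullet> e \<le> 1}"
    and "\<Phi> \<equiv> \<lambda>y. y + (h y - y \<bullet> e) *\<^sub>R e"
  shows "integrable lborel (\<lambda>y. indicator slab y * (f (\<Phi> y) * (v \<bullet> e - h' y v)))"
    and "(\<integral>x. indicator \<Omega> x * f' x v \<partial>lborel)
       = (\<integral>y. indicator slab y * (f (\<Phi> y) * (v \<bullet> e - h' y v)) \<partial>lborel)"
proof -
  have ee: "e \<bullet> e = 1" using e by (simp add: dot_square_norm)
  have hcont: "continuous_on A h" for A
    by (rule has_derivative_continuous_on) (use h has_derivative_at_withinI in blast)
  \<comment> \<open>Height below the graph, measured along \<open>e\<close>: inside \<open>U\<close>
    the domain is where \<open>p\<close> is positive.\<close>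
  define p where "p x = h x - x \<bullet> e" for x
  have pd: "(p has_derivative (\<lambda>w. h' x w - w \<bullet> e)) (at x)" for x
    unfolding p_def by (intro has_derivative_diff h has_derivative_inner_left has_derivative_ident)
  have pc: "continuous_on A p" for A unfolding p_def by (intro continuous_intros hcont)
  have \<Omega>cl: "\<Omega> \<subseteq> closure \<Omega>" by (rule closure_subset)
  have fc\<Omega>: "continuous_on \<Omega> f" by (rule continuous_on_subset[OF fc \<Omega>cl])
  obtain F where F: "\<And>x. x \<in> closure \<Omega> \<Longrightarrow> \<bar>f x\<bar> \<le> F" and F0: "0 \<le> F"
  proof -
    have "bounded (f ` closure \<Omega>)"
      by (intro compact_imp_bounded compact_continuous_image fc) (use \<Omega> in \<open>simp add: compact_closure\<close>)
    then obtain b where "\<forall>y\<in>f ` closure \<Omega>. norm y \<le> b" unfolding bounded_iff by blast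
    then have "\<And>x. x \<in> closure \<Omega> \<Longrightarrow> \<bar>f x\<bar> \<le> max b 0" by fastforce
    then show ?thesis by (rule that[of "max b 0"]) auto
  qed
  obtain RO where RO: "\<And>x. x \<in> \<Omega> \<Longrightarrow> norm x \<le> RO" using \<Omega>(2) by (auto simp: bounded_iff)
  have ve: "\<bar>v \<bullet> e\<bar> \<le> norm v" using Cauchy_Schwarz_ineq2[of v e] e by simp
  have H0: "0 \<le> H" using hB[of 0] by linarith
  \<comment> \<open>Cut off near the graph and extended by zero, \<open>f\<close> becomes
    differentiable on the whole space, so the integral of its directional derivative is
    zero.\<close>
  define k where "k m x = indicator \<Omega> x * (cutoff (m * p x) * f x)" for m x
  define k' where "k' m x w = indicator \<Omega> x * (cutoff (m * p x) * f' x w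
      + ((m * (h' x w - w \<bullet> e)) * cutoff' (m * p x)) * f x)" for m x w
  have kd: "(k m has_derivative k' m x) (at x)" if m: "m > 0" for m x
  proof (cases "x \<in> \<Omega>")
    case True
    have "((\<lambda>x. cutoff (m * p x) * f x) has_derivative (\<lambda>w. cutoff (m * p x) * f' x w
      + ((m * (h' x w - w \<bullet> e)) * cutoff' (m * p x)) * f x)) (at x)"
      by (intro has_derivative_mult fd[OF True] DERIV_compose_FDERIV[OF cutoff_deriv]
          has_derivative_mult_right pd)
    moreover have "(\<lambda>w. cutoff (m * p x) * f' x w + ((m * (h' x w - w \<bullet> e)) * cutoff' (m * p x)) * f x) = k' m x"
      using True by (simp add: k'_def fun_eq_iff)
    ultimately have "((\<lambda>x. cutoff (m * p x) * f x) has_derivative k' m x) (at x)" by simp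
    then show ?thesis
      by (rule has_derivative_transform_within_open[OF _ \<Omega>(1) True]) (simp add: k_def)
  next
    case False
    \<comment> \<open>Outside the domain there are two reasons for vanishing nearby: in the closed
      ball \<open>p x \<le> 0\<close>, and the cutoff is zero wherever \<open>m * p < 1\<close>; off
      the closed ball \<open>f\<close> itself is zero.\<close>
    have "\<exists>V. open V \<and> x \<in> V \<and> (\<forall>z\<in>V. k m z = 0)"
    proof (cases "x \<in> cball c r")
      case True
      then have xU: "x \<in> U" using cU by auto
      let ?V = "U \<inter> {z. m * p z < 1}"
      have "p x \<le> 0" using False sub[OF xU] by (simp add: p_def)
      then have 1: "m * p x < 1" using m mult_nonneg_nonpos[of m "p x"] by linarith
      have "open ?V"
        by (intro open_Int U open_Collect_less continuous_intros pc)
      moreover have "k m z = 0" if "z \<in> ?V" for z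
        using that cutoff_values(1)[of "m * p z"] by (simp add: k_def)
      ultimately show ?thesis using xU 1 by (intro exI[of _ ?V]) auto
    next
      case False
      have "k m z = 0" if "z \<in> - cball c r" for z
        using fs[of z] that ball_subset_cball[of c r] by (auto simp: k_def)
      then show ?thesis using False by (intro exI[of _ "- cball c r"]) auto
    qed
    then obtain V where V: "open V" "x \<in> V" "\<And>z. z \<in> V \<Longrightarrow> k m z = 0" by blast
    have "((\<lambda>z. 0) has_derivative (\<lambda>w. 0)) (at x)" by simp
    then have "(k m has_derivative (\<lambda>w. 0)) (at x)"
      by (rule has_derivative_transform_within_open[OF _ V(1,2)]) (simp add: V(3))
    moreover have "k' m x = (\<lambda>w. 0)" using False by (simp add: k'_def fun_eq_iff)
    ultimately show ?thesis by simp
  qed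

  \<comment> \<open>The directional derivative is \<open>A m - K m\<close>: \<open>A m\<close> tends
    to the volume integrand, while \<open>K m\<close> carries the derivative of the cutoff and
    produces the boundary term. Their integrals agree for every positive \<open>m\<close>.\<close>
  define A where "A m x = indicator \<Omega> x * (cutoff (m * p x) * f' x v)" for m x
  define K where "K m x = indicator \<Omega> x * (cutoff' (m * p x) * (m * (v \<bullet> e - h' x v)) * f x)" for m x
  have meas: "(\<lambda>x. indicator \<Omega> x * g x) \<in> borel_measurable borel" if "continuous_on \<Omega> g" for g :: "'a \<Rightarrow> real"
    using borel_measurable_continuous_on_indicator[of \<Omega> g] that \<Omega>(1) by simp
  have Am: "A m \<in> borel_measurable borel" for m
    unfolding A_def by (intro meas continuous_intros fdc continuous_on_compose2[OF continuous_cutoff(1)[of UNIV]] pc) auto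
  have Km: "K m \<in> borel_measurable borel" for m
    unfolding K_def by (intro meas continuous_intros continuous_on_subset[OF hc] fc\<Omega>
        continuous_on_compose2[OF continuous_cutoff(2)[of UNIV]] pc) auto
  define CB where "CB = norm v + H"
  have CB: "\<bar>v \<bullet> e - h' x v\<bar> \<le> CB" for x using ve hB[of x] by (simp add: CB_def)
  have CB0: "0 \<le> CB" using H0 by (simp add: CB_def)
  have Ab: "\<bar>A m x\<bar> \<le> \<bar>B\<bar>" for m x
  proof (cases "x \<in> \<Omega>")
    case True
    have "\<bar>cutoff (m * p x)\<bar> * \<bar>f' x v\<bar> \<le> 1 * \<bar>B\<bar>"
      by (rule mult_mono) (use fB[OF True] cutoff_values(3) in auto)
    then show ?thesis using True by (simp add: A_def abs_mult)
  qed (simp add: A_def)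
  have Kb: "\<bar>K m x\<bar> \<le> 2 * (m * CB) * F" if m: "0 < m" for m x
  proof (cases "x \<in> \<Omega>")
    case True
    have "\<bar>cutoff' (m * p x)\<bar> * (m * \<bar>v \<bullet> e - h' x v\<bar>) * \<bar>f x\<bar> \<le> 2 * (m * CB) * F"
      by (intro mult_mono mult_left_mono) (use F[of x] True \<Omega>cl m CB CB0 F0 cutoff_values(6) in auto)
    then show ?thesis using True m by (simp add: K_def abs_mult)
  qed (use m CB0 F0 in \<open>simp add: K_def\<close>)
  have As: "A m x = 0" and Ks: "K m x = 0" if "RO < norm x" for m x
  proof -
    have "x \<notin> \<Omega>" using RO[of x] that by auto
    then show "A m x = 0" "K m x = 0" by (simp_all add: A_def K_def)
  qed
  have Ai: "integrable lborel (A m)" for m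
    by (rule integrable_bounded_support[OF Am Ab As])
  have Ki: "integrable lborel (K m)" if "0 < m" for m
    by (rule integrable_bounded_support[OF Km Kb[OF that] Ks])
  have k'AK: "k' m x v = A m x - K m x" for m x
    by (simp add: k'_def A_def K_def algebra_simps)
  have AK: "(\<integral>x. A m x \<partial>lborel) = (\<integral>x. K m x \<partial>lborel)" if m: "0 < m" for m
  proof -
    have "(\<integral>x. k' m x v \<partial>lborel) = 0"
    proof (rule integral_directional_derivative_zero[OF kd[OF m]])
      show "\<bar>k' m x v\<bar> \<le> \<bar>B\<bar> + 2 * (m * CB) * F" for x
        using Ab[of m x] Kb[OF m, of x] unfolding k'AK by linarith
      show "k m x = 0" if "RO < norm x" for x
        using RO[of x] that by (auto simp: k_def indicator_def)
    qed
    then show ?thesis unfolding k'AK using Ai Ki[OF m] by simp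
  qed
  have f'0: "f' x v = 0" if "x \<in> \<Omega>" "x \<notin> cball c r" for x
  proof -
    have "((\<lambda>z. 0) has_derivative (\<lambda>w. 0)) (at x)" by simp
    then have "(f has_derivative (\<lambda>w. 0)) (at x)"
      by (rule has_derivative_transform_within_open[of _ _ _ _ "- cball c r"])
         (use that fs ball_subset_cball[of c r] in auto)
    from has_derivative_unique[OF this fd[OF that(1)]] show ?thesis by (metis)
  qed
  have limA: "(\<lambda>m. \<integral>x. A (real (Suc m)) x \<partial>lborel) \<longlonglongrightarrow> (\<integral>x. indicator \<Omega> x * f' x v \<partial>lborel)"
  proof (rule integral_dominated_convergence)
    show "(\<lambda>x. indicator \<Omega> x * f' x v) \<in> borel_measurable lborel" using meas[OF fdc] by simp
    show "integrable lborel (\<lambda>x. \<bar>B\<bar> * indicator (cball 0 RO) x)"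
      by (intro integrable_mult_right impI integrable_real_indicator)
         (auto intro: emeasure_lborel_cball_finite[simplified])
    show "AE x in lborel. norm (A (real (Suc m)) x) \<le> \<bar>B\<bar> * indicator (cball 0 RO) x" for m
    proof (rule AE_I2)
      fix x
      show "norm (A (real (Suc m)) x) \<le> \<bar>B\<bar> * indicator (cball 0 RO) x"
        using Ab[of "real (Suc m)" x] As[of x "real (Suc m)"] by (cases "norm x \<le> RO") auto
    qed
    have "(\<lambda>m. A (real (Suc m)) x) \<longlonglongrightarrow> indicator \<Omega> x * f' x v" for x
    proof (cases "x \<in> \<Omega> \<and> x \<in> cball c r")
      case True
      then have "0 < p x" using sub[of x] cU by (auto simp: p_def)
      obtain N where N: "2 < real N * p x" using reals_Archimedean3[OF \<open>0 < p x\<close>] by blast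
      have "A (real (Suc m)) x = indicator \<Omega> x * f' x v" if "N \<le> m" for m
      proof -
        have "real N * p x \<le> real (Suc m) * p x" using that \<open>0 < p x\<close> by (intro mult_right_mono) auto
        then show ?thesis using N by (simp add: A_def cutoff_values(2))
      qed
      then show ?thesis by (intro tendsto_eventually eventually_sequentiallyI)
    next
      case False
      then show ?thesis using f'0[of x] by (cases "x \<in> \<Omega>") (auto simp: A_def)
    qed
    then show "AE x in lborel. (\<lambda>m. A (real (Suc m)) x) \<longlonglongrightarrow> indicator \<Omega> x * f' x v" by simp
  qed (use Am in simp)
  have h'inv: "h' (y + s *\<^sub>R e) v = h' y v" for y s
  proof -
    have "((\<lambda>z. z + s *\<^sub>R e) has_derivative (\<lambda>w. w)) (at y)" by (auto intro!: derivative_eq_intros)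
    from has_derivative_compose[OF this h]
    have "((\<lambda>z. h (z + s *\<^sub>R e)) has_derivative h' (y + s *\<^sub>R e)) (at y)" .
    then have "(h has_derivative h' (y + s *\<^sub>R e)) (at y)" by (simp add: hinv)
    from has_derivative_unique[OF this h[of y]] show ?thesis by simp
  qed
  have cut: "has_bochner_integral lborel cutoff' 1" by (rule has_bochner_integral_cutoff')
  then have ci: "integrable lborel cutoff'" by (simp add: has_bochner_integral_iff)
  define CI where "CI = (\<integral>s. \<bar>cutoff' s\<bar> \<partial>lborel)"
  \<comment> \<open>On the line through \<open>y\<close> the variable is rescaled to
    \<open>s = m * p\<close>, the layer depth in units of \<open>1 / m\<close>. The Jacobian
    \<open>1 / m\<close> cancels the factor \<open>m\<close> in \<open>K m\<close>, leaving a
    bounded integrand.\<close>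
  define J where "J m y s = indicator \<Omega> (\<Phi> y - (s / m) *\<^sub>R e) *
      (cutoff' s * (v \<bullet> e - h' y v) * f (\<Phi> y - (s / m) *\<^sub>R e))" for m y s
  have KJ: "K m (y + (h y - y \<bullet> e + (- (1 / m)) * s) *\<^sub>R e) = m * J m y s" if m: "0 < m" for m y s
  proof -
    have z: "y + (h y - y \<bullet> e + (- (1 / m)) * s) *\<^sub>R e = \<Phi> y - (s / m) *\<^sub>R e"
      by (simp add: \<Phi>_def algebra_simps)
    have "m * p (y + (h y - y \<bullet> e + (- (1 / m)) * s) *\<^sub>R e) = s"
      using m by (simp add: p_def hinv inner_add_left ee field_simps)
    moreover have "h' (\<Phi> y - (s / m) *\<^sub>R e) v = h' y v" unfolding z[symmetric] by (rule h'inv)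
    ultimately show ?thesis unfolding K_def z by (simp add: J_def)
  qed
  have Jm: "(\<lambda>s. J m y s) \<in> borel_measurable borel" if m: "0 < m" for m y
  proof -
    have "(\<lambda>s. K m (y + (h y - y \<bullet> e + (- (1 / m)) * s) *\<^sub>R e) / m) \<in> borel_measurable borel"
      using Km[of m] by measurable
    then show ?thesis unfolding KJ[OF m] using m by simp
  qed
  have inner: "(\<integral>\<tau>. K m (y + \<tau> *\<^sub>R e) \<partial>lborel) = (\<integral>s. J m y s \<partial>lborel)" if m: "0 < m" for m y
  proof -
    have "(\<integral>\<tau>. K m (y + \<tau> *\<^sub>R e) \<partial>lborel)
        = \<bar>- (1 / m)\<bar> *\<^sub>R (\<integral>s. K m (y + (h y - y \<bullet> e + (- (1 / m)) * s) *\<^sub>R e) \<partial>lborel)"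
      by (rule lborel_integral_real_affine) (use m in simp)
    then show ?thesis unfolding KJ[OF m] using m by simp
  qed
  have Jb: "\<bar>J m y s\<bar> \<le> \<bar>cutoff' s\<bar> * (CB * F)" for m y s
  proof (cases "\<Phi> y - (s / m) *\<^sub>R e \<in> \<Omega>")
    case True
    then have "\<Phi> y - (s / m) *\<^sub>R e \<in> closure \<Omega>" using \<Omega>cl by auto
    from F[OF this] have "\<bar>cutoff' s\<bar> * (\<bar>v \<bullet> e - h' y v\<bar> * \<bar>f (\<Phi> y - (s / m) *\<^sub>R e)\<bar>) \<le> \<bar>cutoff' s\<bar> * (CB * F)"
      by (intro mult_mono mult_left_mono) (use CB CB0 F0 in auto)
    then show ?thesis using True by (simp add: J_def abs_mult)
  qed (use CB0 F0 in \<open>simp add: J_def\<close>)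
  \<comment> \<open>Only depths \<open>s > 1\<close> contribute. Then the point at depth
    \<open>s / m\<close> lies strictly below the graph, hence in the domain once it is in
    \<open>U\<close>, and tends to the graph point \<open>\<Phi> y\<close>; continuity of
    \<open>f\<close> up to the closure gives the limit.\<close>
  have Jlim: "(\<lambda>m. J (real (Suc m)) y s) \<longlonglongrightarrow> cutoff' s * ((v \<bullet> e - h' y v) * f (\<Phi> y))" for y s
  proof (cases "1 < s")
    case False
    then show ?thesis by (simp add: J_def cutoff_values(4))
  next
    case s: True
    have zlim: "(\<lambda>m. \<Phi> y - (s / real (Suc m)) *\<^sub>R e) \<longlonglongrightarrow> \<Phi> y"
    proof -
      have "(\<lambda>m. s / real (Suc m)) \<longlonglongrightarrow> 0"
        using tendsto_mult[OF tendsto_const[of s] LIMSEQ_inverse_real_of_nat] by (simp add: divide_inverse)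
      then have "(\<lambda>m. \<Phi> y - (s / real (Suc m)) *\<^sub>R e) \<longlonglongrightarrow> \<Phi> y - 0 *\<^sub>R e"
        by (intro tendsto_intros)
      then show ?thesis by simp
    qed
    show ?thesis
    proof (cases "\<Phi> y \<in> cball c r")
      case True
      then have "\<Phi> y \<in> U" using cU by auto
      then have evU: "\<forall>\<^sub>F m in sequentially. \<Phi> y - (s / real (Suc m)) *\<^sub>R e \<in> U"
        using zlim U by (simp add: topological_tendstoD)
      have "\<Phi> y - (s / real (Suc m)) *\<^sub>R e \<in> \<Omega>" if "\<Phi> y - (s / real (Suc m)) *\<^sub>R e \<in> U" for m
      proof -
        have z: "\<Phi> y - (s / real (Suc m)) *\<^sub>R e = y + (h y - y \<bullet> e - s / real (Suc m)) *\<^sub>R e"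
          by (simp add: \<Phi>_def algebra_simps)
        have "(\<Phi> y - (s / real (Suc m)) *\<^sub>R e) \<bullet> e < h (\<Phi> y - (s / real (Suc m)) *\<^sub>R e)"
          unfolding z hinv using s by (simp add: inner_add_left ee)
        then show ?thesis using sub[OF that] by simp
      qed
      then have ev: "\<forall>\<^sub>F m in sequentially. \<Phi> y - (s / real (Suc m)) *\<^sub>R e \<in> \<Omega>"
        using evU by (auto elim: eventually_mono)
      have cl: "\<Phi> y \<in> closure \<Omega>"
        by (rule Lim_in_closed_set[OF closed_closure _ _ zlim]) (use ev \<Omega>cl in \<open>auto elim: eventually_mono\<close>)
      have "(\<lambda>m. f (\<Phi> y - (s / real (Suc m)) *\<^sub>R e)) \<longlonglongrightarrow> f (\<Phi> y)"
        by (rule continuous_on_tendsto_compose[OF fc zlim cl]) (use ev \<Omega>cl in \<open>auto elim: eventually_mono\<close>)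
      then have "(\<lambda>m. cutoff' s * ((v \<bullet> e - h' y v) * f (\<Phi> y - (s / real (Suc m)) *\<^sub>R e))) \<longlonglongrightarrow> cutoff' s * ((v \<bullet> e - h' y v) * f (\<Phi> y))"
        by (intro tendsto_intros)
      moreover have "\<forall>\<^sub>F m in sequentially. cutoff' s * ((v \<bullet> e - h' y v) * f (\<Phi> y - (s / real (Suc m)) *\<^sub>R e)) = J (real (Suc m)) y s"
        using ev by eventually_elim (simp add: J_def)
      ultimately show ?thesis by (rule Lim_transform_eventually)
    next
      case False
      have "\<forall>\<^sub>F m in sequentially. \<Phi> y - (s / real (Suc m)) *\<^sub>R e \<in> - cball c r"
        using zlim False by (intro topological_tendstoD) auto
      then have "\<forall>\<^sub>F m in sequentially. J (real (Suc m)) y s = 0"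
        by eventually_elim (use fs ball_subset_cball[of c r] in \<open>auto simp: J_def\<close>)
      moreover have "f (\<Phi> y) = 0" using False fs ball_subset_cball[of c r] by auto
      ultimately show ?thesis by (simp add: tendsto_eventually)
    qed
  qed
  have innerlim: "(\<lambda>m. \<integral>s. J (real (Suc m)) y s \<partial>lborel) \<longlonglongrightarrow> f (\<Phi> y) * (v \<bullet> e - h' y v)" for y
  proof -
    have "(\<lambda>m. \<integral>s. J (real (Suc m)) y s \<partial>lborel) \<longlonglongrightarrow> (\<integral>s. cutoff' s * ((v \<bullet> e - h' y v) * f (\<Phi> y)) \<partial>lborel)"
    proof (rule integral_dominated_convergence)
      show "integrable lborel (\<lambda>s. \<bar>cutoff' s\<bar> * (CB * F))" using ci by simp
      show "(\<lambda>s. cutoff' s * ((v \<bullet> e - h' y v) * f (\<Phi> y))) \<in> borel_measurable lborel"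
        using ci by simp
    qed (use Jm Jb Jlim in auto)
    moreover have "(\<integral>s. cutoff' s * ((v \<bullet> e - h' y v) * f (\<Phi> y)) \<partial>lborel) = f (\<Phi> y) * (v \<bullet> e - h' y v)"
    proof -
      have "(\<integral>s. cutoff' s \<partial>lborel) = 1" using has_bochner_integral_integral_eq[OF cut] .
      then show ?thesis by simp
    qed
    ultimately show ?thesis by (simp only:)
  qed
  obtain Hb where Hb: "\<And>z. z \<in> cball c r \<Longrightarrow> \<bar>h z\<bar> \<le> Hb"
  proof -
    have "bounded (h ` cball c r)" by (intro compact_imp_bounded compact_continuous_image hcont) auto
    then obtain b where b: "\<forall>y\<in>h ` cball c r. norm y \<le> b" unfolding bounded_iff by blast
    show ?thesis by (rule that[of b]) (use b in auto)
  qed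
  \<comment> \<open>Where \<open>J\<close> is nonzero the shifted point lies in the ball, the graph
    height there is at most \<open>Hb\<close> in absolute value, \<open>y \<bullet> e\<close> is at
    most 1 and \<open>s / Suc m\<close> at most 2; the last two give the summand 3.\<close>
  define R2 where "R2 = norm c + \<bar>r\<bar> + \<bar>Hb\<bar> + 3"
  define I where "I m y = indicator slab y * (\<integral>\<tau>. K m (y + \<tau> *\<^sub>R e) \<partial>lborel)" for m y
  note slab = slab_integral[OF e Ki, folded slab_def I_def]
  have Ib: "\<bar>I (real (Suc m)) y\<bar> \<le> CI * (CB * F)" for m y
  proof -
    have "\<bar>\<integral>s. J (real (Suc m)) y s \<partial>lborel\<bar> \<le> (\<integral>s. \<bar>cutoff' s\<bar> * (CB * F) \<partial>lborel)"
    proof -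
      have "\<bar>\<integral>s. J (real (Suc m)) y s \<partial>lborel\<bar> \<le> (\<integral>s. \<bar>J (real (Suc m)) y s\<bar> \<partial>lborel)"
        using integral_norm_bound[of lborel "J (real (Suc m)) y"] by simp
      also have "\<dots> \<le> (\<integral>s. \<bar>cutoff' s\<bar> * (CB * F) \<partial>lborel)"
        by (rule integral_mono_AE') (use ci Jb CB0 F0 in auto)
      finally show ?thesis .
    qed
    also have "\<dots> = CI * (CB * F)" by (simp add: CI_def)
    finally have *: "\<bar>\<integral>s. J (real (Suc m)) y s \<partial>lborel\<bar> \<le> CI * (CB * F)" .
    then show ?thesis
      unfolding I_def by (subst inner) (auto simp: indicator_def intro: order_trans[OF abs_ge_zero *])
  qed
  have Is: "I (real (Suc m)) y = 0" if y: "R2 < norm y" for m y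
  proof (cases "y \<in> slab")
    case True
    have "J (real (Suc m)) y s = 0" for s
    proof (rule ccontr)
      assume J: "J (real (Suc m)) y s \<noteq> 0"
      define z where "z = \<Phi> y - (s / real (Suc m)) *\<^sub>R e"
      have "cutoff' s \<noteq> 0" "f z \<noteq> 0" using J by (auto simp: J_def z_def)
      then have s: "1 < s" "s < 2" and zb: "z \<in> cball c r"
        using cutoff_values(4,5)[of s] fs[of z] ball_subset_cball[of c r] by (force simp: not_le)+
      have z: "z = y + (h y - y \<bullet> e - s / real (Suc m)) *\<^sub>R e"
        by (simp add: z_def \<Phi>_def algebra_simps)
      have hz: "h z = h y" unfolding z by (rule hinv)
      have s2: "\<bar>s / real (Suc m)\<bar> \<le> 2" using s by (simp add: divide_le_eq)
      have "norm y = norm (z - (h y - y \<bullet> e - s / real (Suc m)) *\<^sub>R e)" by (simp add: z)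
      also have "\<dots> \<le> norm z + norm ((h y - y \<bullet> e - s / real (Suc m)) *\<^sub>R e)" by (rule norm_triangle_ineq4)
      also have "\<dots> = norm z + \<bar>h z - y \<bullet> e - s / real (Suc m)\<bar>" by (simp add: e hz)
      also have "\<dots> \<le> norm z + (\<bar>Hb\<bar> + 1 + 2)"
      proof -
        have "0 \<le> y \<bullet> e" "y \<bullet> e \<le> 1" using True by (auto simp: slab_def)
        then show ?thesis using Hb[OF zb] s2 by linarith
      qed
      also have "norm z \<le> norm c + \<bar>r\<bar>"
        using zb norm_triangle_ineq2[of z c] by (auto simp: dist_norm norm_minus_commute)
      finally show False using y by (simp add: R2_def)
    qed
    then show ?thesis by (simp add: I_def inner)
  qed (simp add: I_def)
  have Ilim: "(\<lambda>m. I (real (Suc m)) y) \<longlonglongrightarrow> indicator slab y * (f (\<Phi> y) * (v \<bullet> e - h' y v))" for y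
  proof -
    have "I (real (Suc m)) y = indicator slab y * (\<integral>s. J (real (Suc m)) y s \<partial>lborel)" for m
      unfolding I_def by (subst inner) auto
    then show ?thesis by (simp only: tendsto_mult_left[OF innerlim])
  qed
  have Im: "I (real (Suc m)) \<in> borel_measurable lborel" for m
    using slab(1)[of "real (Suc m)"] by (simp add: integrable_iff_bounded)
  have lm: "(\<lambda>y. indicator slab y * (f (\<Phi> y) * (v \<bullet> e - h' y v))) \<in> borel_measurable lborel"
    by (rule borel_measurable_LIMSEQ_real[OF Ilim Im])
  have w: "integrable lborel (\<lambda>y::'a. (CI * (CB * F)) * indicator (cball 0 R2) y)"
    by (intro integrable_mult_right impI integrable_real_indicator)
       (auto intro: emeasure_lborel_cball_finite[simplified])
  have dom: "AE y in lborel. norm (I (real (Suc m)) y) \<le> (CI * (CB * F)) * indicator (cball 0 R2) y" for m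
  proof (rule AE_I2)
    fix y
    show "norm (I (real (Suc m)) y) \<le> (CI * (CB * F)) * indicator (cball 0 R2) y"
      using Ib[of m y] Is[of y m] by (cases "norm y \<le> R2") auto
  qed
  have AEl: "AE y in lborel. (\<lambda>m. I (real (Suc m)) y) \<longlonglongrightarrow> indicator slab y * (f (\<Phi> y) * (v \<bullet> e - h' y v))"
    using Ilim by simp
  show "integrable lborel (\<lambda>y. indicator slab y * (f (\<Phi> y) * (v \<bullet> e - h' y v)))"
    by (rule integrable_dominated_convergence[OF lm Im w AEl dom])
  have "(\<lambda>m. \<integral>y. I (real (Suc m)) y \<partial>lborel) \<longlonglongrightarrow> (\<integral>y. indicator slab y * (f (\<Phi> y) * (v \<bullet> e - h' y v)) \<partial>lborel)"
    by (rule integral_dominated_convergence[OF lm Im w AEl dom])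
  moreover have "(\<integral>y. I (real (Suc m)) y \<partial>lborel) = (\<integral>x. A (real (Suc m)) x \<partial>lborel)" for m
    using slab(2)[of "real (Suc m)"] AK[of "real (Suc m)"] by simp
  ultimately show "(\<integral>x. indicator \<Omega> x * f' x v \<partial>lborel)
       = (\<integral>y. indicator slab y * (f (\<Phi> y) * (v \<bullet> e - h' y v)) \<partial>lborel)"
    using limA LIMSEQ_unique by simp
qed

section \<open>Graph charts: gradient, boundary points, normal and surface measure\<close>

lemma frechet_derivative_eq_grad:
  fixes f :: "real^'n::finite \<Rightarrow> real"
  assumes "f differentiable (at x)"
  shows "(f has_derivative (\<lambda>w. grad f x \<bullet> w)) (at x)"
proof -
  let ?D = "frechet_derivative f (at x)"
  have D: "(f has_derivative ?D) (at x)" using assms by (simp add: frechet_derivative_works)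
  then have lin: "linear ?D" by (rule has_derivative_linear)
  have "?D w = grad f x \<bullet> w" for w
  proof -
    have "?D w = ?D (\<Sum>i\<in>UNIV. w $ i *\<^sub>R axis i 1)"
      using basis_expansion[of w] by (simp add: scalar_mult_eq_scaleR)
    also have "\<dots> = (\<Sum>i\<in>UNIV. w $ i * ?D (axis i 1))"
      by (simp add: linear_sum[OF lin] linear_scale[OF lin])
    also have "\<dots> = grad f x \<bullet> w"
      by (simp add: inner_vec_def grad_def pd_def mult.commute)
    finally show ?thesis .
  qed
  with D show ?thesis by (metis (no_types, lifting) ext)
qed

lemma cl_ext_inside: "x \<in> \<Omega> \<Longrightarrow> cl_ext \<Omega> f x = f x"
  by (simp add: cl_ext_def)

lemma in_Cl_differentiable: "in_Cl \<Omega> l \<alpha> f \<Longrightarrow> 0 < l \<Longrightarrow> x \<in> \<Omega> \<Longrightarrow> f differentiable (at x)"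
  unfolding in_Cl_def by (metis foldr.simps(1) id_apply list.size(3))

lemma in_Cl_continuous: "in_Cl \<Omega> l \<alpha> f \<Longrightarrow> continuous_on (closure \<Omega>) f"
  by (simp add: in_Cl_def)

lemma in_Cl_foldr_continuous:
  assumes "in_Cl \<Omega> l \<alpha> f" "length is \<le> l"
  shows "continuous_on (closure \<Omega>) (cl_ext \<Omega> (foldr pd is f))"
    and "continuous_on \<Omega> (foldr pd is f)"
    and "\<exists>B. \<forall>x\<in>closure \<Omega>. \<bar>cl_ext \<Omega> (foldr pd is f) x\<bar> \<le> B"
    and "\<exists>B. \<forall>x\<in>\<Omega>. \<bar>foldr pd is f x\<bar> \<le> B"
proof -
  show 1: "continuous_on (closure \<Omega>) (cl_ext \<Omega> (foldr pd is f))" using assms by (simp add: in_Cl_def)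
  have "continuous_on \<Omega> (cl_ext \<Omega> (foldr pd is f))"
    by (rule continuous_on_subset[OF 1 closure_subset])
  then show "continuous_on \<Omega> (foldr pd is f)"
    by (rule continuous_on_eq) (simp add: cl_ext_inside)
  show 2: "\<exists>B. \<forall>x\<in>closure \<Omega>. \<bar>cl_ext \<Omega> (foldr pd is f) x\<bar> \<le> B"
    using assms unfolding in_Cl_def bounded_iff by auto
  then show "\<exists>B. \<forall>x\<in>\<Omega>. \<bar>foldr pd is f x\<bar> \<le> B"
    using closure_subset by (metis cl_ext_inside subsetD)
qed

lemma in_Cl_pd:
  assumes "in_Cl \<Omega> l \<alpha> f" "1 \<le> l"
  shows "continuous_on (closure \<Omega>) (cl_ext \<Omega> (pd i f))"
    and "continuous_on \<Omega> (pd i f)"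
    and "\<exists>B. \<forall>x\<in>\<Omega>. \<bar>pd i f x\<bar> \<le> B"
  using in_Cl_foldr_continuous[OF assms(1), of "[i]"] assms(2) by simp_all

text \<open>The last two claims come from differentiating the invariance of \<open>h\<close> under
  translation along \<open>e\<close>; the others are the \<open>C^2\<close> regularity built into
  the chart.\<close>

lemma graph_chart_deriv:
  fixes e :: "real^'n::finite"
  assumes "graph_chart \<alpha> \<Omega> U e h"
  shows "(h has_derivative (\<lambda>w. grad h x \<bullet> w)) (at x)" "continuous_on UNIV (grad h)"
    "\<exists>B. \<forall>x. norm (grad h x) \<le> B" "grad h x \<bullet> e = 0" "grad h (x + s *\<^sub>R e) = grad h x"
proof -
  have h: "in_Cl UNIV 2 \<alpha> h" and inv: "\<And>y s. h (y + s *\<^sub>R e) = h y"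
    using assms by (auto simp: graph_chart_def)
  show d: "(h has_derivative (\<lambda>w. grad h x \<bullet> w)) (at x)" for x
    by (rule frechet_derivative_eq_grad) (rule in_Cl_differentiable[OF h]; simp)
  show "continuous_on UNIV (grad h)"
    unfolding grad_def by (intro continuous_on_vec_lambda in_Cl_pd(2)[OF h]) simp
  have "\<forall>i. \<exists>B. \<forall>x. \<bar>pd i h x\<bar> \<le> B" using in_Cl_pd(3)[OF h] by simp
  then obtain b where b: "\<And>i x. \<bar>pd i h x\<bar> \<le> b i" by metis
  have "norm (grad h x) \<le> sum b UNIV" for x
    using norm_le_l1_cart[of "grad h x"] sum_mono[of UNIV "\<lambda>i. \<bar>grad h x $ i\<bar>" b] b
    by (simp add: grad_def order_trans)
  then show "\<exists>B. \<forall>x. norm (grad h x) \<le> B" by blast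
  show "grad h x \<bullet> e = 0"
  proof -
    have "((\<lambda>s. x + s *\<^sub>R e) has_derivative (\<lambda>s. s *\<^sub>R e)) (at 0)"
      by (auto intro!: derivative_eq_intros)
    from has_derivative_compose[OF this d]
    have "((\<lambda>s. h (x + s *\<^sub>R e)) has_derivative (\<lambda>s. grad h (x + 0 *\<^sub>R e) \<bullet> (s *\<^sub>R e))) (at 0)" .
    then have "((\<lambda>s::real. h x) has_derivative (\<lambda>s. grad h x \<bullet> (s *\<^sub>R e))) (at 0)" by (simp add: inv)
    moreover have "((\<lambda>s::real. h x) has_derivative (\<lambda>s. 0)) (at 0)" by simp
    ultimately have "(\<lambda>s. grad h x \<bullet> (s *\<^sub>R e)) = (\<lambda>s. 0)" by (rule has_derivative_unique)
    then have "grad h x \<bullet> (1 *\<^sub>R e) = 0" by (rule fun_cong)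
    then show ?thesis by simp
  qed
  show "grad h (x + s *\<^sub>R e) = grad h x"
  proof -
    have "((\<lambda>z. z + s *\<^sub>R e) has_derivative (\<lambda>w. w)) (at x)" by (auto intro!: derivative_eq_intros)
    from has_derivative_compose[OF this d]
    have "(h has_derivative (\<lambda>w. grad h (x + s *\<^sub>R e) \<bullet> w)) (at x)" by (simp add: inv)
    from has_derivative_unique[OF this d]
    have "grad h (x + s *\<^sub>R e) \<bullet> w = grad h x \<bullet> w" for w by (rule fun_cong)
    then show ?thesis by (rule vector_eq_rdot[THEN iffD1, OF allI])
  qed
qed

lemma graph_chart_continuous: "graph_chart \<alpha> \<Omega> U e h \<Longrightarrow> continuous_on A h"
  by (rule has_derivative_continuous_on) (use graph_chart_deriv(1) has_derivative_at_withinI in blast)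

text \<open>The strict inequalities on either side of the graph are open conditions, putting a point
  in the interior or outside the closure. A point on the graph is approached from inside along
  \<open>- e\<close>.\<close>

lemma graph_chart_frontier:
  assumes ch: "graph_chart \<alpha> \<Omega> U e h" and x: "x \<in> U"
  shows "x \<in> frontier \<Omega> \<longleftrightarrow> x \<bullet> e = h x"
proof -
  have U: "open U" and e: "norm e = 1" and inv: "\<And>y s. h (y + s *\<^sub>R e) = h y"
    and sub: "\<And>x. x \<in> U \<Longrightarrow> x \<in> \<Omega> \<longleftrightarrow> x \<bullet> e < h x"
    using ch by (auto simp: graph_chart_def)
  note hc = graph_chart_continuous[OF ch]
  have ee: "e \<bullet> e = 1" using e by (simp add: dot_square_norm)
  consider "x \<bullet> e < h x" | "x \<bullet> e = h x" | "h x < x \<bullet> e" by linarith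
  then show ?thesis
  proof cases
    case 1
    have "open (U \<inter> {z. z \<bullet> e < h z})" by (intro open_Int U open_Collect_less continuous_intros hc)
    moreover have "U \<inter> {z. z \<bullet> e < h z} \<subseteq> \<Omega>" using sub by auto
    ultimately have "x \<in> interior \<Omega>" using x 1 by (intro interiorI[of "U \<inter> {z. z \<bullet> e < h z}"]) auto
    then show ?thesis using 1 by (simp add: frontier_def)
  next
    case 3
    have "open (U \<inter> {z. h z < z \<bullet> e})" by (intro open_Int U open_Collect_less continuous_intros hc)
    moreover have "U \<inter> {z. h z < z \<bullet> e} \<inter> \<Omega> = {}" using sub by auto
    ultimately have "x \<notin> closure \<Omega>" using x 3 by (auto simp: closure_iff_nhds_not_empty)
    then show ?thesis using 3 by (simp add: frontier_def)
  next
    case 2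
    have "x \<notin> \<Omega>" using sub[OF x] 2 by simp
    then have "x \<notin> interior \<Omega>" using interior_subset by auto
    moreover have "x \<in> closure \<Omega>"
    proof -
      have lim: "(\<lambda>m. x + (- inverse (real (Suc m))) *\<^sub>R e) \<longlonglongrightarrow> x"
      proof -
        have "(\<lambda>m. x + (- inverse (real (Suc m))) *\<^sub>R e) \<longlonglongrightarrow> x + (- 0) *\<^sub>R e"
          by (intro tendsto_intros LIMSEQ_inverse_real_of_nat)
        then show ?thesis by simp
      qed
      then have "\<forall>\<^sub>F m in sequentially. x + (- inverse (real (Suc m))) *\<^sub>R e \<in> U"
        using U x by (simp add: topological_tendstoD)
      then have "\<forall>\<^sub>F m in sequentially. x + (- inverse (real (Suc m))) *\<^sub>R e \<in> closure \<Omega>"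
      proof eventually_elim
        case (elim m)
        have "(x + (- inverse (real (Suc m))) *\<^sub>R e) \<bullet> e < h (x + (- inverse (real (Suc m))) *\<^sub>R e)"
          unfolding inv using 2 by (simp add: inner_add_left ee inner_diff_left)
        then show ?case using sub[OF elim] closure_subset by auto
      qed
      then show ?thesis by (rule Lim_in_closed_set[OF closed_closure _ _ lim]) simp
    qed
    ultimately show ?thesis using 2 by (simp add: frontier_def)
  qed
qed

text \<open>Every direction entering the first subgraph does not leave the second one, so the two unit
  normals cannot differ.\<close>

lemma graph_chart_normal_unique:
  fixes e1 e2 :: "real^'n::finite"
  assumes c1: "graph_chart \<alpha> \<Omega> U1 e1 k1" and c2: "graph_chart \<alpha> \<Omega> U2 e2 k2"
    and x: "x \<in> U1" "x \<in> U2" "x \<in> frontier \<Omega>"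
  shows "(1 / norm (e1 - grad k1 x)) *\<^sub>R (e1 - grad k1 x) = (1 / norm (e2 - grad k2 x)) *\<^sub>R (e2 - grad k2 x)"
proof -
  have U: "open U1" "open U2" using c1 c2 by (auto simp: graph_chart_def)
  have sub1: "\<And>x. x \<in> U1 \<Longrightarrow> x \<in> \<Omega> \<longleftrightarrow> x \<bullet> e1 < k1 x" and sub2: "\<And>x. x \<in> U2 \<Longrightarrow> x \<in> \<Omega> \<longleftrightarrow> x \<bullet> e2 < k2 x"
    using c1 c2 by (auto simp: graph_chart_def)
  define a where "a = e1 - grad k1 x"
  define b where "b = e2 - grad k2 x"
  have ne: "e - grad h x \<noteq> 0" if "graph_chart \<alpha> \<Omega> U e h" for U e h
  proof
    assume "e - grad h x = 0"
    then have "e \<bullet> e = grad h x \<bullet> e" by simp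
    also have "\<dots> = 0" by (rule graph_chart_deriv(4)[OF that])
    finally show False using that by (auto simp: graph_chart_def)
  qed
  have a0: "a \<noteq> 0" and b0: "b \<noteq> 0" using ne[OF c1] ne[OF c2] by (auto simp: a_def b_def)
  have pd: "((\<lambda>s. (x + s *\<^sub>R v) \<bullet> e - h (x + s *\<^sub>R v)) has_real_derivative v \<bullet> (e - grad h x)) (at 0)"
    if "graph_chart \<alpha> \<Omega> U e h" for U e h and v :: "real^'n"
  proof -
    have l: "((\<lambda>s. x + s *\<^sub>R v) has_derivative (\<lambda>s. s *\<^sub>R v)) (at 0)"
      by (auto intro!: derivative_eq_intros)
    have "((\<lambda>s. h (x + s *\<^sub>R v)) has_derivative (\<lambda>s. grad h (x + 0 *\<^sub>R v) \<bullet> (s *\<^sub>R v))) (at 0)"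
      by (rule has_derivative_compose[OF l graph_chart_deriv(1)[OF that]])
    then have "((\<lambda>s. (x + s *\<^sub>R v) \<bullet> e - h (x + s *\<^sub>R v)) has_derivative
       (\<lambda>s. (s *\<^sub>R v) \<bullet> e - grad h (x + 0 *\<^sub>R v) \<bullet> (s *\<^sub>R v))) (at 0)"
      by (intro has_derivative_diff has_derivative_inner_left l)
    moreover have "(\<lambda>s. (s *\<^sub>R v) \<bullet> e - grad h (x + 0 *\<^sub>R v) \<bullet> (s *\<^sub>R v)) = (*) (v \<bullet> (e - grad h x))"
      by (auto simp: fun_eq_iff inner_diff_right inner_commute algebra_simps)
    ultimately show ?thesis by (simp add: has_field_derivative_def)
  qed
  have line: "\<forall>\<^sub>F s in at_right (0::real). x + s *\<^sub>R v \<in> U" if "open U" "x \<in> U" for U and v :: "real^'n"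
  proof -
    have "((\<lambda>s. x + s *\<^sub>R v) \<longlongrightarrow> x + 0 *\<^sub>R v) (at_right 0)" by (intro tendsto_intros)
    then show ?thesis using that by (intro topological_tendstoD[where S = U]) auto
  qed
  \<comment> \<open>If \<open>v \<bullet> a < 0\<close>, small steps along \<open>v\<close> enter
    the first subgraph; if also \<open>v \<bullet> b > 0\<close>, they leave the second. Both
    describe the same domain near \<open>x\<close>.\<close>
  have key: "v \<bullet> b \<le> 0" if v: "v \<bullet> a < 0" for v
  proof (rule ccontr)
    assume "\<not> v \<bullet> b \<le> 0"
    then have vb: "0 < v \<bullet> b" by simp
    obtain d1 where d1: "0 < d1" "\<And>s. 0 < s \<Longrightarrow> s < d1 \<Longrightarrow>
        (x + (0 + s) *\<^sub>R v) \<bullet> e1 - k1 (x + (0 + s) *\<^sub>R v) < (x + 0 *\<^sub>R v) \<bullet> e1 - k1 (x + 0 *\<^sub>R v)"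
      using DERIV_neg_dec_right[OF pd[OF c1, of v]] v by (auto simp: a_def)
    obtain d2 where d2: "0 < d2" "\<And>s. 0 < s \<Longrightarrow> s < d2 \<Longrightarrow>
        (x + 0 *\<^sub>R v) \<bullet> e2 - k2 (x + 0 *\<^sub>R v) < (x + (0 + s) *\<^sub>R v) \<bullet> e2 - k2 (x + (0 + s) *\<^sub>R v)"
      using DERIV_pos_inc_right[OF pd[OF c2, of v]] vb by (auto simp: b_def)
    have "\<forall>\<^sub>F s in at_right (0::real). s < min d1 d2" "\<forall>\<^sub>F s in at_right (0::real). 0 < s"
      using d1 d2 by (auto simp: eventually_at_right_less intro!: eventually_at_rightI[of 0 "min d1 d2"])
    then have "\<forall>\<^sub>F s in at_right (0::real). x + s *\<^sub>R v \<in> U1 \<and> x + s *\<^sub>R v \<in> U2 \<and> s < min d1 d2 \<and> 0 < s"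
      using line[OF U(1) x(1), of v] line[OF U(2) x(2), of v] by eventually_elim auto
    then obtain s where s: "x + s *\<^sub>R v \<in> U1" "x + s *\<^sub>R v \<in> U2" "s < min d1 d2" "0 < s"
      using eventually_happens[of _ "at_right (0::real)"] by (auto simp: trivial_limit_at_right_real)
    have "x \<bullet> e1 = k1 x" "x \<bullet> e2 = k2 x"
      using graph_chart_frontier[OF c1 x(1)] graph_chart_frontier[OF c2 x(2)] x(3) by auto
    then show False using d1(2)[of s] d2(2)[of s] s sub1[OF s(1)] sub2[OF s(2)] by auto
  qed
  have "(1 / norm a) *\<^sub>R a = (1 / norm b) *\<^sub>R b"
  proof (rule ccontr)
    assume neq: "(1 / norm a) *\<^sub>R a \<noteq> (1 / norm b) *\<^sub>R b"
    \<comment> \<open>For distinct unit vectors Cauchy-Schwarz is strict, so their difference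
      satisfies \<open>v \<bullet> a < 0\<close> and \<open>v \<bullet> b > 0\<close>, contradicting
      \<open>key\<close>.\<close>
    define v where "v = (1 / norm b) *\<^sub>R b - (1 / norm a) *\<^sub>R a"
    have cs: "a \<bullet> b < norm a * norm b"
    proof -
      have "a \<bullet> b \<noteq> norm a * norm b"
      proof
        assume "a \<bullet> b = norm a * norm b"
        then have "norm a *\<^sub>R b = norm b *\<^sub>R a" by (simp add: norm_cauchy_schwarz_eq)
        then have "(1 / (norm a * norm b)) *\<^sub>R (norm a *\<^sub>R b) = (1 / (norm a * norm b)) *\<^sub>R (norm b *\<^sub>R a)" by simp
        then show False using neq a0 b0 by simp
      qed
      then show ?thesis using norm_cauchy_schwarz[of a b] by simp
    qed
    have aa: "a \<bullet> a = norm a * norm a" "b \<bullet> b = norm b * norm b"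
      by (simp_all add: dot_square_norm power2_eq_square)
    have "v \<bullet> a = (1 / norm b) * (b \<bullet> a) - (1 / norm a) * (a \<bullet> a)"
      unfolding v_def inner_diff_left inner_scaleR_left ..
    also have "\<dots> = (a \<bullet> b - norm a * norm b) / norm b"
      unfolding aa inner_commute[of b a] using a0 b0 by (simp add: field_simps)
    finally have va: "v \<bullet> a = (a \<bullet> b - norm a * norm b) / norm b" .
    have "v \<bullet> b = (1 / norm b) * (b \<bullet> b) - (1 / norm a) * (a \<bullet> b)"
      unfolding v_def inner_diff_left inner_scaleR_left ..
    also have "\<dots> = (norm a * norm b - a \<bullet> b) / norm a"
      unfolding aa using a0 b0 by (simp add: field_simps)
    finally have vb: "v \<bullet> b = (norm a * norm b - a \<bullet> b) / norm a" .
    have "v \<bullet> a < 0" unfolding va using cs b0 by (simp add: divide_neg_pos)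
    moreover have "v \<bullet> b > 0" unfolding vb using cs a0 by simp
    ultimately show False using key by force
  qed
  then show ?thesis by (simp add: a_def b_def)
qed

text \<open>Independence of the chart makes the definite description in
  \<open>outward_normal\<close> well defined at every boundary point lying in a chart.\<close>

lemma outward_normal_chart:
  assumes ch: "graph_chart \<alpha> \<Omega> U e h" and x: "x \<in> U" "x \<in> frontier \<Omega>"
  shows "outward_normal \<alpha> \<Omega> x = (1 / norm (e - grad h x)) *\<^sub>R (e - grad h x)"
  unfolding outward_normal_def
proof (rule the_equality)
  show "\<exists>U' e' h'. x \<in> U' \<and> graph_chart \<alpha> \<Omega> U' e' h' \<and>
      (1 / norm (e - grad h x)) *\<^sub>R (e - grad h x) = (1 / norm (e' - grad h' x)) *\<^sub>R (e' - grad h' x)"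
    using ch x by blast
qed (use graph_chart_normal_unique[OF _ ch] x in blast)

lemma borel_measurable_indicator_continuous:
  fixes g :: "'a::euclidean_space \<Rightarrow> real"
  assumes "S \<in> sets borel" "continuous_on S g"
  shows "(\<lambda>x. indicator S x * g x) \<in> borel_measurable borel"
  using borel_measurable_continuous_on_indicator[OF assms] by simp

text \<open>On Borel subsets of \<open>U \<inter> frontier \<Omega>\<close> the surface measure
  agrees with the push-forward under \<open>\<Phi>\<close> of the weighted Lebesgue measure on the
  slab. Restricting both measures by the indicator of that set makes them equal, and functions
  supported there have equal integrals.\<close>

lemma surface_measure_chart:
  fixes \<Omega> :: "(real^'n::finite) set" and g :: "real^'n \<Rightarrow> real"
  assumes sm: "surface_measure \<alpha> \<Omega> \<sigma>" and ch: "graph_chart \<alpha> \<Omega> U e h"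
    and gm: "g \<in> borel_measurable borel" and g0: "\<And>x. x \<notin> U \<inter> frontier \<Omega> \<Longrightarrow> g x = 0"
  defines "w \<equiv> \<lambda>y. indicator {y. 0 \<le> y \<bullet> e \<and> y \<bullet> e \<le> 1} y * sqrt (1 + (norm (grad h y))\<^sup>2)"
    and "\<Phi> \<equiv> \<lambda>y. y + (h y - y \<bullet> e) *\<^sub>R e"
  shows "integrable \<sigma> g \<longleftrightarrow> integrable lborel (\<lambda>y. w y * g (\<Phi> y))"
    and "(\<integral>x. g x \<partial>\<sigma>) = (\<integral>y. w y * g (\<Phi> y) \<partial>lborel)"
proof -
  define S where "S = U \<inter> frontier \<Omega>"
  have S: "S \<in> sets borel" using ch by (auto simp: S_def graph_chart_def)
  note hc = graph_chart_continuous[OF ch]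
  have \<Phi>m[measurable]: "\<Phi> \<in> borel_measurable borel"
    unfolding \<Phi>_def by (intro borel_measurable_continuous_onI continuous_intros hc)
  have slm: "{y. 0 \<le> y \<bullet> e \<and> y \<bullet> e \<le> 1} \<in> sets borel" by measurable
  have wm[measurable]: "w \<in> borel_measurable borel"
    unfolding w_def
    by (intro borel_measurable_times borel_measurable_indicator slm borel_measurable_continuous_onI
        continuous_intros graph_chart_deriv(2)[OF ch])
  have w0: "0 \<le> w y" for y by (simp add: w_def)
  have sets\<sigma>[measurable_cong]: "sets \<sigma> = sets borel" using sm by (simp add: surface_measure_def)
  have form: "emeasure \<sigma> A = (\<integral>\<^sup>+ y. ennreal (w y) * indicator A (\<Phi> y) \<partial>lborel)"
    if "A \<in> sets borel" "A \<subseteq> S" for A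
  proof -
    have "emeasure \<sigma> A = (\<integral>\<^sup>+ y. indicator {y. 0 \<le> y \<bullet> e \<and> y \<bullet> e \<le> 1} y
                * indicator A (y + (h y - y \<bullet> e) *\<^sub>R e)
                * ennreal (sqrt (1 + (norm (grad h y))\<^sup>2)) \<partial>lborel)"
      using sm ch that unfolding surface_measure_def S_def by blast
    also have "\<dots> = (\<integral>\<^sup>+ y. ennreal (w y) * indicator A (\<Phi> y) \<partial>lborel)"
      by (rule nn_integral_cong) (auto simp: w_def \<Phi>_def indicator_def)
    finally show ?thesis .
  qed
  define N where "N = distr (density lborel (\<lambda>y. ennreal (w y))) borel \<Phi>"
  have eq: "density \<sigma> (\<lambda>x. ennreal (indicator S x)) = density N (\<lambda>x. ennreal (indicator S x))"
  proof (rule measure_eqI)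
    show "sets (density \<sigma> (\<lambda>x. ennreal (indicator S x))) = sets (density N (\<lambda>x. ennreal (indicator S x)))"
      by (simp add: N_def sets\<sigma>)
    fix A assume "A \<in> sets (density \<sigma> (\<lambda>x. ennreal (indicator S x)))"
    then have A[measurable]: "A \<in> sets borel" by (simp add: sets\<sigma>)
    note S[measurable]
    have "emeasure (density \<sigma> (\<lambda>x. ennreal (indicator S x))) A = (\<integral>\<^sup>+ x. indicator (S \<inter> A) x \<partial>\<sigma>)"
    proof (subst emeasure_density)
      show "(\<integral>\<^sup>+ x. ennreal (indicator S x) * indicator A x \<partial>\<sigma>) = (\<integral>\<^sup>+ x. indicator (S \<inter> A) x \<partial>\<sigma>)"
        by (rule nn_integral_cong) (simp split: split_indicator)
    qed (simp_all add: sets\<sigma>)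
    also have "\<dots> = emeasure \<sigma> (S \<inter> A)" by (rule nn_integral_indicator) (simp add: sets\<sigma>)
    also have "\<dots> = (\<integral>\<^sup>+ y. ennreal (w y) * indicator (S \<inter> A) (\<Phi> y) \<partial>lborel)"
      by (rule form) auto
    also have "\<dots> = (\<integral>\<^sup>+ y. indicator (S \<inter> A) (\<Phi> y) \<partial>density lborel (\<lambda>y. ennreal (w y)))"
      by (subst nn_integral_density) auto
    also have "\<dots> = (\<integral>\<^sup>+ x. indicator (S \<inter> A) x \<partial>N)"
      unfolding N_def by (subst nn_integral_distr) auto
    also have "\<dots> = (\<integral>\<^sup>+ x. ennreal (indicator S x) * indicator A x \<partial>N)"
      by (rule nn_integral_cong) (simp split: split_indicator)
    also have "\<dots> = emeasure (density N (\<lambda>x. ennreal (indicator S x))) A"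
      by (subst emeasure_density) (auto simp: N_def)
    finally show "emeasure (density \<sigma> (\<lambda>x. ennreal (indicator S x))) A
      = emeasure (density N (\<lambda>x. ennreal (indicator S x))) A" .
  qed
  have gS: "indicator S x * g x = g x" for x using g0[of x] by (auto simp: S_def indicator_def)
  note S[measurable] gm[measurable]
  have setsN[measurable_cong]: "sets N = sets borel" by (simp add: N_def)
  have "integrable \<sigma> g \<longleftrightarrow> integrable (density \<sigma> (\<lambda>x. ennreal (indicator S x))) g"
    by (subst integrable_density) (auto simp: gS)
  also have "\<dots> \<longleftrightarrow> integrable N g"
    unfolding eq by (subst integrable_density) (auto simp: gS)
  also have "\<dots> \<longleftrightarrow> integrable lborel (\<lambda>y. w y * g (\<Phi> y))"
    unfolding N_def by (subst integrable_distr_eq; (subst integrable_density)?) (auto simp: w0)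
  finally show "integrable \<sigma> g \<longleftrightarrow> integrable lborel (\<lambda>y. w y * g (\<Phi> y))" .
  have "(\<integral>x. g x \<partial>\<sigma>) = (\<integral>x. g x \<partial>density \<sigma> (\<lambda>x. ennreal (indicator S x)))"
    by (subst integral_density) (auto simp: gS)
  also have "\<dots> = (\<integral>x. g x \<partial>N)"
    unfolding eq by (subst integral_density) (auto simp: gS)
  also have "\<dots> = (\<integral>y. w y * g (\<Phi> y) \<partial>lborel)"
    unfolding N_def by (subst integral_distr; (subst integral_density)?) (auto simp: w0)
  finally show "(\<integral>x. g x \<partial>\<sigma>) = (\<integral>y. w y * g (\<Phi> y) \<partial>lborel)" .
qed

section \<open>From charts to the whole domain by a partition of unity\<close>

text \<open>The derivative is only required to be continuous and bounded inside; the function itself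
  extends to the closure. This suits dominated convergence in the volume term and still gives
  boundary values, and the class is closed under products and finite sums.\<close>

definition C1_closure :: "'a::euclidean_space set \<Rightarrow> ('a \<Rightarrow> real) \<Rightarrow> ('a \<Rightarrow> 'a \<Rightarrow> real) \<Rightarrow> bool" where
  "C1_closure \<Omega> f f' \<longleftrightarrow> continuous_on (closure \<Omega>) f \<and> (\<forall>x\<in>\<Omega>. (f has_derivative f' x) (at x)) \<and>
     (\<forall>v. continuous_on \<Omega> (\<lambda>x. f' x v)) \<and> (\<forall>v. \<exists>B. \<forall>x\<in>\<Omega>. \<bar>f' x v\<bar> \<le> B)"

lemma C1_closureD:
  assumes "C1_closure \<Omega> f f'"
  shows "continuous_on (closure \<Omega>) f" "x \<in> \<Omega> \<Longrightarrow> (f has_derivative f' x) (at x)"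
    "continuous_on \<Omega> (\<lambda>x. f' x v)" "\<exists>B. \<forall>x\<in>\<Omega>. \<bar>f' x v\<bar> \<le> B"
  using assms by (auto simp: C1_closure_def)

lemma continuous_on_closure_bounded:
  fixes f :: "'a::euclidean_space \<Rightarrow> real"
  assumes "bounded \<Omega>" "continuous_on (closure \<Omega>) f"
  shows "\<exists>B. \<forall>x\<in>closure \<Omega>. \<bar>f x\<bar> \<le> B"
proof -
  have "bounded (f ` closure \<Omega>)"
    by (intro compact_imp_bounded compact_continuous_image assms) (use assms in \<open>simp add: compact_closure\<close>)
  then obtain b where "\<forall>y\<in>f ` closure \<Omega>. norm y \<le> b" unfolding bounded_iff by blast
  then show ?thesis by (intro exI[of _ b]) auto
qed

lemma C1_closureI:
  assumes "bounded \<Omega>" "continuous_on (closure \<Omega>) f" "\<And>x. x \<in> \<Omega> \<Longrightarrow> (f has_derivative f' x) (at x)"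
    "\<And>v. continuous_on (closure \<Omega>) (\<lambda>x. f' x v)"
  shows "C1_closure \<Omega> f f'"
proof -
  have "\<exists>B. \<forall>x\<in>\<Omega>. \<bar>f' x v\<bar> \<le> B" for v
    using continuous_on_closure_bounded[OF assms(1) assms(4)[of v]] closure_subset[of \<Omega>] by blast
  then show ?thesis
    unfolding C1_closure_def using assms continuous_on_subset[OF assms(4) closure_subset] by blast
qed

lemma C1_closure_mult:
  assumes \<Omega>: "bounded \<Omega>" and f: "C1_closure \<Omega> f f'" and g: "C1_closure \<Omega> g g'"
  shows "C1_closure \<Omega> (\<lambda>x. f x * g x) (\<lambda>x v. f x * g' x v + f' x v * g x)"
  unfolding C1_closure_def
proof (intro conjI allI ballI)
  show "continuous_on (closure \<Omega>) (\<lambda>x. f x * g x)"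
    by (intro continuous_intros C1_closureD(1)[OF f] C1_closureD(1)[OF g])
  show "((\<lambda>x. f x * g x) has_derivative (\<lambda>v. f x * g' x v + f' x v * g x)) (at x)" if "x \<in> \<Omega>" for x
    by (intro has_derivative_mult C1_closureD(2)[OF f that] C1_closureD(2)[OF g that])
  fix v
  note cs = continuous_on_subset[OF _ closure_subset]
  show "continuous_on \<Omega> (\<lambda>x. f x * g' x v + f' x v * g x)"
    by (intro continuous_intros C1_closureD(3)[OF f] C1_closureD(3)[OF g] cs[OF C1_closureD(1)[OF f]] cs[OF C1_closureD(1)[OF g]])
  obtain A1 where A1: "\<And>x. x \<in> closure \<Omega> \<Longrightarrow> \<bar>f x\<bar> \<le> A1"
    using continuous_on_closure_bounded[OF \<Omega> C1_closureD(1)[OF f]] by blast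
  obtain A2 where A2: "\<And>x. x \<in> closure \<Omega> \<Longrightarrow> \<bar>g x\<bar> \<le> A2"
    using continuous_on_closure_bounded[OF \<Omega> C1_closureD(1)[OF g]] by blast
  obtain B1 where B1: "\<And>x. x \<in> \<Omega> \<Longrightarrow> \<bar>f' x v\<bar> \<le> B1" using C1_closureD(4)[OF f] by blast
  obtain B2 where B2: "\<And>x. x \<in> \<Omega> \<Longrightarrow> \<bar>g' x v\<bar> \<le> B2" using C1_closureD(4)[OF g] by blast
  have "\<bar>f x * g' x v + f' x v * g x\<bar> \<le> A1 * B2 + B1 * A2" if x: "x \<in> \<Omega>" for x
  proof -
    have xc: "x \<in> closure \<Omega>" using x closure_subset by auto
    have "\<bar>f x * g' x v\<bar> \<le> A1 * B2" "\<bar>f' x v * g x\<bar> \<le> B1 * A2"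
      unfolding abs_mult using A1[OF xc] A2[OF xc] B1[OF x] B2[OF x] by (intro mult_mono; linarith)+
    then show ?thesis by linarith
  qed
  then show "\<exists>B. \<forall>x\<in>\<Omega>. \<bar>f x * g' x v + f' x v * g x\<bar> \<le> B" by blast
qed

lemma C1_closure_sum:
  assumes "\<And>i. i \<in> I \<Longrightarrow> C1_closure \<Omega> (f i) (f' i)" and "finite I"
  shows "C1_closure \<Omega> (\<lambda>x. \<Sum>i\<in>I. f i x) (\<lambda>x v. \<Sum>i\<in>I. f' i x v)"
  unfolding C1_closure_def
proof (intro conjI allI ballI)
  show "continuous_on (closure \<Omega>) (\<lambda>x. \<Sum>i\<in>I. f i x)"
    by (intro continuous_on_sum) (rule C1_closureD(1)[OF assms(1)])
  show "((\<lambda>x. \<Sum>i\<in>I. f i x) has_derivative (\<lambda>v. \<Sum>i\<in>I. f' i x v)) (at x)" if "x \<in> \<Omega>" for x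
    by (intro has_derivative_sum C1_closureD(2)[OF assms(1) that])
  fix v
  show "continuous_on \<Omega> (\<lambda>x. \<Sum>i\<in>I. f' i x v)"
    by (intro continuous_on_sum) (rule C1_closureD(3)[OF assms(1)])
  have "\<forall>i\<in>I. \<exists>B. \<forall>x\<in>\<Omega>. \<bar>f' i x v\<bar> \<le> B" using C1_closureD(4)[OF assms(1)] by blast
  then obtain b where b: "\<And>i x. i \<in> I \<Longrightarrow> x \<in> \<Omega> \<Longrightarrow> \<bar>f' i x v\<bar> \<le> b i" by metis
  have "\<bar>\<Sum>i\<in>I. f' i x v\<bar> \<le> sum b I" if "x \<in> \<Omega>" for x
    by (rule order_trans[OF sum_abs]) (rule sum_mono, rule b[OF _ that])
  then show "\<exists>B. \<forall>x\<in>\<Omega>. \<bar>\<Sum>i\<in>I. f' i x v\<bar> \<le> B" by blast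
qed

lemma C1_closure_integrable:
  assumes "C1_closure \<Omega> f f'" "open \<Omega>" "bounded \<Omega>"
  shows "integrable lborel (\<lambda>x. indicator \<Omega> x * f' x v)"
proof -
  obtain B where B: "\<And>x. x \<in> \<Omega> \<Longrightarrow> \<bar>f' x v\<bar> \<le> B" using C1_closureD(4)[OF assms(1)] by blast
  obtain R where R: "\<And>x. x \<in> \<Omega> \<Longrightarrow> norm x \<le> R" using assms(3) by (auto simp: bounded_iff)
  show ?thesis
  proof (rule integrable_bounded_support[where B = "\<bar>B\<bar>" and R = R])
    show "(\<lambda>x. indicator \<Omega> x * f' x v) \<in> borel_measurable borel"
      using borel_measurable_indicator_continuous[OF _ C1_closureD(3)[OF assms(1)]] assms(2) by simp
    show "\<bar>indicator \<Omega> x * f' x v\<bar> \<le> \<bar>B\<bar>" for x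
      using B[of x] by (cases "x \<in> \<Omega>") auto
    show "indicator \<Omega> x * f' x v = 0" if "R < norm x" for x
      using R[of x] that by (cases "x \<in> \<Omega>") auto
  qed
qed

text \<open>Directional form of the divergence theorem. Integrability of the boundary term is part
  of it, since the pieces of a partition of unity are added up and the Bochner integral is additive
  only on integrable functions.\<close>

definition divergence_formula ::
  "real \<Rightarrow> (real^'n::finite) set \<Rightarrow> (real^'n) measure \<Rightarrow> real^'n \<Rightarrow> (real^'n \<Rightarrow> real)
     \<Rightarrow> (real^'n \<Rightarrow> real^'n \<Rightarrow> real) \<Rightarrow> bool" where
  "divergence_formula \<alpha> \<Omega> \<sigma> v f f' \<longleftrightarrow>
     integrable \<sigma> (\<lambda>x. indicator (frontier \<Omega>) x * (f x * (outward_normal \<alpha> \<Omega> x \<bullet> v))) \<and>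
     (\<integral>x. indicator \<Omega> x * f' x v \<partial>lborel)
       = (\<integral>x. indicator (frontier \<Omega>) x * (f x * (outward_normal \<alpha> \<Omega> x \<bullet> v)) \<partial>\<sigma>)"

text \<open>As \<open>grad h\<close> is orthogonal to \<open>e\<close>, the length of
  \<open>e - grad h\<close> is the surface density \<open>sqrt (1 + |grad h|^2)\<close>. It cancels
  the normalisation of the outward normal, and the chart integral becomes the one in
  \<open>subgraph_divergence\<close>.\<close>

lemma divergence_formula_chart:
  assumes sm: "surface_measure \<alpha> \<Omega> \<sigma>" and ch: "graph_chart \<alpha> \<Omega> U e h"
    and \<Omega>: "open \<Omega>" "bounded \<Omega>" and f: "C1_closure \<Omega> f f'"
    and cU: "cball c r \<subseteq> U" and fs: "\<And>x. x \<notin> ball c r \<Longrightarrow> f x = 0"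
  shows "divergence_formula \<alpha> \<Omega> \<sigma> v f f'"
proof -
  have U: "open U" and e: "norm e = 1" and inv: "\<And>y s. h (y + s *\<^sub>R e) = h y"
    and sub: "\<And>x. x \<in> U \<Longrightarrow> x \<in> \<Omega> \<longleftrightarrow> x \<bullet> e < h x"
    using ch by (auto simp: graph_chart_def)
  have ee: "e \<bullet> e = 1" using e by (simp add: dot_square_norm)
  obtain B where B: "\<And>x. x \<in> \<Omega> \<Longrightarrow> \<bar>f' x v\<bar> \<le> B" using C1_closureD(4)[OF f] by blast
  obtain H where H: "\<And>x. norm (grad h x) \<le> H" using graph_chart_deriv(3)[OF ch] by blast
  have H': "\<bar>grad h x \<bullet> v\<bar> \<le> H * norm v" for x
    using Cauchy_Schwarz_ineq2[of "grad h x" v] mult_right_mono[OF H[of x], of "norm v"] by simp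
  have hvc: "continuous_on UNIV (\<lambda>x. grad h x \<bullet> v)" by (intro continuous_intros graph_chart_deriv(2)[OF ch])
  define \<Phi> where "\<Phi> y = y + (h y - y \<bullet> e) *\<^sub>R e" for y
  note sd = subgraph_divergence[OF e U cU \<Omega> sub graph_chart_deriv(1)[OF ch] H' hvc inv
      C1_closureD(1)[OF f] fs C1_closureD(2)[OF f] B C1_closureD(3)[OF f], folded \<Phi>_def]
  define nn where "nn x = e - grad h x" for x
  have nn: "norm (nn x) = sqrt (1 + (norm (grad h x))\<^sup>2)" for x
  proof -
    have "nn x \<bullet> nn x = 1 + grad h x \<bullet> grad h x"
      using graph_chart_deriv(4)[OF ch, of x]
      by (simp add: nn_def inner_diff_left inner_diff_right ee inner_commute)
    then show ?thesis by (simp add: norm_eq_sqrt_inner)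
  qed
  have npos: "norm (nn x) > 0" for x unfolding nn by (intro real_sqrt_gt_zero add_pos_nonneg) auto
  define g where "g x = indicator (frontier \<Omega>) x * (f x * (outward_normal \<alpha> \<Omega> x \<bullet> v))" for x
  define S where "S = U \<inter> frontier \<Omega>"
  have S: "S \<in> sets borel" using U by (auto simp: S_def)
  have ball: "f x = 0" if "x \<notin> U" for x using fs[of x] cU that ball_subset_cball[of c r] by blast
  have g: "g x = indicator S x * (f x * ((1 / norm (nn x)) * (nn x \<bullet> v)))" for x
  proof (cases "x \<in> S")
    case True
    then show ?thesis using outward_normal_chart[OF ch, of x] by (simp add: g_def S_def nn_def)
  next
    case False
    then show ?thesis using ball[of x] by (auto simp: g_def S_def indicator_def)
  qed
  have "continuous_on S f"
    by (rule continuous_on_subset[OF C1_closureD(1)[OF f]]) (auto simp: S_def frontier_def)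
  then have gm: "g \<in> borel_measurable borel"
    unfolding g[abs_def]
  proof (intro borel_measurable_indicator_continuous S continuous_intros)
    show "continuous_on S nn" unfolding nn_def
      by (intro continuous_intros continuous_on_subset[OF graph_chart_deriv(2)[OF ch]]) auto
    then show "continuous_on S nn" .
  qed (use npos in auto)
  have g0: "g x = 0" if "x \<notin> U \<inter> frontier \<Omega>" for x using that by (simp add: g S_def)
  note sc = surface_measure_chart[OF sm ch gm g0, folded \<Phi>_def]
  have id: "indicator {y. 0 \<le> y \<bullet> e \<and> y \<bullet> e \<le> 1} y * sqrt (1 + (norm (grad h y))\<^sup>2) * g (\<Phi> y)
      = indicator {y. 0 \<le> y \<bullet> e \<and> y \<bullet> e \<le> 1} y * (f (\<Phi> y) * (v \<bullet> e - grad h y \<bullet> v))" for y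
  proof (cases "\<Phi> y \<in> S")
    case True
    have "grad h (\<Phi> y) = grad h y" unfolding \<Phi>_def by (rule graph_chart_deriv(5)[OF ch])
    then have "nn (\<Phi> y) = nn y" by (simp add: nn_def)
    moreover have "v \<bullet> e - grad h y \<bullet> v = nn y \<bullet> v" by (simp add: nn_def inner_diff_left inner_diff_right inner_commute)
    ultimately show ?thesis using True npos[of y] by (simp add: g nn[symmetric])
  next
    case False
    have "f (\<Phi> y) = 0"
    proof (rule ccontr)
      assume "f (\<Phi> y) \<noteq> 0"
      then have "\<Phi> y \<in> U" using ball by blast
      moreover have "\<Phi> y \<bullet> e = h (\<Phi> y)" unfolding \<Phi>_def inv by (simp add: inner_add_left ee)
      ultimately show False using graph_chart_frontier[OF ch] False by (auto simp: S_def)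
    qed
    then show ?thesis using False by (simp add: g)
  qed
  show ?thesis
    unfolding divergence_formula_def g_def[symmetric]
    using sd sc unfolding id by simp
qed

text \<open>Support in a ball inside the open domain: extension by zero is differentiable
  everywhere, so the volume integral vanishes, and \<open>f\<close> is zero on the boundary.\<close>

lemma divergence_formula_interior:
  assumes \<Omega>: "open \<Omega>" "bounded \<Omega>" and f: "C1_closure \<Omega> f f'"
    and cU: "cball c r \<subseteq> \<Omega>" and fs: "\<And>x. x \<notin> ball c r \<Longrightarrow> f x = 0"
  shows "divergence_formula \<alpha> \<Omega> \<sigma> v f f'"
proof -
  have fr: "f x = 0" if "x \<notin> \<Omega>" for x
    using fs[of x] that cU ball_subset_cball[of c r] by blast
  have "indicator (frontier \<Omega>) x * (f x * (outward_normal \<alpha> \<Omega> x \<bullet> v)) = 0" for x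
    using fr[of x] \<Omega>(1) by (auto simp: frontier_def interior_open indicator_def)
  then have "\<And>x. indicator (frontier \<Omega>) x * (f x * (outward_normal \<alpha> \<Omega> x \<bullet> v)) = 0" .
  then have rhs: "(\<lambda>x. indicator (frontier \<Omega>) x * (f x * (outward_normal \<alpha> \<Omega> x \<bullet> v))) = (\<lambda>x. 0)" by (rule ext)
  obtain B where B: "\<And>x. x \<in> \<Omega> \<Longrightarrow> \<bar>f' x v\<bar> \<le> B" using C1_closureD(4)[OF f] by blast
  have "(\<integral>x. (\<lambda>w. indicator \<Omega> x * f' x w) v \<partial>lborel) = 0"
  proof (rule integral_directional_derivative_zero[where k = f and R = "norm c + \<bar>r\<bar>" and B = "\<bar>B\<bar>"])
    fix x
    show "(f has_derivative (\<lambda>w. indicator \<Omega> x * f' x w)) (at x)"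
    proof (cases "x \<in> \<Omega>")
      case True
      then show ?thesis using C1_closureD(2)[OF f True] by simp
    next
      case False
      then have x: "x \<in> - cball c r" using cU by auto
      have "((\<lambda>z. 0) has_derivative (\<lambda>w. 0)) (at x)" by simp
      then have "(f has_derivative (\<lambda>w. 0)) (at x)"
        by (rule has_derivative_transform_within_open[OF _ _ x])
           (use fs ball_subset_cball[of c r] in \<open>auto simp: open_Compl\<close>)
      then show ?thesis using False by simp
    qed
    show "\<bar>indicator \<Omega> x * f' x v\<bar> \<le> \<bar>B\<bar>" using B[of x] by (cases "x \<in> \<Omega>") auto
    show "f x = 0" if "norm c + \<bar>r\<bar> < norm x"
    proof (rule fs)
      show "x \<notin> ball c r" using that norm_triangle_ineq2[of x c] by (auto simp: dist_norm norm_minus_commute)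
    qed
  qed
  then show ?thesis unfolding divergence_formula_def rhs by simp
qed

text \<open>A quartic that is \<open>C^1\<close> and, for positive \<open>r\<close>, positive
  exactly on the open ball. Continuous first derivatives are all that the partition of unity
  needs.\<close>

definition bump :: "'a::euclidean_space \<Rightarrow> real \<Rightarrow> 'a \<Rightarrow> real" where
  "bump c r z = (max 0 (r\<^sup>2 - (z - c) \<bullet> (z - c)))\<^sup>2"

definition bump' :: "'a::euclidean_space \<Rightarrow> real \<Rightarrow> 'a \<Rightarrow> 'a \<Rightarrow> real" where
  "bump' c r z w = - (2 * ((z - c) \<bullet> w)) * (2 * max 0 (r\<^sup>2 - (z - c) \<bullet> (z - c)))"

lemma bump_props:
  "(bump c r has_derivative bump' c r z) (at z)" "continuous_on A (bump c r)"
  "continuous_on A (\<lambda>z. bump' c r z w)" "0 \<le> bump c r z"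
  "0 < r \<Longrightarrow> z \<in> ball c r \<Longrightarrow> 0 < bump c r z" "0 < r \<Longrightarrow> z \<notin> ball c r \<Longrightarrow> bump c r z = 0"
proof -
  have "((\<lambda>z. r\<^sup>2 - (z - c) \<bullet> (z - c)) has_derivative (\<lambda>w. - (2 * ((z - c) \<bullet> w)))) (at z)"
    by (auto intro!: derivative_eq_intros simp: inner_commute)
  from DERIV_compose_FDERIV[OF square_pos_part_deriv this]
  show "(bump c r has_derivative bump' c r z) (at z)" by (simp add: bump_def[abs_def] bump'_def[abs_def])
  show "continuous_on A (bump c r)" unfolding bump_def by (intro continuous_intros)
  show "continuous_on A (\<lambda>z. bump' c r z w)" unfolding bump'_def by (intro continuous_intros)
  show "0 \<le> bump c r z" by (simp add: bump_def)
  have d: "(z - c) \<bullet> (z - c) = (dist c z)\<^sup>2" by (simp add: dist_norm dot_square_norm norm_minus_commute)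
  show "0 < bump c r z" if "0 < r" "z \<in> ball c r"
  proof -
    have "(dist c z)\<^sup>2 < r\<^sup>2" using that by (intro power_strict_mono) auto
    then show ?thesis by (simp add: bump_def d)
  qed
  show "bump c r z = 0" if "0 < r" "z \<notin> ball c r"
  proof -
    have "r\<^sup>2 \<le> (dist c z)\<^sup>2" using that by (intro power_mono) auto
    then show ?thesis by (simp add: bump_def d)
  qed
qed

text \<open>Finitely many balls, each contained either in the domain or in a chart neighbourhood,
  cover the compact closure. The bumps divided by their sum split \<open>f\<close> into pieces
  treated by the two local formulas.\<close>

theorem divergence_theorem:
  assumes dom: "C2_domain \<alpha> \<Omega>" and sm: "surface_measure \<alpha> \<Omega> \<sigma>" and f: "C1_closure \<Omega> f f'"
  shows "divergence_formula \<alpha> \<Omega> \<sigma> v f f'"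
proof -
  have \<Omega>: "open \<Omega>" "bounded \<Omega>" using dom by (auto simp: C2_domain_def)
  have cp: "compact (closure \<Omega>)" using \<Omega> by (simp add: compact_closure)
  have "\<exists>r>0. cball x r \<subseteq> \<Omega> \<or> (\<exists>U e h. graph_chart \<alpha> \<Omega> U e h \<and> cball x r \<subseteq> U)" if "x \<in> closure \<Omega>" for x
  proof (cases "x \<in> \<Omega>")
    case True
    then show ?thesis using \<Omega>(1) by (meson open_contains_cball)
  next
    case False
    then have "x \<in> frontier \<Omega>" using that \<Omega>(1) by (simp add: frontier_def interior_open)
    then obtain U e h where U: "x \<in> U" "graph_chart \<alpha> \<Omega> U e h" using dom unfolding C2_domain_def by blast
    then have "open U" by (simp add: graph_chart_def)
    then obtain d where "0 < d" "cball x d \<subseteq> U" using U(1) by (meson open_contains_cball)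
    then show ?thesis using U(2) by (intro exI[of _ d] conjI disjI2 exI[of _ U] exI[of _ e] exI[of _ h])
  qed
  then obtain r where r: "\<And>x. x \<in> closure \<Omega> \<Longrightarrow> 0 < r x \<and>
      (cball x (r x) \<subseteq> \<Omega> \<or> (\<exists>U e h. graph_chart \<alpha> \<Omega> U e h \<and> cball x (r x) \<subseteq> U))" by metis
  have "closure \<Omega> \<subseteq> (\<Union>x\<in>closure \<Omega>. ball x (r x))" using r by force
  then obtain X where X: "X \<subseteq> closure \<Omega>" "finite X" "closure \<Omega> \<subseteq> (\<Union>x\<in>X. ball x (r x))"
    using compactE_image[OF cp, of "closure \<Omega>" "\<lambda>x. ball x (r x)"] by auto
  define S where "S z = (\<Sum>x\<in>X. bump x (r x) z)" for z
  define S' where "S' z w = (\<Sum>x\<in>X. bump' x (r x) z w)" for z w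
  have Spos: "S z > 0" if z: "z \<in> closure \<Omega>" for z
  proof -
    obtain x where x: "x \<in> X" "z \<in> ball x (r x)" using X z by auto
    have "0 < bump x (r x) z" using bump_props(5)[of "r x" z x] x X r by auto
    then show ?thesis unfolding S_def by (intro sum_pos2[OF X(2) x(1)]) (auto simp: bump_props(4))
  qed
  have Sd: "(S has_derivative S' z) (at z)" for z
    unfolding S_def S'_def by (intro has_derivative_sum bump_props(1))
  have Sc: "continuous_on A S" for A unfolding S_def by (intro continuous_on_sum bump_props(2))
  have S'c: "continuous_on A (\<lambda>z. S' z w)" for A w unfolding S'_def by (intro continuous_on_sum bump_props(3))
  \<comment> \<open>The sum of bumps is positive on the closure because the balls cover it, so its
    reciprocal is again of this class.\<close>
  have Sinv: "C1_closure \<Omega> (\<lambda>z. inverse (S z)) (\<lambda>z w. - (inverse (S z) * S' z w * inverse (S z)))"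
  proof (rule C1_closureI[OF \<Omega>(2)])
    have S0: "\<forall>z\<in>closure \<Omega>. S z \<noteq> 0" using Spos by force
    show "continuous_on (closure \<Omega>) (\<lambda>z. inverse (S z))" by (intro continuous_intros Sc S0)
    show "((\<lambda>z. inverse (S z)) has_derivative (\<lambda>w. - (inverse (S x) * S' x w * inverse (S x)))) (at x)" if "x \<in> \<Omega>" for x
      by (rule Deriv.has_derivative_inverse[OF _ Sd]) (use Spos[of x] that closure_subset in force)
    show "continuous_on (closure \<Omega>) (\<lambda>z. - (inverse (S z) * S' z v * inverse (S z)))" for v
      by (intro continuous_intros Sc S'c S0)
  qed
  define F where "F x z = bump x (r x) z * (f z * inverse (S z))" for x z
  define F' where "F' x z w = bump x (r x) z * (f z * (- (inverse (S z) * S' z w * inverse (S z))) + f' z w * inverse (S z))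
     + bump' x (r x) z w * (f z * inverse (S z))" for x z w
  have FC: "C1_closure \<Omega> (F x) (F' x)" for x
    unfolding F_def F'_def
    by (intro C1_closure_mult \<Omega>(2) C1_closureI bump_props f Sinv)
  have Fdiv: "divergence_formula \<alpha> \<Omega> \<sigma> v (F x) (F' x)" if x: "x \<in> X" for x
  proof -
    have rx: "0 < r x" using x X r by auto
    have F0: "F x z = 0" if "z \<notin> ball x (r x)" for z using bump_props(6)[OF rx that] by (simp add: F_def)
    consider "cball x (r x) \<subseteq> \<Omega>" | U e h where "graph_chart \<alpha> \<Omega> U e h" "cball x (r x) \<subseteq> U"
      using r[of x] x X by auto
    then show ?thesis
    proof cases
      case 1 show ?thesis by (rule divergence_formula_interior[OF \<Omega> FC 1 F0])
    next
      case 2 show ?thesis by (rule divergence_formula_chart[OF sm 2(1) \<Omega> FC 2(2) F0])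
    qed
  qed
  have Fsum: "(\<Sum>x\<in>X. F x z) = f z" if "z \<in> closure \<Omega>" for z
    using Spos[OF that] by (simp add: F_def sum_distrib_right[symmetric] S_def[symmetric])
  \<comment> \<open>The pieces add up to \<open>f\<close> on the open domain, so their derivatives
    add up to \<open>f'\<close> by uniqueness of the derivative, without expanding the quotient
    rule.\<close>
  have F'sum: "(\<Sum>x\<in>X. F' x z v) = f' z v" if z: "z \<in> \<Omega>" for z
  proof -
    have "((\<lambda>z. \<Sum>x\<in>X. F x z) has_derivative (\<lambda>w. \<Sum>x\<in>X. F' x z w)) (at z)"
      by (intro has_derivative_sum C1_closureD(2)[OF FC z])
    then have "(f has_derivative (\<lambda>w. \<Sum>x\<in>X. F' x z w)) (at z)"
      by (rule has_derivative_transform_within_open[OF _ \<Omega>(1) z]) (use Fsum closure_subset in blast)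
    from has_derivative_unique[OF this C1_closureD(2)[OF f z]] show ?thesis by (rule fun_cong)
  qed
  have l: "indicator \<Omega> z * f' z v = (\<Sum>x\<in>X. indicator \<Omega> z * F' x z v)" for z
    using F'sum[of z] by (cases "z \<in> \<Omega>") auto
  have rr: "indicator (frontier \<Omega>) z * (f z * (outward_normal \<alpha> \<Omega> z \<bullet> v))
      = (\<Sum>x\<in>X. indicator (frontier \<Omega>) z * (F x z * (outward_normal \<alpha> \<Omega> z \<bullet> v)))" for z
    using Fsum[of z] by (cases "z \<in> frontier \<Omega>") (auto simp: frontier_def sum_distrib_right[symmetric])
  show ?thesis
    unfolding divergence_formula_def l rr
    using Fdiv C1_closure_integrable[OF FC \<Omega>]
    by (auto simp: divergence_formula_def Bochner_Integration.integral_sum)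
qed

section \<open>Dimension one\<close>

lemma all_equal_if_card_1:
  fixes i j :: "'n::finite"
  assumes "CARD('n) = 1"
  shows "j = i"
proof -
  obtain k :: 'n where "UNIV = {k}" by (rule card_1_singletonE[OF assms])
  then have "i \<in> {k}" "j \<in> {k}" by auto
  then show ?thesis by simp
qed

text \<open>The image under the single coordinate is open, connected and bounded, hence an open
  interval bounded by its infimum and supremum; the domain is its preimage.\<close>

lemma one_dimensional_domain:
  fixes \<Omega> :: "(real^'n::finite) set"
  assumes card: "CARD('n) = 1" and dom: "open \<Omega>" "connected \<Omega>" "bounded \<Omega>" "\<Omega> \<noteq> {}"
  obtains l r where "l < r" "\<Omega> = {x. l < x $ i \<and> x $ i < r}"
    "left_end \<Omega> = l *\<^sub>R axis i 1" "right_end \<Omega> = r *\<^sub>R axis i 1"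
    "closure \<Omega> = {x. l \<le> x $ i \<and> x $ i \<le> r}"
    "left_end \<Omega> \<in> frontier \<Omega>" "right_end \<Omega> \<in> frontier \<Omega>"
proof -
  have one: "j = i" for j :: 'n using card by (rule all_equal_if_card_1)
  have coord: "x = x $ i *\<^sub>R axis i 1" for x :: "real^'n"
  proof -
    have "x $ j = (x $ i *\<^sub>R axis i 1) $ j" for j using one[of j] by simp
    then show ?thesis unfolding vec_eq_iff by blast
  qed
  define J where "J = (\<lambda>x. x $ i) ` \<Omega>"
  have J: "t \<in> J \<longleftrightarrow> t *\<^sub>R axis i 1 \<in> \<Omega>" for t
  proof
    assume "t \<in> J"
    then obtain x where "x \<in> \<Omega>" "t = x $ i" by (auto simp: J_def)
    then show "t *\<^sub>R axis i 1 \<in> \<Omega>" using coord[of x] by simp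
  next
    assume "t *\<^sub>R axis i 1 \<in> \<Omega>"
    then show "t \<in> J" unfolding J_def by (rule rev_image_eqI) simp
  qed
  have xJ: "x \<in> \<Omega> \<longleftrightarrow> x $ i \<in> J" for x using J[of "x $ i"] coord[of x] by simp
  have Jne: "J \<noteq> {}" using dom(4) by (simp add: J_def)
  have Jb: "bdd_above J" "bdd_below J"
  proof -
    obtain B where B: "\<And>x. x \<in> \<Omega> \<Longrightarrow> norm x \<le> B" using dom(3) by (auto simp: bounded_iff)
    have "- B \<le> t \<and> t \<le> B" if "t \<in> J" for t
    proof -
      obtain x where x: "x \<in> \<Omega>" "t = x $ i" using \<open>t \<in> J\<close> by (auto simp: J_def)
      then have "\<bar>t\<bar> \<le> B" using order_trans[OF component_le_norm_cart B[OF x(1)]] by simp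
      then show ?thesis by linarith
    qed
    then show "bdd_above J" "bdd_below J"
      by (auto intro: bdd_aboveI[of _ B] bdd_belowI[of _ "- B"])
  qed
  have Jc: "connected J" unfolding J_def
    by (intro connected_continuous_image dom continuous_intros)
  have Jo: "open J"
  proof -
    have "J = (\<lambda>t. t *\<^sub>R axis i 1) -` \<Omega>" using J by auto
    moreover have "open ((\<lambda>t. t *\<^sub>R axis i (1::real)) -` \<Omega>)"
      by (intro open_vimage dom continuous_intros)
    ultimately show ?thesis by simp
  qed
  define l where "l = Inf J"
  define r where "r = Sup J"
  have Jlr: "t \<in> J \<longleftrightarrow> l < t \<and> t < r" for t
  proof
    assume t: "t \<in> J"
    then obtain d where d: "0 < d" "ball t d \<subseteq> J" using Jo by (meson open_contains_ball)
    have "t - d/2 \<in> J" "t + d/2 \<in> J" using d by (auto simp: dist_real_def subset_iff)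
    then have "l \<le> t - d/2" "t + d/2 \<le> r" using Jb by (auto simp: l_def r_def intro: cInf_lower cSup_upper)
    then show "l < t \<and> t < r" using d by auto
  next
    assume "l < t \<and> t < r"
    then obtain a b where "a \<in> J" "a < t" "b \<in> J" "t < b"
      using cInf_lessD[of J t] less_cSupD[of J t] Jne by (auto simp: l_def r_def)
    then show "t \<in> J" using connectedD_interval[OF Jc, of a b t] by auto
  qed
  have lr: "l < r" using Jne Jlr by fastforce
  have L: "left_end \<Omega> = l *\<^sub>R axis i 1" and R: "right_end \<Omega> = r *\<^sub>R axis i 1"
  proof -
    have "left_end \<Omega> $ i = l" "right_end \<Omega> $ i = r" by (simp_all add: left_end_def right_end_def l_def r_def J_def)
    then show "left_end \<Omega> = l *\<^sub>R axis i 1" "right_end \<Omega> = r *\<^sub>R axis i 1"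
      using coord[of "left_end \<Omega>"] coord[of "right_end \<Omega>"] by simp_all
  qed
  have \<Omega>lr: "x \<in> \<Omega> \<longleftrightarrow> l < x $ i \<and> x $ i < r" for x using xJ[of x] Jlr[of "x $ i"] by simp
  have cl: "closure \<Omega> = {x. l \<le> x $ i \<and> x $ i \<le> r}"
  proof
    have "closed {x::real^'n. l \<le> x $ i \<and> x $ i \<le> r}"
      by (intro closed_Collect_conj closed_Collect_le continuous_intros)
    then show "closure \<Omega> \<subseteq> {x. l \<le> x $ i \<and> x $ i \<le> r}"
      by (rule closure_minimal[rotated]) (auto simp: \<Omega>lr)
    show "{x. l \<le> x $ i \<and> x $ i \<le> r} \<subseteq> closure \<Omega>"
    proof
      fix x :: "real^'n" assume "x \<in> {x. l \<le> x $ i \<and> x $ i \<le> r}"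
      then have x: "l \<le> x $ i" "x $ i \<le> r" by auto
      have "closure {l<..<r} = {l..r}" using lr by simp
      then have "x $ i \<in> closure {l<..<r}" using x by simp
      then obtain a where a: "\<And>n. a n \<in> {l<..<r}" "a \<longlonglongrightarrow> x $ i" unfolding closure_sequential by blast
      have "(\<lambda>n. a n *\<^sub>R axis i (1::real)) \<longlonglongrightarrow> x $ i *\<^sub>R axis i 1" by (intro tendsto_intros a)
      moreover have "a n *\<^sub>R axis i 1 \<in> \<Omega>" for n using a(1)[of n] by (simp add: \<Omega>lr)
      ultimately show "x \<in> closure \<Omega>" unfolding closure_sequential using coord[of x] by metis
    qed
  qed
  have fr: "left_end \<Omega> \<in> frontier \<Omega>" "right_end \<Omega> \<in> frontier \<Omega>"
    using lr by (auto simp: frontier_def interior_open[OF dom(1)] cl \<Omega>lr L R)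
  have "\<Omega> = {x. l < x $ i \<and> x $ i < r}" using \<Omega>lr by blast
  then show ?thesis using that[OF lr _ L R cl fr] by blast
qed

text \<open>In dimension one \<open>conormal\<close> is 1 at both end points and
  \<open>bd_flux\<close> is a difference of end point values, so this case is expressed without a
  surface integral: the fundamental theorem along the only axis.\<close>

lemma one_dimensional_divergence:
  fixes \<Omega> :: "(real^'n::finite) set"
  assumes card: "CARD('n) = 1" and dom: "open \<Omega>" "connected \<Omega>" "bounded \<Omega>" "\<Omega> \<noteq> {}"
    and f: "C1_closure \<Omega> f f'"
  shows "(\<integral>x. indicator \<Omega> x * f' x (axis i 1) \<partial>lborel) = f (right_end \<Omega>) - f (left_end \<Omega>)"
proof -
  obtain l r where lr: "l < r" and \<Omega>eq: "\<Omega> = {x. l < x $ i \<and> x $ i < r}"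
    and L: "left_end \<Omega> = l *\<^sub>R axis i 1" and R: "right_end \<Omega> = r *\<^sub>R axis i 1"
    and cl: "closure \<Omega> = {x. l \<le> x $ i \<and> x $ i \<le> r}"
    and "left_end \<Omega> \<in> frontier \<Omega>" "right_end \<Omega> \<in> frontier \<Omega>"
    by (rule one_dimensional_domain[OF card dom, of i])
  have \<Omega>: "x \<in> \<Omega> \<longleftrightarrow> l < x $ i \<and> x $ i < r" for x by (subst \<Omega>eq) simp
  have one: "j = i" for j :: 'n using card by (rule all_equal_if_card_1)
  define e where "e = (axis i 1 :: real^'n)"
  have e: "norm e = 1" by (simp add: e_def)
  have ei: "e $ i = 1" by (simp add: e_def)
  have ye: "y \<bullet> e = y $ i" for y :: "real^'n" by (simp add: e_def inner_axis)
  have coord: "y = y $ i *\<^sub>R e" for y :: "real^'n"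
  proof -
    have "y $ j = (y $ i *\<^sub>R e) $ j" for j using one[of j] by (simp add: ei)
    then show ?thesis unfolding vec_eq_iff by blast
  qed
  define k where "k t = indicator \<Omega> (t *\<^sub>R e) * f' (t *\<^sub>R e) e" for t
  have Ki: "integrable lborel (\<lambda>x. indicator \<Omega> x * f' x e)" by (rule C1_closure_integrable[OF f dom(1,3)])
  then have Km[measurable]: "(\<lambda>x. indicator \<Omega> x * f' x e) \<in> borel_measurable borel" by (simp add: integrable_iff_bounded)
  obtain B where B: "\<And>x. x \<in> \<Omega> \<Longrightarrow> \<bar>f' x e\<bar> \<le> B" using C1_closureD(4)[OF f] by blast
  have km: "k \<in> borel_measurable borel"
    unfolding k_def by (rule measurable_compose[OF _ Km]) simp
  have ki: "integrable lborel k"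
  proof (rule integrable_bounded_support[OF km, where B = "\<bar>B\<bar>" and R = "\<bar>l\<bar> + \<bar>r\<bar>"])
    show "\<bar>k t\<bar> \<le> \<bar>B\<bar>" for t using B[of "t *\<^sub>R e"] by (cases "t *\<^sub>R e \<in> \<Omega>") (auto simp: k_def)
    show "k t = 0" if "\<bar>l\<bar> + \<bar>r\<bar> < norm t" for t using that by (auto simp: k_def \<Omega> ei indicator_def)
  qed
  have kval: "(\<integral>t. k t \<partial>lborel) = f (r *\<^sub>R e) - f (l *\<^sub>R e)"
  proof -
    have "((\<lambda>t. f' (t *\<^sub>R e) e) has_integral (f (r *\<^sub>R e) - f (l *\<^sub>R e))) {l..r}"
    proof (rule fundamental_theorem_of_calculus_interior)
      show "continuous_on {l..r} (\<lambda>t. f (t *\<^sub>R e))"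
        by (rule continuous_on_compose2[OF C1_closureD(1)[OF f]]) (auto intro!: continuous_intros simp: cl ei)
      fix t assume t: "t \<in> {l<..<r}"
      have "((\<lambda>t. t *\<^sub>R e) has_derivative (\<lambda>s. s *\<^sub>R e)) (at t)" by (auto intro!: derivative_eq_intros)
      moreover have fd: "(f has_derivative f' (t *\<^sub>R e)) (at (t *\<^sub>R e))" 
        by (rule C1_closureD(2)[OF f]) (use t in \<open>simp add: \<Omega> ei\<close>)
      ultimately have "((\<lambda>t. f (t *\<^sub>R e)) has_derivative (\<lambda>s. f' (t *\<^sub>R e) (s *\<^sub>R e))) (at t)"
        by (rule has_derivative_compose)
      then show "((\<lambda>t. f (t *\<^sub>R e)) has_vector_derivative f' (t *\<^sub>R e) e) (at t)"
        using linear_scale[OF has_derivative_linear[OF fd]] by (simp add: has_vector_derivative_def)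
    qed (use lr in simp)
    then have "((\<lambda>t. f' (t *\<^sub>R e) e) has_integral (f (r *\<^sub>R e) - f (l *\<^sub>R e))) {l<..<r}"
      by (simp add: has_integral_Icc_iff_Ioo)
    moreover have "k = (\<lambda>t. if t \<in> {l<..<r} then f' (t *\<^sub>R e) e else 0)"
      by (auto simp: k_def \<Omega> ei fun_eq_iff)
    ultimately have "(k has_integral (f (r *\<^sub>R e) - f (l *\<^sub>R e))) UNIV"
      by (simp only: has_integral_restrict_UNIV)
    moreover have "(k has_integral (\<integral>t. k t \<partial>lborel)) UNIV" by (rule has_integral_integral_lborel[OF ki])
    ultimately show ?thesis by (rule has_integral_unique[rotated])
  qed
  have inner: "(\<integral>\<tau>. indicator \<Omega> (y + \<tau> *\<^sub>R e) * f' (y + \<tau> *\<^sub>R e) e \<partial>lborel) = f (r *\<^sub>R e) - f (l *\<^sub>R e)" for y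
  proof -
    have "(\<integral>\<tau>. indicator \<Omega> (y + \<tau> *\<^sub>R e) * f' (y + \<tau> *\<^sub>R e) e \<partial>lborel) = (\<integral>\<tau>. k (\<tau> + y $ i) \<partial>lborel)"
    proof (rule Bochner_Integration.integral_cong[OF refl])
      fix \<tau> :: real
      have "y + \<tau> *\<^sub>R e = (\<tau> + y $ i) *\<^sub>R e" using coord[of y] by (simp add: scaleR_add_left add.commute)
      then show "indicator \<Omega> (y + \<tau> *\<^sub>R e) * f' (y + \<tau> *\<^sub>R e) e = k (\<tau> + y $ i)" by (simp add: k_def)
    qed
    then show ?thesis using integral_lborel_translate[OF km] kval by simp
  qed
  have "(\<integral>x. indicator \<Omega> x * f' x e \<partial>lborel)
     = (\<integral>y. indicator {y. 0 \<le> y \<bullet> e \<and> y \<bullet> e \<le> 1} y * (f (r *\<^sub>R e) - f (l *\<^sub>R e)) \<partial>lborel)"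
    using slab_integral(2)[OF e Ki] unfolding inner .
  \<comment> \<open>With one coordinate the slab is the unit cube, of volume one.\<close>
  also have "{y. 0 \<le> y \<bullet> e \<and> y \<bullet> e \<le> 1} = cbox 0 (1::real^'n)"
  proof -
    have "(0 \<le> y $ j \<and> y $ j \<le> 1) = (0 \<le> y $ i \<and> y $ i \<le> 1)" for j and y :: "real^'n"
    proof -
      have "j = i" by (rule one)
      then show ?thesis by simp
    qed
    then show ?thesis unfolding set_eq_iff mem_box_cart mem_Collect_eq ye zero_index one_index by blast
  qed
  also have "(\<integral>y. indicator (cbox 0 (1::real^'n)) y * (f (r *\<^sub>R e) - f (l *\<^sub>R e)) \<partial>lborel) = f (r *\<^sub>R e) - f (l *\<^sub>R e)"
  proof -
    have "measure lborel (cbox 0 (1::real^'n)) = 1" by (subst content_cbox) (auto simp: Basis_vec_def inner_axis intro!: prod.neutral)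
    then show ?thesis by simp
  qed
  finally show ?thesis by (simp add: L R e_def)
qed

subsection \<open>Hoelder spaces\<close>

text \<open>All norms are such suprema. Boundedness, supplied by the membership predicates, is what
  makes a supremum an upper bound; the inserted 0 makes it nonnegative even for an empty index
  set.\<close>

lemma Sup_insert_0:
  fixes A :: "real set"
  assumes "bdd_above A"
  shows "0 \<le> Sup (insert 0 A)" "a \<in> A \<Longrightarrow> a \<le> Sup (insert 0 A)"
  using assms by (auto intro!: cSup_upper)

lemma Sup_insert_0_le:
  fixes A :: "real set"
  assumes "0 \<le> C" "\<And>a. a \<in> A \<Longrightarrow> a \<le> C"
  shows "Sup (insert 0 A) \<le> C"
  by (rule cSup_least) (use assms in auto)

lemma sup_norm_bounds:
  assumes "\<exists>B. \<forall>x\<in>S. \<bar>f x\<bar> \<le> B"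
  shows "0 \<le> sup_norm S f" "x \<in> S \<Longrightarrow> \<bar>f x\<bar> \<le> sup_norm S f"
proof -
  have "bdd_above ((\<lambda>x. \<bar>f x\<bar>) ` S)" using assms by (auto simp: bdd_above_def)
  then show "0 \<le> sup_norm S f" "x \<in> S \<Longrightarrow> \<bar>f x\<bar> \<le> sup_norm S f"
    unfolding sup_norm_def using Sup_insert_0 by auto
qed

lemma sup_norm_le: "0 \<le> C \<Longrightarrow> (\<And>x. x \<in> S \<Longrightarrow> \<bar>f x\<bar> \<le> C) \<Longrightarrow> sup_norm S f \<le> C"
  unfolding sup_norm_def by (rule Sup_insert_0_le) auto

lemma holder_seminorm_bounds:
  assumes "holder_on \<beta> S f"
  shows "0 \<le> holder_seminorm \<beta> S f"
    "x \<in> S \<Longrightarrow> y \<in> S \<Longrightarrow> \<bar>f x - f y\<bar> \<le> holder_seminorm \<beta> S f * dist x y powr \<beta>"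
proof -
  let ?A = "{\<bar>f x - f y\<bar> / dist x y powr \<beta> | x y. x \<in> S \<and> y \<in> S \<and> x \<noteq> y}"
  obtain C where C: "\<And>x y. x \<in> S \<Longrightarrow> y \<in> S \<Longrightarrow> \<bar>f x - f y\<bar> \<le> C * dist x y powr \<beta>"
    using assms by (auto simp: holder_on_def)
  have "a \<le> C" if "a \<in> ?A" for a
    using that C by (auto simp: divide_le_eq)
  then have bdd: "bdd_above ?A" by (rule bdd_aboveI)
  show "0 \<le> holder_seminorm \<beta> S f" unfolding holder_seminorm_def by (rule Sup_insert_0(1)[OF bdd])
  show "\<bar>f x - f y\<bar> \<le> holder_seminorm \<beta> S f * dist x y powr \<beta>" if "x \<in> S" "y \<in> S"
  proof (cases "x = y")
    case False
    then have "\<bar>f x - f y\<bar> / dist x y powr \<beta> \<le> holder_seminorm \<beta> S f"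
      unfolding holder_seminorm_def by (intro Sup_insert_0(2)[OF bdd]) (use that in blast)
    then show ?thesis using False by (simp add: divide_le_eq)
  qed simp
qed

lemma holder_seminorm_le:
  assumes "0 \<le> C" "\<And>x y. x \<in> S \<Longrightarrow> y \<in> S \<Longrightarrow> \<bar>f x - f y\<bar> \<le> C * dist x y powr \<beta>"
  shows "holder_seminorm \<beta> S f \<le> C"
  unfolding holder_seminorm_def by (rule Sup_insert_0_le) (use assms in \<open>auto simp: divide_le_eq\<close>)

lemma time_seminorm_bounds:
  assumes "time_holder \<beta> S T v"
  shows "0 \<le> time_seminorm \<beta> S T v"
    "x \<in> S \<Longrightarrow> t \<in> {0..T} \<Longrightarrow> s \<in> {0..T} \<Longrightarrow> \<bar>v x t - v x s\<bar> \<le> time_seminorm \<beta> S T v * \<bar>t - s\<bar> powr \<beta>"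
proof -
  let ?A = "{\<bar>v x t - v x s\<bar> / \<bar>t - s\<bar> powr \<beta> | x t s. x \<in> S \<and> t \<in> {0..T} \<and> s \<in> {0..T} \<and> t \<noteq> s}"
  obtain C where C: "\<And>x t s. x \<in> S \<Longrightarrow> t \<in> {0..T} \<Longrightarrow> s \<in> {0..T} \<Longrightarrow> \<bar>v x t - v x s\<bar> \<le> C * \<bar>t - s\<bar> powr \<beta>"
    using assms unfolding time_holder_def by blast
  have "a \<le> C" if "a \<in> ?A" for a
  proof -
    obtain x t s where "a = \<bar>v x t - v x s\<bar> / \<bar>t - s\<bar> powr \<beta>" "x \<in> S" "t \<in> {0..T}" "s \<in> {0..T}" "t \<noteq> s"
      using \<open>a \<in> ?A\<close> by blast
    then show ?thesis using C[of x t s] by (simp add: divide_le_eq)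
  qed
  then have bdd: "bdd_above ?A" by (rule bdd_aboveI)
  show "0 \<le> time_seminorm \<beta> S T v" unfolding time_seminorm_def by (rule Sup_insert_0(1)[OF bdd])
  show "\<bar>v x t - v x s\<bar> \<le> time_seminorm \<beta> S T v * \<bar>t - s\<bar> powr \<beta>" if "x \<in> S" "t \<in> {0..T}" "s \<in> {0..T}"
  proof (cases "t = s")
    case False
    then have "\<bar>v x t - v x s\<bar> / \<bar>t - s\<bar> powr \<beta> \<le> time_seminorm \<beta> S T v"
      unfolding time_seminorm_def by (intro Sup_insert_0(2)[OF bdd]) (use that in blast)
    then show ?thesis using False by (simp add: divide_le_eq)
  qed simp
qed

section \<open>Multi-indices and derivatives extended to the closure\<close>

text \<open>Ensures that the sums over multi-indices in the norms are genuine; a sum over an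
  infinite set would be 0 by convention.\<close>

lemma finite_multisets_size_le: "finite {\<beta> :: 'n::finite multiset. size \<beta> \<le> l}"
proof -
  have "{\<beta> :: 'n multiset. size \<beta> \<le> l} \<subseteq> mset ` {xs. set xs \<subseteq> UNIV \<and> length xs \<le> l}"
  proof
    fix \<beta> :: "'n multiset" assume "\<beta> \<in> {\<beta>. size \<beta> \<le> l}"
    moreover obtain xs where "mset xs = \<beta>" using ex_mset by blast
    ultimately show "\<beta> \<in> mset ` {xs. set xs \<subseteq> UNIV \<and> length xs \<le> l}" by auto
  qed
  then show ?thesis by (rule finite_subset) (intro finite_imageI finite_lists_length_le finite)
qed

lemma D_multi_list: "\<exists>is. mset is = \<beta> \<and> length is = size \<beta> \<and> D_multi p \<beta> = foldr p is"
proof -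
  have "mset (SOME is. mset is = \<beta>) = \<beta>" by (rule someI_ex) (rule ex_mset)
  then show ?thesis by (intro exI[of _ "SOME is. mset is = \<beta>"]) (auto simp: D_multi_def fun_eq_iff dest: arg_cong[of _ _ size])
qed

lemma D_multi_empty: "D_multi p {#} f = f"
  using D_multi_list[of "{#}" p] by auto

lemma D_multi_single: "D_multi p {#i#} f = p i f"
  using D_multi_list[of "{#i#}" p] by auto

text \<open>The enumeration of a multi-index is an arbitrary choice, so either order of
  differentiation may be the selected one. Symmetry of second derivatives removes the ambiguity
  later.\<close>

lemma D_multi_pair: "(\<forall>f. D_multi p {#i, j#} f = p i (p j f)) \<or> (\<forall>f. D_multi p {#i, j#} f = p j (p i f))"
proof -
  obtain "is" where i: "mset is = {#i, j#}" "length is = size {#i, j#}" "D_multi p {#i, j#} = foldr p is"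
    using D_multi_list[of "{#i, j#}" p] by blast
  then obtain a b where ab: "is = [a, b]" by (auto simp: length_Suc_conv numeral_2_eq_2)
  have "{#a, b#} = {#i, j#}" using i(1) by (simp add: ab)
  then have "a = i \<and> b = j \<or> a = j \<and> b = i" by (auto simp: add_eq_conv_ex)
  then show ?thesis using i(3) ab by auto
qed

lemma pd_cong:
  assumes "open \<Omega>" "x \<in> \<Omega>" "\<And>y. y \<in> \<Omega> \<Longrightarrow> f y = g y"
  shows "pd i f x = pd i g x"
proof -
  have "(f has_derivative D) (at x) \<longleftrightarrow> (g has_derivative D) (at x)" for D
    using has_derivative_transform_within_open[of f D x UNIV \<Omega> g] has_derivative_transform_within_open[of g D x UNIV \<Omega> f] assms
    by auto
  then show ?thesis unfolding pd_def frechet_derivative_def by simp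
qed

lemma pd_eqI: "(f has_derivative D) (at x) \<Longrightarrow> pd i f x = D (axis i 1)"
  unfolding pd_def using frechet_derivative_at by metis

lemma pd_diff:
  assumes "f differentiable (at x)" "g differentiable (at x)"
  shows "pd i (\<lambda>y. f y - g y) x = pd i f x - pd i g x"
proof -
  have "((\<lambda>y. f y - g y) has_derivative (\<lambda>w. grad f x \<bullet> w - grad g x \<bullet> w)) (at x)"
    by (intro has_derivative_diff frechet_derivative_eq_grad assms)
  from pd_eqI[OF this] show ?thesis by (simp add: inner_axis grad_def)
qed

lemma foldr_pd_diff:
  assumes \<Omega>: "open \<Omega>" and f: "in_Cl \<Omega> l \<alpha> f" and g: "in_Cl \<Omega> l \<alpha> g"
  shows "length is \<le> l \<Longrightarrow> x \<in> \<Omega> \<Longrightarrow> foldr pd is (\<lambda>y. f y - g y) x = foldr pd is f x - foldr pd is g x"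
proof (induction "is" arbitrary: x)
  case (Cons i "is")
  have d: "foldr pd is f differentiable (at x)" "foldr pd is g differentiable (at x)"
    using f g Cons.prems unfolding in_Cl_def by auto
  have "foldr pd (i # is) (\<lambda>y. f y - g y) x = pd i (\<lambda>y. foldr pd is f y - foldr pd is g y) x"
    using Cons by (auto intro!: pd_cong[OF \<Omega>])
  then show ?case using pd_diff[OF d] by simp
qed simp

text \<open>A closure point outside the domain is a limit point of it, so the limit in
  \<open>cl_ext\<close> is unique and, by continuity of the extension, attained.\<close>

lemma cl_ext_tendsto:
  assumes "open \<Omega>" "continuous_on (closure \<Omega>) (cl_ext \<Omega> f)" "x \<in> closure \<Omega>" "x \<notin> \<Omega>"
  shows "(f \<longlongrightarrow> cl_ext \<Omega> f x) (at x within \<Omega>)" "at x within \<Omega> \<noteq> bot"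
proof -
  show "at x within \<Omega> \<noteq> bot"
    using assms(3,4) by (auto simp: trivial_limit_within closure_def)
  have "(cl_ext \<Omega> f \<longlongrightarrow> cl_ext \<Omega> f x) (at x within closure \<Omega>)"
    using assms(2,3) by (auto simp: continuous_on_def)
  then have "(cl_ext \<Omega> f \<longlongrightarrow> cl_ext \<Omega> f x) (at x within \<Omega>)"
    by (rule tendsto_within_subset) (rule closure_subset)
  then show "(f \<longlongrightarrow> cl_ext \<Omega> f x) (at x within \<Omega>)"
    by (rule Lim_transform_eventually) (auto simp: eventually_at_filter cl_ext_inside)
qed

lemma cl_ext_diff:
  assumes "open \<Omega>" "continuous_on (closure \<Omega>) (cl_ext \<Omega> f)" "continuous_on (closure \<Omega>) (cl_ext \<Omega> g)" "x \<in> closure \<Omega>"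
    and k: "\<And>y. y \<in> \<Omega> \<Longrightarrow> k y = f y - g y"
  shows "cl_ext \<Omega> k x = cl_ext \<Omega> f x - cl_ext \<Omega> g x"
proof (cases "x \<in> \<Omega>")
  case False
  note F = cl_ext_tendsto[OF assms(1,2,4) False] and G = cl_ext_tendsto[OF assms(1,3,4) False]
  have "((\<lambda>y. f y - g y) \<longlongrightarrow> cl_ext \<Omega> f x - cl_ext \<Omega> g x) (at x within \<Omega>)"
    by (intro tendsto_diff F(1) G(1))
  then have "(k \<longlongrightarrow> cl_ext \<Omega> f x - cl_ext \<Omega> g x) (at x within \<Omega>)"
    by (rule Lim_transform_eventually) (auto simp: eventually_at_filter k)
  from tendsto_Lim[OF F(2) this] show ?thesis using False by (simp add: cl_ext_def)
qed (simp add: cl_ext_inside k)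

lemma cl_ext_continuous:
  assumes "open \<Omega>" "continuous_on (closure \<Omega>) f" "x \<in> closure \<Omega>"
  shows "cl_ext \<Omega> f x = f x"
proof (cases "x \<in> \<Omega>")
  case False
  then have nb: "at x within \<Omega> \<noteq> bot"
    using assms(3) by (auto simp: trivial_limit_within closure_def)
  have "(f \<longlongrightarrow> f x) (at x within closure \<Omega>)"
    using assms(2,3) by (auto simp: continuous_on_def)
  then have "(f \<longlongrightarrow> f x) (at x within \<Omega>)"
    by (rule tendsto_within_subset) (rule closure_subset)
  from tendsto_Lim[OF nb this] show ?thesis using False by (simp add: cl_ext_def)
qed (simp add: cl_ext_inside)

text \<open>Continuity in time is stated through the norm of a difference of slices. That norm
  yields bounds only when the difference belongs to the space, and derivatives and extensions are
  additive only where they exist.\<close>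

lemma in_Cl_diff:
  assumes \<Omega>: "open \<Omega>" and f: "in_Cl \<Omega> l \<alpha> f" and g: "in_Cl \<Omega> l \<alpha> g"
  shows "in_Cl \<Omega> l \<alpha> (\<lambda>y. f y - g y)"
proof -
  have ext: "cl_ext \<Omega> (foldr pd is (\<lambda>y. f y - g y)) x = cl_ext \<Omega> (foldr pd is f) x - cl_ext \<Omega> (foldr pd is g) x"
    if "length is \<le> l" "x \<in> closure \<Omega>" for "is" x
    using in_Cl_foldr_continuous(1)[OF f that(1)] in_Cl_foldr_continuous(1)[OF g that(1)] that foldr_pd_diff[OF \<Omega> f g that(1)]
    by (intro cl_ext_diff[OF \<Omega>]) auto
  have 1: "continuous_on (closure \<Omega>) (\<lambda>y. f y - g y)"
    using f g by (auto simp: in_Cl_def intro!: continuous_intros)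
  have 2: "foldr pd is (\<lambda>y. f y - g y) differentiable (at x)" if "length is < l" "x \<in> \<Omega>" for "is" x
  proof -
    have "foldr pd is f differentiable (at x)" "foldr pd is g differentiable (at x)"
      using f g that unfolding in_Cl_def by auto
    then have "(\<lambda>y. foldr pd is f y - foldr pd is g y) differentiable (at x)" by (rule differentiable_diff)
    then obtain D where "((\<lambda>y. foldr pd is f y - foldr pd is g y) has_derivative D) (at x)" by (auto simp: differentiable_def)
    then have "(foldr pd is (\<lambda>y. f y - g y) has_derivative D) (at x)"
      by (rule has_derivative_transform_within_open[OF _ \<Omega> that(2)])
         (use foldr_pd_diff[OF \<Omega> f g, of "is"] that in auto)
    then show ?thesis by (auto simp: differentiable_def)
  qed
  have 3: "continuous_on (closure \<Omega>) (cl_ext \<Omega> (foldr pd is (\<lambda>y. f y - g y)))"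
    if "length is \<le> l" for "is"
    by (rule continuous_on_eq[OF continuous_on_diff[OF in_Cl_foldr_continuous(1)[OF f that] in_Cl_foldr_continuous(1)[OF g that]]])
       (simp add: ext that)
  have 4: "bounded (cl_ext \<Omega> (foldr pd is (\<lambda>y. f y - g y)) ` closure \<Omega>)" if le: "length is \<le> l" for "is"
  proof -
    obtain A where A: "\<And>x. x \<in> closure \<Omega> \<Longrightarrow> \<bar>cl_ext \<Omega> (foldr pd is f) x\<bar> \<le> A"
      using in_Cl_foldr_continuous(3)[OF f le] by blast
    obtain B where B: "\<And>x. x \<in> closure \<Omega> \<Longrightarrow> \<bar>cl_ext \<Omega> (foldr pd is g) x\<bar> \<le> B"
      using in_Cl_foldr_continuous(3)[OF g le] by blast
    have "\<bar>cl_ext \<Omega> (foldr pd is (\<lambda>y. f y - g y)) x\<bar> \<le> A + B" if "x \<in> closure \<Omega>" for x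
      using A[OF that] B[OF that] ext[OF le that] by linarith
    then show ?thesis by (intro boundedI[where B = "A + B"]) auto
  qed
  have 5: "holder_on \<alpha> (closure \<Omega>) (cl_ext \<Omega> (foldr pd is (\<lambda>y. f y - g y)))" if eq: "length is = l" for "is"
  proof -
    have le: "length is \<le> l" using eq by simp
    obtain A where A: "\<And>x y. x \<in> closure \<Omega> \<Longrightarrow> y \<in> closure \<Omega> \<Longrightarrow>
        \<bar>cl_ext \<Omega> (foldr pd is f) x - cl_ext \<Omega> (foldr pd is f) y\<bar> \<le> A * dist x y powr \<alpha>"
      using f eq unfolding in_Cl_def holder_on_def by blast
    obtain B where B: "\<And>x y. x \<in> closure \<Omega> \<Longrightarrow> y \<in> closure \<Omega> \<Longrightarrow>
        \<bar>cl_ext \<Omega> (foldr pd is g) x - cl_ext \<Omega> (foldr pd is g) y\<bar> \<le> B * dist x y powr \<alpha>"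
      using g eq unfolding in_Cl_def holder_on_def by blast
    have "\<bar>cl_ext \<Omega> (foldr pd is (\<lambda>y. f y - g y)) x - cl_ext \<Omega> (foldr pd is (\<lambda>y. f y - g y)) y\<bar>
        \<le> (A + B) * dist x y powr \<alpha>" if "x \<in> closure \<Omega>" "y \<in> closure \<Omega>" for x y
      using A[OF that] B[OF that] unfolding ext[OF le that(1)] ext[OF le that(2)] distrib_right by linarith
    then show ?thesis unfolding holder_on_def by blast
  qed
  show ?thesis unfolding in_Cl_def using 1 2 3 4 5 by blast
qed

lemma D_cl_bounds:
  assumes "in_Cl \<Omega> l \<alpha> f"
  shows "size \<beta> \<le> l \<Longrightarrow> \<exists>B. \<forall>x\<in>closure \<Omega>. \<bar>D_cl \<Omega> \<beta> f x\<bar> \<le> B"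
    "size \<beta> = l \<Longrightarrow> holder_on \<alpha> (closure \<Omega>) (D_cl \<Omega> \<beta> f)"
proof -
  obtain "is" where i: "length is = size \<beta>" "D_multi pd \<beta> = foldr pd is"
    using D_multi_list[of \<beta> pd] by blast
  have D: "D_cl \<Omega> \<beta> f = cl_ext \<Omega> (foldr pd is f)" unfolding D_cl_def i(2) by (rule refl)
  show "\<exists>B. \<forall>x\<in>closure \<Omega>. \<bar>D_cl \<Omega> \<beta> f x\<bar> \<le> B" if "size \<beta> \<le> l"
    unfolding D by (rule in_Cl_foldr_continuous(3)[OF assms]) (use that i in simp)
  show "holder_on \<alpha> (closure \<Omega>) (D_cl \<Omega> \<beta> f)" if "size \<beta> = l"
    unfolding D using assms that i unfolding in_Cl_def by simp
qed

lemma norm_Cl_bounds: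
  assumes "in_Cl \<Omega> l \<alpha> f"
  shows "0 \<le> norm_Cl \<Omega> l \<alpha> f"
    "size \<beta> \<le> l \<Longrightarrow> x \<in> closure \<Omega> \<Longrightarrow> \<bar>D_cl \<Omega> \<beta> f x\<bar> \<le> norm_Cl \<Omega> l \<alpha> f"
proof -
  have a: "0 \<le> sup_norm (closure \<Omega>) (D_cl \<Omega> \<beta> f)" if "size \<beta> \<le> l" for \<beta>
    by (rule sup_norm_bounds(1)[OF D_cl_bounds(1)[OF assms that]])
  have b: "0 \<le> holder_seminorm \<alpha> (closure \<Omega>) (D_cl \<Omega> \<beta> f)" if "size \<beta> = l" for \<beta>
    by (rule holder_seminorm_bounds(1)[OF D_cl_bounds(2)[OF assms that]])
  have sb: "0 \<le> (\<Sum>\<beta> | size \<beta> = l. holder_seminorm \<alpha> (closure \<Omega>) (D_cl \<Omega> \<beta> f))"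
    by (rule sum_nonneg) (use b in simp)
  have "0 \<le> (\<Sum>\<beta> | size \<beta> \<le> l. sup_norm (closure \<Omega>) (D_cl \<Omega> \<beta> f))"
    by (rule sum_nonneg) (use a in simp)
  with sb show "0 \<le> norm_Cl \<Omega> l \<alpha> f" unfolding Cl_norm_def by simp
  show "\<bar>D_cl \<Omega> \<beta> f x\<bar> \<le> norm_Cl \<Omega> l \<alpha> f" if \<beta>: "size \<beta> \<le> l" and x: "x \<in> closure \<Omega>"
  proof -
    have "\<bar>D_cl \<Omega> \<beta> f x\<bar> \<le> sup_norm (closure \<Omega>) (D_cl \<Omega> \<beta> f)"
      by (rule sup_norm_bounds(2)[OF D_cl_bounds(1)[OF assms \<beta>] x])
    also have "\<dots> \<le> (\<Sum>\<beta> | size \<beta> \<le> l. sup_norm (closure \<Omega>) (D_cl \<Omega> \<beta> f))"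
      by (rule member_le_sum) (use a \<beta> finite_multisets_size_le in auto)
    finally show ?thesis using sb unfolding Cl_norm_def by simp
  qed
qed

section \<open>Families of functions depending continuously on time\<close>

abbreviation in_ct :: "(real^'n::finite) set \<Rightarrow> nat \<Rightarrow> real \<Rightarrow> real \<Rightarrow> (real^'n \<Rightarrow> real \<Rightarrow> real) \<Rightarrow> bool" where
  "in_ct \<Omega> l \<alpha> T v \<equiv> in_C_time (in_Cl \<Omega> l \<alpha>) (closure \<Omega>) (D_cl \<Omega>) l \<alpha> T v"

lemma in_ct_slice: "in_ct \<Omega> l \<alpha> T v \<Longrightarrow> t \<in> {0..T} \<Longrightarrow> in_Cl \<Omega> l \<alpha> (\<lambda>x. v x t)"
  by (simp add: in_C_time_def)

lemma D_cl_diff: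
  assumes \<Omega>: "open \<Omega>" and f: "in_Cl \<Omega> l \<alpha> f" and g: "in_Cl \<Omega> l \<alpha> g" and "size \<beta> \<le> l" "x \<in> closure \<Omega>"
  shows "D_cl \<Omega> \<beta> (\<lambda>y. f y - g y) x = D_cl \<Omega> \<beta> f x - D_cl \<Omega> \<beta> g x"
proof -
  obtain "is" where i: "length is = size \<beta>" "D_multi pd \<beta> = foldr pd is"
    using D_multi_list[of \<beta> pd] by blast
  have le: "length is \<le> l" using i assms by simp
  show ?thesis unfolding D_cl_def i(2)
    by (rule cl_ext_diff[OF \<Omega> in_Cl_foldr_continuous(1)[OF f le] in_Cl_foldr_continuous(1)[OF g le] assms(5)])
       (rule foldr_pd_diff[OF \<Omega> f g le])
qed

text \<open>The norm of the difference of two slices dominates each of its derivatives at every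
  closure point, so continuity into the normed space gives continuity in time uniform in
  \<open>x\<close>.\<close>

lemma in_ct_uniform:
  fixes \<Omega> :: "(real^'n::finite) set"
  assumes \<Omega>: "open \<Omega>" and v: "in_ct \<Omega> l \<alpha> T v" and t0: "t0 \<in> {0..T}" and e: "0 < e"
  shows "\<exists>d>0. \<forall>t\<in>{0..T}. \<bar>t - t0\<bar> < d \<longrightarrow> (\<forall>\<beta>. size \<beta> \<le> l \<longrightarrow> (\<forall>x\<in>closure \<Omega>.
     \<bar>D_cl \<Omega> \<beta> (\<lambda>y. v y t) x - D_cl \<Omega> \<beta> (\<lambda>y. v y t0) x\<bar> < e))"
proof -
  have "((\<lambda>t. norm_Cl \<Omega> l \<alpha> (\<lambda>x. v x t - v x t0)) \<longlongrightarrow> 0) (at t0 within {0..T})"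
    using v t0 by (simp add: in_C_time_def)
  then have "\<forall>\<^sub>F t in at t0 within {0..T}. dist (norm_Cl \<Omega> l \<alpha> (\<lambda>x. v x t - v x t0)) 0 < e"
    using e by (rule tendstoD)
  then obtain d where d: "0 < d" "\<And>t. t \<in> {0..T} \<Longrightarrow> t \<noteq> t0 \<Longrightarrow> dist t t0 < d \<Longrightarrow> dist (norm_Cl \<Omega> l \<alpha> (\<lambda>x. v x t - v x t0)) 0 < e"
    unfolding eventually_at by blast
  show ?thesis
  proof (intro exI[of _ d] conjI ballI impI allI d(1))
    fix t and \<beta> :: "'n multiset" and x assume t: "t \<in> {0..T}" "\<bar>t - t0\<bar> < d" and \<beta>: "size \<beta> \<le> l" and x: "x \<in> closure \<Omega>"
    show "\<bar>D_cl \<Omega> \<beta> (\<lambda>y. v y t) x - D_cl \<Omega> \<beta> (\<lambda>y. v y t0) x\<bar> < e"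
    proof (cases "t = t0")
      case False
      note s = in_ct_slice[OF v t(1)] in_ct_slice[OF v t0]
      have "\<bar>D_cl \<Omega> \<beta> (\<lambda>y. v y t) x - D_cl \<Omega> \<beta> (\<lambda>y. v y t0) x\<bar> = \<bar>D_cl \<Omega> \<beta> (\<lambda>y. v y t - v y t0) x\<bar>"
        by (simp add: D_cl_diff[OF \<Omega> s \<beta> x])
      also have "\<dots> \<le> norm_Cl \<Omega> l \<alpha> (\<lambda>x. v x t - v x t0)"
        by (rule norm_Cl_bounds(2)[OF in_Cl_diff[OF \<Omega> s] \<beta> x])
      also have "\<dots> < e" using d(2)[OF t(1) False] t(2) by (simp add: dist_real_def)
      finally show ?thesis .
    qed (use e in simp)
  qed
qed

lemma in_ct_continuous:
  assumes \<Omega>: "open \<Omega>" and v: "in_ct \<Omega> l \<alpha> T v" and \<beta>: "size \<beta> \<le> l" and x: "x \<in> closure \<Omega>"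
  shows "continuous_on {0..T} (\<lambda>t. D_cl \<Omega> \<beta> (\<lambda>y. v y t) x)"
  unfolding continuous_on_iff
proof (intro ballI allI impI)
  fix t0 e :: real assume t0: "t0 \<in> {0..T}" and e: "0 < e"
  obtain d where "0 < d" "\<And>t. t \<in> {0..T} \<Longrightarrow> \<bar>t - t0\<bar> < d \<Longrightarrow>
     \<bar>D_cl \<Omega> \<beta> (\<lambda>y. v y t) x - D_cl \<Omega> \<beta> (\<lambda>y. v y t0) x\<bar> < e"
    using in_ct_uniform[OF \<Omega> v t0 e] \<beta> x by blast
  then show "\<exists>d>0. \<forall>t\<in>{0..T}. dist t t0 < d \<longrightarrow>
     dist (D_cl \<Omega> \<beta> (\<lambda>y. v y t) x) (D_cl \<Omega> \<beta> (\<lambda>y. v y t0) x) < e"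
    by (auto simp: dist_real_def)
qed

lemma D_cl_empty: "D_cl \<Omega> {#} f = cl_ext \<Omega> f"
  by (simp add: D_cl_def D_multi_empty)

lemma D_cl_empty_in_Cl:
  assumes "open \<Omega>" "in_Cl \<Omega> l \<alpha> f" "x \<in> closure \<Omega>"
  shows "D_cl \<Omega> {#} f x = f x"
  unfolding D_cl_empty by (rule cl_ext_continuous[OF assms(1) in_Cl_continuous[OF assms(2)] assms(3)])

lemma in_ct_continuous_time:
  assumes \<Omega>: "open \<Omega>" and v: "in_ct \<Omega> l \<alpha> T v" and x: "x \<in> closure \<Omega>"
  shows "continuous_on {0..T} (v x)"
  by (rule continuous_on_eq[OF in_ct_continuous[OF \<Omega> v, of "{#}"]])
     (use D_cl_empty_in_Cl[OF \<Omega> in_ct_slice[OF v] x] x in auto)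

text \<open>Uniformity in \<open>x\<close> of the time continuity, together with spatial continuity
  of the single slice at \<open>t0\<close>; each accounts for half of \<open>e\<close>.\<close>

lemma in_ct_continuous_joint:
  assumes \<Omega>: "open \<Omega>" and v: "in_ct \<Omega> l \<alpha> T v"
  shows "continuous_on (closure \<Omega> \<times> {0..T}) (\<lambda>(x, t). v x t)"
  unfolding continuous_on_iff
proof (intro ballI allI impI)
  fix p0 and e :: real assume p0: "p0 \<in> closure \<Omega> \<times> {0..T}" and e: "0 < e"
  obtain x0 t0 where p: "p0 = (x0, t0)" "x0 \<in> closure \<Omega>" "t0 \<in> {0..T}" using p0 by auto
  obtain d where d: "0 < d" "\<And>t x. t \<in> {0..T} \<Longrightarrow> \<bar>t - t0\<bar> < d \<Longrightarrow> x \<in> closure \<Omega> \<Longrightarrow>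
     \<bar>D_cl \<Omega> {#} (\<lambda>y. v y t) x - D_cl \<Omega> {#} (\<lambda>y. v y t0) x\<bar> < e / 2"
    using in_ct_uniform[OF \<Omega> v p(3), of "e/2"] e by (metis half_gt_zero size_empty zero_le)
  have "continuous_on (closure \<Omega>) (\<lambda>x. v x t0)" by (rule in_Cl_continuous[OF in_ct_slice[OF v p(3)]])
  then obtain d' where d': "0 < d'" "\<And>x. x \<in> closure \<Omega> \<Longrightarrow> dist x x0 < d' \<Longrightarrow> dist (v x t0) (v x0 t0) < e / 2"
    using p(2) e unfolding continuous_on_iff by (metis half_gt_zero)
  show "\<exists>d>0. \<forall>q\<in>closure \<Omega> \<times> {0..T}. dist q p0 < d \<longrightarrow> dist (case q of (x, t) \<Rightarrow> v x t) (case p0 of (x, t) \<Rightarrow> v x t) < e"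
  proof (intro exI[of _ "min d d'"] conjI ballI impI)
    fix q assume q: "q \<in> closure \<Omega> \<times> {0..T}" "dist q p0 < min d d'"
    obtain x t where q': "q = (x, t)" "x \<in> closure \<Omega>" "t \<in> {0..T}" using q by auto
    have "dist x x0 \<le> dist q p0" "dist t t0 \<le> dist q p0"
      using dist_fst_le[of q p0] dist_snd_le[of q p0] by (simp_all add: q' p)
    then have xt: "dist x x0 < d'" "\<bar>t - t0\<bar> < d" using q(2) by (auto simp: dist_real_def)
    have "\<bar>v x t - v x t0\<bar> < e / 2"
      using d(2)[OF q'(3) xt(2) q'(2)] D_cl_empty_in_Cl[OF \<Omega> in_ct_slice[OF v] q'(2)] q'(3) p(3) by simp
    moreover have "\<bar>v x t0 - v x0 t0\<bar> < e / 2" using d'(2)[OF q'(2) xt(1)] by (simp add: dist_real_def)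
    ultimately show "dist (case q of (x, t) \<Rightarrow> v x t) (case p0 of (x, t) \<Rightarrow> v x t) < e"
      unfolding q' p prod.case dist_real_def by linarith
  qed (use d d' in auto)
qed

subsection \<open>The equation at the initial time\<close>

lemma has_real_derivative_line_pd:
  assumes "f differentiable (at (z + s *\<^sub>R axis i 1))"
  shows "((\<lambda>s. f (z + s *\<^sub>R axis i 1)) has_real_derivative pd i f (z + s *\<^sub>R axis i 1)) (at s)"
proof -
  have "((\<lambda>s. z + s *\<^sub>R axis i 1) has_derivative (\<lambda>t. t *\<^sub>R axis i (1::real))) (at s)"
    by (auto intro!: derivative_eq_intros)
  from has_derivative_compose[OF this frechet_derivative_eq_grad[OF assms]]
  have "((\<lambda>s. f (z + s *\<^sub>R axis i 1)) has_derivative (\<lambda>t. grad f (z + s *\<^sub>R axis i 1) \<bullet> (t *\<^sub>R axis i 1))) (at s)" .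
  moreover have "(\<lambda>t. grad f (z + s *\<^sub>R axis i 1) \<bullet> (t *\<^sub>R axis i 1)) = (*) (pd i f (z + s *\<^sub>R axis i 1))"
    by (auto simp: fun_eq_iff inner_axis grad_def)
  ultimately show ?thesis by (simp add: has_field_derivative_def)
qed

text \<open>Mean value theorem twice: first in direction \<open>i\<close> for the increment of
  \<open>f\<close> in direction \<open>j\<close>, then in direction \<open>j\<close> for
  \<open>pd i f\<close>. The intermediate point moves at most \<open>h\<close> in each
  direction.\<close>

lemma second_difference:
  fixes f :: "real^'n::finite \<Rightarrow> real"
  assumes \<Omega>: "ball x r \<subseteq> \<Omega>" and h: "0 < h" "2 * h < r"
    and f: "\<And>y. y \<in> \<Omega> \<Longrightarrow> f differentiable (at y)" and pf: "\<And>y. y \<in> \<Omega> \<Longrightarrow> pd i f differentiable (at y)"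
  shows "\<exists>y. dist x y \<le> 2 * h \<and> f (x + h *\<^sub>R axis j 1 + h *\<^sub>R axis i 1) - f (x + h *\<^sub>R axis i 1) - f (x + h *\<^sub>R axis j 1) + f x
      = h * (h * pd j (pd i f) y)"
proof -
  have near: "x + q *\<^sub>R axis j 1 + s *\<^sub>R axis i 1 \<in> \<Omega>" "dist x (x + q *\<^sub>R axis j 1 + s *\<^sub>R axis i 1) \<le> 2 * h"
    if "0 \<le> q" "q \<le> h" "0 \<le> s" "s \<le> h" for q s
  proof -
    have "dist x (x + q *\<^sub>R axis j 1 + s *\<^sub>R axis i 1) = norm (q *\<^sub>R axis j (1::real) + s *\<^sub>R axis i 1)"
      by (subst dist_commute) (simp add: dist_norm add.assoc)
    also have "\<dots> \<le> q + s" using norm_triangle_ineq[of "q *\<^sub>R axis j (1::real)" "s *\<^sub>R axis i 1"] that by simp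
    finally show "dist x (x + q *\<^sub>R axis j 1 + s *\<^sub>R axis i 1) \<le> 2 * h" using that by linarith
    then show "x + q *\<^sub>R axis j 1 + s *\<^sub>R axis i 1 \<in> \<Omega>" using h \<Omega> by (intro subsetD[OF \<Omega>]) simp
  qed
  define g where "g s = f (x + h *\<^sub>R axis j 1 + s *\<^sub>R axis i 1) - f (x + s *\<^sub>R axis i 1)" for s
  have g': "(g has_real_derivative pd i f (x + h *\<^sub>R axis j 1 + s *\<^sub>R axis i 1) - pd i f (x + s *\<^sub>R axis i 1)) (at s)"
    if "0 \<le> s" "s \<le> h" for s
    unfolding g_def
    by (intro DERIV_diff has_real_derivative_line_pd f)
       (use near[of h s] near[of 0 s] that h in auto)
  obtain s where s: "0 < s" "s < h"
      "g h - g 0 = (h - 0) * (pd i f (x + h *\<^sub>R axis j 1 + s *\<^sub>R axis i 1) - pd i f (x + s *\<^sub>R axis i 1))"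
    using MVT2[OF h(1), of g "\<lambda>s. pd i f (x + h *\<^sub>R axis j 1 + s *\<^sub>R axis i 1) - pd i f (x + s *\<^sub>R axis i 1)"] g' by blast
  have k': "((\<lambda>q. pd i f ((x + s *\<^sub>R axis i 1) + q *\<^sub>R axis j 1)) has_real_derivative
      pd j (pd i f) ((x + s *\<^sub>R axis i 1) + q *\<^sub>R axis j 1)) (at q)" if "0 \<le> q" "q \<le> h" for q
    by (intro has_real_derivative_line_pd pf) (use near(1)[of q s] that s in \<open>simp add: add_ac\<close>)
  obtain q where q: "0 < q" "q < h"
      "pd i f ((x + s *\<^sub>R axis i 1) + h *\<^sub>R axis j 1) - pd i f ((x + s *\<^sub>R axis i 1) + 0 *\<^sub>R axis j 1)
        = (h - 0) * pd j (pd i f) ((x + s *\<^sub>R axis i 1) + q *\<^sub>R axis j 1)"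
    using MVT2[OF h(1), of "\<lambda>q. pd i f ((x + s *\<^sub>R axis i 1) + q *\<^sub>R axis j 1)"
        "\<lambda>q. pd j (pd i f) ((x + s *\<^sub>R axis i 1) + q *\<^sub>R axis j 1)"] k' by blast
  have e: "x + s *\<^sub>R axis i 1 + q *\<^sub>R axis j 1 = x + q *\<^sub>R axis j 1 + s *\<^sub>R axis i 1" for s q :: real
    by (simp add: add_ac)
  show ?thesis
  proof (intro exI[of _ "x + q *\<^sub>R axis j 1 + s *\<^sub>R axis i 1"] conjI)
    show "dist x (x + q *\<^sub>R axis j 1 + s *\<^sub>R axis i 1) \<le> 2 * h" using near(2)[of q s] s q by simp
    have "g h - g 0 = h * (h * pd j (pd i f) (x + q *\<^sub>R axis j 1 + s *\<^sub>R axis i 1))"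
      using s(3) q(3) unfolding e by simp
    then show "f (x + h *\<^sub>R axis j 1 + h *\<^sub>R axis i 1) - f (x + h *\<^sub>R axis i 1) - f (x + h *\<^sub>R axis j 1) + f x
      = h * (h * pd j (pd i f) (x + q *\<^sub>R axis j 1 + s *\<^sub>R axis i 1))" by (simp add: g_def)
  qed
qed

text \<open>The second difference is symmetric in the two directions, so both mixed derivatives
  agree at points converging to \<open>x\<close>, and continuity passes to the limit.\<close>

lemma mixed_partials:
  fixes f :: "real^'n::finite \<Rightarrow> real"
  assumes \<Omega>: "open \<Omega>" and x: "x \<in> \<Omega>" and f: "\<And>y. y \<in> \<Omega> \<Longrightarrow> f differentiable (at y)"
    and pf: "\<And>k y. y \<in> \<Omega> \<Longrightarrow> pd k f differentiable (at y)"
    and c: "\<And>k l. continuous_on \<Omega> (pd k (pd l f))"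
  shows "pd i (pd j f) x = pd j (pd i f) x"
proof -
  obtain r where r: "0 < r" "ball x r \<subseteq> \<Omega>" using \<Omega> x by (meson open_contains_ball)
  define h where "h n = r / 3 * inverse (real (Suc n))" for n
  have h: "0 < h n" "2 * h n < r" for n
  proof -
    show "0 < h n" using r by (simp add: h_def)
    have "inverse (real (Suc n)) \<le> 1" by (simp add: inverse_le_1_iff)
    then have "h n \<le> r / 3 * 1" unfolding h_def by (intro mult_left_mono) (use r in auto)
    then show "2 * h n < r" using r by simp
  qed
  have h0: "h \<longlonglongrightarrow> 0"
    unfolding h_def using tendsto_mult_right[OF LIMSEQ_inverse_real_of_nat, of "r / 3"] by (simp add: mult.commute)
  have "\<exists>y z. dist x y \<le> 2 * h n \<and> dist x z \<le> 2 * h n \<and> pd i (pd j f) y = pd j (pd i f) z" for n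
  proof -
    have sd: "\<exists>y. dist x y \<le> 2 * h n \<and> f (x + h n *\<^sub>R axis b 1 + h n *\<^sub>R axis a 1) - f (x + h n *\<^sub>R axis a 1) - f (x + h n *\<^sub>R axis b 1) + f x
      = h n * (h n * pd b (pd a f) y)" for a b
      by (rule second_difference[OF r(2) h[of n]]) (rule f pf, assumption)+
    obtain z where z: "dist x z \<le> 2 * h n" "f (x + h n *\<^sub>R axis j 1 + h n *\<^sub>R axis i 1) - f (x + h n *\<^sub>R axis i 1) - f (x + h n *\<^sub>R axis j 1) + f x
        = h n * (h n * pd j (pd i f) z)"
      using sd[where a = i and b = j] by (elim exE conjE) (rule that)
    obtain y where y: "dist x y \<le> 2 * h n" "f (x + h n *\<^sub>R axis i 1 + h n *\<^sub>R axis j 1) - f (x + h n *\<^sub>R axis j 1) - f (x + h n *\<^sub>R axis i 1) + f x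
        = h n * (h n * pd i (pd j f) y)"
      using sd[where a = j and b = i] by (elim exE conjE) (rule that)
    have e: "x + h n *\<^sub>R axis i 1 + h n *\<^sub>R axis j 1 = x + h n *\<^sub>R axis j 1 + h n *\<^sub>R axis i 1" by (simp add: add_ac)
    have "h n * (h n * pd i (pd j f) y) = h n * (h n * pd j (pd i f) z)"
      using y(2) z(2) unfolding e by linarith
    then have "pd i (pd j f) y = pd j (pd i f) z" using h(1)[of n] by simp
    then show ?thesis using y(1) z(1) by (intro exI[of _ y] exI[of _ z] conjI)
  qed
  then obtain y z where yz: "\<And>n. dist x (y n) \<le> 2 * h n" "\<And>n. dist x (z n) \<le> 2 * h n"
    "\<And>n. pd i (pd j f) (y n) = pd j (pd i f) (z n)" by metis
  have lim: "w \<longlonglongrightarrow> x" if "\<And>n. dist x (w n) \<le> 2 * h n" for w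
  proof -
    have "(\<lambda>n. 2 * h n) \<longlonglongrightarrow> 0" using tendsto_mult_left[OF h0, of 2] by simp
    then have "(\<lambda>n. dist (w n) x) \<longlonglongrightarrow> 0"
      by (rule Lim_null_comparison[rotated]) (use that in \<open>simp add: dist_commute\<close>)
    then show ?thesis by (rule iffD2[OF tendsto_dist_iff])
  qed
  have ct: "isCont (pd k (pd l f)) x" for k l
    using c[of k l] \<Omega> x by (simp add: continuous_on_eq_continuous_at)
  have yl: "y \<longlonglongrightarrow> x" and zl: "z \<longlonglongrightarrow> x" by (rule lim, rule yz)+
  have "(\<lambda>n. pd i (pd j f) (y n)) \<longlonglongrightarrow> pd i (pd j f) x"
    using isCont_tendsto_compose[OF ct yl] .
  moreover have "(\<lambda>n. pd j (pd i f) (z n)) \<longlonglongrightarrow> pd j (pd i f) x"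
    using isCont_tendsto_compose[OF ct zl] .
  ultimately show ?thesis unfolding yz(3) by (rule LIMSEQ_unique)
qed

lemma in_Cl_2:
  assumes f: "in_Cl \<Omega> 2 \<alpha> f"
  shows "x \<in> \<Omega> \<Longrightarrow> f differentiable (at x)" "x \<in> \<Omega> \<Longrightarrow> pd i f differentiable (at x)"
    "continuous_on \<Omega> (pd i (pd j f))" "\<exists>B. \<forall>x\<in>\<Omega>. \<bar>pd i (pd j f) x\<bar> \<le> B"
proof -
  show "f differentiable (at x)" if "x \<in> \<Omega>" by (rule in_Cl_differentiable[OF f _ that]) simp
  have "\<forall>is. length is < 2 \<longrightarrow> (\<forall>x\<in>\<Omega>. foldr pd is f differentiable (at x))"
    using f by (simp add: in_Cl_def)
  from spec[OF this, of "[i]"] show "pd i f differentiable (at x)" if "x \<in> \<Omega>" using that by simp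
  show "continuous_on \<Omega> (pd i (pd j f))" "\<exists>B. \<forall>x\<in>\<Omega>. \<bar>pd i (pd j f) x\<bar> \<le> B"
    using in_Cl_foldr_continuous(2,4)[OF f, of "[i, j]"] by simp_all
qed

lemma C1_closure_gradI:
  fixes g :: "real^'n::finite \<Rightarrow> real"
  assumes "continuous_on (closure \<Omega>) g" "\<And>x. x \<in> \<Omega> \<Longrightarrow> g differentiable (at x)"
    "\<And>i. continuous_on \<Omega> (pd i g)" "\<And>i. \<exists>B. \<forall>x\<in>\<Omega>. \<bar>pd i g x\<bar> \<le> B"
  shows "C1_closure \<Omega> g (\<lambda>x v. grad g x \<bullet> v)"
proof -
  obtain b where b: "\<And>i x. x \<in> \<Omega> \<Longrightarrow> \<bar>pd i g x\<bar> \<le> b i" using assms(4) by metis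
  have c: "continuous_on \<Omega> (grad g)" unfolding grad_def by (intro continuous_on_vec_lambda assms(3))
  have "\<bar>grad g x \<bullet> v\<bar> \<le> sum b UNIV * norm v" if "x \<in> \<Omega>" for x v
  proof -
    have "norm (grad g x) \<le> (\<Sum>i\<in>UNIV. \<bar>grad g x $ i\<bar>)" by (rule norm_le_l1_cart)
    also have "\<dots> \<le> sum b UNIV" by (rule sum_mono) (use b[OF that] in \<open>simp add: grad_def\<close>)
    finally have "norm (grad g x) * norm v \<le> sum b UNIV * norm v" by (rule mult_right_mono) simp
    then show ?thesis using Cauchy_Schwarz_ineq2[of "grad g x" v] by linarith
  qed
  then have "\<exists>B. \<forall>x\<in>\<Omega>. \<bar>grad g x \<bullet> v\<bar> \<le> B" for v by blast
  moreover have "continuous_on \<Omega> (\<lambda>x. grad g x \<bullet> v)" for v by (intro continuous_intros c)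
  moreover have "\<forall>x\<in>\<Omega>. (g has_derivative (\<lambda>v. grad g x \<bullet> v)) (at x)"
    using frechet_derivative_eq_grad[OF assms(2)] by blast
  ultimately show ?thesis unfolding C1_closure_def using assms(1) by blast
qed

lemma in_Cl_1_C1_closure:
  assumes g: "in_Cl \<Omega> 1 \<alpha> g"
  shows "C1_closure \<Omega> g (\<lambda>x v. grad g x \<bullet> v)"
  by (rule C1_closure_gradI[OF in_Cl_continuous[OF g] in_Cl_differentiable[OF g] in_Cl_pd(2)[OF g] in_Cl_pd(3)[OF g]])
     simp_all

text \<open>The conormal operator evaluates first derivatives on the boundary through
  \<open>cl_ext\<close>, so the flux field is built from these extensions; inside the domain their
  derivatives are those of \<open>pd j f\<close>.\<close>

lemma in_Cl_2_pd_C1_closure: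
  assumes \<Omega>: "open \<Omega>" and f: "in_Cl \<Omega> 2 \<alpha> f"
  shows "C1_closure \<Omega> (cl_ext \<Omega> (pd j f)) (\<lambda>x v. grad (cl_ext \<Omega> (pd j f)) x \<bullet> v)"
proof (rule C1_closure_gradI)
  have pdeq: "pd i (cl_ext \<Omega> (pd j f)) x = pd i (pd j f) x" if "x \<in> \<Omega>" for i x
    by (rule pd_cong[OF \<Omega> that]) (simp add: cl_ext_inside)
  show "continuous_on (closure \<Omega>) (cl_ext \<Omega> (pd j f))" by (rule in_Cl_pd(1)[OF f]) simp
  show "cl_ext \<Omega> (pd j f) differentiable (at x)" if x: "x \<in> \<Omega>" for x
  proof -
    obtain D where "(pd j f has_derivative D) (at x)" using in_Cl_2(2)[OF f x] unfolding differentiable_def by blast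
    then have "(cl_ext \<Omega> (pd j f) has_derivative D) (at x)"
      by (rule has_derivative_transform_within_open[OF _ \<Omega> x]) (simp add: cl_ext_inside)
    then show ?thesis by (auto simp: differentiable_def)
  qed
  show "continuous_on \<Omega> (pd i (cl_ext \<Omega> (pd j f)))" for i
    by (rule continuous_on_eq[OF in_Cl_2(3)[OF f]]) (simp add: pdeq)
  show "\<exists>B. \<forall>x\<in>\<Omega>. \<bar>pd i (cl_ext \<Omega> (pd j f)) x\<bar> \<le> B" for i
    using in_Cl_2(4)[OF f, of i j] pdeq by simp
qed

lemma pd_mult:
  assumes "f differentiable (at x)" "g differentiable (at x)"
  shows "pd i (\<lambda>y. f y * g y) x = f x * pd i g x + pd i f x * g x"
proof -
  have "((\<lambda>y. f y * g y) has_derivative (\<lambda>w. f x * (grad g x \<bullet> w) + (grad f x \<bullet> w) * g x)) (at x)"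
    by (intro has_derivative_mult frechet_derivative_eq_grad assms)
  from pd_eqI[OF this] show ?thesis by (simp add: inner_axis grad_def)
qed

lemma in_ct_pd_continuous:
  assumes \<Omega>: "open \<Omega>" and v: "in_ct \<Omega> l \<alpha> T v" and x: "x \<in> \<Omega>" and l: "1 \<le> l"
  shows "continuous_on {0..T} (\<lambda>t. pd i (\<lambda>y. v y t) x)"
proof -
  have "continuous_on {0..T} (\<lambda>t. D_cl \<Omega> {#i#} (\<lambda>y. v y t) x)"
    by (rule in_ct_continuous[OF \<Omega> v]) (use l x closure_subset in auto)
  then show ?thesis using x by (simp add: D_cl_def D_multi_single cl_ext_inside)
qed

text \<open>The norm controls only the order of differentiation selected by \<open>D_multi\<close>;
  \<open>mixed_partials\<close> transfers the continuity to the prescribed order.\<close>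

lemma in_ct_pd_pd_continuous:
  assumes \<Omega>: "open \<Omega>" and v: "in_ct \<Omega> 2 \<alpha> T v" and x: "x \<in> \<Omega>"
  shows "continuous_on {0..T} (\<lambda>t. pd i (pd j (\<lambda>y. v y t)) x)"
proof -
  have c1: "continuous_on {0..T} (\<lambda>t. D_cl \<Omega> {#i, j#} (\<lambda>y. v y t) x)"
    by (rule in_ct_continuous[OF \<Omega> v]) (use x closure_subset in auto)
  have eq: "D_cl \<Omega> {#i, j#} (\<lambda>y. v y t) x = pd i (pd j (\<lambda>y. v y t)) x" if "t \<in> {0..T}" for t
  proof -
    have f: "in_Cl \<Omega> 2 \<alpha> (\<lambda>y. v y t)" by (rule in_ct_slice[OF v that])
    have "pd i (pd j (\<lambda>y. v y t)) x = pd j (pd i (\<lambda>y. v y t)) x"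
      by (rule mixed_partials[OF \<Omega> x]) (use in_Cl_2[OF f] in auto)
    then show ?thesis using D_multi_pair[of pd i j] x by (auto simp: D_cl_def cl_ext_inside)
  qed
  show ?thesis by (rule continuous_on_eq[OF c1 eq])
qed

lemma div_part_expand:
  assumes "\<And>i j. (\<lambda>y. bc P i j y t) differentiable (at x)"
    and "\<And>j. pd j (\<lambda>y. u y t) differentiable (at x)"
  shows "div_part P u x t = (\<Sum>i\<in>UNIV. \<Sum>j\<in>UNIV. bc P i j x t * pd i (pd j (\<lambda>y. u y t)) x
     + pd i (\<lambda>y. bc P i j y t) x * pd j (\<lambda>y. u y t) x)"
  unfolding div_part_def by (simp add: pd_mult assms)

lemma div_part_continuous:
  assumes \<Omega>: "open (dom P)" and x: "x \<in> dom P"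
    and b: "\<And>i j. in_ct (dom P) 1 \<alpha> T (bc P i j)" and u: "in_ct (dom P) 2 \<alpha> T u"
  shows "continuous_on {0..T} (div_part P u x)"
proof -
  have xc: "x \<in> closure (dom P)" using x closure_subset by auto
  have "continuous_on {0..T} (\<lambda>t. \<Sum>i\<in>UNIV. \<Sum>j\<in>UNIV. bc P i j x t * pd i (pd j (\<lambda>y. u y t)) x
     + pd i (\<lambda>y. bc P i j y t) x * pd j (\<lambda>y. u y t) x)"
    by (intro continuous_intros in_ct_continuous_time[OF \<Omega> b xc] in_ct_pd_pd_continuous[OF \<Omega> u x]
        in_ct_pd_continuous[OF \<Omega> b x] in_ct_pd_continuous[OF \<Omega> u x]) auto
  moreover have eq: "div_part P u x t = (\<Sum>i\<in>UNIV. \<Sum>j\<in>UNIV. bc P i j x t * pd i (pd j (\<lambda>y. u y t)) x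
     + pd i (\<lambda>y. bc P i j y t) x * pd j (\<lambda>y. u y t) x)" if "t \<in> {0..T}" for t
    by (rule div_part_expand)
       (use in_Cl_differentiable[OF in_ct_slice[OF b that]] in_Cl_2(2)[OF in_ct_slice[OF u that]] x in auto)
  ultimately show ?thesis by (subst continuous_on_cong[OF refl eq])
qed

lemma set_lebesgue_continuous_on_closure:
  fixes f :: "real^'n::finite \<Rightarrow> real"
  assumes \<Omega>: "open \<Omega>" "bounded \<Omega>" and f: "continuous_on (closure \<Omega>) f"
  shows "integrable lborel (\<lambda>x. indicator \<Omega> x * f x)"
    and "(LINT x:\<Omega>|lebesgue. f x) = (\<integral>x. indicator \<Omega> x * f x \<partial>lborel)"
proof -
  have m: "(\<lambda>x. indicator \<Omega> x * f x) \<in> borel_measurable borel"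
    by (intro borel_measurable_indicator_continuous continuous_on_subset[OF f closure_subset]) (use \<Omega> in simp)
  obtain B where B: "\<And>x. x \<in> closure \<Omega> \<Longrightarrow> \<bar>f x\<bar> \<le> B" using continuous_on_closure_bounded[OF \<Omega>(2) f] by blast
  obtain R where R: "\<And>x. x \<in> \<Omega> \<Longrightarrow> norm x \<le> R" using \<Omega>(2) by (auto simp: bounded_iff)
  show "integrable lborel (\<lambda>x. indicator \<Omega> x * f x)"
  proof (rule integrable_bounded_support[OF m, where B = "\<bar>B\<bar>" and R = R])
    show "\<bar>indicator \<Omega> x * f x\<bar> \<le> \<bar>B\<bar>" for x
      using B[of x] closure_subset[of \<Omega>] by (cases "x \<in> \<Omega>") auto
    show "indicator \<Omega> x * f x = 0" if "R < norm x" for x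
      using R[of x] that by (cases "x \<in> \<Omega>") auto
  qed
  show "(LINT x:\<Omega>|lebesgue. f x) = (\<integral>x. indicator \<Omega> x * f x \<partial>lborel)"
    by (rule set_lebesgue_eq_lborel[OF m])
qed

section \<open>The total flux of the initial datum\<close>

text \<open>The divergence theorem for the field \<open>F\<close> with components the sums over
  \<open>j\<close> of \<open>bc P i j\<close> times the extended \<open>pd j (init P)\<close>. By
  the compatibility condition \<open>h6\<close> its component along the conormal is
  \<open>- phi P x 0\<close> on the boundary.\<close>

lemma initial_flux:
  fixes P :: "('n::finite) problem"
  assumes dom: "C2_domain (alpha P) (dom P)" and sm: "surface_measure (alpha P) (dom P) (surf P)"
    and b: "\<And>i j. in_Cl (dom P) 1 (alpha P) (\<lambda>x. bc P i j x 0)"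
    and u0: "in_Cl (dom P) 2 (alpha P) (init P)" and h6: "h6 P"
  shows "integrable lborel (\<lambda>x. indicator (dom P) x * div_part P (\<lambda>y s. init P y) x 0)"
    and "(\<integral>x. indicator (dom P) x * div_part P (\<lambda>y s. init P y) x 0 \<partial>lborel) = - bd_flux P 0"
proof -
  define \<Omega> where "\<Omega> = dom P"
  have \<Omega>: "open \<Omega>" "connected \<Omega>" "bounded \<Omega>" "\<Omega> \<noteq> {}" using dom by (auto simp: C2_domain_def \<Omega>_def)
  define F where "F i x = (\<Sum>j\<in>UNIV. bc P i j x 0 * cl_ext \<Omega> (pd j (init P)) x)" for i x
  define F' where "F' i x v = (\<Sum>j\<in>UNIV. bc P i j x 0 * (grad (cl_ext \<Omega> (pd j (init P))) x \<bullet> v)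
      + (grad (\<lambda>x. bc P i j x 0) x \<bullet> v) * cl_ext \<Omega> (pd j (init P)) x)" for i x v
  have FC: "C1_closure \<Omega> (F i) (F' i)" for i
    unfolding F_def F'_def
    by (intro C1_closure_sum C1_closure_mult \<Omega>(3) in_Cl_1_C1_closure in_Cl_2_pd_C1_closure \<Omega>(1) finite)
       (use b u0 in \<open>simp_all add: \<Omega>_def\<close>)
  have div: "div_part P (\<lambda>y s. init P y) x 0 = (\<Sum>i\<in>UNIV. F' i x (axis i 1))" if x: "x \<in> \<Omega>" for x
    unfolding div_part_def F'_def
  proof (intro sum.cong refl)
    fix i j
    have "((\<lambda>x. bc P i j x 0) has_derivative (\<lambda>v. grad (\<lambda>x. bc P i j x 0) x \<bullet> v)) (at x)"
      using C1_closureD(2)[OF in_Cl_1_C1_closure[OF b[of i j]]] x by (simp add: \<Omega>_def)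
    moreover have "((\<lambda>x. cl_ext \<Omega> (pd j (init P)) x) has_derivative (\<lambda>v. grad (cl_ext \<Omega> (pd j (init P))) x \<bullet> v)) (at x)"
      using C1_closureD(2)[OF in_Cl_2_pd_C1_closure[OF \<Omega>(1)], of "alpha P" "init P"] x u0 by (simp add: \<Omega>_def)
    ultimately have "((\<lambda>x. bc P i j x 0 * cl_ext \<Omega> (pd j (init P)) x) has_derivative
      (\<lambda>v. bc P i j x 0 * (grad (cl_ext \<Omega> (pd j (init P))) x \<bullet> v)
      + (grad (\<lambda>x. bc P i j x 0) x \<bullet> v) * cl_ext \<Omega> (pd j (init P)) x)) (at x)"
      by (rule has_derivative_mult)
    from pd_eqI[OF this]
    have "pd i (\<lambda>x. bc P i j x 0 * cl_ext \<Omega> (pd j (init P)) x) x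
      = bc P i j x 0 * (grad (cl_ext \<Omega> (pd j (init P))) x \<bullet> axis i 1)
      + (grad (\<lambda>x. bc P i j x 0) x \<bullet> axis i 1) * cl_ext \<Omega> (pd j (init P)) x" .
    moreover have "pd i (\<lambda>x. bc P i j x 0 * cl_ext \<Omega> (pd j (init P)) x) x
      = pd i (\<lambda>y. bc P i j y 0 * pd j (\<lambda>z. init P z) y) x"
      by (rule pd_cong[OF \<Omega>(1) x]) (simp add: cl_ext_inside)
    ultimately show "pd i (\<lambda>y. bc P i j y 0 * pd j (\<lambda>z. init P z) y) x
      = bc P i j x 0 * (grad (cl_ext \<Omega> (pd j (init P))) x \<bullet> axis i 1)
      + (grad (\<lambda>x. bc P i j x 0) x \<bullet> axis i 1) * cl_ext \<Omega> (pd j (init P)) x" by simp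
  qed
  have ind: "indicator \<Omega> x * div_part P (\<lambda>y s. init P y) x 0 = (\<Sum>i\<in>UNIV. indicator \<Omega> x * F' i x (axis i 1))" for x
    using div[of x] by (cases "x \<in> \<Omega>") auto
  have Fi: "integrable lborel (\<lambda>x. indicator \<Omega> x * F' i x (axis i 1))" for i
    by (rule C1_closure_integrable[OF FC \<Omega>(1,3)])
  show "integrable lborel (\<lambda>x. indicator (dom P) x * div_part P (\<lambda>y s. init P y) x 0)"
    unfolding \<Omega>_def[symmetric] ind by (intro Bochner_Integration.integrable_sum Fi)
  have lhs: "(\<integral>x. indicator (dom P) x * div_part P (\<lambda>y s. init P y) x 0 \<partial>lborel)
      = (\<Sum>i\<in>UNIV. \<integral>x. indicator \<Omega> x * F' i x (axis i 1) \<partial>lborel)"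
    unfolding \<Omega>_def[symmetric] ind by (intro Bochner_Integration.integral_sum Fi)
  have phi: "phi P x 0 = - (\<Sum>i\<in>UNIV. F i x * conormal (alpha P) \<Omega> x $ i)" if "x \<in> frontier \<Omega>" for x
  proof -
    have "phi P x 0 = N_op P (\<lambda>y s. init P y) x 0" using h6 that by (simp add: h6_def \<Omega>_def)
    also have "\<dots> = - (\<Sum>i\<in>UNIV. F i x * conormal (alpha P) \<Omega> x $ i)"
      by (simp add: N_op_def F_def \<Omega>_def sum_distrib_right sum_distrib_left mult_ac)
    finally show ?thesis .
  qed
  show "(\<integral>x. indicator (dom P) x * div_part P (\<lambda>y s. init P y) x 0 \<partial>lborel) = - bd_flux P 0"
  proof (cases "CARD('n) = 1")
    case True
    obtain i0 :: 'n where i0: "UNIV = {i0}" using True by (rule card_1_singletonE)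
    have s: "(\<Sum>i\<in>UNIV. f i) = f i0" for f :: "'n \<Rightarrow> real" unfolding i0 by simp
    obtain l r where fr: "left_end \<Omega> \<in> frontier \<Omega>" "right_end \<Omega> \<in> frontier \<Omega>"
      using one_dimensional_domain[OF True \<Omega>, of i0] by metis
    have "(\<integral>x. indicator (dom P) x * div_part P (\<lambda>y s. init P y) x 0 \<partial>lborel)
        = F i0 (right_end \<Omega>) - F i0 (left_end \<Omega>)"
      unfolding lhs s by (rule one_dimensional_divergence[OF True \<Omega> FC])
    also have "\<dots> = - bd_flux P 0"
      using phi[OF fr(1)] phi[OF fr(2)] True by (simp add: s conormal_def bd_flux_def \<Omega>_def)
    finally show ?thesis .
  next
    case False
    have dv: "divergence_formula (alpha P) \<Omega> (surf P) (axis i 1) (F i) (F' i)" for i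
      unfolding \<Omega>_def by (rule divergence_theorem[OF dom sm FC[unfolded \<Omega>_def]])
    have "(\<Sum>i\<in>UNIV. \<integral>x. indicator \<Omega> x * F' i x (axis i 1) \<partial>lborel)
      = (\<Sum>i\<in>UNIV. \<integral>x. indicator (frontier \<Omega>) x * (F i x * (outward_normal (alpha P) \<Omega> x \<bullet> axis i 1)) \<partial>surf P)"
      using dv by (simp add: divergence_formula_def)
    also have "\<dots> = (\<integral>x. (\<Sum>i\<in>UNIV. indicator (frontier \<Omega>) x * (F i x * (outward_normal (alpha P) \<Omega> x \<bullet> axis i 1))) \<partial>surf P)"
      using dv by (intro Bochner_Integration.integral_sum[symmetric]) (simp add: divergence_formula_def)
    also have "\<dots> = (\<integral>x. - (indicator (frontier \<Omega>) x * phi P x 0) \<partial>surf P)"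
    proof (rule Bochner_Integration.integral_cong[OF refl])
      fix x
      show "(\<Sum>i\<in>UNIV. indicator (frontier \<Omega>) x * (F i x * (outward_normal (alpha P) \<Omega> x \<bullet> axis i 1)))
        = - (indicator (frontier \<Omega>) x * phi P x 0)"
        using phi[of x] False
        by (cases "x \<in> frontier \<Omega>") (auto simp: conormal_def inner_axis)
    qed
    also have "\<dots> = - bd_flux P 0"
      using False by (simp add: bd_flux_def set_lebesgue_integral_def \<Omega>_def)
    finally show ?thesis unfolding lhs .
  qed
qed

section \<open>Terms that disappear at the initial time\<close>

lemma holder_on_continuous:
  fixes f :: "'a::metric_space \<Rightarrow> real"
  assumes f: "holder_on \<beta> S f" and \<beta>: "0 < \<beta>"
  shows "continuous_on S f"
proof -
  obtain C where C: "\<And>x y. x \<in> S \<Longrightarrow> y \<in> S \<Longrightarrow> \<bar>f x - f y\<bar> \<le> C * dist x y powr \<beta>"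
    using f by (auto simp: holder_on_def)
  show ?thesis
    unfolding continuous_on_def
  proof (intro ballI)
    fix x assume x: "x \<in> S"
    have "((\<lambda>y. dist y x powr \<beta>) \<longlongrightarrow> dist x x powr \<beta>) (at x within S)"
      by (rule tendsto_powr'[OF tendsto_dist[OF tendsto_ident_at tendsto_const] tendsto_const]) (use \<beta> in auto)
    then have "((\<lambda>y. C * dist y x powr \<beta>) \<longlongrightarrow> C * 0) (at x within S)" by (intro tendsto_mult_left) simp
    then have "((\<lambda>y. C * dist y x powr \<beta>) \<longlongrightarrow> 0) (at x within S)" by simp
    then have "((\<lambda>y. f y - f x) \<longlongrightarrow> 0) (at x within S)"
      by (rule Lim_null_comparison[rotated]) (auto simp: eventually_at_filter intro!: always_eventually C x)
    then show "(f \<longlongrightarrow> f x) (at x within S)" by (rule LIM_zero_cancel)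
  qed
qed

text \<open>On a short interval the convolution is at most a bound for \<open>L\<close> times the
  integral of the absolute kernel there, which tends to zero by dominated convergence. A singularity
  of the kernel at 0 is therefore allowed.\<close>

lemma conv_tendsto_0:
  fixes T :: real
  assumes K: "K absolutely_integrable_on {0<..<T}" and L: "continuous_on {0..T} L"
    and t: "\<And>n. 0 < t n" "\<And>n. t n < T" "t \<longlonglongrightarrow> 0"
  shows "(\<lambda>n. conv K L (t n)) \<longlonglongrightarrow> 0"
proof -
  have T: "0 < T" using t(1,2)[of 0] by simp
  have "bounded (L ` {0..T})" by (intro compact_imp_bounded compact_continuous_image L) auto
  then obtain B where B0: "\<forall>y\<in>L ` {0..T}. norm y \<le> B" unfolding bounded_iff by blast
  have B: "\<bar>L s\<bar> \<le> B" if "s \<in> {0..T}" for s using B0 that by simp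
  have Bp: "0 \<le> B" using B[of 0] T by auto
  have Ki: "integrable lebesgue (\<lambda>s. indicator {0<..<T} s * K s)"
    using K by (simp add: set_integrable_def)
  define g where "g n s = indicator {0<..t n} s * \<bar>indicator {0<..<T} s * K s\<bar>" for n s
  have gm: "g n \<in> borel_measurable lebesgue" for n
    unfolding g_def using Ki by (intro borel_measurable_times borel_measurable_indicator) auto
  have gi: "integrable lebesgue (g n)" for n
    by (rule Bochner_Integration.integrable_bound[OF Ki gm]) (auto simp: g_def indicator_def)
  \<comment> \<open>The convolution integrates over a closed interval while the kernel is integrable
    on the open one; the extra point 0 is a null set.\<close>
  have ae0: "AE s::real in lebesgue. s \<noteq> 0"
    using AE_lborel_singleton[of "0::real"] by (rule AE_completion)
  have glim: "(\<lambda>n. \<integral>s. g n s \<partial>lebesgue) \<longlonglongrightarrow> (\<integral>s. (0::real) \<partial>(lebesgue :: real measure))"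
  proof (rule integral_dominated_convergence)
    show "integrable lebesgue (\<lambda>s. \<bar>indicator {0<..<T} s * K s\<bar>)" using Ki by simp
    show "AE s in lebesgue. (\<lambda>n. g n s) \<longlonglongrightarrow> 0"
    proof (rule AE_I2)
      fix s :: real
      show "(\<lambda>n. g n s) \<longlonglongrightarrow> 0"
      proof (cases "0 < s")
        case True
        have "\<forall>\<^sub>F n in sequentially. t n < s" using order_tendstoD(2)[OF t(3) True] .
        then have "\<forall>\<^sub>F n in sequentially. g n s = 0" by eventually_elim (simp add: g_def)
        then show ?thesis by (rule tendsto_eventually)
      qed (simp add: g_def)
    qed
    show "AE s in lebesgue. norm (g n s) \<le> \<bar>indicator {0<..<T} s * K s\<bar>" for n
      by (rule AE_I2) (auto simp: g_def indicator_def)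
  qed (use gm in auto)
  have bound: "\<bar>conv K L (t n)\<bar> \<le> B * (\<integral>s. g n s \<partial>lebesgue)" for n
  proof -
    let ?f = "\<lambda>s. indicator {0..t n} s *\<^sub>R (K s * L (t n - s))"
    have "\<bar>conv K L (t n)\<bar> \<le> (\<integral>s. \<bar>?f s\<bar> \<partial>lebesgue)"
      unfolding conv_def set_lebesgue_integral_def using integral_norm_bound[of lebesgue ?f] by simp
    also have "\<dots> \<le> (\<integral>s. B * g n s \<partial>lebesgue)"
    proof (rule integral_mono_AE')
      show "integrable lebesgue (\<lambda>s. B * g n s)" using gi by simp
      show "AE s in lebesgue. \<bar>?f s\<bar> \<le> B * g n s"
        using ae0
      proof eventually_elim
        case (elim s)
        show ?case
        proof (cases "s \<in> {0..t n}")
          case True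
          then have "\<bar>L (t n - s)\<bar> \<le> B" using t(2)[of n] by (intro B) auto
          then have "\<bar>K s\<bar> * \<bar>L (t n - s)\<bar> \<le> \<bar>K s\<bar> * B" by (intro mult_left_mono) auto
          then show ?thesis using True elim t(2)[of n] by (simp add: g_def abs_mult mult.commute)
        next
          case False then show ?thesis by (auto simp: g_def)
        qed
      qed
      show "AE s in lebesgue. 0 \<le> B * g n s" using Bp by (simp add: g_def)
    qed
    finally show ?thesis by simp
  qed
  have "(\<lambda>n. B * (\<integral>s. g n s \<partial>lebesgue)) \<longlonglongrightarrow> B * 0" using glim by (intro tendsto_mult_left) simp
  then have "(\<lambda>n. B * (\<integral>s. g n s \<partial>lebesgue)) \<longlonglongrightarrow> 0" by simp
  then show ?thesis by (rule Lim_null_comparison[rotated]) (use bound in simp)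
qed

lemma conv_0: "conv K L 0 = 0"
proof -
  have "(\<lambda>s. indicator {0..0} s *\<^sub>R (K s * L (0 - s))) = (\<lambda>s. indicator {0} s * (K 0 * L 0))"
    by (auto simp: indicator_def fun_eq_iff)
  then show ?thesis by (simp add: conv_def set_lebesgue_integral_def)
qed

lemma orders_less:
  assumes "orders_ok P" "1 \<le> i" "i < j" "j \<le> M P"
  shows "orders P j < orders P i"
  using assms(3,4)
proof (induction j)
  case (Suc j)
  have step: "orders P (Suc j) < orders P j" if "i \<le> j"
    using assms(1,2) Suc.prems that by (auto simp: orders_ok_def)
  show ?case
  proof (cases "i = j")
    case False
    then have "orders P j < orders P i" using Suc by simp
    then show ?thesis using step False Suc.prems by simp
  qed (use step in simp)
qed simp

text \<open>The linear bound at 0 is what lets multiplication by a coefficient preserve growth of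
  order \<open>nu1 P\<close>, as that order is below 1.\<close>

lemma in_C1_holder_props:
  assumes f: "in_C1_holder \<nu> \<tau> f" and \<nu>: "1 < \<nu>" and \<tau>: "0 < \<tau>"
  shows "continuous_on {0..\<tau>} f" "\<exists>L\<ge>0. \<forall>s\<in>{0..\<tau>}. \<bar>f s - f 0\<bar> \<le> L * s"
proof -
  have d: "(f has_real_derivative time_deriv \<tau> f t) (at t within {0..\<tau>})" if "t \<in> {0..\<tau>}" for t
  proof -
    have "f differentiable (at t within {0..\<tau>})" using f that by (simp add: in_C1_holder_def)
    then show ?thesis
      unfolding has_real_derivative_iff_has_vector_derivative time_deriv_def by (rule iffD1[OF vector_derivative_works])
  qed
  show "continuous_on {0..\<tau>} f"
    by (rule DERIV_continuous_on[OF d])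
  have dc: "continuous_on {0..\<tau>} (time_deriv \<tau> f)"
    by (rule holder_on_continuous[of "\<nu> - 1"]) (use f \<nu> in \<open>auto simp: in_C1_holder_def\<close>)
  have "bounded (time_deriv \<tau> f ` {0..\<tau>})" by (intro compact_imp_bounded compact_continuous_image dc) auto
  then obtain B where B0: "\<forall>y\<in>time_deriv \<tau> f ` {0..\<tau>}. norm y \<le> B" unfolding bounded_iff by blast
  have B: "\<bar>time_deriv \<tau> f s\<bar> \<le> B" if "s \<in> {0..\<tau>}" for s using B0 that by simp
  have "norm (f s - f 0) \<le> B * norm (s - 0)" if "s \<in> {0..\<tau>}" for s
    by (rule field_differentiable_bound[of "{0..\<tau>}" f "time_deriv \<tau> f"]) (use d B that \<tau> in auto)
  moreover have "0 \<le> B" using B[of 0] \<tau> by auto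
  ultimately show "\<exists>L\<ge>0. \<forall>s\<in>{0..\<tau>}. \<bar>f s - f 0\<bar> \<le> L * s" by (intro exI[of _ B]) auto
qed

section \<open>A classical solution and its equation at the initial time\<close>

text \<open>Treats both operator types at once: at time 0 the whole operator reduces to
  \<open>lead_weight P\<close> times the Caputo derivative of order \<open>nu1 P\<close> of this
  function.\<close>

definition weighted :: "('n::finite) problem \<Rightarrow> (real^'n \<Rightarrow> real \<Rightarrow> real) \<Rightarrow> real^'n \<Rightarrow> real \<Rightarrow> real" where
  "weighted P u x s = (case ftype P of TypeI \<Rightarrow> u x s | TypeII \<Rightarrow> rho P 1 s * u x s)"

definition lead_weight :: "('n::finite) problem \<Rightarrow> real" where
  "lead_weight P = (case ftype P of TypeI \<Rightarrow> rho P 1 0 | TypeII \<Rightarrow> 1)"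

locale solved_problem =
  fixes P :: "('n::finite) problem" and u :: "real^'n \<Rightarrow> real \<Rightarrow> real"
  assumes hyps: "direct_hyps P" and sol: "classical_solution P u"
begin

lemma dom_props: "open (dom P)" "bounded (dom P)" "C2_domain (alpha P) (dom P)"
    "surface_measure (alpha P) (dom P) (surf P)"
  using hyps by (auto simp: direct_hyps_def setting_def C2_domain_def)

lemma T_pos: "0 < horizon P" "0 < tstar P" "tstar P < 1" "tstar P < horizon P"
  using hyps by (auto simp: direct_hyps_def setting_def)

lemma alpha_props: "0 < alpha P" "alpha P < 1"
  using hyps by (auto simp: direct_hyps_def setting_def)

lemma M_pos: "1 \<le> M P" and ord: "orders_ok P"
  using hyps by (auto simp: direct_hyps_def setting_def)

lemma nu_bounds: "i \<in> {1..M P} \<Longrightarrow> 0 < orders P i" "i \<in> {1..M P} \<Longrightarrow> orders P i < 1"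
  using ord by (auto simp: orders_ok_def)

lemma nu1_bounds: "0 < nu1 P" "nu1 P < 1"
  using nu_bounds[of 1] M_pos by auto

lemma rho_props:
  assumes "i \<in> {1..M P}"
  shows "continuous_on {0..horizon P} (rho P i)" "\<exists>L\<ge>0. \<forall>s\<in>{0..horizon P}. \<bar>rho P i s - rho P i 0\<bar> \<le> L * s"
  using in_C1_holder_props[of "rexp P" "horizon P" "rho P i"] hyps assms T_pos by (auto simp: direct_hyps_def h3_def)

lemma rho1_pos: "t \<in> {0..horizon P} \<Longrightarrow> 0 < rho P 1 t"
  using hyps by (force simp: direct_hyps_def h2_def)

lemma lead_weight_pos: "0 < lead_weight P"
  using rho1_pos[of 0] T_pos by (auto simp: lead_weight_def split: fdo_type.split)

lemma u_ct: "in_ct (dom P) 2 (alpha P) (horizon P) u"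
  using sol by (simp add: classical_solution_def in_par2_def)

lemma u_init: "x \<in> closure (dom P) \<Longrightarrow> u x 0 = init P x"
  using sol by (simp add: classical_solution_def)

lemma caputo_u:
  assumes "i \<in> {1..M P}"
  shows "x \<in> closure (dom P) \<Longrightarrow> has_caputo (orders P i) (horizon P) (u x)"
    "in_par (dom P) 0 (alpha P) (nu1 P) (horizon P) (\<lambda>x. caputo (orders P i) (horizon P) (u x))"
  using sol assms unfolding classical_solution_def in_par2_def
  by (cases "i = 1"; force)+

lemma caputo_u_ct:
  "i \<in> {1..M P} \<Longrightarrow> in_ct (dom P) 0 (alpha P) (horizon P) (\<lambda>x. caputo (orders P i) (horizon P) (u x))"
  using caputo_u(2) by (simp add: in_aniso_def)

lemma u_time: "x \<in> closure (dom P) \<Longrightarrow> continuous_on {0..horizon P} (u x)"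
  by (rule in_ct_continuous_time[OF dom_props(1) u_ct])

lemma caputo_u_time:
  "i \<in> {1..M P} \<Longrightarrow> x \<in> closure (dom P) \<Longrightarrow> continuous_on {0..horizon P} (caputo (orders P i) (horizon P) (u x))"
  by (rule in_ct_continuous_time[OF dom_props(1) caputo_u_ct])

text \<open>The leading Caputo derivative is continuous on a compact interval, hence bounded;
  comparison with \<open>c = 0\<close> turns its bound into growth of order
  \<open>nu1 P\<close>.\<close>

lemma u_growth:
  assumes x: "x \<in> closure (dom P)"
  shows "\<exists>C\<ge>0. \<forall>s\<in>{0..horizon P}. \<bar>u x s - u x 0\<bar> \<le> C * s powr nu1 P"
proof -
  have one: "1 \<in> {1..M P}" using M_pos by simp
  have "bounded (caputo (nu1 P) (horizon P) (u x) ` {0..horizon P})"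
    by (intro compact_imp_bounded compact_continuous_image caputo_u_time one x) auto
  then obtain B where B0: "\<forall>y\<in>caputo (nu1 P) (horizon P) (u x) ` {0..horizon P}. norm y \<le> B" unfolding bounded_iff by blast
  have B: "\<bar>caputo (nu1 P) (horizon P) (u x) s - 0\<bar> \<le> B" if "s \<in> {0..horizon P}" for s using B0 that by simp
  have G: "0 < Gamma (1 + nu1 P)" by (rule Gamma_real_pos) (use nu1_bounds in simp)
  have "\<bar>u x s - u x 0\<bar> \<le> B / Gamma (1 + nu1 P) * s powr nu1 P" if s: "s \<in> {0..horizon P}" for s
  proof (cases "s = 0")
    case False
    have "\<bar>u x s - u x 0 - 0 * (s powr nu1 P / Gamma (1 + nu1 P))\<bar> \<le> B * (s powr nu1 P / Gamma (1 + nu1 P))"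
      by (rule caputo_asymptotics[OF nu1_bounds T_pos(1) u_time[OF x] caputo_u(1)[OF one x] caputo_u_time[OF one x]])
         (use s False B in auto)
    then show ?thesis by simp
  qed simp
  moreover have "0 \<le> B" using B[of 0] T_pos by auto
  ultimately show ?thesis using G by (intro exI[of _ "B / Gamma (1 + nu1 P)"]) auto
qed

lemma caputo_0:
  assumes i: "i \<in> {2..M P}" and x: "x \<in> closure (dom P)"
  shows "caputo (orders P i) (horizon P) (u x) 0 = 0"
    and "caputo (orders P i) (horizon P) (\<lambda>s. rho P i s * u x s) 0 = 0"
proof -
  have i1: "i \<in> {1..M P}" using i by simp
  have lt: "orders P i < nu1 P" by (rule orders_less[OF ord]) (use i in auto)
  obtain C where C: "0 \<le> C" "\<And>s. s \<in> {0..horizon P} \<Longrightarrow> \<bar>u x s - u x 0\<bar> \<le> C * s powr nu1 P"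
    using u_growth[OF x] by blast
  show "caputo (orders P i) (horizon P) (u x) 0 = 0"
    by (rule caputo_initial_zero[OF nu_bounds(1)[OF i1] lt nu1_bounds(2) T_pos(1) u_time[OF x]]) (use C in auto)
  obtain L where L: "0 \<le> L" "\<And>s. s \<in> {0..horizon P} \<Longrightarrow> \<bar>rho P i s - rho P i 0\<bar> \<le> L * s"
    using rho_props(2)[OF i1] by blast
  have "bounded (rho P i ` {0..horizon P})"
    by (intro compact_imp_bounded compact_continuous_image rho_props(1) i1) auto
  then obtain A where A0: "\<forall>y\<in>rho P i ` {0..horizon P}. norm y \<le> A" unfolding bounded_iff by blast
  have A: "\<bar>rho P i s\<bar> \<le> A" if "s \<in> {0..horizon P}" for s using A0 that by simp
  have A_nn: "0 \<le> A" using A[of 0] T_pos by auto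
  \<comment> \<open>From \<open>rho * u - rho0 * u0 = rho * (u - u0) + (rho - rho0) * u0\<close>:
    the first part grows like \<open>s powr nu1 P\<close>, and in the second a factor
    \<open>s\<close> is at most \<open>horizon P powr (1 - nu1 P)\<close> times that power.\<close>
  define Q where "Q = A * C + L * horizon P powr (1 - nu1 P) * \<bar>u x 0\<bar>"
  have bnd: "\<bar>rho P i s * u x s - rho P i 0 * u x 0\<bar> \<le> Q * s powr nu1 P" if s: "0 \<le> s" "s \<le> horizon P" for s
  proof -
    have s': "s \<in> {0..horizon P}" using s by simp
    have e: "rho P i s * u x s - rho P i 0 * u x 0 = rho P i s * (u x s - u x 0) + (rho P i s - rho P i 0) * u x 0"
      by (simp add: algebra_simps)
    have "\<bar>rho P i s * (u x s - u x 0)\<bar> \<le> A * (C * s powr nu1 P)"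
      unfolding abs_mult by (rule mult_mono) (use A[OF s'] C(2)[OF s'] A_nn in auto)
    moreover have "\<bar>(rho P i s - rho P i 0) * u x 0\<bar> \<le> (L * horizon P powr (1 - nu1 P) * s powr nu1 P) * \<bar>u x 0\<bar>"
      unfolding abs_mult
    proof (rule mult_right_mono)
      have "s = s powr (1 - nu1 P) * s powr nu1 P"
        using s by (cases "s = 0") (auto simp: powr_add[symmetric])
      also have "\<dots> \<le> horizon P powr (1 - nu1 P) * s powr nu1 P"
        by (intro mult_right_mono powr_mono2) (use s nu1_bounds in auto)
      finally have "L * s \<le> L * (horizon P powr (1 - nu1 P) * s powr nu1 P)"
        by (rule mult_left_mono) (rule L(1))
      then show "\<bar>rho P i s - rho P i 0\<bar> \<le> L * horizon P powr (1 - nu1 P) * s powr nu1 P"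
        using L(2)[OF s'] by (simp add: mult.assoc)
    qed simp
    ultimately have "\<bar>rho P i s * u x s - rho P i 0 * u x 0\<bar>
        \<le> A * (C * s powr nu1 P) + (L * horizon P powr (1 - nu1 P) * s powr nu1 P) * \<bar>u x 0\<bar>"
      unfolding e by linarith
    also have "\<dots> = Q * s powr nu1 P" by (simp add: Q_def algebra_simps)
    finally show ?thesis .
  qed
  have wc: "continuous_on {0..horizon P} (\<lambda>s. rho P i s * u x s)"
    by (intro continuous_intros rho_props(1) i1 u_time x)
  show "caputo (orders P i) (horizon P) (\<lambda>s. rho P i s * u x s) 0 = 0"
    by (rule caputo_initial_zero[OF nu_bounds(1)[OF i1] lt nu1_bounds(2) T_pos(1) wc bnd])
qed

lemma caputo_rho_u:
  assumes "ftype P = TypeII" and i: "i \<in> {1..M P}"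
  shows "x \<in> closure (dom P) \<Longrightarrow> has_caputo (orders P i) (horizon P) (\<lambda>s. rho P i s * u x s)"
    and "continuous_on (closure (dom P) \<times> {0..horizon P})
             (\<lambda>(x, t). caputo (orders P i) (horizon P) (\<lambda>s. rho P i s * u x s) t)"
    and "x \<in> closure (dom P) \<Longrightarrow>
          continuous_on {0..horizon P} (caputo (orders P i) (horizon P) (\<lambda>s. rho P i s * u x s))"
proof -
  show "x \<in> closure (dom P) \<Longrightarrow> has_caputo (orders P i) (horizon P) (\<lambda>s. rho P i s * u x s)"
    and c: "continuous_on (closure (dom P) \<times> {0..horizon P})
             (\<lambda>(x, t). caputo (orders P i) (horizon P) (\<lambda>s. rho P i s * u x s) t)"
    using sol assms unfolding classical_solution_def by blast+
  assume x: "x \<in> closure (dom P)"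
  have "continuous_on {0..horizon P} (\<lambda>t. case (x, t) of (x, t) \<Rightarrow> caputo (orders P i) (horizon P) (\<lambda>s. rho P i s * u x s) t)"
    by (rule continuous_on_compose2[OF c, of "{0..horizon P}" "\<lambda>t. (x, t)"]) (auto intro!: continuous_intros x)
  then show "continuous_on {0..horizon P} (caputo (orders P i) (horizon P) (\<lambda>s. rho P i s * u x s))" by simp
qed

lemma weighted_props:
  shows "x \<in> closure (dom P) \<Longrightarrow> continuous_on {0..horizon P} (weighted P u x)"
    and "x \<in> closure (dom P) \<Longrightarrow> has_caputo (nu1 P) (horizon P) (weighted P u x)"
    and "continuous_on (closure (dom P) \<times> {0..horizon P}) (\<lambda>(x, t). caputo (nu1 P) (horizon P) (weighted P u x) t)"
    and "x \<in> closure (dom P) \<Longrightarrow> continuous_on {0..horizon P} (caputo (nu1 P) (horizon P) (weighted P u x))"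
proof -
  have one: "1 \<in> {1..M P}" using M_pos by simp
  show "continuous_on {0..horizon P} (weighted P u x)" if "x \<in> closure (dom P)"
    unfolding weighted_def using u_time[OF that] rho_props(1)[OF one]
    by (cases "ftype P") (auto intro!: continuous_intros)
  have w1: "weighted P u x = u x" if "ftype P = TypeI" for x using that by (simp add: weighted_def fun_eq_iff)
  have w2: "weighted P u x = (\<lambda>s. rho P 1 s * u x s)" if "ftype P = TypeII" for x using that by (simp add: weighted_def fun_eq_iff)
  show "has_caputo (nu1 P) (horizon P) (weighted P u x)" if "x \<in> closure (dom P)"
    using caputo_u(1)[OF one that] caputo_rho_u(1)[OF _ one that] by (cases "ftype P") (auto simp: w1 w2)
  show c: "continuous_on (closure (dom P) \<times> {0..horizon P}) (\<lambda>(x, t). caputo (nu1 P) (horizon P) (weighted P u x) t)"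
  proof (cases "ftype P")
    case TypeI
    then show ?thesis using in_ct_continuous_joint[OF dom_props(1) caputo_u_ct[OF one]] by (simp only: w1[OF TypeI])
  next
    case TypeII
    show ?thesis unfolding w2[OF TypeII] by (rule caputo_rho_u(2)[OF TypeII one])
  qed
  assume x: "x \<in> closure (dom P)"
  have "continuous_on {0..horizon P} (\<lambda>t. case (x, t) of (x, t) \<Rightarrow> caputo (nu1 P) (horizon P) (weighted P u x) t)"
    by (rule continuous_on_compose2[OF c, of "{0..horizon P}" "\<lambda>t. (x, t)"]) (auto intro!: continuous_intros x)
  then show "continuous_on {0..horizon P} (caputo (nu1 P) (horizon P) (weighted P u x))" by simp
qed

lemma FDO_initial:
  assumes x: "x \<in> closure (dom P)"
  shows "continuous_on {0..horizon P} (FDO P u x)"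
    "FDO P u x 0 = lead_weight P * caputo (nu1 P) (horizon P) (weighted P u x) 0"
proof -
  have split: "(\<Sum>i=Suc 0..M P. f i) = f (Suc 0) + (\<Sum>i=2..M P. f i)" for f :: "nat \<Rightarrow> real"
    using M_pos sum.atLeast_Suc_atMost[of 1 "M P" f] by (simp add: numeral_2_eq_2)
  show "continuous_on {0..horizon P} (FDO P u x)"
  proof (cases "ftype P")
    case TypeI
    have "continuous_on {0..horizon P} (\<lambda>t. \<Sum>i=1..M P. rho P i t * caputo (orders P i) (horizon P) (u x) t)"
      by (intro continuous_on_sum continuous_on_mult rho_props(1) caputo_u_time x)
    moreover have "FDO P u x = (\<lambda>t. \<Sum>i=1..M P. rho P i t * caputo (orders P i) (horizon P) (u x) t)"
      using TypeI by (simp add: FDO_def fun_eq_iff)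
    ultimately show ?thesis by simp
  next
    case TypeII
    have "continuous_on {0..horizon P} (\<lambda>t. \<Sum>i=1..M P. caputo (orders P i) (horizon P) (\<lambda>s. rho P i s * u x s) t)"
      by (intro continuous_on_sum caputo_rho_u(3) TypeII x)
    moreover have "FDO P u x = (\<lambda>t. \<Sum>i=1..M P. caputo (orders P i) (horizon P) (\<lambda>s. rho P i s * u x s) t)"
      using TypeII by (simp add: FDO_def fun_eq_iff)
    ultimately show ?thesis by simp
  qed
  have w1: "weighted P u x = u x" if "ftype P = TypeI" using that by (simp add: weighted_def fun_eq_iff)
  have w2: "weighted P u x = (\<lambda>s. rho P 1 s * u x s)" if "ftype P = TypeII" using that by (simp add: weighted_def fun_eq_iff)
  show "FDO P u x 0 = lead_weight P * caputo (nu1 P) (horizon P) (weighted P u x) 0"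
  proof (cases "ftype P")
    case TypeI
    have "(\<Sum>i=2..M P. rho P i 0 * caputo (orders P i) (horizon P) (u x) 0) = 0"
      by (rule sum.neutral) (use caputo_0(1)[OF _ x] in simp)
    then show ?thesis using TypeI unfolding FDO_def lead_weight_def by (simp add: split w1)
  next
    case TypeII
    have "(\<Sum>i=2..M P. caputo (orders P i) (horizon P) (\<lambda>s. rho P i s * u x s) 0) = 0"
      by (rule sum.neutral) (use caputo_0(2)[OF _ x] in simp)
    then show ?thesis using TypeII unfolding FDO_def lead_weight_def by (simp add: split w2)
  qed
qed

lemma bc_ct: "in_ct (dom P) 1 (alpha P) (horizon P) (bc P i j)"
  using hyps by (simp add: direct_hyps_def h3_def in_aniso_def)

lemma rhs_ct: "in_ct (dom P) 0 (alpha P) (horizon P) (rhs P)"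
  using hyps by (simp add: direct_hyps_def h4_def in_aniso_def)

lemma coeff_continuous: "continuous_on {0..horizon P} (a0 P)" "continuous_on {0..horizon P} (b0 P)"
  using hyps alpha_props holder_on_continuous[of "alpha P / 2" "{0..horizon P}"]
  by (auto simp: direct_hyps_def h3_def)

text \<open>The equation is required only for positive times; all its terms are continuous up to
  \<open>t = 0\<close>, where the lower order derivatives and the convolution vanish.\<close>

lemma initial_equation:
  assumes x: "x \<in> dom P"
  shows "lead_weight P * caputo (nu1 P) (horizon P) (weighted P u x) 0
    = div_part P (\<lambda>y s. init P y) x 0 + a0 P 0 * init P x + rhs P x 0"
proof -
  have xc: "x \<in> closure (dom P)" using x closure_subset by auto
  have divc: "continuous_on {0..horizon P} (div_part P u x)"
    by (rule div_part_continuous[OF dom_props(1) x bc_ct u_ct])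
  have L1c: "continuous_on {0..horizon P} (L1_op P u x)" and L2c: "continuous_on {0..horizon P} (L2_op P u x)"
  proof -
    have "continuous_on {0..horizon P} (\<lambda>t. div_part P u x t + a0 P t * u x t)"
      "continuous_on {0..horizon P} (\<lambda>t. div_part P u x t + b0 P t * u x t)"
      by (intro continuous_intros divc coeff_continuous u_time xc)+
    then show "continuous_on {0..horizon P} (L1_op P u x)" "continuous_on {0..horizon P} (L2_op P u x)"
      by (simp_all add: L1_op_def[abs_def] L2_op_def[abs_def])
  qed
  \<comment> \<open>The double successor keeps even the first time at half the horizon, strictly
    inside the interval where the equation is assumed.\<close>
  define t where "t n = horizon P * inverse (real (Suc (Suc n)))" for n
  have tpos: "0 < t n" and tT: "t n < horizon P" for n
  proof -
    have "inverse (real (Suc (Suc n))) < 1" by (simp add: inverse_less_1_iff)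
    then show "0 < t n" "t n < horizon P" using T_pos(1) by (simp_all add: t_def)
  qed
  have t0: "t \<longlonglongrightarrow> 0"
  proof -
    have "(\<lambda>n. horizon P * inverse (real (Suc (Suc n)))) \<longlonglongrightarrow> horizon P * 0"
      by (intro tendsto_mult_left LIMSEQ_Suc[OF LIMSEQ_inverse_real_of_nat])
    then show ?thesis by (simp add: t_def[abs_def])
  qed
  have lim: "(\<lambda>n. F (t n)) \<longlonglongrightarrow> F 0" if "continuous_on {0..horizon P} F" for F :: "real \<Rightarrow> real"
    by (rule continuous_on_tendsto_compose[OF that t0])
       (use tpos tT T_pos(1) in \<open>auto intro!: always_eventually less_imp_le\<close>)
  have "(\<lambda>n. FDO P u x (t n) - L1_op P u x (t n) - conv (ker P) (L2_op P u x) (t n))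
      \<longlonglongrightarrow> FDO P u x 0 - L1_op P u x 0 - 0"
  proof (intro tendsto_diff lim FDO_initial(1) xc L1c)
    show "(\<lambda>n. conv (ker P) (L2_op P u x) (t n)) \<longlonglongrightarrow> 0"
      by (rule conv_tendsto_0[OF _ L2c tpos tT t0])
         (use hyps in \<open>simp add: direct_hyps_def h4_def\<close>)
  qed
  moreover have "FDO P u x (t n) - L1_op P u x (t n) - conv (ker P) (L2_op P u x) (t n) = rhs P x (t n)" for n
    using sol x tpos[of n] tT[of n] unfolding classical_solution_def by simp
  moreover have "(\<lambda>n. rhs P x (t n)) \<longlonglongrightarrow> rhs P x 0"
    by (rule lim[OF in_ct_continuous_time[OF dom_props(1) rhs_ct xc]])
  ultimately have eq: "FDO P u x 0 - L1_op P u x 0 - 0 = rhs P x 0"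
    using LIMSEQ_unique by simp
  \<comment> \<open>The solution and the initial datum agree only on the closure; that suffices,
    since partial derivatives at a point of the open domain are local.\<close>
  have "div_part P u x 0 = div_part P (\<lambda>y s. init P y) x 0"
    unfolding div_part_def
  proof (intro sum.cong refl pd_cong[OF dom_props(1) x])
    fix i j y assume y: "y \<in> dom P"
    have "pd j (\<lambda>z. u z 0) y = pd j (\<lambda>z. init P z) y"
      by (rule pd_cong[OF dom_props(1) y]) (use u_init closure_subset in blast)
    then show "bc P i j y 0 * pd j (\<lambda>z. u z 0) y = bc P i j y 0 * pd j (\<lambda>z. init P z) y" by simp
  qed
  with eq show ?thesis
    unfolding FDO_initial(2)[OF xc] L1_op_def using u_init[OF xc] by simp
qed

text \<open>The three terms of \<open>initial_equation\<close> integrate to minus the boundary flux,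
  \<open>a0 P 0 * psi P 0\<close> and the total source; both convolutions in \<open>C_nu P 0\<close>
  run over a single point and vanish.\<close>

lemma initial_total:
  assumes obs: "observed P u"
  shows "integrable lborel (\<lambda>x. indicator (dom P) x * (lead_weight P * caputo (nu1 P) (horizon P) (weighted P u x) 0))"
    and "(\<integral>x. indicator (dom P) x * (lead_weight P * caputo (nu1 P) (horizon P) (weighted P u x) 0) \<partial>lborel) = C_nu P 0"
proof -
  have z: "0 \<in> {0..horizon P}" using T_pos(1) by simp
  have u0: "in_Cl (dom P) 2 (alpha P) (init P)" using hyps by (simp add: direct_hyps_def h4_def)
  note fl = initial_flux[OF dom_props(3,4) in_ct_slice[OF bc_ct z] u0]
  have h6: "h6 P" using hyps by (simp add: direct_hyps_def)
  note ci = set_lebesgue_continuous_on_closure[OF dom_props(1,2) in_Cl_continuous[OF u0]]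
  note cr = set_lebesgue_continuous_on_closure[OF dom_props(1,2) in_Cl_continuous[OF in_ct_slice[OF rhs_ct z]]]
  have e: "indicator (dom P) x * (lead_weight P * caputo (nu1 P) (horizon P) (weighted P u x) 0)
     = indicator (dom P) x * div_part P (\<lambda>y s. init P y) x 0 + a0 P 0 * (indicator (dom P) x * init P x)
       + indicator (dom P) x * rhs P x 0" for x
    using initial_equation[of x] by (cases "x \<in> dom P") auto
  show "integrable lborel (\<lambda>x. indicator (dom P) x * (lead_weight P * caputo (nu1 P) (horizon P) (weighted P u x) 0))"
    unfolding e using fl(1)[OF h6] ci(1) cr(1) by simp
  have psi0: "psi P 0 = (\<integral>x. indicator (dom P) x * init P x \<partial>lborel)"
  proof -
    have "psi P 0 = (LINT x:dom P|lebesgue. u x 0)" using obs T_pos by (simp add: observed_def)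
    also have "\<dots> = (LINT x:dom P|lebesgue. init P x)"
      unfolding set_lebesgue_integral_def
      by (rule Bochner_Integration.integral_cong[OF refl]) (use u_init closure_subset in \<open>auto simp: indicator_def\<close>)
    finally show ?thesis by (simp add: ci(2))
  qed
  show "(\<integral>x. indicator (dom P) x * (lead_weight P * caputo (nu1 P) (horizon P) (weighted P u x) 0) \<partial>lborel) = C_nu P 0"
    unfolding e C_nu_def psi0 conv_0 cr(2)
    using fl[OF h6] ci(1) cr(1) by simp
qed

end

subsection \<open>The logarithmic quotient\<close>

text \<open>Log-convexity between the equal values \<open>Gamma 1 = Gamma 2 = 1\<close>.\<close>

lemma Gamma_le_1:
  assumes "0 \<le> \<nu>" "\<nu> \<le> (1::real)"
  shows "Gamma (1 + \<nu>) \<le> 1"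
proof -
  have "(ln \<circ> Gamma) ((1 - \<nu>) *\<^sub>R (1::real) + \<nu> *\<^sub>R 2) \<le> (1 - \<nu>) * (ln \<circ> Gamma) 1 + \<nu> * (ln \<circ> Gamma) 2"
    by (rule convex_onD[OF log_convex_Gamma_real]) (use assms in auto)
  moreover have "Gamma (2::real) = 1" using Gamma_real_plus1[of 1] by simp
  moreover have "(1 - \<nu>) *\<^sub>R (1::real) + \<nu> *\<^sub>R 2 = 1 + \<nu>" by simp
  ultimately have "ln (Gamma (1 + \<nu>)) \<le> 0" by (simp add: add.commute)
  then show ?thesis using Gamma_real_pos[of "1 + \<nu>"] assms by (simp add: ln_le_zero_iff)
qed

text \<open>The functional equation moves \<open>y\<close> by unit steps into \<open>{1..2}\<close>
  without increasing the value: downwards the dropped factor is at least 1, upwards the new factor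
  is below 1. The minimum over the half-line is thus sought on a compact interval.\<close>

lemma Gamma_ge_on_unit:
  assumes "0 < y"
  shows "\<exists>z\<in>{1..2}. Gamma z \<le> Gamma (y::real)"
proof -
  have up: "\<exists>z\<in>{1..2}. Gamma z \<le> Gamma y" if "1 \<le> y" "y \<le> 2 + real n" for y :: real and n
    using that
  proof (induction n arbitrary: y)
    case 0
    then show ?case by (intro bexI[of _ y]) auto
  next
    case (Suc n)
    show ?case
    proof (cases "y \<le> 2")
      case True
      then show ?thesis using Suc.prems by (intro bexI[of _ y]) auto
    next
      case False
      then obtain z where z: "z \<in> {1..2}" "Gamma z \<le> Gamma (y - 1)" using Suc.IH[of "y - 1"] Suc.prems by auto
      have "Gamma y = (y - 1) * Gamma (y - 1)" using Gamma_real_plus1[of "y - 1"] False by simp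
      moreover have "1 * Gamma (y - 1) \<le> (y - 1) * Gamma (y - 1)"
        by (intro mult_right_mono) (use False Gamma_real_pos[of "y - 1"] in auto)
      ultimately have "Gamma z \<le> Gamma y" using z(2) by linarith
      then show ?thesis using z(1) by blast
    qed
  qed
  show ?thesis
  proof (cases "1 \<le> y")
    case True
    obtain n where "y \<le> real n" using real_arch_simple by blast
    then show ?thesis using up[OF True, of n] by simp
  next
    case False
    have "Gamma (y + 1) = y * Gamma y" using Gamma_real_plus1[of y] assms by simp
    also have "\<dots> \<le> 1 * Gamma y" by (intro mult_right_mono) (use False Gamma_real_pos[of y] assms in auto)
    finally show ?thesis using False assms by (intro bexI[of _ "y + 1"]) auto
  qed
qed

text \<open>A minimiser exists on \<open>{1..2}\<close> and is global by the preceding reduction, so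
  the choice defining \<open>x_star\<close> is meaningful. The last bound compares with
  \<open>Gamma 1\<close>.\<close>

lemma Gamma_x_star: "0 < Gamma (1 + x_star)" "0 < y \<Longrightarrow> Gamma (1 + x_star) \<le> Gamma y" "Gamma (1 + x_star) \<le> 1"
proof -
  have "continuous_on {1..2} (Gamma :: real \<Rightarrow> real)"
    by (intro continuous_intros) (auto simp: nonpos_Ints_def)
  then obtain m :: real where m: "m \<in> {1..2}" "\<forall>z\<in>{1..2}. Gamma m \<le> Gamma z"
    using continuous_attains_inf[of "{1..2::real}" Gamma] by auto
  have "Gamma m \<le> Gamma y" if y: "0 < y" for y
  proof -
    obtain z where z: "z \<in> {1..2}" "Gamma z \<le> Gamma y" using Gamma_ge_on_unit[OF y] by blast
    have "Gamma m \<le> Gamma z" using m(2) z(1) by blast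
    with z(2) show ?thesis by linarith
  qed
  then have ex: "0 < 1 + (m - 1) \<and> (\<forall>y>0. Gamma (1 + (m - 1)) \<le> Gamma y)" using m by simp
  have x: "0 < 1 + x_star \<and> (\<forall>y>0. Gamma (1 + x_star) \<le> Gamma y)"
    unfolding x_star_def by (rule someI[of "\<lambda>x. 0 < 1 + x \<and> (\<forall>y>0. Gamma (1 + x) \<le> Gamma y)", OF ex])
  show "0 < Gamma (1 + x_star)" using x by (intro Gamma_real_pos) simp
  show *: "Gamma (1 + x_star) \<le> Gamma y" if "0 < y" for y using x that by simp
  show "Gamma (1 + x_star) \<le> 1" using *[of 1] by simp
qed

lemma powr_neg_bound:
  fixes A t \<epsilon> :: real
  assumes "0 < A" "0 < \<epsilon>" "0 < t" "t \<le> A powr (- 2 / \<epsilon>)"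
  shows "A \<le> t powr (- \<epsilon> / 2)"
proof -
  have "A = (A powr (- 2 / \<epsilon>)) powr (- \<epsilon> / 2)" using assms by (simp add: powr_powr)
  also have "\<dots> \<le> t powr (- \<epsilon> / 2)"
    by (rule powr_mono2') (use assms in auto)
  finally show ?thesis .
qed

lemma powr_pos_bound:
  fixes A t \<epsilon> :: real
  assumes "0 < A" "0 < \<epsilon>" "0 < t" "t \<le> A powr (2 / \<epsilon>)"
  shows "t powr (\<epsilon> / 2) \<le> A"
proof -
  have "t powr (\<epsilon> / 2) \<le> (A powr (2 / \<epsilon>)) powr (\<epsilon> / 2)"
    by (rule powr_mono2) (use assms in auto)
  also have "\<dots> = A" using assms by (simp add: powr_powr)
  finally show ?thesis .
qed

text \<open>The thresholds are exactly what is needed to absorb, in powers \<open>t powr (\<epsilon> / 2)\<close>, the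
  factor \<open>\<bar>c\<bar> / Gamma (1 + \<nu>)\<close> and the relative error \<open>\<epsilon>\<close>.\<close>

lemma log_quotient_bound:
  fixes t \<nu> \<epsilon> c G X :: real
  assumes t: "0 < t" "t < 1" and \<nu>: "0 < \<nu>" "\<nu> < 1" and \<epsilon>: "0 < \<epsilon>" "\<epsilon> < 1" and c: "c \<noteq> 0"
    and G: "0 < G" "G \<le> 1" "G \<le> Gamma (1 + \<nu>)"
    and up: "\<bar>c\<bar> / G \<le> t powr (- \<epsilon> / 2)" and low: "1 / (G * \<bar>c\<bar>) \<le> t powr (- \<epsilon> / 2)"
    and e: "t powr (\<epsilon> / 2) \<le> 1 - \<epsilon>"
    and X: "\<bar>X - c * (t powr \<nu> / Gamma (1 + \<nu>))\<bar> < \<epsilon> * \<bar>c\<bar> * (t powr \<nu> / Gamma (1 + \<nu>))"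
  shows "\<bar>\<nu> - ln \<bar>X\<bar> / ln t\<bar> < \<epsilon>"
proof -
  define d where "d = \<bar>c\<bar> / Gamma (1 + \<nu>)"
  have \<Gamma>: "0 < Gamma (1 + \<nu>)" "Gamma (1 + \<nu>) \<le> 1" using G Gamma_le_1[of \<nu>] \<nu> by auto
  have d0: "0 < d" using c \<Gamma> by (simp add: d_def)
  \<comment> \<open>In terms of \<open>p\<close> the thresholds become \<open>d \<le> 1 / p\<close>,
    \<open>p \<le> d\<close> and \<open>p \<le> 1 - \<epsilon>\<close>. Each outer bound for
    \<open>\<bar>X\<bar>\<close> uses two of them, giving \<open>p * p = t powr \<epsilon>\<close>
    or its reciprocal.\<close>
  define p where "p = t powr (\<epsilon> / 2)"
  have p: "0 < p" "t powr (- \<epsilon> / 2) = 1 / p" using t by (simp_all add: p_def powr_minus_divide)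
  have pp: "p * p = t powr \<epsilon>" by (simp add: p_def powr_add[symmetric])
  have aX: "\<bar>c\<bar> * (t powr \<nu> / Gamma (1 + \<nu>)) = d * t powr \<nu>" by (simp add: d_def)
  have ab: "\<bar>c * (t powr \<nu> / Gamma (1 + \<nu>))\<bar> = d * t powr \<nu>" using \<Gamma> by (simp add: abs_mult d_def)
  have X': "\<bar>X - c * (t powr \<nu> / Gamma (1 + \<nu>))\<bar> < \<epsilon> * (d * t powr \<nu>)"
    using X aX by (simp only: mult.assoc)
  define Y where "Y = c * (t powr \<nu> / Gamma (1 + \<nu>))"
  define W where "W = d * t powr \<nu>"
  have "\<bar>X - Y\<bar> < \<epsilon> * W" "\<bar>Y\<bar> = W" using X' ab by (simp_all add: Y_def W_def)
  then have "\<bar>X\<bar> < W + \<epsilon> * W" "W - \<epsilon> * W < \<bar>X\<bar>" by linarith+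
  then have ub: "\<bar>X\<bar> < (1 + \<epsilon>) * d * t powr \<nu>" and lb: "(1 - \<epsilon>) * d * t powr \<nu> < \<bar>X\<bar>"
    by (simp_all add: W_def algebra_simps)
  have d1: "d \<le> 1 / p"
  proof -
    have "d \<le> \<bar>c\<bar> / G" unfolding d_def by (rule divide_left_mono) (use G \<Gamma> in auto)
    then show ?thesis using up p(2) by simp
  qed
  have d2: "p \<le> d"
  proof -
    have "1 / (G * \<bar>c\<bar>) \<le> 1 / p" using low p(2) by simp
    then have "p \<le> G * \<bar>c\<bar>" using p(1) G(1) c by (simp add: field_simps)
    also have "\<dots> \<le> 1 * \<bar>c\<bar>" by (rule mult_right_mono) (use G in auto)
    also have "\<dots> \<le> d" using \<Gamma> by (simp add: d_def le_divide_eq mult_left_le)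
    finally show ?thesis .
  qed
  have e': "p \<le> 1 - \<epsilon>" using e by (simp add: p_def)
  \<comment> \<open>One threshold serves both signs: \<open>p \<le> 1 - \<epsilon>\<close> also
    yields \<open>1 + \<epsilon> \<le> 1 / p\<close>.\<close>
  have "(1 + \<epsilon>) * (1 - \<epsilon>) \<le> 1" by (simp add: algebra_simps)
  then have "(1 + \<epsilon>) * p \<le> 1" using mult_left_mono[OF e', of "1 + \<epsilon>"] \<epsilon> by linarith
  then have e1: "1 + \<epsilon> \<le> 1 / p" using p(1) by (simp add: le_divide_eq)
  have "(1 + \<epsilon>) * d \<le> (1 / p) * (1 / p)" by (rule mult_mono) (use e1 d1 d0 p in auto)
  also have "\<dots> = t powr (- \<epsilon>)" using pp by (simp add: powr_minus_divide)
  finally have "(1 + \<epsilon>) * d * t powr \<nu> \<le> t powr (- \<epsilon>) * t powr \<nu>" by (rule mult_right_mono) simp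
  with ub have U: "\<bar>X\<bar> < t powr (\<nu> - \<epsilon>)" by (simp add: powr_add[symmetric])
  have "p * p \<le> (1 - \<epsilon>) * d" by (rule mult_mono) (use e' d2 p \<epsilon> in auto)
  then have "t powr \<epsilon> * t powr \<nu> \<le> (1 - \<epsilon>) * d * t powr \<nu>" unfolding pp by (rule mult_right_mono) simp
  with lb have L: "t powr (\<nu> + \<epsilon>) < \<bar>X\<bar>" by (simp add: powr_add mult.commute)
  have Xp: "0 < \<bar>X\<bar>" using L powr_ge_zero[of t "\<nu> + \<epsilon>"] by linarith
  have lt: "ln t < 0" using t by simp
  have "ln (t powr (\<nu> + \<epsilon>)) < ln \<bar>X\<bar>" using L t by (subst ln_less_cancel_iff) auto
  then have 1: "(\<nu> + \<epsilon>) * ln t < ln \<bar>X\<bar>" using t by (simp add: ln_powr)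
  have "ln \<bar>X\<bar> < ln (t powr (\<nu> - \<epsilon>))" using U Xp t by (subst ln_less_cancel_iff) auto
  then have 2: "ln \<bar>X\<bar> < (\<nu> - \<epsilon>) * ln t" using t by (simp add: ln_powr)
  have "ln \<bar>X\<bar> / ln t < \<nu> + \<epsilon>" using 1 lt by (simp add: neg_divide_less_eq)
  moreover have "\<nu> - \<epsilon> < ln \<bar>X\<bar> / ln t" using 2 lt by (simp add: neg_less_divide_eq)
  ultimately show ?thesis by linarith
qed

section \<open>The observed mass and the existence of a good time\<close>

locale observed_problem = solved_problem +
  assumes obs: "observed P u" and C_nonzero: "C_nu P 0 \<noteq> 0"
begin

definition mass :: "real \<Rightarrow> real" where
  "mass t = (\<integral>x. indicator (dom P) x * weighted P u x t \<partial>lborel)"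

definition vol :: real where "vol = measure lebesgue (dom P)"

definition lead :: real where "lead = C_nu P 0 / lead_weight P"

lemma lead_nonzero: "lead \<noteq> 0"
  using C_nonzero lead_weight_pos by (simp add: lead_def)

lemma vol_nonneg: "0 \<le> vol"
  by (simp add: vol_def)

lemma psi_eq:
  assumes "t \<in> {0..tstar P}"
  shows "psi P t = (\<integral>x. indicator (dom P) x * u x t \<partial>lborel)"
    and "integrable lborel (\<lambda>x. indicator (dom P) x * u x t)"
proof -
  have t: "t \<in> {0..horizon P}" using assms T_pos by auto
  note c = set_lebesgue_continuous_on_closure[OF dom_props(1,2) in_Cl_continuous[OF in_ct_slice[OF u_ct t]]]
  have "psi P t = (LINT x:dom P|lebesgue. u x t)" using obs assms by (simp add: observed_def)
  then show "psi P t = (\<integral>x. indicator (dom P) x * u x t \<partial>lborel)" by (simp only: c(2))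
  show "integrable lborel (\<lambda>x. indicator (dom P) x * u x t)" by (rule c(1))
qed

lemma mass_eq:
  assumes "t \<in> {0..tstar P}"
  shows "mass t = (case ftype P of TypeI \<Rightarrow> psi P t | TypeII \<Rightarrow> rho P 1 t * psi P t)"
    and "integrable lborel (\<lambda>x. indicator (dom P) x * weighted P u x t)"
proof -
  have "integrable lborel (\<lambda>x. indicator (dom P) x * weighted P u x t) \<and>
     mass t = (case ftype P of TypeI \<Rightarrow> psi P t | TypeII \<Rightarrow> rho P 1 t * psi P t)"
  proof (cases "ftype P")
    case TypeI
    then show ?thesis using psi_eq[OF assms] by (simp add: mass_def weighted_def)
  next
    case TypeII
    have e: "indicator (dom P) x * weighted P u x t = rho P 1 t * (indicator (dom P) x * u x t)" for x
      using TypeII by (simp add: weighted_def)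
    show ?thesis unfolding mass_def e using TypeII psi_eq[OF assms] by simp
  qed
  then show "mass t = (case ftype P of TypeI \<Rightarrow> psi P t | TypeII \<Rightarrow> rho P 1 t * psi P t)"
    "integrable lborel (\<lambda>x. indicator (dom P) x * weighted P u x t)" by blast+
qed

lemma nu1a_eq:
  assumes "t \<in> {0..tstar P}"
  shows "nu1a P t = ln \<bar>mass t - mass 0\<bar> / ln t"
proof -
  have z: "0 \<in> {0..tstar P}" using T_pos by simp
  have u0: "in_Cl (dom P) 2 (alpha P) (init P)" using hyps by (simp add: direct_hyps_def h4_def)
  have "(LINT x:dom P|lebesgue. init P x) = (\<integral>x. indicator (dom P) x * init P x \<partial>lborel)"
    by (rule set_lebesgue_continuous_on_closure(2)[OF dom_props(1,2) in_Cl_continuous[OF u0]])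
  also have "\<dots> = psi P 0" unfolding psi_eq(1)[OF z]
    by (rule Bochner_Integration.integral_cong[OF refl]) (use u_init closure_subset[of "dom P"] in \<open>auto simp: indicator_def\<close>)
  finally have i: "(LINT x:dom P|lebesgue. init P x) = psi P 0" .
  show ?thesis unfolding nu1a_def mass_eq(1)[OF assms] mass_eq(1)[OF z] i
    by (cases "ftype P") simp_all
qed

lemma integral_const_dom: "integrable lborel (\<lambda>x. indicator (dom P) x * (c::real))"
    "(\<integral>x. indicator (dom P) x * (c::real) \<partial>lborel) = c * vol"
proof -
  have "dom P \<in> sets borel" using dom_props(1) by simp
  then have m: "measure lebesgue (dom P) = measure lborel (dom P)" by simp
  have "emeasure lborel (dom P) < \<infinity>" by (rule emeasure_bounded_finite[OF dom_props(2)])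
  then show "integrable lborel (\<lambda>x. indicator (dom P) x * (c::real))"
    "(\<integral>x. indicator (dom P) x * (c::real) \<partial>lborel) = c * vol"
    using dom_props(1) by (auto simp: vol_def m)
qed

text \<open>The one-dimensional expansion holds for each \<open>x\<close> with its own initial
  derivative and the common error \<open>\<eta>\<close>. Integrating over the domain turns the
  initial derivatives into \<open>lead\<close> and multiplies the error by the volume.\<close>

lemma mass_asymptotics:
  assumes t: "0 < t" "t \<le> tstar P"
    and \<eta>: "\<And>x s. x \<in> dom P \<Longrightarrow> 0 \<le> s \<Longrightarrow> s \<le> t \<Longrightarrow>
      \<bar>caputo (nu1 P) (horizon P) (weighted P u x) s - caputo (nu1 P) (horizon P) (weighted P u x) 0\<bar> \<le> \<eta>"
  shows "\<bar>mass t - mass 0 - lead * (t powr nu1 P / Gamma (1 + nu1 P))\<bar>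
     \<le> \<eta> * vol * (t powr nu1 P / Gamma (1 + nu1 P))"
proof -
  define \<kappa> where "\<kappa> = t powr nu1 P / Gamma (1 + nu1 P)"
  define D where "D x = caputo (nu1 P) (horizon P) (weighted P u x) 0" for x
  have tt: "t \<in> {0..tstar P}" "0 \<in> {0..tstar P}" "t \<le> horizon P" using t T_pos by auto
  have point: "\<bar>weighted P u x t - weighted P u x 0 - D x * \<kappa>\<bar> \<le> \<eta> * \<kappa>" if x: "x \<in> dom P" for x
  proof -
    have xc: "x \<in> closure (dom P)" using x closure_subset by auto
    show ?thesis unfolding \<kappa>_def D_def
      by (rule caputo_asymptotics[OF nu1_bounds T_pos(1) weighted_props(1,2,4)[OF xc] t(1) tt(3)])
         (use \<eta>[OF x] in auto)
  qed
  have Di: "integrable lborel (\<lambda>x. indicator (dom P) x * D x)" and Dv: "(\<integral>x. indicator (dom P) x * D x \<partial>lborel) = lead"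
  proof -
    have e: "(\<lambda>x. indicator (dom P) x * D x) = (\<lambda>x. (indicator (dom P) x * (lead_weight P * D x)) / lead_weight P)"
      using lead_weight_pos by (auto simp: fun_eq_iff)
    note it = initial_total[OF obs, folded D_def]
    show "integrable lborel (\<lambda>x. indicator (dom P) x * D x)"
      unfolding e by (rule integrable_divide[OF it(1)])
    show "(\<integral>x. indicator (dom P) x * D x \<partial>lborel) = lead"
      unfolding e lead_def it(2)[symmetric] by (rule integral_divide_zero)
  qed
  note i1 = mass_eq(2)[OF tt(1)] and i0 = mass_eq(2)[OF tt(2)]
  let ?g = "\<lambda>x. indicator (dom P) x * weighted P u x t - indicator (dom P) x * weighted P u x 0 - indicator (dom P) x * D x * \<kappa>"
  have gi: "integrable lborel ?g" using i1 i0 Di by simp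
  have gv: "(\<integral>x. ?g x \<partial>lborel) = mass t - mass 0 - lead * \<kappa>"
    using i1 i0 Di Dv by (simp add: mass_def)
  have "\<bar>\<integral>x. ?g x \<partial>lborel\<bar> \<le> (\<integral>x. \<bar>?g x\<bar> \<partial>lborel)"
    using integral_norm_bound[of lborel ?g] by simp
  also have "\<dots> \<le> (\<integral>x. indicator (dom P) x * (\<eta> * \<kappa>) \<partial>lborel)"
  proof (rule integral_mono)
    show "integrable lborel (\<lambda>x. \<bar>?g x\<bar>)" using gi by (rule integrable_abs)
    show "\<bar>?g x\<bar> \<le> indicator (dom P) x * (\<eta> * \<kappa>)" for x
      using point[of x] by (cases "x \<in> dom P") auto
  qed (rule integral_const_dom)
  also have "\<dots> = \<eta> * \<kappa> * vol" by (rule integral_const_dom)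
  finally have "\<bar>mass t - mass 0 - lead * \<kappa>\<bar> \<le> \<eta> * \<kappa> * vol" unfolding gv .
  then show ?thesis unfolding \<kappa>_def[symmetric] by (simp only: mult_ac)
qed

text \<open>Uniform continuity of the leading derivative on the compact space-time cylinder. It
  serves the qualitative statement, where no a priori constant is given.\<close>

lemma modulus:
  assumes e: "0 < e"
  shows "\<exists>d>0. \<forall>x\<in>dom P. \<forall>s\<in>{0..horizon P}. s < d \<longrightarrow>
      \<bar>caputo (nu1 P) (horizon P) (weighted P u x) s - caputo (nu1 P) (horizon P) (weighted P u x) 0\<bar> \<le> e"
proof -
  have "compact (closure (dom P) \<times> {0..horizon P})"
    using dom_props(2) by (intro compact_Times) (auto simp: compact_closure)
  from compact_uniformly_continuous[OF weighted_props(3) this] e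
  obtain d where d: "0 < d" "\<And>p q. p \<in> closure (dom P) \<times> {0..horizon P} \<Longrightarrow> q \<in> closure (dom P) \<times> {0..horizon P} \<Longrightarrow> dist q p < d \<Longrightarrow>
     dist (case q of (x, t) \<Rightarrow> caputo (nu1 P) (horizon P) (weighted P u x) t) (case p of (x, t) \<Rightarrow> caputo (nu1 P) (horizon P) (weighted P u x) t) < e"
    unfolding uniformly_continuous_on_def by metis
  show ?thesis
  proof (intro exI[of _ d] conjI ballI impI d(1))
    fix x s assume x: "x \<in> dom P" and s: "s \<in> {0..horizon P}" "s < d"
    have xc: "x \<in> closure (dom P)" using x closure_subset by auto
    have "dist (x, s) (x, 0) < d" using s by (simp add: dist_Pair_Pair dist_real_def)
    from d(2)[OF _ _ this] xc s T_pos(1)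
    show "\<bar>caputo (nu1 P) (horizon P) (weighted P u x) s - caputo (nu1 P) (horizon P) (weighted P u x) 0\<bar> \<le> e"
      by (simp add: dist_real_def)
  qed
qed

lemma small_time_estimate:
  assumes e: "0 < e"
  shows "\<exists>d>0. \<forall>t. 0 < t \<and> t \<le> tstar P \<and> t < d \<longrightarrow>
    \<bar>mass t - mass 0 - lead * (t powr nu1 P / Gamma (1 + nu1 P))\<bar> < e * (t powr nu1 P / Gamma (1 + nu1 P))"
proof -
  \<comment> \<open>Dividing by \<open>vol + 1\<close> keeps the quotient defined and makes the
    final inequality strict without knowing that the volume is positive.\<close>
  have ev: "0 < e / (vol + 1)" using e vol_nonneg by simp
  obtain d where d: "0 < d" "\<And>x s. x \<in> dom P \<Longrightarrow> s \<in> {0..horizon P} \<Longrightarrow> s < d \<Longrightarrow>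
      \<bar>caputo (nu1 P) (horizon P) (weighted P u x) s - caputo (nu1 P) (horizon P) (weighted P u x) 0\<bar> \<le> e / (vol + 1)"
    using modulus[OF ev] by blast
  show ?thesis
  proof (intro exI[of _ d] conjI allI impI d(1))
    fix t assume t: "0 < t \<and> t \<le> tstar P \<and> t < d"
    have "\<bar>mass t - mass 0 - lead * (t powr nu1 P / Gamma (1 + nu1 P))\<bar>
      \<le> e / (vol + 1) * vol * (t powr nu1 P / Gamma (1 + nu1 P))"
      by (rule mass_asymptotics) (use t d(2) T_pos in auto)
    also have "\<dots> < e * (t powr nu1 P / Gamma (1 + nu1 P))"
    proof (rule mult_strict_right_mono)
      show "e / (vol + 1) * vol < e" using e vol_nonneg by (simp add: field_simps)
      show "0 < t powr nu1 P / Gamma (1 + nu1 P)"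
        using t Gamma_real_pos[of "1 + nu1 P"] nu1_bounds by simp
    qed
    finally show "\<bar>mass t - mass 0 - lead * (t powr nu1 P / Gamma (1 + nu1 P))\<bar> < e * (t powr nu1 P / Gamma (1 + nu1 P))" .
  qed
qed

text \<open>Expressed through \<open>lead\<close>, in which the weight \<open>rho P 1 0\<close> of
  the I type is already divided out, the two versions of \<open>T0\<close> coincide; each entry of
  the minimum becomes one threshold of \<open>log_quotient_bound\<close>.\<close>

lemma T0_props:
  assumes \<epsilon>: "0 < \<epsilon>" "\<epsilon> < 1"
  shows "0 < T0 P \<epsilon>" "T0 P \<epsilon> \<le> tstar P"
    and "0 < t \<Longrightarrow> t \<le> T0 P \<epsilon> \<Longrightarrow> \<bar>lead\<bar> / Gamma (1 + x_star) \<le> t powr (- \<epsilon> / 2)"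
    and "0 < t \<Longrightarrow> t \<le> T0 P \<epsilon> \<Longrightarrow> 1 / (Gamma (1 + x_star) * \<bar>lead\<bar>) \<le> t powr (- \<epsilon> / 2)"
    and "0 < t \<Longrightarrow> t \<le> T0 P \<epsilon> \<Longrightarrow> t powr (\<epsilon> / 2) \<le> 1 - \<epsilon>"
proof -
  define G where "G = Gamma (1 + x_star)"
  define d where "d = \<bar>lead\<bar>"
  have G: "0 < G" using Gamma_x_star by (simp add: G_def)
  have d: "0 < d" using lead_nonzero by (simp add: d_def)
  have T0: "T0 P \<epsilon> = Min {tstar P, (1 / (G * d)) powr (- 2 / \<epsilon>), (d / G) powr (- 2 / \<epsilon>), (1 - \<epsilon>) powr (2 / \<epsilon>)}"
  proof (cases "ftype P")
    case TypeI
    then have "d = \<bar>C_nu P 0\<bar> / rho P 1 0" "0 < rho P 1 0"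
      using lead_weight_pos by (simp_all add: d_def lead_def lead_weight_def)
    then have C: "\<bar>C_nu P 0\<bar> = d * rho P 1 0" and r: "0 < rho P 1 0" by (auto simp: field_simps)
    have "rho P 1 0 / (G * \<bar>C_nu P 0\<bar>) = 1 / (G * d)" "\<bar>C_nu P 0\<bar> / (G * rho P 1 0) = d / G"
      unfolding C using r by simp_all
    then show ?thesis using TypeI unfolding T0_def Let_def G_def by simp
  next
    case TypeII
    then have dd: "d = \<bar>C_nu P 0\<bar>" by (simp add: d_def lead_def lead_weight_def)
    have "(1 / (G * d)) powr (- 2 / \<epsilon>) = (G * d) powr (2 / \<epsilon>)"
      using G d by (simp add: powr_minus_divide powr_divide)
    then show ?thesis using TypeII unfolding T0_def Let_def G_def dd by simp
  qed
  show "0 < T0 P \<epsilon>" unfolding T0 using T_pos(2) G d \<epsilon> by simp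
  show "T0 P \<epsilon> \<le> tstar P" unfolding T0 by simp
  assume t: "0 < t" "t \<le> T0 P \<epsilon>"
  have t1: "t \<le> (1 / (G * d)) powr (- 2 / \<epsilon>)" "t \<le> (d / G) powr (- 2 / \<epsilon>)" "t \<le> (1 - \<epsilon>) powr (2 / \<epsilon>)"
    using t(2) unfolding T0 by simp_all
  show "\<bar>lead\<bar> / Gamma (1 + x_star) \<le> t powr (- \<epsilon> / 2)"
    using powr_neg_bound[OF _ \<epsilon>(1) t(1) t1(2)] G d by (simp add: G_def d_def)
  show "1 / (Gamma (1 + x_star) * \<bar>lead\<bar>) \<le> t powr (- \<epsilon> / 2)"
    using powr_neg_bound[OF _ \<epsilon>(1) t(1) t1(1)] G d by (simp add: G_def d_def)
  show "t powr (\<epsilon> / 2) \<le> 1 - \<epsilon>"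
    using powr_pos_bound[OF _ \<epsilon>(1) t(1) t1(3)] \<epsilon> by simp
qed

lemma good_timeI:
  assumes \<epsilon>: "0 < \<epsilon>" "\<epsilon> < 1" and TI: "0 < TI" "TI \<le> T0 P \<epsilon>"
    and est: "\<And>t. 0 < t \<Longrightarrow> t \<le> TI \<Longrightarrow>
      \<bar>mass t - mass 0 - lead * (t powr nu1 P / Gamma (1 + nu1 P))\<bar> < \<epsilon> * \<bar>lead\<bar> * (t powr nu1 P / Gamma (1 + nu1 P))"
  shows "good_time P \<epsilon> TI"
  unfolding good_time_def
proof (intro conjI ballI TI)
  fix t assume "t \<in> {0<..TI}"
  then have t: "0 < t" "t \<le> TI" "t \<le> T0 P \<epsilon>" "t \<le> tstar P" "t < 1"
    using TI T0_props(2)[OF \<epsilon>] T_pos by auto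
  have "\<bar>nu1 P - ln \<bar>mass t - mass 0\<bar> / ln t\<bar> < \<epsilon>"
  proof (rule log_quotient_bound[OF t(1,5) nu1_bounds \<epsilon> lead_nonzero])
    show "0 < Gamma (1 + x_star)" "Gamma (1 + x_star) \<le> 1" "Gamma (1 + x_star) \<le> Gamma (1 + nu1 P)"
      using Gamma_x_star nu1_bounds by auto
  qed (use T0_props[OF \<epsilon>] t est in auto)
  then show "\<bar>nu1 P - nu1a P t\<bar> < \<epsilon>" using nu1a_eq[of t] t by simp
qed

lemma good_time_exists:
  assumes \<epsilon>: "0 < \<epsilon>" "\<epsilon> < 1"
  shows "\<exists>TI. good_time P \<epsilon> TI"
proof -
  have "0 < \<epsilon> * \<bar>lead\<bar>" using \<epsilon> lead_nonzero by simp
  from small_time_estimate[OF this] obtain d where d: "0 < d"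
    "\<And>t. 0 < t \<Longrightarrow> t \<le> tstar P \<Longrightarrow> t < d \<Longrightarrow>
    \<bar>mass t - mass 0 - lead * (t powr nu1 P / Gamma (1 + nu1 P))\<bar> < \<epsilon> * \<bar>lead\<bar> * (t powr nu1 P / Gamma (1 + nu1 P))"
    by blast
  \<comment> \<open>The small-time estimate requires \<open>t < d\<close>, whereas a good time
    covers its right end point; hence \<open>d / 2\<close>.\<close>
  have "good_time P \<epsilon> (min (T0 P \<epsilon>) (d / 2))"
    by (rule good_timeI[OF \<epsilon>]) (use d T0_props(1,2)[OF \<epsilon>] in auto)
  then show ?thesis ..
qed

end

subsection \<open>Quantitative bounds\<close>

lemma in_C_time_sup_Cl_norm:
  assumes "in_C_time R S D l \<alpha> T v"
  shows "0 \<le> sup_Cl_norm S D l \<alpha> T v"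
    "t \<in> {0..T} \<Longrightarrow> Cl_norm S D l \<alpha> (\<lambda>x. v x t) \<le> sup_Cl_norm S D l \<alpha> T v"
proof -
  have b: "bdd_above ((\<lambda>t. Cl_norm S D l \<alpha> (\<lambda>x. v x t)) ` {0..T})" using assms by (simp add: in_C_time_def)
  show "0 \<le> sup_Cl_norm S D l \<alpha> T v" unfolding sup_Cl_norm_def by (rule Sup_insert_0(1)[OF b])
  show "Cl_norm S D l \<alpha> (\<lambda>x. v x t) \<le> sup_Cl_norm S D l \<alpha> T v" if "t \<in> {0..T}"
    unfolding sup_Cl_norm_def by (rule Sup_insert_0(2)[OF b]) (use that in auto)
qed

lemma in_aniso_norm_nonneg:
  fixes D :: "'n multiset \<Rightarrow> ('a::metric_space \<Rightarrow> real) \<Rightarrow> 'a \<Rightarrow> real"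
  assumes "in_aniso R S D l \<alpha> \<nu> T v"
  shows "0 \<le> aniso_norm S D l \<alpha> \<nu> T v"
proof -
  have "in_C_time R S D l \<alpha> T v" using assms by (simp add: in_aniso_def)
  from in_C_time_sup_Cl_norm(1)[OF this]
  have "0 \<le> sup_Cl_norm S D l \<alpha> T v" .
  moreover have "0 \<le> (\<Sum>\<beta> | size \<beta> \<le> l. time_seminorm ((real l + \<alpha> - real (size \<beta>)) / 2 * \<nu>) S T
           (\<lambda>x t. D \<beta> (\<lambda>y. v y t) x))"
  proof (rule sum_nonneg)
    fix \<beta> :: "'n multiset" assume "\<beta> \<in> {\<beta>. size \<beta> \<le> l}"
    then have "time_holder ((real l + \<alpha> - real (size \<beta>)) / 2 * \<nu>) S T (\<lambda>x t. D \<beta> (\<lambda>y. v y t) x)"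
      using assms unfolding in_aniso_def by blast
    then show "0 \<le> time_seminorm ((real l + \<alpha> - real (size \<beta>)) / 2 * \<nu>) S T (\<lambda>x t. D \<beta> (\<lambda>y. v y t) x)"
      by (rule time_seminorm_bounds(1))
  qed
  ultimately show ?thesis unfolding aniso_norm_def by simp
qed

text \<open>The one-sided derivative in \<open>time_deriv\<close> depends on the interval, while
  regularity is assumed on the longer one; the proof first checks that both derivatives agree on
  \<open>{0..\<tau>}\<close>.\<close>

lemma C1_holder_norm_nonneg:
  assumes f: "in_C1_holder \<nu> T f" and \<nu>: "1 < \<nu>" and \<tau>: "0 < \<tau>" "\<tau> \<le> T"
  shows "0 \<le> C1_holder_norm \<nu> \<tau> f"
proof -
  have eq: "time_deriv \<tau> f t = time_deriv T f t" if t: "t \<in> {0..\<tau>}" for t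
  proof (rule time_deriv_eqI[OF _ t \<tau>(1)])
    have "f differentiable (at t within {0..T})" using f t \<tau> by (auto simp: in_C1_holder_def)
    then have "(f has_vector_derivative time_deriv T f t) (at t within {0..T})"
      unfolding time_deriv_def by (rule iffD1[OF vector_derivative_works])
    then show "(f has_vector_derivative time_deriv T f t) (at t within {0..\<tau>})"
      by (rule has_vector_derivative_within_subset) (use \<tau> in auto)
  qed
  have h: "holder_on (\<nu> - 1) {0..\<tau>} (time_deriv \<tau> f)"
  proof -
    have "holder_on (\<nu> - 1) {0..T} (time_deriv T f)" using f by (simp add: in_C1_holder_def)
    then obtain C where "\<And>x y. x \<in> {0..T} \<Longrightarrow> y \<in> {0..T} \<Longrightarrow> \<bar>time_deriv T f x - time_deriv T f y\<bar> \<le> C * dist x y powr (\<nu> - 1)"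
      unfolding holder_on_def by blast
    then show ?thesis unfolding holder_on_def using eq \<tau> by (intro exI[of _ C]) auto
  qed
  have b: "\<exists>B. \<forall>x\<in>{0..\<tau>}. \<bar>g x\<bar> \<le> B" if "continuous_on {0..\<tau>} g" for g :: "real \<Rightarrow> real"
  proof -
    have "bounded (g ` {0..\<tau>})" by (intro compact_imp_bounded compact_continuous_image that) auto
    then obtain B where "\<forall>y\<in>g ` {0..\<tau>}. norm y \<le> B" unfolding bounded_iff by blast
    then show ?thesis by (intro exI[of _ B]) auto
  qed
  have fc: "continuous_on {0..\<tau>} f"
    by (rule continuous_on_subset[OF in_C1_holder_props(1)[OF f \<nu>]]) (use \<tau> in auto)
  have dc: "continuous_on {0..\<tau>} (time_deriv \<tau> f)"
    by (rule holder_on_continuous[OF h]) (use \<nu> in simp)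
  show ?thesis unfolding C1_holder_norm_def
    using sup_norm_bounds(1)[OF b[OF fc]] sup_norm_bounds(1)[OF b[OF dc]] holder_seminorm_bounds(1)[OF h] by simp
qed

context solved_problem
begin

lemma data_norm_nonneg: "0 \<le> data_norm P"
proof -
  have "in_par (dom P) 0 (alpha P) 1 (horizon P) (rhs P)" "in_par1_bd (dom P) (alpha P) (horizon P) (phi P)"
    "in_Cl (dom P) 2 (alpha P) (init P)"
    using hyps by (simp_all add: direct_hyps_def h4_def)
  then show ?thesis unfolding data_norm_def
    using in_aniso_norm_nonneg norm_Cl_bounds(1) by (intro add_nonneg_nonneg) blast+
qed

text \<open>For \<open>l = 0\<close> the only multi-index is empty, so the norm is a spatial part
  \<open>N1\<close> bounding the values plus one time seminorm \<open>N2\<close>. Keeping the two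
  apart allows each to be used with its own share of the norm.\<close>

lemma in_par_0_bounds:
  assumes v: "in_par (dom P) 0 (alpha P) \<nu> (horizon P) v"
  shows "\<exists>N1\<ge>0. \<exists>N2\<ge>0. N1 + N2 = norm_par (dom P) 0 (alpha P) \<nu> (horizon P) v \<and>
    (\<forall>x\<in>dom P. \<forall>t\<in>{0..horizon P}. \<bar>v x t\<bar> \<le> N1) \<and>
    (\<forall>x\<in>dom P. \<forall>t\<in>{0..horizon P}. \<forall>s\<in>{0..horizon P}. \<bar>v x t - v x s\<bar> \<le> N2 * \<bar>t - s\<bar> powr (alpha P * \<nu> / 2))"
proof -
  define N1 where "N1 = sup_Cl_norm (closure (dom P)) (D_cl (dom P)) 0 (alpha P) (horizon P) v"
  define w where "w = (\<lambda>x t. D_cl (dom P) {#} (\<lambda>y. v y t) x)"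
  define N2 where "N2 = time_seminorm (alpha P * \<nu> / 2) (closure (dom P)) (horizon P) w"
  have ct: "in_ct (dom P) 0 (alpha P) (horizon P) v" using v by (simp add: in_aniso_def)
  have w: "w x t = v x t" if "x \<in> dom P" "t \<in> {0..horizon P}" for x t
    unfolding w_def by (rule D_cl_empty_in_Cl[OF dom_props(1) in_ct_slice[OF ct that(2)]]) (use that closure_subset in auto)
  have th: "time_holder (alpha P * \<nu> / 2) (closure (dom P)) (horizon P) w"
    using v unfolding in_aniso_def w_def by (auto dest: spec[of _ "{#}"])
  have "{\<beta> :: 'n multiset. size \<beta> \<le> 0} = {{#}}" by auto
  then have sum: "N1 + N2 = norm_par (dom P) 0 (alpha P) \<nu> (horizon P) v"
    unfolding aniso_norm_def N1_def N2_def w_def by simp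
  have n1: "0 \<le> N1" unfolding N1_def by (rule in_C_time_sup_Cl_norm(1)[OF ct])
  have n2: "0 \<le> N2" unfolding N2_def by (rule time_seminorm_bounds(1)[OF th])
  have b1: "\<bar>v x t\<bar> \<le> N1" if x: "x \<in> dom P" and t: "t \<in> {0..horizon P}" for x t
  proof -
    have "\<bar>w x t\<bar> \<le> norm_Cl (dom P) 0 (alpha P) (\<lambda>y. v y t)"
      unfolding w_def by (rule norm_Cl_bounds(2)[OF in_ct_slice[OF ct t]]) (use x closure_subset in auto)
    also have "\<dots> \<le> N1" unfolding N1_def by (rule in_C_time_sup_Cl_norm(2)[OF ct t])
    finally show ?thesis using w[OF x t] by simp
  qed
  have b2: "\<bar>v x t - v x s\<bar> \<le> N2 * \<bar>t - s\<bar> powr (alpha P * \<nu> / 2)"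
    if x: "x \<in> dom P" and t: "t \<in> {0..horizon P}" and s: "s \<in> {0..horizon P}" for x t s
    using time_seminorm_bounds(2)[OF th _ t s, of x] x closure_subset[of "dom P"]
    unfolding w[OF x t] w[OF x s] N2_def by blast
  show ?thesis using n1 n2 sum b1 b2 by blast
qed

text \<open>Every summand of the estimated norm is nonnegative, so the retained ones are bounded by
  the same right-hand side.\<close>

lemma apriori_bounds:
  assumes "apriori P C"
  shows "\<exists>N1\<ge>0. \<exists>N2\<ge>0. N1 + N2 \<le> C * data_norm P \<and>
    (\<forall>x\<in>dom P. \<forall>t\<in>{0..horizon P}. \<bar>caputo (nu1 P) (horizon P) (u x) t\<bar> \<le> N1) \<and>
    (\<forall>x\<in>dom P. \<forall>t\<in>{0..horizon P}. \<forall>s\<in>{0..horizon P}.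
       \<bar>caputo (nu1 P) (horizon P) (u x) t - caputo (nu1 P) (horizon P) (u x) s\<bar> \<le> N2 * \<bar>t - s\<bar> powr (alpha P * nu1 P / 2))"
    and "x \<in> dom P \<Longrightarrow> t \<in> {0..horizon P} \<Longrightarrow> \<bar>u x t\<bar> \<le> C * data_norm P"
proof -
  define v where "v = (\<lambda>x. caputo (nu1 P) (horizon P) (u x))"
  have one: "1 \<in> {1..M P}" using M_pos by simp
  have v: "in_par (dom P) 0 (alpha P) (nu1 P) (horizon P) v" unfolding v_def by (rule caputo_u(2)[OF one])
  have bound: "norm_par2 (dom P) (alpha P) (nu1 P) (horizon P) u
        + (\<Sum>i=2..M P. norm_par (dom P) 0 (alpha P) (nu1 P) (horizon P)
              (\<lambda>x. caputo (orders P i) (horizon P) (u x))) \<le> C * data_norm P"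
    using assms hyps sol unfolding apriori_def by blast
  have s1: "0 \<le> (\<Sum>i=2..M P. norm_par (dom P) 0 (alpha P) (nu1 P) (horizon P)
              (\<lambda>x. caputo (orders P i) (horizon P) (u x)))"
    by (rule sum_nonneg, rule in_aniso_norm_nonneg, rule caputo_u(2)) auto
  define S where "S = sup_Cl_norm (closure (dom P)) (D_cl (dom P)) 2 (alpha P) (horizon P) u"
  have S: "0 \<le> S" unfolding S_def by (rule in_C_time_sup_Cl_norm(1)[OF u_ct])
  have s2: "0 \<le> (\<Sum>\<beta> | size \<beta> \<in> {1, 2}. time_seminorm ((2 + alpha P - real (size \<beta>)) / 2 * nu1 P) (closure (dom P)) (horizon P)
           (\<lambda>x t. D_cl (dom P) \<beta> (\<lambda>y. u y t) x))"
  proof (rule sum_nonneg)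
    fix \<beta> :: "'n multiset" assume "\<beta> \<in> {\<beta>. size \<beta> \<in> {1, 2}}"
    then have "time_holder ((2 + alpha P - real (size \<beta>)) / 2 * nu1 P) (closure (dom P)) (horizon P)
           (\<lambda>x t. D_cl (dom P) \<beta> (\<lambda>y. u y t) x)"
      using sol unfolding classical_solution_def in_par2_def by blast
    then show "0 \<le> time_seminorm ((2 + alpha P - real (size \<beta>)) / 2 * nu1 P) (closure (dom P)) (horizon P)
           (\<lambda>x t. D_cl (dom P) \<beta> (\<lambda>y. u y t) x)" by (rule time_seminorm_bounds(1))
  qed
  have Sv: "S + norm_par (dom P) 0 (alpha P) (nu1 P) (horizon P) v \<le> C * data_norm P"
    using bound s1 s2 unfolding norm_par2_def S_def v_def by linarith
  show "\<exists>N1\<ge>0. \<exists>N2\<ge>0. N1 + N2 \<le> C * data_norm P \<and>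
    (\<forall>x\<in>dom P. \<forall>t\<in>{0..horizon P}. \<bar>caputo (nu1 P) (horizon P) (u x) t\<bar> \<le> N1) \<and>
    (\<forall>x\<in>dom P. \<forall>t\<in>{0..horizon P}. \<forall>s\<in>{0..horizon P}.
       \<bar>caputo (nu1 P) (horizon P) (u x) t - caputo (nu1 P) (horizon P) (u x) s\<bar> \<le> N2 * \<bar>t - s\<bar> powr (alpha P * nu1 P / 2))"
  proof -
    obtain N1 N2 where N: "0 \<le> N1" "0 \<le> N2" "N1 + N2 = norm_par (dom P) 0 (alpha P) (nu1 P) (horizon P) v"
      "\<forall>x\<in>dom P. \<forall>t\<in>{0..horizon P}. \<bar>v x t\<bar> \<le> N1"
      "\<forall>x\<in>dom P. \<forall>t\<in>{0..horizon P}. \<forall>s\<in>{0..horizon P}. \<bar>v x t - v x s\<bar> \<le> N2 * \<bar>t - s\<bar> powr (alpha P * nu1 P / 2)"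
      using in_par_0_bounds[OF v] by (elim exE conjE) (rule that)
    have "N1 + N2 \<le> C * data_norm P" using N(3) Sv S by linarith
    then show ?thesis using N(1,2,4,5) unfolding v_def by (intro exI[of _ N1] exI[of _ N2] conjI)
  qed
  show "\<bar>u x t\<bar> \<le> C * data_norm P" if x: "x \<in> dom P" and t: "t \<in> {0..horizon P}"
  proof -
    have xc: "x \<in> closure (dom P)" using x closure_subset by auto
    note sl = in_ct_slice[OF u_ct t]
    have "\<bar>D_cl (dom P) {#} (\<lambda>y. u y t) x\<bar> \<le> norm_Cl (dom P) 2 (alpha P) (\<lambda>y. u y t)"
      by (rule norm_Cl_bounds(2)[OF sl _ xc]) simp
    also have "\<dots> \<le> S" unfolding S_def by (rule in_C_time_sup_Cl_norm(2)[OF u_ct t])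
    also have "\<dots> \<le> C * data_norm P" using Sv in_aniso_norm_nonneg[OF v] by linarith
    finally show ?thesis using D_cl_empty_in_Cl[OF dom_props(1) sl xc] by simp
  qed
qed

end

section \<open>Explicit good times\<close>

context observed_problem
begin

text \<open>Zero data norm would force the solution, hence the mass, to vanish, contradicting the
  expansion with nonzero \<open>lead\<close>. Positivity matters because the explicit time divides
  by this norm.\<close>

lemma data_norm_pos:
  assumes "apriori P C"
  shows "0 < data_norm P"
proof (rule ccontr)
  assume "\<not> 0 < data_norm P"
  then have "data_norm P = 0" using data_norm_nonneg by simp
  then have u0: "u x t = 0" if "x \<in> dom P" "t \<in> {0..horizon P}" for x t
    using apriori_bounds(2)[OF assms that] by simp
  have m0: "mass t = 0" if t: "t \<in> {0..horizon P}" for t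
  proof -
    have "(\<lambda>x. indicator (dom P) x * weighted P u x t) = (\<lambda>x. 0)"
    proof
      fix x show "indicator (dom P) x * weighted P u x t = 0"
        using u0[of x t] t by (cases "x \<in> dom P"; cases "ftype P") (auto simp: weighted_def)
    qed
    then show ?thesis unfolding mass_def by simp
  qed
  have "0 < \<bar>lead\<bar>" using lead_nonzero by simp
  from small_time_estimate[OF this] obtain d where d: "0 < d" "\<And>t. 0 < t \<Longrightarrow> t \<le> tstar P \<Longrightarrow> t < d \<Longrightarrow>
    \<bar>mass t - mass 0 - lead * (t powr nu1 P / Gamma (1 + nu1 P))\<bar> < \<bar>lead\<bar> * (t powr nu1 P / Gamma (1 + nu1 P))"
    by blast
  define t where "t = min (tstar P) (d / 2)"
  have t: "0 < t" "t \<le> tstar P" "t < d" using d T_pos by (auto simp: t_def)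
  define \<kappa> where "\<kappa> = t powr nu1 P / Gamma (1 + nu1 P)"
  have k: "0 < \<kappa>" unfolding \<kappa>_def using t(1) nu1_bounds Gamma_real_pos[of "1 + nu1 P"] by simp
  have "\<bar>mass t - mass 0 - lead * \<kappa>\<bar> < \<bar>lead\<bar> * \<kappa>" unfolding \<kappa>_def by (rule d(2)[OF t])
  moreover have "mass t = 0" "mass 0 = 0" using m0 t T_pos by auto
  ultimately show False using k by (simp add: abs_mult)
qed

lemma explicit_time_eq:
  "explicit_time P \<epsilon> C0 C1 C2 = \<epsilon> * \<bar>lead\<bar> / (C4 P C0 C1 C2 * data_norm P)"
proof (cases "ftype P")
  case TypeI
  then have r: "0 < rho P 1 0" and "\<bar>lead\<bar> = \<bar>C_nu P 0\<bar> / rho P 1 0"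
    using lead_weight_pos by (simp_all add: lead_def lead_weight_def)
  then have C: "\<bar>C_nu P 0\<bar> = \<bar>lead\<bar> * rho P 1 0" by (simp add: field_simps)
  have "explicit_time P \<epsilon> C0 C1 C2 = \<epsilon> * \<bar>C_nu P 0\<bar> / (C4 P C0 C1 C2 * rho P 1 0 * data_norm P)"
    using TypeI by (simp add: explicit_time_def)
  also have "\<dots> = \<epsilon> * \<bar>lead\<bar> / (C4 P C0 C1 C2 * data_norm P)" unfolding C using r by simp
  finally show ?thesis .
next
  case TypeII
  then show ?thesis by (simp add: explicit_time_def lead_def lead_weight_def)
qed

text \<open>For \<open>t < 1\<close> a smaller exponent \<open>q\<close> gives a larger power, so
  \<open>t powr (alpha P * nu1 P / 2) \<le> t powr q\<close>, which is at most the explicit time.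
  Multiplied by \<open>Z\<close>, strictly below \<open>C4 * data_norm\<close>, this is strictly
  below \<open>\<epsilon> * \<bar>lead\<bar>\<close>.\<close>

lemma explicit_good_time:
  assumes \<epsilon>: "0 < \<epsilon>" "\<epsilon> < 1" and Z: "0 \<le> Z" "Z < C4 P C0 C1 C2 * data_norm P"
    and est: "\<And>t. 0 < t \<Longrightarrow> t \<le> tstar P \<Longrightarrow>
      \<bar>mass t - mass 0 - lead * (t powr nu1 P / Gamma (1 + nu1 P))\<bar>
        \<le> Z * t powr (alpha P * nu1 P / 2) * (t powr nu1 P / Gamma (1 + nu1 P))"
    and q: "0 < q" "q \<le> alpha P * nu1 P / 2"
    and TI: "0 < TI" "TI \<le> T0 P \<epsilon>" "TI \<le> explicit_time P \<epsilon> C0 C1 C2 powr (1 / q)"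
  shows "good_time P \<epsilon> TI"
proof (rule good_timeI[OF \<epsilon> TI(1,2)])
  fix t assume t: "0 < t" "t \<le> TI"
  define E where "E = explicit_time P \<epsilon> C0 C1 C2"
  have ts: "t \<le> tstar P" "t < 1" using t TI(2) T0_props(2)[OF \<epsilon>] T_pos by auto
  have CR: "0 < C4 P C0 C1 C2 * data_norm P" using Z by linarith
  have E: "E = \<epsilon> * \<bar>lead\<bar> / (C4 P C0 C1 C2 * data_norm P)" unfolding E_def by (rule explicit_time_eq)
  have E0: "0 < E" unfolding E using CR \<epsilon> lead_nonzero by simp
  have "t powr (alpha P * nu1 P / 2) \<le> t powr q"
    by (rule powr_mono') (use t ts q in auto)
  also have "\<dots> \<le> (E powr (1 / q)) powr q"
    by (rule powr_mono2) (use t TI(3) q E_def in auto)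
  also have "\<dots> = E" using E0 q by (simp add: powr_powr)
  finally have tE: "t powr (alpha P * nu1 P / 2) \<le> E" .
  have "Z * t powr (alpha P * nu1 P / 2) \<le> Z * E" by (rule mult_left_mono[OF tE Z(1)])
  also have "\<dots> < (C4 P C0 C1 C2 * data_norm P) * E" by (rule mult_strict_right_mono[OF Z(2) E0])
  also have "\<dots> = \<epsilon> * \<bar>lead\<bar>" unfolding E using less_imp_neq[OF CR] by (metis nonzero_mult_div_cancel_left times_divide_eq_right)
  finally have "Z * t powr (alpha P * nu1 P / 2) < \<epsilon> * \<bar>lead\<bar>" .
  moreover have "0 < t powr nu1 P / Gamma (1 + nu1 P)"
    using t(1) nu1_bounds Gamma_real_pos[of "1 + nu1 P"] by simp
  ultimately have "Z * t powr (alpha P * nu1 P / 2) * (t powr nu1 P / Gamma (1 + nu1 P))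
      < \<epsilon> * \<bar>lead\<bar> * (t powr nu1 P / Gamma (1 + nu1 P))"
    by (rule mult_strict_right_mono)
  with est[OF t(1) ts(1)]
  show "\<bar>mass t - mass 0 - lead * (t powr nu1 P / Gamma (1 + nu1 P))\<bar> < \<epsilon> * \<bar>lead\<bar> * (t powr nu1 P / Gamma (1 + nu1 P))"
    by linarith
qed

text \<open>The time seminorm in the a priori estimate is a modulus of continuity of the leading
  derivative with exponent \<open>alpha P * nu1 P / 2\<close>, uniform in \<open>x\<close>, as
  required by \<open>mass_asymptotics\<close>.\<close>

lemma estimate_TypeI:
  assumes ty: "ftype P = TypeI" and ap: "apriori P C"
  shows "\<exists>Z\<ge>0. Z \<le> vol * C * data_norm P \<and> (\<forall>t. 0 < t \<and> t \<le> tstar P \<longrightarrow>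
      \<bar>mass t - mass 0 - lead * (t powr nu1 P / Gamma (1 + nu1 P))\<bar>
        \<le> Z * t powr (alpha P * nu1 P / 2) * (t powr nu1 P / Gamma (1 + nu1 P)))"
proof -
  obtain N1 N2 where N: "0 \<le> N1" "0 \<le> N2" "N1 + N2 \<le> C * data_norm P"
    and N2: "\<forall>x\<in>dom P. \<forall>t\<in>{0..horizon P}. \<forall>s\<in>{0..horizon P}.
       \<bar>caputo (nu1 P) (horizon P) (u x) t - caputo (nu1 P) (horizon P) (u x) s\<bar> \<le> N2 * \<bar>t - s\<bar> powr (alpha P * nu1 P / 2)"
    using apriori_bounds(1)[OF ap] by (elim exE conjE) (rule that)
  have w: "weighted P u x = u x" for x using ty by (simp add: weighted_def fun_eq_iff)
  show ?thesis
  proof (intro exI[of _ "N2 * vol"] conjI allI impI)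
    show "0 \<le> N2 * vol" using N vol_nonneg by simp
    have "N2 \<le> C * data_norm P" using N by linarith
    from mult_right_mono[OF this vol_nonneg] show "N2 * vol \<le> vol * C * data_norm P" by (simp add: mult_ac)
    fix t assume t: "0 < t \<and> t \<le> tstar P"
    have "\<bar>mass t - mass 0 - lead * (t powr nu1 P / Gamma (1 + nu1 P))\<bar>
      \<le> (N2 * t powr (alpha P * nu1 P / 2)) * vol * (t powr nu1 P / Gamma (1 + nu1 P))"
    proof (rule mass_asymptotics)
      fix x s assume x: "x \<in> dom P" and s: "0 \<le> s" "s \<le> t"
      have sz: "s \<in> {0..horizon P}" "0 \<in> {0..horizon P}" using s t T_pos by auto
      have "\<bar>caputo (nu1 P) (horizon P) (u x) s - caputo (nu1 P) (horizon P) (u x) 0\<bar> \<le> N2 * \<bar>s - 0\<bar> powr (alpha P * nu1 P / 2)"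
        using N2 x sz by blast
      also have "\<dots> \<le> N2 * t powr (alpha P * nu1 P / 2)"
        by (intro mult_left_mono powr_mono2 N(2)) (use s alpha_props nu1_bounds in auto)
      finally show "\<bar>caputo (nu1 P) (horizon P) (weighted P u x) s - caputo (nu1 P) (horizon P) (weighted P u x) 0\<bar>
         \<le> N2 * t powr (alpha P * nu1 P / 2)" unfolding w .
    qed (use t in auto)
    then show "\<bar>mass t - mass 0 - lead * (t powr nu1 P / Gamma (1 + nu1 P))\<bar>
        \<le> N2 * vol * t powr (alpha P * nu1 P / 2) * (t powr nu1 P / Gamma (1 + nu1 P))"
      by (simp only: mult_ac)
  qed
qed

section \<open>The Caputo derivative of the observation, for the II type operator\<close>

lemma u_bounded: "\<exists>B. \<forall>x\<in>closure (dom P). \<forall>s\<in>{0..horizon P}. \<bar>u x s\<bar> \<le> B"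
proof -
  have "compact (closure (dom P) \<times> {0..horizon P})"
    using dom_props(2) by (intro compact_Times) auto
  then have "bounded ((\<lambda>(x, t). u x t) ` (closure (dom P) \<times> {0..horizon P}))"
    by (intro compact_imp_bounded compact_continuous_image in_ct_continuous_joint[OF dom_props(1) u_ct])
  then obtain B where "\<forall>y\<in>(\<lambda>(x, t). u x t) ` (closure (dom P) \<times> {0..horizon P}). norm y \<le> B"
    unfolding bounded_iff by blast
  then show ?thesis by (intro exI[of _ B]) auto
qed

text \<open>Fubini for the spatial integral and the singular time kernel, justified by boundedness
  of the solution and integrability of the kernel.\<close>

lemma frac_int_psi:
  assumes t: "t \<in> {0..tstar P}" and \<theta>: "0 < \<theta>" "\<theta> < 1" and psi: "continuous_on {0..tstar P} (psi P)"
  shows "integrable lborel (\<lambda>x. indicator (dom P) x * frac_int \<theta> (u x) t)"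
    and "frac_int \<theta> (psi P) t = (\<integral>x. indicator (dom P) x * frac_int \<theta> (u x) t \<partial>lborel)"
proof -
  define \<Omega> where "\<Omega> = dom P"
  define T where "T = horizon P"
  have T: "0 < T" "tstar P < T" "0 < tstar P" using T_pos by (auto simp: T_def)
  \<comment> \<open>Clamped times keep the arguments of \<open>u\<close> in the cylinder, so the
    integrand is Borel and bounded for every real \<open>s\<close>.\<close>
  define cl where "cl s = max 0 (min T s)" for s
  have cl: "cl s \<in> {0..T}" for s using T by (auto simp: cl_def)
  obtain B where B: "\<And>x s. x \<in> closure \<Omega> \<Longrightarrow> s \<in> {0..T} \<Longrightarrow> \<bar>u x s\<bar> \<le> B"
    using u_bounded unfolding \<Omega>_def T_def by blast
  define U where "U p = indicator (\<Omega> \<times> {0..T}) p * (case p of (x, s) \<Rightarrow> u x s - u x 0)" for p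
  have Um: "U \<in> borel_measurable borel"
    unfolding U_def
  proof (rule borel_measurable_indicator_continuous)
    show "\<Omega> \<times> {0..T} \<in> sets borel" using dom_props(1) by (intro borel_Times) (auto simp: \<Omega>_def)
    have c: "continuous_on (closure \<Omega> \<times> {0..T}) (\<lambda>(x, s). u x s)"
      unfolding \<Omega>_def T_def by (rule in_ct_continuous_joint[OF dom_props(1) u_ct])
    have sub: "\<Omega> \<times> {0..T} \<subseteq> closure \<Omega> \<times> {0..T}" using closure_subset by blast
    have c1: "continuous_on (\<Omega> \<times> {0..T}) (\<lambda>p. case p of (x, s) \<Rightarrow> u x s)" by (rule continuous_on_subset[OF c sub])
    have c2: "continuous_on (\<Omega> \<times> {0..T}) (\<lambda>p. case (fst p, 0) of (x, s) \<Rightarrow> u x s)"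
      by (rule continuous_on_compose2[OF c]) (use T sub in \<open>auto intro!: continuous_intros\<close>)
    have "continuous_on (\<Omega> \<times> {0..T}) (\<lambda>p. (case p of (x, s) \<Rightarrow> u x s) - (case (fst p, 0) of (x, s) \<Rightarrow> u x s))"
      by (rule continuous_on_diff[OF c1 c2])
    then show "continuous_on (\<Omega> \<times> {0..T}) (\<lambda>p. case p of (x, s) \<Rightarrow> u x s - u x 0)"
      by (simp add: case_prod_unfold)
  qed
  have Ueq: "U (x, cl s) = indicator \<Omega> x * (u x (cl s) - u x 0)" for x s
    using cl[of s] by (simp add: U_def indicator_def)
  have Ub: "\<bar>U (x, cl s)\<bar> \<le> indicator \<Omega> x * (2 * B)" for x s
  proof (cases "x \<in> \<Omega>")
    case True
    then have "x \<in> closure \<Omega>" using closure_subset by auto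
    from B[OF this cl[of s]] B[OF this, of 0] T True show ?thesis by (simp add: Ueq)
  qed (simp add: Ueq)
  define F where "F = (\<lambda>(s, x). (indicator {0..t} s * (t - s) powr (- \<theta>)) * U (x, cl s))"
  have clm[measurable]: "cl \<in> borel_measurable borel" unfolding cl_def by measurable
  have FM: "F \<in> borel_measurable (lborel \<Otimes>\<^sub>M lborel)"
  proof -
    have "(\<lambda>p. U (snd p, cl (fst p))) \<in> borel_measurable (lborel \<Otimes>\<^sub>M lborel)"
      by (rule measurable_compose[OF _ Um]) measurable
    then show ?thesis unfolding F_def case_prod_unfold by measurable
  qed
  have Ui: "integrable lborel (\<lambda>x. U (x, cl s))" for s
  proof -
    have "integrable lborel (\<lambda>x. indicator (dom P) x * u x s')" if "s' \<in> {0..T}" for s'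
      by (rule set_lebesgue_continuous_on_closure(1)[OF dom_props(1,2) in_Cl_continuous[OF in_ct_slice[OF u_ct]]])
         (use that in \<open>simp add: T_def\<close>)
    from this[OF cl[of s]] this[of 0] T show ?thesis by (simp add: Ueq \<Omega>_def right_diff_distrib)
  qed
  have kp: "integrable lborel (\<lambda>s. indicator {0..t} s * (1 * (t - s) powr (1 - \<theta> - 1)))"
    by (rule integrable_powr_kernel[where B = 1]) (use \<theta> t in auto)
  have Fi: "integrable (lborel \<Otimes>\<^sub>M lborel) F"
  proof (rule lborel_pair.Fubini_integrable[OF FM])
    show "AE s in lborel. integrable lborel (\<lambda>x. F (s, x))"
      unfolding F_def by (simp add: Ui)
    show "integrable lborel (\<lambda>s. \<integral>x. norm (F (s, x)) \<partial>lborel)"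
    proof (rule Bochner_Integration.integrable_bound)
      show "integrable lborel (\<lambda>s. (2 * B * vol) * (indicator {0..t} s * (1 * (t - s) powr (1 - \<theta> - 1))))"
        by (intro integrable_mult_right kp)
      show "(\<lambda>s. \<integral>x. norm (F (s, x)) \<partial>lborel) \<in> borel_measurable lborel"
        using FM by measurable
      show "AE s in lborel. norm (\<integral>x. norm (F (s, x)) \<partial>lborel)
          \<le> norm ((2 * B * vol) * (indicator {0..t} s * (1 * (t - s) powr (1 - \<theta> - 1))))"
      proof (rule AE_I2)
        fix s :: real
        define k where "k = indicator {0..t} s * (t - s) powr (- \<theta>)"
        have k0: "0 \<le> k" by (simp add: k_def)
        have "(\<integral>x. norm (F (s, x)) \<partial>lborel) = k * (\<integral>x. \<bar>U (x, cl s)\<bar> \<partial>lborel)"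
          by (simp add: F_def abs_mult k_def)
        moreover have "(\<integral>x. \<bar>U (x, cl s)\<bar> \<partial>lborel) \<le> (\<integral>x. indicator (dom P) x * (2 * B) \<partial>lborel)"
          by (rule integral_mono[OF integrable_abs[OF Ui] integral_const_dom(1)]) (use Ub \<Omega>_def in auto)
        then have "(\<integral>x. \<bar>U (x, cl s)\<bar> \<partial>lborel) \<le> 2 * B * vol" unfolding integral_const_dom(2) .
        from mult_left_mono[OF this k0]
        have "k * (\<integral>x. \<bar>U (x, cl s)\<bar> \<partial>lborel) \<le> k * (2 * B * vol)" .
        moreover have "0 \<le> (\<integral>x. norm (F (s, x)) \<partial>lborel)" by simp
        ultimately have "(\<integral>x. norm (F (s, x)) \<partial>lborel) \<le> k * (2 * B * vol)" "0 \<le> (\<integral>x. norm (F (s, x)) \<partial>lborel)"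
          by simp_all
        moreover have eqk: "(2 * B * vol) * (indicator {0..t} s * (1 * (t - s) powr (1 - \<theta> - 1))) = k * (2 * B * vol)"
          by (simp add: k_def mult_ac)
        ultimately show "norm (\<integral>x. norm (F (s, x)) \<partial>lborel)
          \<le> norm ((2 * B * vol) * (indicator {0..t} s * (1 * (t - s) powr (1 - \<theta> - 1))))"
          unfolding eqk unfolding real_norm_def by linarith
      qed
    qed
  qed
  have inner_s: "(\<integral>s. F (s, x) \<partial>lborel) = indicator (dom P) x * frac_int \<theta> (u x) t" for x
  proof (cases "x \<in> dom P")
    case True
    then have xc: "x \<in> closure (dom P)" using closure_subset by auto
    have "frac_int \<theta> (u x) t = (\<integral>s. indicator {0..t} s * ((u x (max 0 (min (horizon P) s)) - u x 0) * (t - s) powr (- \<theta>)) \<partial>lborel)"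
      by (rule frac_int_eq_lborel[OF u_time[OF xc]]) (use t T_pos in auto)
    also have "\<dots> = (\<integral>s. F (s, x) \<partial>lborel)"
      by (rule Bochner_Integration.integral_cong[OF refl])
         (simp only: F_def prod.case Ueq, use True in \<open>simp add: \<Omega>_def cl_def T_def mult_ac\<close>)
    finally show ?thesis using True by simp
  next
    case False
    have "F (s, x) = 0" for s using False by (simp add: F_def Ueq \<Omega>_def)
    then have "(\<lambda>s. F (s, x)) = (\<lambda>s. 0)" by (rule ext)
    then show ?thesis using False by simp
  qed
  have inner_x: "(\<integral>x. F (s, x) \<partial>lborel)
      = indicator {0..t} s * ((psi P (max 0 (min (tstar P) s)) - psi P 0) * (t - s) powr (- \<theta>))" for s
  proof (cases "s \<in> {0..t}")
    case True
    have s: "s \<in> {0..tstar P}" "0 \<in> {0..tstar P}" "cl s = s" "max 0 (min (tstar P) s) = s"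
      using True t T by (auto simp: cl_def)
    have "(\<integral>x. U (x, cl s) \<partial>lborel) = psi P s - psi P 0"
      unfolding Ueq unfolding s(3) psi_eq(1)[OF s(1)] psi_eq(1)[OF s(2)] \<Omega>_def
      using psi_eq(2)[OF s(1)] psi_eq(2)[OF s(2)] by (simp add: right_diff_distrib)
    then show ?thesis using True by (simp add: F_def s(4) mult_ac)
  next
    case False
    then show ?thesis by (simp add: F_def)
  qed
  have Fi': "integrable (lborel \<Otimes>\<^sub>M lborel) (\<lambda>(x, s). F (s, x))"
    using Fi by (subst lborel_pair.integrable_product_swap_iff)
  show "integrable lborel (\<lambda>x. indicator (dom P) x * frac_int \<theta> (u x) t)"
    using lborel_pair.integrable_fst'[OF Fi'] by (simp add: inner_s)
  have "frac_int \<theta> (psi P) t = (\<integral>s. (\<integral>x. F (s, x) \<partial>lborel) \<partial>lborel)"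
    unfolding inner_x by (rule frac_int_eq_lborel[OF psi]) (use t T in auto)
  also have "\<dots> = (\<integral>x. (\<integral>s. F (s, x) \<partial>lborel) \<partial>lborel)"
    using lborel_pair.Fubini_integral[of "\<lambda>s x. F (s, x)"] Fi by simp
  finally show "frac_int \<theta> (psi P) t = (\<integral>x. indicator (dom P) x * frac_int \<theta> (u x) t \<partial>lborel)"
    unfolding inner_s .
qed

text \<open>Differentiation under the spatial integral. The Hoelder bound in time makes the
  remainder of the first order expansion of \<open>frac_int\<close> uniform in \<open>x\<close>, so
  the integrated quotient converges. The derivative of the observation is taken on
  \<open>{0..tstar P}\<close>, that of the solution on \<open>{0..horizon P}\<close>.\<close>

lemma caputo_psi:
  assumes psi: "continuous_on {0..tstar P} (psi P)" and t: "t \<in> {0..tstar P}" and N: "0 \<le> N"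
    and \<beta>: "0 < \<beta>" and N2: "\<And>x t s. x \<in> dom P \<Longrightarrow> t \<in> {0..horizon P} \<Longrightarrow> s \<in> {0..horizon P} \<Longrightarrow>
       \<bar>caputo (nu1 P) (horizon P) (u x) t - caputo (nu1 P) (horizon P) (u x) s\<bar> \<le> N * \<bar>t - s\<bar> powr \<beta>"
  shows "integrable lborel (\<lambda>x. indicator (dom P) x * caputo (nu1 P) (horizon P) (u x) t)"
    and "caputo (nu1 P) (tstar P) (psi P) t = (\<integral>x. indicator (dom P) x * caputo (nu1 P) (horizon P) (u x) t \<partial>lborel)"
proof -
  define \<gamma> where "\<gamma> = Gamma (1 - nu1 P)"
  define D where "D x s = caputo (nu1 P) (horizon P) (u x) s" for x s
  define f where "f x s = frac_int (nu1 P) (u x) s" for x s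
  have \<gamma>: "0 < \<gamma>" unfolding \<gamma>_def by (rule Gamma_real_pos) (use nu1_bounds in simp)
  have one: "1 \<in> {1..M P}" using M_pos by simp
  have tT: "t \<in> {0..horizon P}" using t T_pos by auto
  show Di: "integrable lborel (\<lambda>x. indicator (dom P) x * caputo (nu1 P) (horizon P) (u x) t)"
    by (rule set_lebesgue_continuous_on_closure(1)[OF dom_props(1,2) in_Cl_continuous[OF in_ct_slice[OF caputo_u_ct[OF one] tT]]])
  \<comment> \<open>Mean value inequality for \<open>f x\<close> minus its linear part at
    \<open>t\<close>; the derivative of the difference is bounded by the Hoelder modulus over the
    segment between \<open>t\<close> and \<open>s\<close>.\<close>
  have point: "\<bar>f x s - f x t - (s - t) * (\<gamma> * D x t)\<bar> \<le> \<gamma> * N * \<bar>s - t\<bar> powr \<beta> * \<bar>s - t\<bar>"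
    if x: "x \<in> dom P" and s: "s \<in> {0..tstar P}" for x s
  proof -
    have xc: "x \<in> closure (dom P)" using x closure_subset by auto
    define g where "g r = f x r - r * (\<gamma> * D x t)" for r
    have sub: "closed_segment t s \<subseteq> {0..horizon P}"
      using t s T_pos by (intro closed_segment_subset) auto
    have gd: "(g has_field_derivative \<gamma> * (D x r - D x t)) (at r within closed_segment t s)"
      if r: "r \<in> closed_segment t s" for r
    proof -
      have "(f x has_real_derivative \<gamma> * D x r) (at r within {0..horizon P})"
        using has_vector_derivative_frac_int[OF caputo_u(1)[OF one xc] _ nu1_bounds(2), of r] r sub
        by (auto simp: f_def[abs_def] D_def \<gamma>_def has_real_derivative_iff_has_vector_derivative)
      then have "(f x has_real_derivative \<gamma> * D x r) (at r within closed_segment t s)"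
        by (rule has_field_derivative_subset[OF _ sub])
      then show ?thesis unfolding g_def by (auto intro!: derivative_eq_intros simp: algebra_simps)
    qed
    have gb: "norm (\<gamma> * (D x r - D x t)) \<le> \<gamma> * (N * \<bar>s - t\<bar> powr \<beta>)" if r: "r \<in> closed_segment t s" for r
    proof -
      have "\<bar>D x r - D x t\<bar> \<le> N * \<bar>r - t\<bar> powr \<beta>" unfolding D_def by (rule N2[OF x _ tT]) (use r sub in auto)
      also have "\<dots> \<le> N * \<bar>s - t\<bar> powr \<beta>"
        by (intro mult_left_mono powr_mono2 N) (use r \<beta> in \<open>auto simp: closed_segment_eq_real_ivl split: if_splits\<close>)
      finally show ?thesis using \<gamma> by (simp add: abs_mult)
    qed
    have "norm (g s - g t) \<le> \<gamma> * (N * \<bar>s - t\<bar> powr \<beta>) * norm (s - t)"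
      by (rule field_differentiable_bound[OF _ gd gb]) auto
    then show ?thesis by (simp add: g_def algebra_simps)
  qed
  have fi: "integrable lborel (\<lambda>x. indicator (dom P) x * f x s)"
    and fv: "frac_int (nu1 P) (psi P) s = (\<integral>x. indicator (dom P) x * f x s \<partial>lborel)" if s: "s \<in> {0..tstar P}" for s
    unfolding f_def by (rule frac_int_psi[OF s nu1_bounds psi])+
  define L where "L = (\<integral>x. indicator (dom P) x * D x t \<partial>lborel)"
  have Di': "integrable lborel (\<lambda>x. indicator (dom P) x * D x t)" using Di by (simp add: D_def)
  have quot: "\<bar>(frac_int (nu1 P) (psi P) s - frac_int (nu1 P) (psi P) t) - (s - t) * (\<gamma> * L)\<bar>
      \<le> (\<gamma> * N * \<bar>s - t\<bar> powr \<beta> * \<bar>s - t\<bar>) * vol" if s: "s \<in> {0..tstar P}" for s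
  proof -
    let ?g = "\<lambda>x. indicator (dom P) x * f x s - indicator (dom P) x * f x t - (s - t) * (\<gamma> * (indicator (dom P) x * D x t))"
    have gi: "integrable lborel ?g" using fi[OF s] fi[OF t] Di' by simp
    have gv: "(\<integral>x. ?g x \<partial>lborel) = (frac_int (nu1 P) (psi P) s - frac_int (nu1 P) (psi P) t) - (s - t) * (\<gamma> * L)"
      unfolding fv[OF s] fv[OF t] L_def using fi[OF s] fi[OF t] Di' by simp
    have "\<bar>\<integral>x. ?g x \<partial>lborel\<bar> \<le> (\<integral>x. \<bar>?g x\<bar> \<partial>lborel)"
      using integral_norm_bound[of lborel ?g] by simp
    also have "\<dots> \<le> (\<integral>x. indicator (dom P) x * (\<gamma> * N * \<bar>s - t\<bar> powr \<beta> * \<bar>s - t\<bar>) \<partial>lborel)"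
    proof (rule integral_mono[OF integrable_abs[OF gi] integral_const_dom(1)])
      show "\<bar>?g x\<bar> \<le> indicator (dom P) x * (\<gamma> * N * \<bar>s - t\<bar> powr \<beta> * \<bar>s - t\<bar>)" for x
        using point[OF _ s, of x] by (cases "x \<in> dom P") auto
    qed
    also have "\<dots> = (\<gamma> * N * \<bar>s - t\<bar> powr \<beta> * \<bar>s - t\<bar>) * vol" by (rule integral_const_dom(2))
    finally show ?thesis unfolding gv .
  qed
  have "((\<lambda>s. (frac_int (nu1 P) (psi P) s - frac_int (nu1 P) (psi P) t) / (s - t)) \<longlongrightarrow> \<gamma> * L) (at t within {0..tstar P})"
  proof (rule LIM_zero_cancel, rule Lim_null_comparison)
    show "\<forall>\<^sub>F s in at t within {0..tstar P}. norm ((frac_int (nu1 P) (psi P) s - frac_int (nu1 P) (psi P) t) / (s - t) - \<gamma> * L)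
       \<le> (\<gamma> * N * vol) * dist s t powr \<beta>"
      unfolding eventually_at_filter
    proof (rule always_eventually, intro allI impI)
      fix s assume s: "s \<noteq> t" "s \<in> {0..tstar P}"
      define A where "A = frac_int (nu1 P) (psi P) s - frac_int (nu1 P) (psi P) t"
      have "A / (s - t) - \<gamma> * L = (A - (s - t) * (\<gamma> * L)) / (s - t)" using s by (simp add: field_simps)
      then have "\<bar>A / (s - t) - \<gamma> * L\<bar> = \<bar>A - (s - t) * (\<gamma> * L)\<bar> / \<bar>s - t\<bar>" by simp
      also have "\<dots> \<le> ((\<gamma> * N * \<bar>s - t\<bar> powr \<beta> * \<bar>s - t\<bar>) * vol) / \<bar>s - t\<bar>"
        by (rule divide_right_mono) (use quot[OF s(2)] A_def in auto)
      also have "\<dots> = (\<gamma> * N * vol) * dist s t powr \<beta>" using s by (simp add: dist_real_def)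
      finally show "norm ((frac_int (nu1 P) (psi P) s - frac_int (nu1 P) (psi P) t) / (s - t) - \<gamma> * L)
       \<le> (\<gamma> * N * vol) * dist s t powr \<beta>" by (simp add: A_def)
    qed
    have "((\<lambda>s. dist s t powr \<beta>) \<longlongrightarrow> dist t t powr \<beta>) (at t within {0..tstar P})"
      by (rule tendsto_powr'[OF tendsto_dist[OF tendsto_ident_at tendsto_const] tendsto_const]) (use \<beta> in auto)
    then have "((\<lambda>s. (\<gamma> * N * vol) * dist s t powr \<beta>) \<longlongrightarrow> (\<gamma> * N * vol) * 0) (at t within {0..tstar P})"
      by (intro tendsto_mult_left) simp
    then show "((\<lambda>s. (\<gamma> * N * vol) * dist s t powr \<beta>) \<longlongrightarrow> 0) (at t within {0..tstar P})" by simp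
  qed
  then have "(frac_int (nu1 P) (psi P) has_vector_derivative \<gamma> * L) (at t within {0..tstar P})"
    by (simp add: has_real_derivative_iff_has_vector_derivative[symmetric] has_field_derivative_iff)
  from time_deriv_eqI[OF this t] T_pos have "time_deriv (tstar P) (frac_int (nu1 P) (psi P)) t = \<gamma> * L" by simp
  then show "caputo (nu1 P) (tstar P) (psi P) t = (\<integral>x. indicator (dom P) x * caputo (nu1 P) (horizon P) (u x) t \<partial>lborel)"
    unfolding caputo_def[of "nu1 P" "tstar P"] using \<gamma> by (simp add: \<gamma>_def L_def D_def)
qed

lemma caputo_psi_norm:
  assumes psi: "continuous_on {0..tstar P} (psi P)" and ap: "apriori P C"
  shows "0 \<le> C_holder_norm (alpha P * nu1 P / 2) (tstar P) (caputo (nu1 P) (tstar P) (psi P))"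
    and "C_holder_norm (alpha P * nu1 P / 2) (tstar P) (caputo (nu1 P) (tstar P) (psi P)) \<le> vol * C * data_norm P"
proof -
  define \<beta> where "\<beta> = alpha P * nu1 P / 2"
  have \<beta>: "0 < \<beta>" unfolding \<beta>_def using alpha_props nu1_bounds by simp
  obtain N1 N2 where N: "0 \<le> N1" "0 \<le> N2" "N1 + N2 \<le> C * data_norm P"
    and N1: "\<forall>x\<in>dom P. \<forall>t\<in>{0..horizon P}. \<bar>caputo (nu1 P) (horizon P) (u x) t\<bar> \<le> N1"
    and N2: "\<forall>x\<in>dom P. \<forall>t\<in>{0..horizon P}. \<forall>s\<in>{0..horizon P}.
       \<bar>caputo (nu1 P) (horizon P) (u x) t - caputo (nu1 P) (horizon P) (u x) s\<bar> \<le> N2 * \<bar>t - s\<bar> powr (alpha P * nu1 P / 2)"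
    using apriori_bounds(1)[OF ap] by (elim exE conjE) (rule that)
  have N2': "\<bar>caputo (nu1 P) (horizon P) (u x) t - caputo (nu1 P) (horizon P) (u x) s\<bar> \<le> N2 * \<bar>t - s\<bar> powr \<beta>"
    if "x \<in> dom P" "t \<in> {0..horizon P}" "s \<in> {0..horizon P}" for x t s
    using N2 that unfolding \<beta>_def by blast
  note cp = caputo_psi[OF psi _ N(2) \<beta> N2']
  define w where "w = caputo (nu1 P) (tstar P) (psi P)"
  have bnd: "\<bar>\<integral>x. g x \<partial>lborel\<bar> \<le> K * vol"
    if gi: "integrable lborel g" and g: "\<And>x. \<bar>g x\<bar> \<le> indicator (dom P) x * K" for g K
  proof -
    have "\<bar>\<integral>x. g x \<partial>lborel\<bar> \<le> (\<integral>x. \<bar>g x\<bar> \<partial>lborel)" using integral_norm_bound[of lborel g] by simp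
    also have "\<dots> \<le> (\<integral>x. indicator (dom P) x * K \<partial>lborel)"
      by (rule integral_mono[OF integrable_abs[OF gi] integral_const_dom(1) g])
    also have "\<dots> = K * vol" by (rule integral_const_dom(2))
    finally show ?thesis .
  qed
  have w1: "\<bar>w t\<bar> \<le> N1 * vol" if t: "t \<in> {0..tstar P}" for t
  proof -
    have e: "w t = (\<integral>x. indicator (dom P) x * caputo (nu1 P) (horizon P) (u x) t \<partial>lborel)"
      unfolding w_def by (rule cp(2)[OF t])
    show ?thesis
      unfolding e
    proof (rule bnd[OF cp(1)[OF t]])
      have tT: "t \<in> {0..horizon P}" using t T_pos by auto
      show "\<bar>indicator (dom P) x * caputo (nu1 P) (horizon P) (u x) t\<bar> \<le> indicator (dom P) x * N1" for x
        using N1 tT by (cases "x \<in> dom P") auto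
    qed
  qed
  have w2: "\<bar>w t - w s\<bar> \<le> (N2 * vol) * dist t s powr \<beta>" if t: "t \<in> {0..tstar P}" and s: "s \<in> {0..tstar P}" for t s
  proof -
    have tT: "t \<in> {0..horizon P}" "s \<in> {0..horizon P}" using t s T_pos by auto
    have e: "w t - w s = (\<integral>x. indicator (dom P) x * caputo (nu1 P) (horizon P) (u x) t
        - indicator (dom P) x * caputo (nu1 P) (horizon P) (u x) s \<partial>lborel)"
    proof -
      have "w t = (\<integral>x. indicator (dom P) x * caputo (nu1 P) (horizon P) (u x) t \<partial>lborel)"
        "w s = (\<integral>x. indicator (dom P) x * caputo (nu1 P) (horizon P) (u x) s \<partial>lborel)"
        using cp(2)[OF t] cp(2)[OF s] by (simp_all only: w_def)
      then show ?thesis using Bochner_Integration.integral_diff[OF cp(1)[OF t] cp(1)[OF s]] by linarith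
    qed
    have "\<bar>w t - w s\<bar> \<le> (N2 * \<bar>t - s\<bar> powr \<beta>) * vol"
      unfolding e
    proof (rule bnd)
      show "integrable lborel (\<lambda>x. indicator (dom P) x * caputo (nu1 P) (horizon P) (u x) t
        - indicator (dom P) x * caputo (nu1 P) (horizon P) (u x) s)" using cp(1)[OF t] cp(1)[OF s] by simp
      show "\<bar>indicator (dom P) x * caputo (nu1 P) (horizon P) (u x) t
        - indicator (dom P) x * caputo (nu1 P) (horizon P) (u x) s\<bar> \<le> indicator (dom P) x * (N2 * \<bar>t - s\<bar> powr \<beta>)" for x
        using N2'[OF _ tT, of x] by (cases "x \<in> dom P") auto
    qed
    then show ?thesis by (simp add: dist_real_def mult_ac)
  qed
  have ho: "holder_on \<beta> {0..tstar P} w" unfolding holder_on_def using w2 by blast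
  have sb: "\<exists>B. \<forall>t\<in>{0..tstar P}. \<bar>w t\<bar> \<le> B" using w1 by blast
  show "0 \<le> C_holder_norm (alpha P * nu1 P / 2) (tstar P) (caputo (nu1 P) (tstar P) (psi P))"
    unfolding C_holder_norm_def w_def[symmetric] \<beta>_def[symmetric]
    using sup_norm_bounds(1)[OF sb] holder_seminorm_bounds(1)[OF ho] by simp
  have "sup_norm {0..tstar P} w \<le> N1 * vol" by (rule sup_norm_le) (use w1 N vol_nonneg in auto)
  moreover have "holder_seminorm \<beta> {0..tstar P} w \<le> N2 * vol" by (rule holder_seminorm_le) (use w2 N vol_nonneg in auto)
  moreover have "(N1 + N2) * vol \<le> C * data_norm P * vol" by (rule mult_right_mono[OF N(3) vol_nonneg])
  ultimately show "C_holder_norm (alpha P * nu1 P / 2) (tstar P) (caputo (nu1 P) (tstar P) (psi P)) \<le> vol * C * data_norm P"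
    unfolding C_holder_norm_def w_def[symmetric] \<beta>_def[symmetric] by (simp add: algebra_simps)
qed

text \<open>The product estimate gives a Hoelder bound for \<open>w\<close>, the leading derivative
  of \<open>rho P 1\<close> times the observation, through \<open>caputo_psi_norm\<close>. The signs
  of \<open>C1\<close>, \<open>C2\<close> and \<open>N\<close> are not assumed: they follow from
  \<open>w 0 = lead\<close> being nonzero.\<close>

lemma estimate_TypeII:
  assumes ty: "ftype P = TypeII" and ap: "apriori P C" and h5: "h5 P" and pe: "product_estimates P C1 C2"
  defines "N \<equiv> C1_holder_norm (rexp P) (tstar P) (rho P 1)"
  shows "0 \<le> C1" "0 < C2" "0 < N"
    "\<exists>Z\<ge>0. Z \<le> C1 * N * (vol * C * data_norm P) \<and> (\<forall>t. 0 < t \<and> t \<le> tstar P \<longrightarrow>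
      \<bar>mass t - mass 0 - lead * (t powr nu1 P / Gamma (1 + nu1 P))\<bar>
        \<le> Z * t powr (alpha P * nu1 P / 2) * (t powr nu1 P / Gamma (1 + nu1 P)))"
proof -
  define \<beta> where "\<beta> = alpha P * nu1 P / 2"
  have \<beta>: "0 < \<beta>" unfolding \<beta>_def using alpha_props nu1_bounds by simp
  define V where "V = C_holder_norm \<beta> (tstar P) (caputo (nu1 P) (tstar P) (psi P))"
  define q where "q = (\<lambda>s. rho P 1 s * psi P s)"
  define w where "w = caputo (nu1 P) (tstar P) q"
  have one: "1 \<in> {1..M P}" using M_pos by simp
  have psi: "continuous_on {0..tstar P} (psi P)" using h5 by (simp add: h5_def)
  have r1: "in_C1_holder (rexp P) (horizon P) (rho P 1)" "1 < rexp P"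
    using hyps one by (auto simp: direct_hyps_def h3_def)
  have N0: "0 \<le> N" unfolding N_def by (rule C1_holder_norm_nonneg[OF r1]) (use T_pos in auto)
  have V: "0 \<le> V" "V \<le> vol * C * data_norm P"
    unfolding V_def \<beta>_def by (rule caputo_psi_norm[OF psi ap])+
  have pe1: "has_caputo (nu1 P) (tstar P) q" "holder_on \<beta> {0..tstar P} w"
     "holder_seminorm \<beta> {0..tstar P} w \<le> C1 * (N * V)" "C_holder_norm \<beta> (tstar P) w \<le> C2 * (N * V)"
  proof -
    have "0 < \<beta> \<and> \<beta> \<le> alpha P * nu1 P / 2" using \<beta> by (simp add: \<beta>_def)
    with pe one have "let w = caputo (nu1 P) (tstar P) (\<lambda>s. rho P 1 s * psi P s);
             B = C1_holder_norm (rexp P) (tstar P) (rho P 1) * C_holder_norm \<beta> (tstar P) (caputo (nu1 P) (tstar P) (psi P))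
         in has_caputo (nu1 P) (tstar P) (\<lambda>s. rho P 1 s * psi P s) \<and> holder_on \<beta> {0..tstar P} w \<and>
            holder_seminorm \<beta> {0..tstar P} w \<le> C1 * B \<and> C_holder_norm \<beta> (tstar P) w \<le> C2 * B"
      unfolding product_estimates_def by blast
    then show "has_caputo (nu1 P) (tstar P) q" "holder_on \<beta> {0..tstar P} w"
     "holder_seminorm \<beta> {0..tstar P} w \<le> C1 * (N * V)" "C_holder_norm \<beta> (tstar P) w \<le> C2 * (N * V)"
      unfolding Let_def q_def w_def N_def V_def by blast+
  qed
  have qc: "continuous_on {0..tstar P} q"
    unfolding q_def by (intro continuous_intros psi continuous_on_subset[OF rho_props(1)[OF one]]) (use T_pos in auto)
  have wc: "continuous_on {0..tstar P} w" by (rule holder_on_continuous[OF pe1(2) \<beta>])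
  have mq: "mass t = q t" if "t \<in> {0..tstar P}" for t
    using mass_eq(1)[OF that] ty by (simp add: q_def)
  have asym: "\<bar>mass t - mass 0 - w 0 * (t powr nu1 P / Gamma (1 + nu1 P))\<bar> \<le> \<eta> * (t powr nu1 P / Gamma (1 + nu1 P))"
    if t: "0 < t" "t \<le> tstar P" and \<eta>: "\<And>s. 0 \<le> s \<Longrightarrow> s \<le> t \<Longrightarrow> \<bar>w s - w 0\<bar> \<le> \<eta>" for t \<eta>
  proof -
    have "t \<in> {0..tstar P}" "0 \<in> {0..tstar P}" using t by auto
    then show ?thesis unfolding mq[OF \<open>t \<in> {0..tstar P}\<close>] mq[OF \<open>0 \<in> {0..tstar P}\<close>]
      by (intro caputo_asymptotics[OF nu1_bounds T_pos(2) qc pe1(1) wc[unfolded w_def] t]) (use \<eta> in \<open>simp add: w_def\<close>)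
  qed
  \<comment> \<open>The same mass has two expansions, with coefficients \<open>w 0\<close> and
    \<open>lead\<close>. With \<open>e\<close> a quarter of their distance, comparing them at one
    small time bounds the distance by half of itself.\<close>
  have w0: "w 0 = lead"
  proof (rule ccontr)
    assume "w 0 \<noteq> lead"
    define e where "e = \<bar>w 0 - lead\<bar> / 4"
    have e: "0 < e" using \<open>w 0 \<noteq> lead\<close> by (simp add: e_def)
    obtain d1 where d1: "0 < d1" "\<And>s. s \<in> {0..tstar P} \<Longrightarrow> dist s 0 < d1 \<Longrightarrow> dist (w s) (w 0) < e"
      using wc e T_pos(2) unfolding continuous_on_iff by (metis atLeastAtMost_iff less_imp_le order_refl)
    obtain d2 where d2: "0 < d2" "\<And>t. 0 < t \<Longrightarrow> t \<le> tstar P \<Longrightarrow> t < d2 \<Longrightarrow>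
      \<bar>mass t - mass 0 - lead * (t powr nu1 P / Gamma (1 + nu1 P))\<bar> < e * (t powr nu1 P / Gamma (1 + nu1 P))"
      using small_time_estimate[OF e] by blast
    define t where "t = min (tstar P) (min d1 d2 / 2)"
    have t: "0 < t" "t \<le> tstar P" "t < d1" "t < d2" using d1 d2 T_pos by (auto simp: t_def)
    define \<kappa> where "\<kappa> = t powr nu1 P / Gamma (1 + nu1 P)"
    have k: "0 < \<kappa>" unfolding \<kappa>_def using t(1) nu1_bounds Gamma_real_pos[of "1 + nu1 P"] by simp
    have a: "\<bar>mass t - mass 0 - w 0 * \<kappa>\<bar> \<le> e * \<kappa>"
      unfolding \<kappa>_def
    proof (rule asym[OF t(1,2)])
      fix s assume "0 \<le> s" "s \<le> t"
      then show "\<bar>w s - w 0\<bar> \<le> e" using d1(2)[of s] t by (auto simp: dist_real_def)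
    qed
    have b: "\<bar>mass t - mass 0 - lead * \<kappa>\<bar> < e * \<kappa>" unfolding \<kappa>_def by (rule d2(2)[OF t(1,2,4)])
    have "\<bar>w 0 * \<kappa> - lead * \<kappa>\<bar> < 2 * (e * \<kappa>)" using a b by linarith
    then have "\<bar>w 0 - lead\<bar> * \<kappa> < 2 * e * \<kappa>" using k by (simp add: left_diff_distrib[symmetric] abs_mult)
    then have "\<bar>w 0 - lead\<bar> < 2 * e" using k by (simp only: mult_less_cancel_right_pos)
    then show False using e by (simp add: e_def)
  qed
  have sb: "\<exists>B. \<forall>t\<in>{0..tstar P}. \<bar>w t\<bar> \<le> B"
  proof -
    have "bounded (w ` {0..tstar P})" by (intro compact_imp_bounded compact_continuous_image wc) auto
    then obtain B where "\<forall>y\<in>w ` {0..tstar P}. norm y \<le> B" unfolding bounded_iff by blast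
    then show ?thesis by (intro exI[of _ B]) auto
  qed
  have z: "0 \<in> {0..tstar P}" using T_pos by simp
  have sem: "0 \<le> holder_seminorm \<beta> {0..tstar P} w" by (rule holder_seminorm_bounds(1)[OF pe1(2)])
  \<comment> \<open>This chain bounds \<open>C2 * (N * V)\<close> below by a positive number; as
    \<open>N\<close> and \<open>V\<close> are nonnegative, \<open>N * V\<close> and
    \<open>C2\<close> are positive.\<close>
  have "0 < \<bar>w 0\<bar>" using lead_nonzero w0 by simp
  also have "\<bar>w 0\<bar> \<le> sup_norm {0..tstar P} w" by (rule sup_norm_bounds(2)[OF sb z])
  also have "\<dots> \<le> C_holder_norm \<beta> (tstar P) w" using sem by (simp add: C_holder_norm_def)
  also have "\<dots> \<le> C2 * (N * V)" by (rule pe1(4))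
  finally have C2: "0 < C2 * (N * V)" .
  have NV: "0 \<le> N * V" using N0 V by simp
  have "N * V \<noteq> 0" using C2 by auto
  with NV have NV': "0 < N * V" by linarith
  show "0 < C2" using C2 NV by (simp add: zero_less_mult_iff)
  show "0 < N" using NV' N0 by (cases "N = 0") auto
  have "0 \<le> C1 * (N * V)" using sem pe1(3) by linarith
  then show C1: "0 \<le> C1" using NV' by (simp add: zero_le_mult_iff)
  show "\<exists>Z\<ge>0. Z \<le> C1 * N * (vol * C * data_norm P) \<and> (\<forall>t. 0 < t \<and> t \<le> tstar P \<longrightarrow>
      \<bar>mass t - mass 0 - lead * (t powr nu1 P / Gamma (1 + nu1 P))\<bar>
        \<le> Z * t powr (alpha P * nu1 P / 2) * (t powr nu1 P / Gamma (1 + nu1 P)))"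
  proof (intro exI[of _ "C1 * (N * V)"] conjI allI impI)
    show "0 \<le> C1 * (N * V)" by fact
    have "C1 * N * V \<le> C1 * N * (vol * C * data_norm P)" by (intro mult_left_mono V) (use C1 N0 in auto)
    then show "C1 * (N * V) \<le> C1 * N * (vol * C * data_norm P)" by (simp add: mult.assoc)
    fix t assume t: "0 < t \<and> t \<le> tstar P"
    show "\<bar>mass t - mass 0 - lead * (t powr nu1 P / Gamma (1 + nu1 P))\<bar>
        \<le> C1 * (N * V) * t powr (alpha P * nu1 P / 2) * (t powr nu1 P / Gamma (1 + nu1 P))"
      unfolding w0[symmetric]
    proof (rule asym)
      fix s assume s: "0 \<le> s" "s \<le> t"
      have "\<bar>w s - w 0\<bar> \<le> holder_seminorm \<beta> {0..tstar P} w * dist s 0 powr \<beta>"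
        by (rule holder_seminorm_bounds(2)[OF pe1(2) _ z]) (use s t in auto)
      also have "\<dots> \<le> C1 * (N * V) * t powr \<beta>"
        by (intro mult_mono pe1(3) powr_mono2) (use s \<beta> \<open>0 \<le> C1 * (N * V)\<close> in auto)
      finally show "\<bar>w s - w 0\<bar> \<le> C1 * (N * V) * t powr (alpha P * nu1 P / 2)" by (simp add: \<beta>_def)
    qed (use t in auto)
  qed
qed

text \<open>Shows that \<open>C4\<close> exceeds the error constants of both types: the factors
  multiplying \<open>C0\<close> are at least 1, or at least \<open>C1 * N\<close> for the II type,
  since \<open>Gamma (1 + x_star) \<le> 1\<close>, while \<open>C0\<close> is strictly larger than
  the volume times the a priori constant.\<close>

lemma explicit_estimate:
  assumes ap: "apriori P C" and h5: "h5 P" and pe: "ftype P = TypeII \<longrightarrow> product_estimates P C1 C2"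
    and C0: "vol * \<bar>C\<bar> < C0" and \<epsilon>: "0 < \<epsilon>" "\<epsilon> < 1"
  shows "0 < explicit_time P \<epsilon> C0 C1 C2"
    and "0 < q \<Longrightarrow> q \<le> alpha P * nu1 P / 2 \<Longrightarrow> 0 < TI \<Longrightarrow> TI \<le> T0 P \<epsilon> \<Longrightarrow>
      TI \<le> explicit_time P \<epsilon> C0 C1 C2 powr (1 / q) \<Longrightarrow> good_time P \<epsilon> TI"
proof -
  define G where "G = Gamma (1 + x_star)"
  have G: "0 < G" "G \<le> 1" using Gamma_x_star by (simp_all add: G_def)
  have R: "0 < data_norm P" by (rule data_norm_pos[OF ap])
  have vC: "0 \<le> vol * \<bar>C\<bar>" using vol_nonneg by simp
  have C0p: "0 < C0" using vC C0 by linarith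
  have C0G: "C0 \<le> C0 / G" using G C0p by (simp add: le_divide_eq mult_left_le)
  have vCC: "vol * C \<le> vol * \<bar>C\<bar>" by (rule mult_left_mono) (use vol_nonneg in auto)
  have "\<exists>Z\<ge>0. Z < C4 P C0 C1 C2 * data_norm P \<and> (\<forall>t. 0 < t \<and> t \<le> tstar P \<longrightarrow>
      \<bar>mass t - mass 0 - lead * (t powr nu1 P / Gamma (1 + nu1 P))\<bar>
        \<le> Z * t powr (alpha P * nu1 P / 2) * (t powr nu1 P / Gamma (1 + nu1 P)))"
  proof (cases "ftype P")
    case TypeI
    obtain Z where Z: "0 \<le> Z" "Z \<le> vol * C * data_norm P" "\<forall>t. 0 < t \<and> t \<le> tstar P \<longrightarrow>
      \<bar>mass t - mass 0 - lead * (t powr nu1 P / Gamma (1 + nu1 P))\<bar>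
        \<le> Z * t powr (alpha P * nu1 P / 2) * (t powr nu1 P / Gamma (1 + nu1 P))"
      using estimate_TypeI[OF TypeI ap] by (elim exE conjE) (rule that)
    define Sm where "Sm = (\<Sum>i=2..M P. \<bar>rho P i 0\<bar> / (rho P 1 0 * G))"
    have Sm: "0 \<le> Sm" unfolding Sm_def
      by (rule sum_nonneg) (use rho1_pos[of 0] T_pos G in \<open>auto intro!: divide_nonneg_pos\<close>)
    have C4: "C4 P C0 C1 C2 = C0 / G * (1 + 2 * Sm)" using TypeI by (simp add: C4_def Let_def G_def Sm_def)
    have "C0 / G * 1 \<le> C0 / G * (1 + 2 * Sm)" by (rule mult_left_mono) (use Sm C0p G in auto)
    then have "vol * C < C4 P C0 C1 C2" unfolding C4 using C0 C0G vCC by linarith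
    from mult_strict_right_mono[OF this R] have "Z < C4 P C0 C1 C2 * data_norm P" using Z(2) by linarith
    then show ?thesis using Z(1,3) by (intro exI[of _ Z] conjI)
  next
    case TypeII
    define N where "N = C1_holder_norm (rexp P) (tstar P) (rho P 1)"
    note est = estimate_TypeII[OF TypeII ap h5 mp[OF pe TypeII], folded N_def]
    obtain Z where Z: "0 \<le> Z" "Z \<le> C1 * N * (vol * C * data_norm P)" "\<forall>t. 0 < t \<and> t \<le> tstar P \<longrightarrow>
      \<bar>mass t - mass 0 - lead * (t powr nu1 P / Gamma (1 + nu1 P))\<bar>
        \<le> Z * t powr (alpha P * nu1 P / 2) * (t powr nu1 P / Gamma (1 + nu1 P))"
      using est(4) by (elim exE conjE) (rule that)
    define Sm where "Sm = (\<Sum>i=1..M P. C1_holder_norm (rexp P) (tstar P) (rho P i))"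
    have NS: "N \<le> Sm" unfolding N_def Sm_def
    proof (rule member_le_sum)
      show "1 \<in> {1..M P}" using M_pos by simp
      fix i assume "i \<in> {1..M P} - {1}"
      then have "in_C1_holder (rexp P) (horizon P) (rho P i)" "1 < rexp P"
        using hyps by (auto simp: direct_hyps_def h3_def)
      then show "0 \<le> C1_holder_norm (rexp P) (tstar P) (rho P i)"
        by (rule C1_holder_norm_nonneg) (use T_pos in auto)
    qed simp
    have C4: "C4 P C0 C1 C2 = C0 / G * (C1 + C2) * (1 + 2 / G) * Sm"
      using TypeII by (simp add: C4_def Let_def G_def Sm_def)
    \<comment> \<open>The part of \<open>C4\<close> that dominates \<open>C1 * N\<close>; the
      remaining factors \<open>C0 / G\<close> and \<open>1 + 2 / G\<close> only increase the
      product.\<close>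
    define X where "X = (C1 + C2) * Sm"
    have X: "0 < X" unfolding X_def using est(1,2,3) NS by (intro mult_pos_pos) auto
    have "C1 * N \<le> X" unfolding X_def by (rule mult_mono) (use est(1,2,3) NS in auto)
    then have "C1 * N * (vol * C) \<le> X * (vol * \<bar>C\<bar>)"
    proof -
      have "C1 * N * (vol * C) \<le> C1 * N * (vol * \<bar>C\<bar>)" by (rule mult_left_mono[OF vCC]) (use est(1,3) in auto)
      also have "\<dots> \<le> X * (vol * \<bar>C\<bar>)" by (rule mult_right_mono[OF \<open>C1 * N \<le> X\<close> vC])
      finally show ?thesis .
    qed
    also have "\<dots> < X * C0" by (rule mult_strict_left_mono[OF C0 X])
    also have "\<dots> \<le> X * (C0 / G)" by (rule mult_left_mono[OF C0G]) (use X in simp)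
    also have "\<dots> \<le> X * (C0 / G) * (1 + 2 / G)"
      using mult_left_mono[of 1 "1 + 2 / G" "X * (C0 / G)"] X C0p G by simp
    also have "\<dots> = C4 P C0 C1 C2" unfolding C4 X_def by (simp only: mult_ac)
    finally have "C1 * N * (vol * C) < C4 P C0 C1 C2" .
    from mult_strict_right_mono[OF this R] have "Z < C4 P C0 C1 C2 * data_norm P" using Z(2) by (simp add: mult.assoc)
    then show ?thesis using Z(1,3) by (intro exI[of _ Z] conjI)
  qed
  then obtain Z where Z: "0 \<le> Z" "Z < C4 P C0 C1 C2 * data_norm P" "\<forall>t. 0 < t \<and> t \<le> tstar P \<longrightarrow>
      \<bar>mass t - mass 0 - lead * (t powr nu1 P / Gamma (1 + nu1 P))\<bar>
        \<le> Z * t powr (alpha P * nu1 P / 2) * (t powr nu1 P / Gamma (1 + nu1 P))"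
    by (elim exE conjE) (rule that)
  have "0 < C4 P C0 C1 C2 * data_norm P" using Z by linarith
  then show "0 < explicit_time P \<epsilon> C0 C1 C2" unfolding explicit_time_eq using \<epsilon> lead_nonzero by simp
  show "good_time P \<epsilon> TI" if "0 < q" "q \<le> alpha P * nu1 P / 2" "0 < TI" "TI \<le> T0 P \<epsilon>"
      "TI \<le> explicit_time P \<epsilon> C0 C1 C2 powr (1 / q)"
    by (rule explicit_good_time[OF \<epsilon> Z(1,2) _ that]) (use Z(3) in blast)
qed

end

section \<open>Assembling the two inverse problems\<close>

lemma observed_problem_A:
  assumes "assumption_A P i u"
  shows "observed_problem P u"
proof -
  have "solves_first P i (nu1 P) (orders P i) u" using assms by (simp add: assumption_A_def unique_first_def)
  then have "classical_solution P u" "observed P u"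
    by (simp_all add: solves_first_def Let_def unique_classical_solution_def)
  then show ?thesis using assms by unfold_locales (simp_all add: assumption_A_def)
qed

lemma observed_problem_B:
  assumes "assumption_B P K0 \<gamma>0 \<gamma> u"
  shows "observed_problem P u"
proof -
  have s: "solves_second P K0 \<gamma>0 (nu1 P) \<gamma> u" and k: "ker P = sing_kernel \<gamma> K0"
    using assms by (simp_all add: assumption_B_def unique_second_def)
  have eq: "P\<lparr>orders := (orders P)(1 := nu1 P), ker := sing_kernel \<gamma> K0\<rparr> = P"
    unfolding k[symmetric] by simp
  have "unique_classical_solution P u \<and> observed P u"
    using s unfolding solves_second_def Let_def eq by blast
  then have "classical_solution P u" "observed P u" by (simp_all add: unique_classical_solution_def)
  then show ?thesis using assms by unfold_locales (simp_all add: assumption_B_def)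
qed

text \<open>Near 0 the continuous function stays closer to \<open>K0 0\<close> than the distance of
  that value from zero, so the set in the supremum contains a positive time.\<close>

lemma T_K_pos:
  assumes K: "continuous_on {0..tstar P} K0" and K0: "K0 0 \<noteq> 0" and T: "0 < tstar P"
  shows "0 < T_K P K0"
proof -
  define A where "A = {\<tau>. 0 < \<tau> \<and> \<tau> \<le> tstar P \<and> (\<forall>t. 0 \<le> t \<and> t < \<tau> \<longrightarrow> sgn (K0 t) = sgn (K0 0))}"
  have "0 \<in> {0..tstar P}" "0 < \<bar>K0 0\<bar>" using T K0 by auto
  then obtain d where d: "0 < d" "\<And>t. t \<in> {0..tstar P} \<Longrightarrow> dist t 0 < d \<Longrightarrow> dist (K0 t) (K0 0) < \<bar>K0 0\<bar>"
    using K unfolding continuous_on_iff by metis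
  have sg: "sgn (K0 t) = sgn (K0 0)" if "0 \<le> t" "t < min d (tstar P)" for t
  proof -
    have "\<bar>K0 t - K0 0\<bar> < \<bar>K0 0\<bar>" using d(2)[of t] that by (simp add: dist_real_def)
    then show ?thesis using K0 by (cases "0 < K0 0") (auto simp: sgn_if)
  qed
  have mem: "min d (tstar P) \<in> A"
    unfolding A_def mem_Collect_eq
  proof (intro conjI allI impI)
    show "0 < min d (tstar P)" "min d (tstar P) \<le> tstar P" using d(1) T by simp_all
    fix t assume "0 \<le> t \<and> t < min d (tstar P)"
    then show "sgn (K0 t) = sgn (K0 0)" by (intro sg) simp_all
  qed
  have "bdd_above A" by (rule bdd_aboveI[of _ "tstar P"]) (simp add: A_def)
  then have "min d (tstar P) \<le> Sup A" by (rule cSup_upper[OF mem])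
  moreover have "0 < min d (tstar P)" using d(1) T by simp
  ultimately show ?thesis unfolding T_K_def A_def[symmetric] by linarith
qed

text \<open>The constant is one function of \<open>size_data\<close> for the whole class
  \<open>\<S>\<close>, which expresses on which quantities it may depend; it is chosen before the
  individual problem and \<open>\<epsilon>\<close>.\<close>

theorem theorem3p3:
  fixes \<S> :: "('n::finite) problem set"
  shows "(\<forall>(P :: 'n problem) \<epsilon>. 0 < \<epsilon> \<and> \<epsilon> < 1 \<longrightarrow>
            (\<exists>i u. assumption_A P i u) \<or> (\<exists>K0 \<gamma> u. assumption_B P K0 1 \<gamma> u) \<longrightarrow>
            (\<exists>TI. good_time P \<epsilon> TI))
     \<and> (\<forall>Cest. (\<forall>P\<in>\<S>. apriori P (Cest (size_data P))) \<longrightarrow>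
         (\<exists>C0. (\<forall>P\<in>\<S>. 0 < C0 (size_data P) \<and> apriori P (C0 (size_data P))) \<and>
            (\<forall>P\<in>\<S>. \<forall>\<epsilon> C1 C2. 0 < \<epsilon> \<and> \<epsilon> < 1 \<longrightarrow>
               (ftype P = TypeII \<longrightarrow> product_estimates P C1 C2) \<longrightarrow>
               (\<forall>i u. assumption_A P i u \<and> 3 \<le> M P \<longrightarrow>
                  good_time P \<epsilon> (T_first P i \<epsilon> (C0 (size_data P)) C1 C2)) \<and>
               (\<forall>K0 \<gamma>0 \<gamma> u. \<gamma>0 < 1 \<and> assumption_B P K0 \<gamma>0 \<gamma> u \<and> 2 \<le> M P \<longrightarrow>
                  good_time P \<epsilon> (T_second P K0 \<epsilon> (C0 (size_data P)) C1 C2)))))"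
proof (intro conjI allI impI)
  fix P :: "'n problem" and \<epsilon> :: real
  assume \<epsilon>: "0 < \<epsilon> \<and> \<epsilon> < 1" and "(\<exists>i u. assumption_A P i u) \<or> (\<exists>K0 \<gamma> u. assumption_B P K0 1 \<gamma> u)"
  then obtain u where "observed_problem P u" using observed_problem_A observed_problem_B by blast
  then show "\<exists>TI. good_time P \<epsilon> TI" using observed_problem.good_time_exists \<epsilon> by blast
next
  fix Cest assume Cest: "\<forall>P\<in>\<S>. apriori P (Cest (size_data P))"
  \<comment> \<open>The component \<open>fst (snd sd)\<close> is the volume. The value dominates the
    given constant and its product with the volume, and the summand 1 makes the latter comparison
    strict and \<open>C0\<close> positive.\<close>
  define C0 where "C0 sd = 1 + (1 + \<bar>fst (snd sd)\<bar>) * \<bar>Cest sd\<bar>" for sd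
  have vol: "fst (snd (size_data P)) = measure lebesgue (dom P)" for P :: "'n problem"
    by (simp add: size_data_def)
  have C0_ge: "\<bar>Cest (size_data P)\<bar> \<le> C0 (size_data P)"
      "measure lebesgue (dom P) * \<bar>Cest (size_data P)\<bar> < C0 (size_data P)" "0 < C0 (size_data P)"
    for P :: "'n problem"
  proof -
    have "0 \<le> measure lebesgue (dom P) * \<bar>Cest (size_data P)\<bar>" "0 \<le> \<bar>Cest (size_data P)\<bar>" by simp_all
    moreover have "C0 (size_data P) = 1 + (\<bar>Cest (size_data P)\<bar> + measure lebesgue (dom P) * \<bar>Cest (size_data P)\<bar>)"
      by (simp add: C0_def vol distrib_right)
    ultimately show "\<bar>Cest (size_data P)\<bar> \<le> C0 (size_data P)"
      "measure lebesgue (dom P) * \<bar>Cest (size_data P)\<bar> < C0 (size_data P)" "0 < C0 (size_data P)"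
      by linarith+
  qed
  show "\<exists>C0. (\<forall>P\<in>\<S>. 0 < C0 (size_data P) \<and> apriori P (C0 (size_data P))) \<and>
            (\<forall>P\<in>\<S>. \<forall>\<epsilon> C1 C2. 0 < \<epsilon> \<and> \<epsilon> < 1 \<longrightarrow>
               (ftype P = TypeII \<longrightarrow> product_estimates P C1 C2) \<longrightarrow>
               (\<forall>i u. assumption_A P i u \<and> 3 \<le> M P \<longrightarrow>
                  good_time P \<epsilon> (T_first P i \<epsilon> (C0 (size_data P)) C1 C2)) \<and>
               (\<forall>K0 \<gamma>0 \<gamma> u. \<gamma>0 < 1 \<and> assumption_B P K0 \<gamma>0 \<gamma> u \<and> 2 \<le> M P \<longrightarrow>
                  good_time P \<epsilon> (T_second P K0 \<epsilon> (C0 (size_data P)) C1 C2)))"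
  proof (intro exI[of _ C0] conjI ballI allI impI)
    fix P assume P: "P \<in> \<S>"
    show "0 < C0 (size_data P)" by (rule C0_ge)
    show "apriori P (C0 (size_data P))"
      unfolding apriori_def
    proof (intro impI allI)
      fix u assume a: "direct_hyps P" "classical_solution P u"
      then interpret solved_problem P u by unfold_locales
      \<comment> \<open>Enlarging the constant preserves the a priori estimate because the data norm
        is nonnegative.\<close>
      have "Cest (size_data P) * data_norm P \<le> C0 (size_data P) * data_norm P"
        by (rule mult_right_mono) (use C0_ge(1)[of P] data_norm_nonneg in auto)
      then show "norm_par2 (dom P) (alpha P) (nu1 P) (horizon P) u
        + (\<Sum>i=2..M P. norm_par (dom P) 0 (alpha P) (nu1 P) (horizon P)
              (\<lambda>x. caputo (orders P i) (horizon P) (u x)))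
        \<le> C0 (size_data P) * data_norm P"
        using Cest P a unfolding apriori_def by (meson order_trans)
    qed
  next
    fix P and \<epsilon> C1 C2 :: real and i u
    assume P: "P \<in> \<S>" and \<epsilon>: "0 < \<epsilon> \<and> \<epsilon> < 1" and pe: "ftype P = TypeII \<longrightarrow> product_estimates P C1 C2"
      and A: "assumption_A P i u \<and> 3 \<le> M P"
    interpret observed_problem P u by (rule observed_problem_A[OF conjunct1[OF A]])
    have h5: "h5 P" using A by (simp add: assumption_A_def)
    have ap: "apriori P (Cest (size_data P))" using Cest P by blast
    note ee = explicit_estimate[OF ap h5 pe C0_ge(2)[of P, folded vol_def] conjunct1[OF \<epsilon>] conjunct2[OF \<epsilon>]]
    \<comment> \<open>With \<open>M P\<close> at least 3 both orders are genuine and below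
      \<open>nu1 P\<close>, so either choice in \<open>nu_zero\<close> is an admissible
      exponent.\<close>
    have o: "0 < orders P 2" "0 < orders P 3" "orders P 2 < nu1 P" "orders P 3 < nu1 P"
      using nu_bounds(1)[of 2] nu_bounds(1)[of 3] orders_less[OF ord, of 1 2] orders_less[OF ord, of 1 3] A by auto
    have q: "0 < nu_zero P i" "nu_zero P i \<le> alpha P * nu1 P / 2"
      unfolding nu_zero_def using o alpha_props by (auto intro!: mult_left_mono)
    have T: "0 < T_first P i \<epsilon> (C0 (size_data P)) C1 C2"
      unfolding T_first_def using T0_props(1)[OF conjunct1[OF \<epsilon>] conjunct2[OF \<epsilon>]] ee(1) by simp
    show "good_time P \<epsilon> (T_first P i \<epsilon> (C0 (size_data P)) C1 C2)"
      by (rule ee(2)[OF q T]) (simp_all add: T_first_def)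
  next
    fix P and \<epsilon> C1 C2 :: real and K0 and \<gamma>0 \<gamma> :: real and u
    assume P: "P \<in> \<S>" and \<epsilon>: "0 < \<epsilon> \<and> \<epsilon> < 1" and pe: "ftype P = TypeII \<longrightarrow> product_estimates P C1 C2"
      and B: "\<gamma>0 < 1 \<and> assumption_B P K0 \<gamma>0 \<gamma> u \<and> 2 \<le> M P"
    interpret observed_problem P u by (rule observed_problem_B[OF conjunct1[OF conjunct2[OF B]]])
    have h5: "h5 P" using B by (simp add: assumption_B_def)
    have ap: "apriori P (Cest (size_data P))" using Cest P by blast
    note ee = explicit_estimate[OF ap h5 pe C0_ge(2)[of P, folded vol_def] conjunct1[OF \<epsilon>] conjunct2[OF \<epsilon>]]
    have o: "0 < orders P 2" "orders P 2 < nu1 P"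
      using nu_bounds(1)[of 2] orders_less[OF ord, of 1 2] B by auto
    have q: "0 < alpha P * orders P 2 / 2" "alpha P * orders P 2 / 2 \<le> alpha P * nu1 P / 2"
      using o alpha_props by auto
    have e: "1 / (alpha P * orders P 2 / 2) = 2 / (alpha P * orders P 2)" by simp
    have TK: "0 < T_K P K0" by (rule T_K_pos) (use B T_pos in \<open>auto simp: assumption_B_def\<close>)
    have T: "0 < T_second P K0 \<epsilon> (C0 (size_data P)) C1 C2"
      unfolding T_second_def using T0_props(1)[OF conjunct1[OF \<epsilon>] conjunct2[OF \<epsilon>]] ee(1) TK by simp
    show "good_time P \<epsilon> (T_second P K0 \<epsilon> (C0 (size_data P)) C1 C2)"
      by (rule ee(2)[OF q T]) (simp_all add: T_second_def e)
  qed
qed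

end
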